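(* Consider the Inverse Linear Feasibility Problem with a target set fixing one variable to zero: given $A\in\mathbb{Q}^{m\times n}$, $B\in\mathbb{Q}^{m\times k}$, $b\in\mathbb{Q}^m$, $C\in\mathbb{Q}^{n\times k}$, $c\in\mathbb{Q}^n$, a polyhedron $X=\{x\in\mathbb{R}^k \mid Dx\le d\}$ with $D\in\mathbb{Q}^{g\times k}$, $d\in\mathbb{Q}^g$, and an index $i\in\{1,\dots,n\}$, let $Y=\{y\in\mathbb{R}^n\mid y_i=0\}$ and let $\mathrm{Opt}(x)$ denote the set of optimal solutions of the parametric LP with parameter $x$, which is either in natural form, $\min\{(Cx+c)^\top y \mid Ay\le Bx+b,\ y\in\mathbb{R}^n\}$, or in standard form, $\min\{(Cx+c)^\top y \mid Ay= Bx+b,\ y\in\mathbb{R}^n,\ y\ge 0\}$. Decide (optimistic scenario) whether there exists $x\in X$ with $\mathrm{Opt}(x)\cap Y\ne\emptyset$; (pessimistic scenario) whether there exists $x\in X$ with $\emptyset\ne\mathrm{Opt}(x)\subseteq Y$. For each of the two forms of the LP, both the optimistic and the pessimistic decision problem are NP-complete, and they remain NP-complete when restricted to instances with fixed right-hand side, i.e., with $B=0$.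
   Context: All input data are rational and given in the usual binary encoding. $\mathrm{Opt}(x)$ is empty if the LP for parameter $x$ is infeasible or unbounded. *)

theory Defs
  imports
    "HOL-Computational_Algebra.Polynomial"
    "Jordan_Normal_Form.Matrix"
begin

section \<open>Turing machines and NP-completeness\<close>

text \<open>Deterministic multitape Turing machines. The tapes are infinite in both directions.
  A machine has \<open>num_tapes\<close> tapes, the tape alphabet \<open>{0..<num_symbols}\<close> and the states
  \<open>{0..num_states}\<close>, where \<open>0\<close> is the initial state and \<open>num_states\<close> is the halting state.
  Tape 0 carries the input and tape 1 the output.\<close>

datatype move = MoveLeft | Stay | MoveRight

record tm =
  num_tapes :: nat
  num_symbols :: nat
  num_states :: nat
  delta :: "nat \<Rightarrow> nat list \<Rightarrow> nat \<times> (nat \<times> move) list"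

text \<open>\<open>delta\<close> is only ever evaluated on the finitely many arguments constrained here. Without
  the bounds on symbols and states the model would not be one of finite machines.
  Symbols 0 to 3 are the blank, the two bits and a separator.\<close>

definition tm_wf :: "tm \<Rightarrow> bool" where
  "tm_wf M \<longleftrightarrow> num_tapes M \<ge> 2 \<and> num_symbols M \<ge> 4 \<and>
     (\<forall>q < num_states M. \<forall>s. length s = num_tapes M \<and> set s \<subseteq> {..<num_symbols M} \<longrightarrow>
        fst (delta M q s) \<le> num_states M \<and>
        length (snd (delta M q s)) = num_tapes M \<and>
        fst ` set (snd (delta M q s)) \<subseteq> {..<num_symbols M})"

type_synonym tape = "(int \<Rightarrow> nat) \<times> int"
type_synonym config = "nat \<times> tape list"

fun read_tape :: "tape \<Rightarrow> nat" where
  "read_tape (f, h) = f h"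

fun move_head :: "move \<Rightarrow> int \<Rightarrow> int" where
  "move_head MoveLeft h = h - 1"
| "move_head Stay h = h"
| "move_head MoveRight h = h + 1"

fun act_tape :: "nat \<times> move \<Rightarrow> tape \<Rightarrow> tape" where
  "act_tape (a, mv) (f, h) = (f(h := a), move_head mv h)"

fun tm_step :: "tm \<Rightarrow> config \<Rightarrow> config" where
  "tm_step M (q, ts) =
     (if q < num_states M
      then (let (q', acts) = delta M q (map read_tape ts) in (q', map2 act_tape acts ts))
      else (q, ts))"

definition tape_of :: "nat list \<Rightarrow> int \<Rightarrow> nat" where
  "tape_of w z = (if 0 \<le> z \<and> z < int (length w) then w ! nat z else 0)"

definition init_config :: "tm \<Rightarrow> nat list \<Rightarrow> config" where
  "init_config M w = (0, (tape_of w, 0) # replicate (num_tapes M - 1) (tape_of [], 0))"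

text \<open>A halted configuration is a fixed point of \<^term>\<open>tm_step M\<close>, so the following says that
  \<open>M\<close> halts after at most \<open>t\<close> steps.\<close>

definition tm_computes :: "tm \<Rightarrow> nat list \<Rightarrow> nat \<Rightarrow> nat list \<Rightarrow> bool" where
  "tm_computes M inp t out \<longleftrightarrow>
     (let (q, ts) = (tm_step M ^^ t) (init_config M inp)
      in q = num_states M \<and> fst (ts ! 1) = tape_of out)"

definition computable_in_polytime :: "('a \<Rightarrow> nat list) \<Rightarrow> ('a \<Rightarrow> nat list) \<Rightarrow> bool" where
  "computable_in_polytime inp out \<longleftrightarrow>
     (\<exists>M (p :: nat poly). tm_wf M \<and>
        (\<forall>a. tm_computes M (inp a) (poly p (length (inp a))) (out a)))"

definition bits :: "bool list \<Rightarrow> nat list" where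
  "bits = map (\<lambda>b. if b then 2 else 1)"

definition polytime_function :: "(bool list \<Rightarrow> bool list) \<Rightarrow> bool" where
  "polytime_function f \<longleftrightarrow> computable_in_polytime bits (\<lambda>x. bits (f x))"

definition polytime_verifier :: "(bool list \<Rightarrow> bool list \<Rightarrow> bool) \<Rightarrow> bool" where
  "polytime_verifier V \<longleftrightarrow>
     computable_in_polytime (\<lambda>(x, u). bits x @ [3] @ bits u) (\<lambda>(x, u). bits [V x u])"

type_synonym language = "bool list set"

definition in_NP :: "language \<Rightarrow> bool" where
  "in_NP L \<longleftrightarrow>
     (\<exists>V (p :: nat poly). polytime_verifier V \<and>
        (\<forall>x. x \<in> L \<longleftrightarrow> (\<exists>u. length u \<le> poly p (length x) \<and> V x u)))"

definition polytime_reducible :: "language \<Rightarrow> language \<Rightarrow> bool" where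
  "polytime_reducible L L' \<longleftrightarrow> (\<exists>f. polytime_function f \<and> (\<forall>x. x \<in> L \<longleftrightarrow> f x \<in> L'))"

definition NP_hard :: "language \<Rightarrow> bool" where
  "NP_hard L \<longleftrightarrow> (\<forall>L'. in_NP L' \<longrightarrow> polytime_reducible L' L)"

definition NP_complete :: "language \<Rightarrow> bool" where
  "NP_complete L \<longleftrightarrow> in_NP L \<and> NP_hard L"


section \<open>The inverse linear feasibility problem\<close>

record ilfp =
  lp_A :: "rat mat"
  lp_B :: "rat mat"
  lp_b :: "rat vec"
  lp_C :: "rat mat"
  lp_c :: "rat vec"
  X_D :: "rat mat"
  X_d :: "rat vec"
  fixed_index :: nat

text \<open>Coordinates are numbered from 0.\<close>

definition ilfp_instance :: "ilfp \<Rightarrow> bool" where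
  "ilfp_instance I \<longleftrightarrow> (\<exists>m n k g.
     lp_A I \<in> carrier_mat m n \<and> lp_B I \<in> carrier_mat m k \<and> lp_b I \<in> carrier_vec m \<and>
     lp_C I \<in> carrier_mat n k \<and> lp_c I \<in> carrier_vec n \<and>
     X_D I \<in> carrier_mat g k \<and> X_d I \<in> carrier_vec g \<and>
     fixed_index I < n)"

definition fixed_rhs :: "ilfp \<Rightarrow> bool" where
  "fixed_rhs I \<longleftrightarrow> lp_B I = 0\<^sub>m (dim_row (lp_B I)) (dim_col (lp_B I))"

abbreviation real_mat :: "rat mat \<Rightarrow> real mat" where
  "real_mat \<equiv> map_mat real_of_rat"

abbreviation real_vec :: "rat vec \<Rightarrow> real vec" where
  "real_vec \<equiv> map_vec real_of_rat"

datatype lp_form = Natural | Standard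

definition lp_rhs :: "ilfp \<Rightarrow> real vec \<Rightarrow> real vec" where
  "lp_rhs I x = real_mat (lp_B I) *\<^sub>v x + real_vec (lp_b I)"

definition lp_objective :: "ilfp \<Rightarrow> real vec \<Rightarrow> real vec \<Rightarrow> real" where
  "lp_objective I x y = (real_mat (lp_C I) *\<^sub>v x + real_vec (lp_c I)) \<bullet> y"

fun lp_feasible :: "lp_form \<Rightarrow> ilfp \<Rightarrow> real vec \<Rightarrow> real vec set" where
  "lp_feasible Natural I x =
     {y \<in> carrier_vec (dim_col (lp_A I)). real_mat (lp_A I) *\<^sub>v y \<le> lp_rhs I x}"
| "lp_feasible Standard I x =
     {y \<in> carrier_vec (dim_col (lp_A I)).
        real_mat (lp_A I) *\<^sub>v y = lp_rhs I x \<and> 0\<^sub>v (dim_col (lp_A I)) \<le> y}"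

definition Opt :: "lp_form \<Rightarrow> ilfp \<Rightarrow> real vec \<Rightarrow> real vec set" where
  "Opt F I x =
     {y \<in> lp_feasible F I x. \<forall>z \<in> lp_feasible F I x. lp_objective I x y \<le> lp_objective I x z}"

definition param_set :: "ilfp \<Rightarrow> real vec set" where
  "param_set I = {x \<in> carrier_vec (dim_col (X_D I)). real_mat (X_D I) *\<^sub>v x \<le> real_vec (X_d I)}"

definition target_set :: "ilfp \<Rightarrow> real vec set" where
  "target_set I = {y \<in> carrier_vec (dim_col (lp_A I)). y $ fixed_index I = 0}"

definition optimistic :: "lp_form \<Rightarrow> ilfp \<Rightarrow> bool" where
  "optimistic F I \<longleftrightarrow> (\<exists>x \<in> param_set I. Opt F I x \<inter> target_set I \<noteq> {})"

definition pessimistic :: "lp_form \<Rightarrow> ilfp \<Rightarrow> bool" where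
  "pessimistic F I \<longleftrightarrow> (\<exists>x \<in> param_set I. Opt F I x \<noteq> {} \<and> Opt F I x \<subseteq> target_set I)"


section \<open>Binary encoding of instances\<close>

text \<open>All codes are self-delimiting: a list is written with a \<^const>\<open>True\<close> in front of each
  element and a final \<^const>\<open>False\<close>. Natural numbers are written in binary, least significant bit
  first, and rationals as a reduced fraction with positive denominator. The dimensions of an
  instance can be read off from the lengths of the coded lists (the number of variables is
  positive, so \<^const>\<open>lp_C\<close> has a row).\<close>

fun enc_list :: "('a \<Rightarrow> bool list) \<Rightarrow> 'a list \<Rightarrow> bool list" where
  "enc_list f [] = [False]"
| "enc_list f (x # xs) = True # f x @ enc_list f xs"

fun binary :: "nat \<Rightarrow> bool list" where
  "binary n = (if n = 0 then [] else odd n # binary (n div 2))"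

declare binary.simps [simp del]

definition enc_nat :: "nat \<Rightarrow> bool list" where
  "enc_nat n = enc_list (\<lambda>b. [b]) (binary n)"

definition enc_int :: "int \<Rightarrow> bool list" where
  "enc_int z = (z < 0) # enc_nat (nat \<bar>z\<bar>)"

definition enc_rat :: "rat \<Rightarrow> bool list" where
  "enc_rat r = enc_int (fst (quotient_of r)) @ enc_nat (nat (snd (quotient_of r)))"

definition enc_vec :: "rat vec \<Rightarrow> bool list" where
  "enc_vec v = enc_list enc_rat (list_of_vec v)"

definition enc_mat :: "rat mat \<Rightarrow> bool list" where
  "enc_mat M = enc_list (enc_list enc_rat) (mat_to_list M)"

definition enc_ilfp :: "ilfp \<Rightarrow> bool list" where
  "enc_ilfp I =
     enc_mat (lp_A I) @ enc_mat (lp_B I) @ enc_vec (lp_b I) @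
     enc_mat (lp_C I) @ enc_vec (lp_c I) @
     enc_mat (X_D I) @ enc_vec (X_d I) @ enc_nat (fixed_index I)"

definition ilfp_language :: "(ilfp \<Rightarrow> bool) \<Rightarrow> language" where
  "ilfp_language P = {enc_ilfp I | I. ilfp_instance I \<and> P I}"


subsection \<open>Distinct instances have distinct codes\<close>

definition self_delimiting :: "('a \<Rightarrow> bool list) \<Rightarrow> bool" where
  "self_delimiting f \<longleftrightarrow> (\<forall>x y s t. f x @ s = f y @ t \<longrightarrow> x = y \<and> s = t)"

lemma self_delimitingD:
  "self_delimiting f \<Longrightarrow> f x @ s = f y @ t \<Longrightarrow> x = y \<and> s = t"
  unfolding self_delimiting_def by blast

lemma self_delimiting_enc_list:
  assumes f: "self_delimiting f"
  shows "self_delimiting (enc_list f)"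
proof -
  have "enc_list f xs @ s = enc_list f ys @ t \<Longrightarrow> xs = ys \<and> s = t" for xs ys s t
  proof (induction xs arbitrary: ys)
    case Nil
    then show ?case by (cases ys) auto
  next
    case (Cons x xs)
    then obtain y ys' where ys: "ys = y # ys'" by (cases ys) auto
    from Cons.prems ys have "f x @ (enc_list f xs @ s) = f y @ (enc_list f ys' @ t)" by simp
    from self_delimitingD[OF f this] Cons.IH[of ys'] ys show ?case by simp
  qed
  then show ?thesis unfolding self_delimiting_def by blast
qed

lemma binary_inj: "binary m = binary n \<Longrightarrow> m = n"
proof (induction m arbitrary: n rule: less_induct)
  case (less m)
  show ?case
  proof (cases "m = 0 \<or> n = 0")
    case True
    then show ?thesis using less.prems by (auto simp: binary.simps split: if_splits)
  next
    case False
    with less.prems have eq: "odd m = odd n" "binary (m div 2) = binary (n div 2)"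
      by (simp_all add: binary.simps[of m] binary.simps[of n])
    from False have "m div 2 < m" by simp
    from less.IH[OF this eq(2)] have "m div 2 = n div 2" .
    with eq(1) show ?thesis by presburger
  qed
qed

lemma self_delimiting_enc_nat: "self_delimiting enc_nat"
proof -
  have "self_delimiting (\<lambda>b::bool. [b])" by (simp add: self_delimiting_def)
  from self_delimiting_enc_list[OF this] show ?thesis
    unfolding self_delimiting_def enc_nat_def using binary_inj by blast
qed

lemma self_delimiting_enc_int: "self_delimiting enc_int"
  unfolding self_delimiting_def
proof (intro allI impI)
  fix x y s t assume "enc_int x @ s = enc_int y @ t"
  then have "(x < 0) = (y < 0)" "enc_nat (nat \<bar>x\<bar>) @ s = enc_nat (nat \<bar>y\<bar>) @ t"
    by (simp_all add: enc_int_def)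
  with self_delimitingD[OF self_delimiting_enc_nat this(2)] show "x = y \<and> s = t" by auto
qed

lemma self_delimiting_enc_rat: "self_delimiting enc_rat"
  unfolding self_delimiting_def
proof (intro allI impI)
  fix x y s t assume "enc_rat x @ s = enc_rat y @ t"
  then have *: "enc_int (fst (quotient_of x)) @ (enc_nat (nat (snd (quotient_of x))) @ s) =
      enc_int (fst (quotient_of y)) @ (enc_nat (nat (snd (quotient_of y))) @ t)"
    by (simp add: enc_rat_def)
  from self_delimitingD[OF self_delimiting_enc_int *]
  have fst: "fst (quotient_of x) = fst (quotient_of y)"
    and **: "enc_nat (nat (snd (quotient_of x))) @ s = enc_nat (nat (snd (quotient_of y))) @ t"
    by auto
  from self_delimitingD[OF self_delimiting_enc_nat **]
  have snd: "nat (snd (quotient_of x)) = nat (snd (quotient_of y))" and "s = t" by auto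
  have "snd (quotient_of x) = snd (quotient_of y)"
    using snd quotient_of_denom_pos'[of x] quotient_of_denom_pos'[of y] by linarith
  with fst have "quotient_of x = quotient_of y" by (simp add: prod_eq_iff)
  then show "x = y \<and> s = t" using \<open>s = t\<close> by (simp add: quotient_of_inject)
qed

lemma self_delimiting_enc_vec: "self_delimiting enc_vec"
proof -
  have "list_of_vec v = list_of_vec w \<Longrightarrow> v = w" for v w :: "rat vec"
    by (metis vec_list)
  with self_delimiting_enc_list[OF self_delimiting_enc_rat] show ?thesis
    unfolding self_delimiting_def enc_vec_def by blast
qed

lemma enc_mat_append_eqD:
  "enc_mat M @ s = enc_mat N @ t \<Longrightarrow> mat_to_list M = mat_to_list N \<and> s = t"
  unfolding enc_mat_def
  by (rule self_delimitingD[OF self_delimiting_enc_list[OF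
        self_delimiting_enc_list[OF self_delimiting_enc_rat]]])

lemma length_mat_to_list: "length (mat_to_list M) = dim_row M"
  by (simp add: mat_to_list_def)

lemma mat_to_list_nth:
  "i < dim_row M \<Longrightarrow> mat_to_list M ! i = map (\<lambda>j. M $$ (i, j)) [0..<dim_col M]"
  by (simp add: mat_to_list_def)

lemma mat_to_list_inj:
  assumes eq: "mat_to_list M = mat_to_list N" and col: "dim_col M = dim_col N"
  shows "M = N"
proof (rule eq_matI)
  show row: "dim_row M = dim_row N" using arg_cong[OF eq, of length] by (simp add: length_mat_to_list)
  fix i j assume ij: "i < dim_row N" "j < dim_col N"
  have "mat_to_list M ! i ! j = mat_to_list N ! i ! j" by (simp add: eq)
  then show "M $$ (i, j) = N $$ (i, j)" using ij row col by (simp add: mat_to_list_nth)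
qed (use col in simp)

lemma enc_ilfp_inj: "inj_on enc_ilfp (Collect ilfp_instance)"
proof (rule inj_onI)
  fix I J assume "I \<in> Collect ilfp_instance" "J \<in> Collect ilfp_instance"
  then have I: "ilfp_instance I" and J: "ilfp_instance J" by auto
  assume "enc_ilfp I = enc_ilfp J"
  then have "enc_ilfp I @ [] = enc_ilfp J @ []" by simp
  note E = this[unfolded enc_ilfp_def append_assoc]
  note A = enc_mat_append_eqD[OF E]
  note B = enc_mat_append_eqD[OF conjunct2[OF A]]
  note b = self_delimitingD[OF self_delimiting_enc_vec conjunct2[OF B]]
  note C = enc_mat_append_eqD[OF conjunct2[OF b]]
  note c = self_delimitingD[OF self_delimiting_enc_vec conjunct2[OF C]]
  note D = enc_mat_append_eqD[OF conjunct2[OF c]]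
  note d = self_delimitingD[OF self_delimiting_enc_vec conjunct2[OF D]]
  note i = self_delimitingD[OF self_delimiting_enc_nat conjunct2[OF d]]
  have dims: "dim_col (lp_A K) = dim_vec (lp_c K) \<and> dim_col (lp_B K) = dim_col (lp_C K) \<and>
      dim_col (X_D K) = dim_col (lp_C K) \<and> 0 < dim_row (lp_C K)" if "ilfp_instance K" for K
    using that unfolding ilfp_instance_def by auto
  have "length (mat_to_list (lp_C I) ! 0) = dim_col (lp_C I)"
    "length (mat_to_list (lp_C J) ! 0) = dim_col (lp_C J)"
    using dims[OF I] dims[OF J] by (simp_all add: mat_to_list_nth)
  with C have col: "dim_col (lp_C I) = dim_col (lp_C J)" by simp
  have "lp_A I = lp_A J" "lp_B I = lp_B J" "lp_C I = lp_C J" "X_D I = X_D J"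
    using A B C D c col dims[OF I] dims[OF J] by (auto intro!: mat_to_list_inj)
  with b c d i show "I = J" by simp
qed

end

theory Submission
  imports Defs "Jordan_Normal_Form.Determinant"
begin

text \<open>Membership. By Farkas' lemma and complementary slackness, \<open>y\<close> is optimal for the parameter \<open>x\<close>
  iff \<open>C x + c\<close> is a combination of the rows that are tight at \<open>y\<close>, and all optimal solutions
  satisfy \<open>y\<^sub>i = 0\<close> iff moreover, for suitable multipliers of the objective, some multiple of the unit
  vector \<open>e\<^sub>i\<close> is a combination of rows with positive multiplier. Once the tight rows are fixed these
  conditions form a linear system, so by Cramer's rule a solution of polynomial size exists; it is
  the certificate.

  Hardness. A verifying Turing machine is turned into a satisfiability problem by the tableau of its
  computation, and a set of clauses into an instance whose parameters are the fractional
  satisfying assignments \<open>x\<close>. The LP compares a solution of cost 1 outside the target with solutions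
  in the target of total cost \<open>4 \<Sum> min x\<^sub>r (1 - x\<^sub>r)\<close>. If the latter are optimal, then \<open>x\<close> can be rounded
  to a satisfying assignment; if \<open>x\<close> is integral, then they are the only optimal ones. So the two
  scenarios agree on these instances, and the right-hand side does not depend on \<open>x\<close>.

  Polynomial-time computability is established by a stack language that is compiled to Turing
  machines and a collection of closure rules for functions on tree-coded data.\<close>

section \<open>Stack programs and their compilation to Turing machines\<close>

text \<open>Hardness and membership refer to concrete machines, so both the verifier and the
  reduction must be run by one; every algorithm is shaped as a composition of folds over lists whose
  states stay polynomially bounded. The verifier never parses its input: the certificate repeats the
  instance, which is encoded again and compared with the input. As codes use reduced fractions, each
  entry carries Bezout coefficients in place of a gcd computation, and a common denominator makes
  all checks integral. Complementary slackness is a disjunction; fixing the support of the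
  multipliers turns it into a linear system with right-hand sides 0 and 1 only, in which strict
  inequalities read \<open>\<ge> 1\<close> and a rational solution may be multiplied by its
  denominator. In the hardness proof a clause falsified by rounding would force the sum of
  \<open>min (x r) (1 - x r)\<close> to be at least 1, against the bound 1/4; any cost factor above
  1 in place of 4 would separate the two cases. The LP is designed in standard form; for the natural
  form its equations and sign conditions are rewritten as inequalities, so one construction serves
  both.\<close>

text \<open>Tapes 0, 2 and 3 are used as stacks whose top is the cell under the head; tape 1 only
  receives output. \<open>Copy r r'\<close> pushes the top of \<open>r'\<close> onto \<open>r\<close>. The top of an empty stack reads as 0.\<close>

datatype com =
    Push nat nat | Copy nat nat | Pop nat | Emit nat
  | Seq com com (infixr ";;" 60)
  | If nat "nat set" com com
  | While nat "nat set" com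

type_synonym stacks = "nat \<Rightarrow> nat list"

definition peek :: "nat list \<Rightarrow> nat" where
  "peek w = (case w of [] \<Rightarrow> 0 | a # _ \<Rightarrow> a)"

lemma peek_simps [simp]: "peek [] = 0" "peek (a # w) = a"
  by (simp_all add: peek_def)

text \<open>The counts are the machine steps of the compiled code: a push is a head move and a
  write, a pop or an emitted symbol is one step, the true branch of \<open>If\<close> pays for the
  test and for the jump over the other branch, an iteration of \<open>While\<close> for the test and
  the jump back.\<close>

inductive runs :: "com \<Rightarrow> stacks \<Rightarrow> nat \<Rightarrow> stacks \<Rightarrow> bool" where
  push: "r \<in> {0,2,3} \<Longrightarrow> a < 4 \<Longrightarrow> runs (Push r a) S 2 (S(r := a # S r))"
| copy: "r \<in> {0,2,3} \<Longrightarrow> r' \<in> {0,2,3} \<Longrightarrow> r \<noteq> r' \<Longrightarrow> runs (Copy r r') S 2 (S(r := peek (S r') # S r))"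
| pop: "r \<in> {0,2,3} \<Longrightarrow> runs (Pop r) S 1 (S(r := tl (S r)))"
| emit: "a < 4 \<Longrightarrow> runs (Emit a) S 1 (S(1 := S 1 @ [a]))"
| seq: "runs c1 S n S' \<Longrightarrow> runs c2 S' m S'' \<Longrightarrow> runs (c1 ;; c2) S (n + m) S''"
| if_true: "r \<in> {0,2,3} \<Longrightarrow> peek (S r) \<in> A \<Longrightarrow> runs c1 S n S' \<Longrightarrow> runs (If r A c1 c2) S (n + 2) S'"
| if_false: "r \<in> {0,2,3} \<Longrightarrow> peek (S r) \<notin> A \<Longrightarrow> runs c2 S n S' \<Longrightarrow> runs (If r A c1 c2) S (n + 1) S'"
| while_true: "r \<in> {0,2,3} \<Longrightarrow> peek (S r) \<in> A \<Longrightarrow> runs c S n S' \<Longrightarrow> runs (While r A c) S' m S'' \<Longrightarrow>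
    runs (While r A c) S (n + m + 2) S''"
| while_false: "r \<in> {0,2,3} \<Longrightarrow> peek (S r) \<notin> A \<Longrightarrow> runs (While r A c) S 1 S"

text \<open>No rule lengthens a stack by more than the number of its steps. Hence a time bound is
  also a bound on the size of the output.\<close>

lemma runs_length_le: "runs c S n S' \<Longrightarrow> length (S' r) \<le> length (S r) + n"
  by (induction rule: runs.induct) auto

section \<open>Machine instructions and compilation\<close>

datatype instr =
    MvL nat | MvR nat | Wr nat nat | Cp nat nat | Em nat | Br nat "nat set" nat | Jmp nat

definition idle :: "nat list \<Rightarrow> (nat \<times> move) list" where
  "idle s = map (\<lambda>a. (a, Stay)) s"

text \<open>The residues modulo 4 keep the written symbols in range for every instruction, and
  \<open>tm_of\<close> clamps jump targets to the halting state, so \<open>tm_wf\<close> holds for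
  any program without a side condition. On the instructions that \<open>runs\<close> admits the
  residues change nothing.\<close>

fun instr_delta :: "instr \<Rightarrow> nat \<Rightarrow> nat list \<Rightarrow> nat \<times> (nat \<times> move) list" where
  "instr_delta (MvL r) q s = (q + 1, (idle s)[r := (s ! (r mod 4), MoveLeft)])"
| "instr_delta (MvR r) q s = (q + 1, (idle s)[r := (s ! (r mod 4), MoveRight)])"
| "instr_delta (Wr r a) q s = (q + 1, (idle s)[r := (a mod 4, Stay)])"
| "instr_delta (Cp r r') q s = (q + 1, (idle s)[r := (s ! (r' mod 4), Stay)])"
| "instr_delta (Em a) q s = (q + 1, (idle s)[1 := (a mod 4, MoveRight)])"
| "instr_delta (Br r A k) q s = (if s ! r \<in> A then q + 1 else k, idle s)"
| "instr_delta (Jmp k) q s = (k, idle s)"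

definition tm_of :: "instr list \<Rightarrow> tm" where
  "tm_of P = \<lparr>num_tapes = 4, num_symbols = 4, num_states = length P,
     delta = (\<lambda>q s. (min (length P) (fst (instr_delta (P ! q) q s)), snd (instr_delta (P ! q) q s)))\<rparr>"

lemma tm_wf_tm_of: "tm_wf (tm_of P)"
proof -
  have "length (snd (instr_delta i q s)) = 4 \<and> fst ` set (snd (instr_delta i q s)) \<subseteq> {..<4}"
    if s: "length s = 4" "set s \<subseteq> {..<4}" for i q s
  proof -
    have "fst ` set (idle s) \<subseteq> {..<4}" using s by (auto simp: idle_def)
    then have upd: "fst ` set ((idle s)[r := (a, mv)]) \<subseteq> {..<4}" if "a < 4" for r a mv
      using that set_update_subset_insert[of "idle s" r "(a, mv)"] by fastforce
    have nth: "s ! (r mod 4) < 4" for r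
    proof -
      have "s ! (r mod 4) \<in> set s" using s by (intro nth_mem) simp
      with s(2) show ?thesis by blast
    qed
    have len: "length (idle s) = 4" using s by (simp add: idle_def)
    show ?thesis using \<open>fst ` set (idle s) \<subseteq> {..<4}\<close> len
      by (cases i) (simp_all add: upd nth)
  qed
  then show ?thesis by (simp add: tm_wf_def tm_of_def)
qed

lemma map2_act_idle:
  "map2 act_tape ((idle (map read_tape ts))[r := (a, mv)]) ts = ts[r := act_tape (a, mv) (ts ! r)]"
proof (rule nth_equalityI)
  fix i assume "i < length (map2 act_tape ((idle (map read_tape ts))[r := (a, mv)]) ts)"
  then have i: "i < length ts" by (simp add: idle_def)
  have "act_tape (read_tape t, Stay) t = t" for t by (cases t) simp
  with i show "map2 act_tape ((idle (map read_tape ts))[r := (a, mv)]) ts ! i =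
      ts[r := act_tape (a, mv) (ts ! r)] ! i"
    by (cases "r = i") (auto simp: idle_def)
qed (simp add: idle_def)

lemma map2_act_idle0: "map2 act_tape (idle (map read_tape ts)) ts = ts"
proof (cases ts)
  case (Cons t ts')
  obtain f h where "t = (f, h)" by force
  with Cons show ?thesis using map2_act_idle[of ts 0 "read_tape t" Stay]
    by (simp add: idle_def fun_upd_idem)
qed (simp add: idle_def)

abbreviation step_of :: "instr list \<Rightarrow> config \<Rightarrow> config" where
  "step_of P \<equiv> tm_step (tm_of P)"

lemma step_of:
  assumes "q < length P"
  shows "step_of P (q, ts) = (min (length P) (fst (instr_delta (P ! q) q (map read_tape ts))),
     map2 act_tape (snd (instr_delta (P ! q) q (map read_tape ts))) ts)"
  using assms by (simp add: tm_of_def)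

lemma funpow_split: "(f ^^ (n + m)) x = (f ^^ m) ((f ^^ n) x)"
  by (metis add.commute comp_apply funpow_add)

text \<open>Only the cells from the head rightwards matter. A pop leaves its symbol behind on the
  left, where a later push overwrites it.\<close>

definition rep_tape :: "tape \<Rightarrow> nat list \<Rightarrow> bool" where
  "rep_tape t w \<longleftrightarrow> (\<forall>i::nat. fst t (snd t + int i) = (if i < length w then w ! i else 0))"

definition rep_cfg :: "tape list \<Rightarrow> stacks \<Rightarrow> bool" where
  "rep_cfg ts S \<longleftrightarrow> length ts = 4 \<and> (\<forall>r\<in>{0,2,3}. rep_tape (ts ! r) (S r)) \<and>
     ts ! 1 = (tape_of (S 1), int (length (S 1)))"

lemma rep_tape_read: "rep_tape t w \<Longrightarrow> read_tape t = peek w"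
  unfolding rep_tape_def by (cases t; cases w) (auto dest: spec[of _ 0])

lemma rep_cfg_read:
  "rep_cfg ts S \<Longrightarrow> r \<in> {0,2,3} \<Longrightarrow> r < length ts \<and> read_tape (ts ! r) = peek (S r)"
  unfolding rep_cfg_def by (auto dest: rep_tape_read)

lemma rep_tape_push:
  assumes "rep_tape t w"
  shows "rep_tape (act_tape (a, Stay) (act_tape (read_tape t, MoveLeft) t)) (a # w)"
proof -
  obtain f h where t: "t = (f, h)" by force
  show ?thesis unfolding rep_tape_def
  proof
    fix i :: nat
    show "fst (act_tape (a, Stay) (act_tape (read_tape t, MoveLeft) t))
        (snd (act_tape (a, Stay) (act_tape (read_tape t, MoveLeft) t)) + int i) =
        (if i < length (a # w) then (a # w) ! i else 0)"
    proof (cases i)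
      case (Suc j)
      then have "h - 1 + int i = h + int j" by simp
      then show ?thesis using assms Suc unfolding rep_tape_def t by auto
    qed (simp add: t)
  qed
qed

lemma rep_tape_pop:
  assumes "rep_tape t w"
  shows "rep_tape (act_tape (read_tape t, MoveRight) t) (tl w)"
proof -
  obtain f h where t: "t = (f, h)" by force
  have "f (h + 1 + int i) = (if i < length (tl w) then tl w ! i else 0)" for i
    using assms[unfolded rep_tape_def t, rule_format, of "Suc i"]
    by (cases w) (auto simp: algebra_simps)
  then show ?thesis by (simp add: t rep_tape_def)
qed

lemma tape_of_snoc: "(tape_of w)(int (length w) := a) = tape_of (w @ [a])"
  by (auto simp: tape_of_def fun_eq_iff nth_append)

fun clen :: "com \<Rightarrow> nat" where
  "clen (Push r a) = 2"
| "clen (Copy r r') = 2"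
| "clen (Pop r) = 1"
| "clen (Emit a) = 1"
| "clen (c1 ;; c2) = clen c1 + clen c2"
| "clen (If r A c1 c2) = clen c1 + clen c2 + 2"
| "clen (While r A c) = clen c + 2"

text \<open>Addresses are absolute: \<open>p\<close> is the address of the first instruction, and
  control leaves the block at \<open>p + clen c\<close>.\<close>

fun compile :: "com \<Rightarrow> nat \<Rightarrow> instr list" where
  "compile (Push r a) p = [MvL r, Wr r a]"
| "compile (Copy r r') p = [MvL r, Cp r r']"
| "compile (Pop r) p = [MvR r]"
| "compile (Emit a) p = [Em a]"
| "compile (c1 ;; c2) p = compile c1 p @ compile c2 (p + clen c1)"
| "compile (If r A c1 c2) p =
     Br r A (p + clen c1 + 2) # compile c1 (p + 1) @ Jmp (p + clen c1 + clen c2 + 2) # compile c2 (p + clen c1 + 2)"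
| "compile (While r A c) p = Br r A (p + clen c + 2) # compile c (p + 1) @ [Jmp p]"

lemma length_compile [simp]: "length (compile c p) = clen c"
  by (induction c arbitrary: p) auto

definition code_at :: "instr list \<Rightarrow> nat \<Rightarrow> instr list \<Rightarrow> bool" where
  "code_at P p is \<longleftrightarrow> (\<exists>u v. P = u @ is @ v \<and> length u = p)"

lemma code_at_append: "code_at P p (is @ js) \<longleftrightarrow> code_at P p is \<and> code_at P (p + length is) js"
proof
  assume "code_at P p (is @ js)"
  then obtain u v where "P = u @ (is @ js) @ v" "length u = p" unfolding code_at_def by blast
  then have "P = u @ is @ (js @ v)" "P = (u @ is) @ js @ v" "length (u @ is) = p + length is" by auto
  then show "code_at P p is \<and> code_at P (p + length is) js"
    unfolding code_at_def using \<open>length u = p\<close> by blast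
next
  assume "code_at P p is \<and> code_at P (p + length is) js"
  then obtain u v u' v' where "P = u @ is @ v" "length u = p" "P = u' @ js @ v'" "length u' = p + length is"
    unfolding code_at_def by blast
  moreover from this have "u' = u @ is" by (metis append_assoc append_eq_append_conv length_append)
  ultimately have "P = u @ (is @ js) @ v'" by simp
  with \<open>length u = p\<close> show "code_at P p (is @ js)" unfolding code_at_def by blast
qed

lemma code_at_Cons: "code_at P p (i # is) \<longleftrightarrow> p < length P \<and> P ! p = i \<and> code_at P (p + 1) is"
proof -
  have "code_at P p [i] \<longleftrightarrow> p < length P \<and> P ! p = i"
  proof
    assume "p < length P \<and> P ! p = i"
    then have "P = take p P @ [i] @ drop (Suc p) P" "length (take p P) = p"
      using id_take_nth_drop[of p P] by auto
    then show "code_at P p [i]" unfolding code_at_def by blast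
  qed (auto simp: code_at_def)
  with code_at_append[of P p "[i]" "is"] show ?thesis by simp
qed

lemma code_at_le: "code_at P p is \<Longrightarrow> p + length is \<le> length P"
  unfolding code_at_def by auto

lemma rep_cfg_upd:
  assumes "rep_cfg ts S" "r \<in> {0,2,3}" "rep_tape t w"
  shows "rep_cfg (ts[r := t]) (S(r := w))"
  using assms unfolding rep_cfg_def by (auto simp: nth_list_update)

text \<open>Induction over the run and not over the command, since the recursive premise for
  \<open>While\<close> concerns the same command at the same address.\<close>

lemma compile_correct:
  "runs c S n S' \<Longrightarrow> code_at P p (compile c p) \<Longrightarrow> rep_cfg ts S \<Longrightarrow>
   \<exists>ts'. (step_of P ^^ n) (p, ts) = (p + clen c, ts') \<and> rep_cfg ts' S'"
proof (induction arbitrary: p ts rule: runs.induct)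
  case (push r a S)
  note rd = rep_cfg_read[OF push(4,1)]
  have P: "p < length P" "P ! p = MvL r" "p + 1 < length P" "P ! (p + 1) = Wr r a"
    using push.prems(1) by (auto simp: code_at_Cons)
  let ?t = "act_tape (read_tape (ts ! r), MoveLeft) (ts ! r)"
  have "r mod 4 = r" using push(1) by auto
  then have "step_of P (p, ts) = (p + 1, ts[r := ?t])"
    using P rd by (simp add: step_of map2_act_idle del: tm_step.simps act_tape.simps)
  moreover have "step_of P (p + 1, ts[r := ?t]) = (p + 2, ts[r := act_tape (a, Stay) ?t])"
    using P rd push(2) step_of[of "p + 1" P "ts[r := ?t]"]
    by (simp add: map2_act_idle del: tm_step.simps act_tape.simps)
  ultimately have "(step_of P ^^ 2) (p, ts) = (p + 2, ts[r := act_tape (a, Stay) ?t])"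
    by (simp add: numeral_2_eq_2 del: tm_step.simps act_tape.simps)
  moreover have "rep_cfg (ts[r := act_tape (a, Stay) ?t]) (S(r := a # S r))"
    using push(1,4) by (intro rep_cfg_upd rep_tape_push) (auto simp: rep_cfg_def)
  ultimately show ?case by (intro exI conjI) (simp_all del: tm_step.simps act_tape.simps fun_upd_apply)
next
  case (copy r r' S)
  note rd = rep_cfg_read[OF copy(5,1)] and rd' = rep_cfg_read[OF copy(5,2)]
  have P: "p < length P" "P ! p = MvL r" "p + 1 < length P" "P ! (p + 1) = Cp r r'"
    using copy.prems(1) by (auto simp: code_at_Cons)
  let ?t = "act_tape (read_tape (ts ! r), MoveLeft) (ts ! r)"
  have m: "r mod 4 = r" "r' mod 4 = r'" using copy(1,2) by auto
  then have "step_of P (p, ts) = (p + 1, ts[r := ?t])"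
    using P rd by (simp add: step_of map2_act_idle del: tm_step.simps act_tape.simps)
  moreover have "step_of P (p + 1, ts[r := ?t]) = (p + 2, ts[r := act_tape (peek (S r'), Stay) ?t])"
    using P rd rd' m copy(3) step_of[of "p + 1" P "ts[r := ?t]"]
    by (simp add: map2_act_idle del: tm_step.simps act_tape.simps)
  ultimately have "(step_of P ^^ 2) (p, ts) = (p + 2, ts[r := act_tape (peek (S r'), Stay) ?t])"
    by (simp add: numeral_2_eq_2 del: tm_step.simps act_tape.simps)
  moreover have "rep_cfg (ts[r := act_tape (peek (S r'), Stay) ?t]) (S(r := peek (S r') # S r))"
    using copy(1,5) by (intro rep_cfg_upd rep_tape_push) (auto simp: rep_cfg_def)
  ultimately show ?case by (intro exI conjI) (simp_all del: tm_step.simps act_tape.simps fun_upd_apply)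
next
  case (pop r S)
  note rd = rep_cfg_read[OF pop(3,1)]
  have P: "p < length P" "P ! p = MvR r" using pop.prems(1) by (auto simp: code_at_Cons)
  let ?t = "act_tape (read_tape (ts ! r), MoveRight) (ts ! r)"
  have "r mod 4 = r" using pop(1) by auto
  then have "step_of P (p, ts) = (p + 1, ts[r := ?t])"
    using P rd by (simp add: step_of map2_act_idle del: tm_step.simps act_tape.simps)
  moreover have "rep_cfg (ts[r := ?t]) (S(r := tl (S r)))"
    using pop(1,3) by (intro rep_cfg_upd rep_tape_pop) (auto simp: rep_cfg_def)
  ultimately show ?case by (intro exI conjI) (simp_all del: tm_step.simps act_tape.simps fun_upd_apply)
next
  case (emit a S)
  have P: "p < length P" "P ! p = Em a" using emit.prems(1) by (auto simp: code_at_Cons)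
  let ?t = "act_tape (a, MoveRight) (ts ! 1)"
  have "step_of P (p, ts) = (p + 1, ts[1 := ?t])"
    using P emit(1) by (simp add: step_of map2_act_idle del: tm_step.simps act_tape.simps)
  moreover have "rep_cfg (ts[1 := ?t]) (S(1 := S 1 @ [a]))"
    using emit(3) by (auto simp: rep_cfg_def tape_of_snoc)
  ultimately show ?case by (intro exI conjI) (simp_all del: tm_step.simps act_tape.simps fun_upd_apply)
next
  case (seq c1 S n S' c2 m S'')
  from seq.prems(1) have C: "code_at P p (compile c1 p)" "code_at P (p + clen c1) (compile c2 (p + clen c1))"
    by (auto simp: code_at_append)
  from seq.IH(1)[OF C(1) seq.prems(2)] obtain ts' where
    1: "(step_of P ^^ n) (p, ts) = (p + clen c1, ts')" "rep_cfg ts' S'" by blast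
  from seq.IH(2)[OF C(2) 1(2)] 1(1) show ?case by (simp add: funpow_split add.assoc)
next
  case (if_true r S A c1 n S' c2)
  note rd = rep_cfg_read[OF if_true.prems(2) if_true.hyps(1)]
  from if_true.prems(1) have C: "p < length P" "P ! p = Br r A (p + clen c1 + 2)"
    "code_at P (p + 1) (compile c1 (p + 1))" "p + 1 + clen c1 < length P"
    "P ! (p + 1 + clen c1) = Jmp (p + clen c1 + clen c2 + 2)"
    by (auto simp: code_at_append code_at_Cons)
  from if_true.IH[OF C(3) if_true.prems(2)] obtain ts' where
    1: "(step_of P ^^ n) (p + 1, ts) = (p + 1 + clen c1, ts')" "rep_cfg ts' S'" by blast
  have 0: "step_of P (p, ts) = (p + 1, ts)"
    using C rd if_true.hyps by (simp add: step_of map2_act_idle0 del: tm_step.simps)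
  have "p + clen c1 + clen c2 + 2 \<le> length P" using code_at_le[OF if_true.prems(1)] by simp
  then have 2: "step_of P (p + 1 + clen c1, ts') = (p + clen c1 + clen c2 + 2, ts')"
    using step_of[OF C(4), of ts'] unfolding C(5) by (simp add: map2_act_idle0 del: tm_step.simps)
  have "(step_of P ^^ (n + 2)) (p, ts) = (step_of P ^^ Suc n) (step_of P (p, ts))"
    by (simp add: funpow_swap1 del: tm_step.simps)
  also have "\<dots> = (p + clen c1 + clen c2 + 2, ts')" unfolding 0 using 1(1) 2
    by (simp del: tm_step.simps)
  finally show ?case using 1(2) by (simp add: algebra_simps)
next
  case (if_false r S A c2 n S' c1)
  note rd = rep_cfg_read[OF if_false.prems(2) if_false.hyps(1)]
  from if_false.prems(1) have C: "p < length P" "P ! p = Br r A (p + clen c1 + 2)"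
    "code_at P (p + 1 + clen c1 + 1) (compile c2 (p + clen c1 + 2))"
    by (auto simp: code_at_append code_at_Cons)
  have "p + 1 + clen c1 + 1 = p + clen c1 + 2" by simp
  with C(3) have C3: "code_at P (p + clen c1 + 2) (compile c2 (p + clen c1 + 2))" by metis
  from if_false.IH[OF C3 if_false.prems(2)] obtain ts' where
    1: "(step_of P ^^ n) (p + clen c1 + 2, ts) = (p + clen c1 + 2 + clen c2, ts')" "rep_cfg ts' S'" by blast
  have 0: "step_of P (p, ts) = (p + clen c1 + 2, ts)"
    using C rd if_false.hyps code_at_le[OF if_false.prems(1)]
    by (simp add: step_of map2_act_idle0 del: tm_step.simps)
  have "(step_of P ^^ (n + 1)) (p, ts) = (step_of P ^^ n) (step_of P (p, ts))"
    by (simp add: funpow_swap1 del: tm_step.simps)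
  with 0 1 show ?case by (simp add: algebra_simps)
next
  case (while_true r S A c n S' m S'')
  note rd = rep_cfg_read[OF while_true.prems(2) while_true.hyps(1)]
  from while_true.prems(1) have C: "p < length P" "P ! p = Br r A (p + clen c + 2)"
    "code_at P (p + 1) (compile c (p + 1))" "p + 1 + clen c < length P" "P ! (p + 1 + clen c) = Jmp p"
    by (auto simp: code_at_append code_at_Cons)
  from while_true.IH(1)[OF C(3) while_true.prems(2)] obtain ts' where
    1: "(step_of P ^^ n) (p + 1, ts) = (p + 1 + clen c, ts')" "rep_cfg ts' S'" by blast
  from while_true.IH(2)[OF while_true.prems(1) 1(2)] obtain ts'' where
    3: "(step_of P ^^ m) (p, ts') = (p + clen (While r A c), ts'')" "rep_cfg ts'' S''" by blast
  have 0: "step_of P (p, ts) = (p + 1, ts)"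
    using C rd while_true.hyps by (simp add: step_of map2_act_idle0 del: tm_step.simps)
  have 2: "step_of P (p + 1 + clen c, ts') = (p, ts')"
    using step_of[OF C(4), of ts'] C(1) unfolding C(5) by (simp add: map2_act_idle0 del: tm_step.simps)
  have "(step_of P ^^ (n + m + 2)) (p, ts) = (step_of P ^^ (Suc n + m)) (step_of P (p, ts))"
    by (simp add: funpow_swap1 del: tm_step.simps)
  also have "\<dots> = (step_of P ^^ m) (p, ts')" unfolding 0 funpow_split using 1(1) 2
    by (simp del: tm_step.simps)
  finally show ?case using 3 by simp
next
  case (while_false r S A c)
  note rd = rep_cfg_read[OF while_false.prems(2) while_false.hyps(1)]
  from while_false.prems(1) have C: "p < length P" "P ! p = Br r A (p + clen c + 2)"
    by (auto simp: code_at_append code_at_Cons)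
  have 0: "step_of P (p, ts) = (p + clen c + 2, ts)"
    using C rd while_false.hyps code_at_le[OF while_false.prems(1)]
    by (simp add: step_of map2_act_idle0 del: tm_step.simps)
  then show ?case using while_false.prems by (simp del: tm_step.simps)
qed

definition input_stacks :: "nat list \<Rightarrow> stacks" where
  "input_stacks w = (\<lambda>r. [])(0 := w)"

text \<open>The code ends at the address that is the halting state, a fixed point of the step
  function; so every time bound above the run time is met.\<close>

lemma tm_computes_compile:
  assumes "runs c (input_stacks w) n S'" "n \<le> t"
  shows "tm_computes (tm_of (compile c 0)) w t (S' 1)"
proof -
  let ?P = "compile c 0"
  let ?ts = "(tape_of w, 0) # replicate 3 (tape_of [], 0)"
  have "rep_cfg ?ts (input_stacks w)"
    by (auto simp: rep_cfg_def rep_tape_def input_stacks_def tape_of_def)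
  moreover have "code_at ?P 0 (compile c 0)" unfolding code_at_def by force
  ultimately obtain ts' where 1: "(step_of ?P ^^ n) (0, ?ts) = (clen c, ts')" "rep_cfg ts' S'"
    using compile_correct[OF assms(1), of ?P 0 ?ts] by auto
  have "(step_of ?P ^^ k) (clen c, ts') = (clen c, ts')" for k
    by (induction k) (simp_all add: tm_of_def)
  then have "(step_of ?P ^^ t) (0, ?ts) = (clen c, ts')"
    using funpow_split[of n "t - n" "step_of ?P"] assms(2) 1(1) by simp
  moreover have "init_config (tm_of ?P) w = (0, ?ts)" by (simp add: init_config_def tm_of_def)
  moreover have "fst (ts' ! 1) = tape_of (S' 1)" using 1(2) by (simp add: rep_cfg_def)
  ultimately show ?thesis unfolding tm_computes_def by (simp add: tm_of_def)
qed

section \<open>Polynomial-time functions on tree-coded data\<close>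

text \<open>Branches of different cost make exact step counts unwieldy; upper bounds compose just as
  well and can be relaxed by \<open>rb_mono\<close>.\<close>

definition runsb :: "com \<Rightarrow> stacks \<Rightarrow> nat \<Rightarrow> stacks \<Rightarrow> bool" where
  "runsb c S n S' \<longleftrightarrow> (\<exists>m\<le>n. runs c S m S')"

lemma rb_mono: "runsb c S n S' \<Longrightarrow> n \<le> k \<Longrightarrow> runsb c S k S'"
  unfolding runsb_def using le_trans by blast

lemma rb_start: "runsb c S n S' \<Longrightarrow> S = T \<Longrightarrow> runsb c T n S'"
  by simp

lemma rb_push: "r \<in> {0,2,3} \<Longrightarrow> a < 4 \<Longrightarrow> S' = S(r := a # S r) \<Longrightarrow> runsb (Push r a) S 2 S'"
  unfolding runsb_def using runs.push by blast

lemma rb_copy: "r \<in> {0,2,3} \<Longrightarrow> r' \<in> {0,2,3} \<Longrightarrow> r \<noteq> r' \<Longrightarrow> S' = S(r := peek (S r') # S r) \<Longrightarrow>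
    runsb (Copy r r') S 2 S'"
  unfolding runsb_def using runs.copy by blast

lemma rb_pop: "r \<in> {0,2,3} \<Longrightarrow> S' = S(r := tl (S r)) \<Longrightarrow> runsb (Pop r) S 1 S'"
  unfolding runsb_def using runs.pop by blast

lemma rb_emit: "a < 4 \<Longrightarrow> S' = S(1 := S 1 @ [a]) \<Longrightarrow> runsb (Emit a) S 1 S'"
  unfolding runsb_def using runs.emit by blast

lemma rb_seq: "runsb c1 S n S' \<Longrightarrow> runsb c2 S' m S'' \<Longrightarrow> runsb (c1 ;; c2) S (n + m) S''"
  unfolding runsb_def using runs.seq add_mono by blast

lemma rb_ifT: "r \<in> {0,2,3} \<Longrightarrow> peek (S r) \<in> A \<Longrightarrow> runsb c1 S n S' \<Longrightarrow> runsb (If r A c1 c2) S (n + 2) S'"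
  unfolding runsb_def using runs.if_true by (meson add_le_mono1)

lemma rb_ifF: "r \<in> {0,2,3} \<Longrightarrow> peek (S r) \<notin> A \<Longrightarrow> runsb c2 S n S' \<Longrightarrow> runsb (If r A c1 c2) S (n + 2) S'"
proof -
  assume a: "r \<in> {0,2,3}" "peek (S r) \<notin> A" "runsb c2 S n S'"
  then obtain m where "m \<le> n" "runs c2 S m S'" unfolding runsb_def by blast
  then have "runs (If r A c1 c2) S (m + 1) S'" "m + 1 \<le> n + 2"
    using a(1,2) by (auto intro: runs.if_false simp del: One_nat_def)
  then show ?thesis unfolding runsb_def by blast
qed

lemma rb_whileT: "r \<in> {0,2,3} \<Longrightarrow> peek (S r) \<in> A \<Longrightarrow> runsb c S n S' \<Longrightarrow> runsb (While r A c) S' m S'' \<Longrightarrow>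
    runsb (While r A c) S (n + m + 2) S''"
  unfolding runsb_def using runs.while_true by (meson add_le_mono add_le_mono1)

lemma rb_whileF: "r \<in> {0,2,3} \<Longrightarrow> peek (S r) \<notin> A \<Longrightarrow> runsb (While r A c) S 1 S"
  unfolding runsb_def using runs.while_false by blast

lemma rb_length_le: "runsb c S n S' \<Longrightarrow> length (S' r) \<le> length (S r) + n"
  unfolding runsb_def by (meson add_left_mono le_trans runs_length_le)

subsection \<open>Trees on stacks\<close>

datatype tree = Leaf | Node tree tree

text \<open>Polish notation, prefix-free over the symbols 1 and 2 alone. Trees can therefore be
  stacked without separators, while 3 remains free to mark the bottom of a region and 0 to signal an
  empty stack.\<close>

fun code :: "tree \<Rightarrow> nat list" where
  "code Leaf = [1]"
| "code (Node l r) = 2 # code l @ code r"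

lemma set_code: "set (code t) \<subseteq> {1,2}"
  by (induction t) auto

lemma code_prefix: "code s @ u = code t @ v \<Longrightarrow> s = t \<and> u = v"
proof (induction s arbitrary: t u v)
  case Leaf
  then show ?case by (cases t) auto
next
  case (Node l r)
  from Node.prems obtain l' r' where t: "t = Node l' r'" by (cases t) auto
  with Node.prems have "code l @ (code r @ u) = code l' @ (code r' @ v)" by simp
  from Node.IH(1)[OF this] have "l = l'" "code r @ u = code r' @ v" by auto
  with Node.IH(2)[OF this(2)] t show ?case by simp
qed

lemma code_pos: "0 < length (code t)"
  by (cases t) auto

text \<open>The number of 1s on stack 3 (above a marker 3) is the number of subtrees still to be read.\<close>

definition move_loop :: com where
  "move_loop = While 3 {1} (Copy 2 0 ;; If 0 {2} (Push 3 1) (Pop 3) ;; Pop 0)"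

text \<open>Both subtrees are consumed by consecutive iterations of one and the same loop, which has
  no program point between them. Stating the run with an arbitrary continuation from the state after
  the tree lets the two induction hypotheses be chained. One symbol costs at most 9 steps.\<close>

lemma move_loop:
  "S 0 = code t @ u \<Longrightarrow> S 3 = 1 # v \<Longrightarrow>
   runsb move_loop (S(0 := u, 2 := rev (code t) @ S 2, 3 := v)) n S' \<Longrightarrow>
   runsb move_loop S (n + 9 * length (code t)) S'"
proof (induction t arbitrary: S u v n S')
  case Leaf
  let ?S1 = "S(2 := 1 # S 2)" and ?S2 = "S(2 := 1 # S 2, 3 := v)"
  have "runsb (Copy 2 0) S 2 ?S1" using Leaf by (intro rb_copy) auto
  moreover have "runsb (If 0 {2} (Push 3 1) (Pop 3)) ?S1 (1 + 2) ?S2"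
    using Leaf by (intro rb_ifF rb_pop) auto
  moreover have "runsb (Pop 0) ?S2 1 (S(0 := u, 2 := rev (code Leaf) @ S 2, 3 := v))"
    using Leaf by (intro rb_pop) (auto simp: fun_eq_iff)
  ultimately have "runsb (Copy 2 0 ;; If 0 {2} (Push 3 1) (Pop 3) ;; Pop 0) S (2 + ((1 + 2) + 1))
      (S(0 := u, 2 := rev (code Leaf) @ S 2, 3 := v))" by - ((rule rb_seq, assumption)+, assumption)
  from rb_whileT[OF _ _ this Leaf(3)[unfolded move_loop_def]] Leaf(2)
  show ?case unfolding move_loop_def by (auto elim!: rb_mono)
next
  case (Node l r)
  let ?S1 = "S(2 := 2 # S 2)" and ?S2 = "S(2 := 2 # S 2, 3 := 1 # 1 # v)"
  let ?S3 = "S(0 := code l @ code r @ u, 2 := 2 # S 2, 3 := 1 # 1 # v)"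
  have "runsb (Copy 2 0) S 2 ?S1" using Node by (intro rb_copy) auto
  moreover have "runsb (If 0 {2} (Push 3 1) (Pop 3)) ?S1 (2 + 2) ?S2"
    using Node by (intro rb_ifT rb_push) auto
  moreover have "runsb (Pop 0) ?S2 1 ?S3"
    using Node by (intro rb_pop) (auto simp: fun_eq_iff)
  ultimately have 1: "runsb (Copy 2 0 ;; If 0 {2} (Push 3 1) (Pop 3) ;; Pop 0) S (2 + ((2 + 2) + 1)) ?S3"
    by - ((rule rb_seq, assumption)+, assumption)
  have "runsb move_loop (?S3(0 := code r @ u, 2 := rev (code l) @ ?S3 2, 3 := 1 # v))
      (n + 9 * length (code r)) S'"
  proof (rule Node.IH(2)[of _ u v])
    show "runsb move_loop ((?S3(0 := code r @ u, 2 := rev (code l) @ ?S3 2, 3 := 1 # v))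
        (0 := u, 2 := rev (code r) @ (?S3(0 := code r @ u, 2 := rev (code l) @ ?S3 2, 3 := 1 # v)) 2, 3 := v)) n S'"
      by (rule rb_start[OF Node.prems(3)]) (auto simp: fun_eq_iff)
  qed auto
  then have "runsb move_loop ?S3 (n + 9 * length (code r) + 9 * length (code l)) S'"
    by (rule Node.IH(1)[of _ "code r @ u" "1 # v", rotated 2]) simp_all
  from rb_whileT[OF _ _ 1 this[unfolded move_loop_def]] Node.prems(2)
  show ?case unfolding move_loop_def by (auto elim!: rb_mono)
qed

definition move_tree :: com where
  "move_tree = Push 3 3 ;; Push 3 1 ;; move_loop ;; Pop 3"

lemma rb_move_tree:
  assumes "S 0 = code t @ u" "S' = S(0 := u, 2 := rev (code t) @ S 2)"
  shows "runsb move_tree S (9 * length (code t) + 6) S'"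
proof -
  let ?S1 = "S(3 := 3 # S 3)" and ?S2 = "S(3 := 1 # 3 # S 3)"
  let ?S3 = "S(0 := u, 2 := rev (code t) @ S 2, 3 := 3 # S 3)"
  have "runsb (Push 3 3) S 2 ?S1" by (rule rb_push) auto
  moreover have "runsb (Push 3 1) ?S1 2 ?S2" by (rule rb_push) auto
  moreover have "runsb move_loop ?S2 (1 + 9 * length (code t)) ?S3"
  proof (rule move_loop[of _ t u "3 # S 3"])
    show "runsb move_loop (?S2(0 := u, 2 := rev (code t) @ ?S2 2, 3 := 3 # S 3)) 1 ?S3"
      unfolding move_loop_def using rb_whileF[of 3 ?S3 "{1}"] by (simp add: fun_upd_twist)
  qed (use assms in auto)
  moreover have "runsb (Pop 3) ?S3 1 S'" using assms by (intro rb_pop) (auto simp: fun_eq_iff)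
  ultimately have "runsb move_tree S (2 + (2 + ((1 + 9 * length (code t)) + 1))) S'"
    unfolding move_tree_def by - ((rule rb_seq, assumption)+, assumption)
  then show ?thesis by (rule rb_mono) simp
qed

section \<open>Moving, discarding, copying, swapping and comparing trees\<close>

definition xfer :: "nat set \<Rightarrow> nat \<Rightarrow> nat \<Rightarrow> com" where
  "xfer A r r' = While r A (Copy r' r ;; Pop r)"

lemma rb_xfer:
  assumes "S r = w @ v" "set w \<subseteq> A" "peek v \<notin> A" "r \<in> {0,2,3}" "r' \<in> {0,2,3}" "r \<noteq> r'"
    "S' = S(r := v, r' := rev w @ S r')"
  shows "runsb (xfer A r r') S (5 * length w + 1) S'"
  using assms(1,2,7)
proof (induction w arbitrary: S)
  case Nil
  then have "S' = S" using assms(6) by (auto simp: fun_eq_iff)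
  with Nil assms show ?case unfolding xfer_def by (auto intro: rb_whileF[THEN rb_mono])
next
  case (Cons a w)
  let ?S1 = "S(r' := a # S r')" and ?S2 = "S(r := w @ v, r' := a # S r')"
  have "runsb (Copy r' r) S 2 ?S1" using assms Cons.prems by (intro rb_copy) auto
  moreover have "runsb (Pop r) ?S1 1 ?S2"
    using assms Cons.prems by (intro rb_pop) (auto simp: fun_eq_iff)
  ultimately have 1: "runsb (Copy r' r ;; Pop r) S (2 + 1) ?S2" by (rule rb_seq)
  have "runsb (xfer A r r') ?S2 (5 * length w + 1) S'"
    using Cons.prems assms(6) by (intro Cons.IH) (auto simp: fun_eq_iff)
  from rb_whileT[OF assms(4) _ 1 this[unfolded xfer_def]] Cons.prems
  show ?case unfolding xfer_def by (auto elim!: rb_mono)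
qed

lemma rb_xfer_code:
  assumes "S r = code t @ 3 # v" "r \<in> {0,2,3}" "r' \<in> {0,2,3}" "r \<noteq> r'"
    "S' = S(r := 3 # v, r' := rev (code t) @ S r')"
  shows "runsb (xfer {1,2} r r') S (5 * length (code t) + 1) S'"
  using assms set_code[of t] by (intro rb_xfer[where w = "code t" and v = "3 # v"]) auto

lemma rb_xfer_rev:
  assumes "S r = rev (code t) @ 3 # v" "r \<in> {0,2,3}" "r' \<in> {0,2,3}" "r \<noteq> r'"
    "S' = S(r := 3 # v, r' := code t @ S r')"
  shows "runsb (xfer {1,2} r r') S (5 * length (code t) + 1) S'"
  using rb_xfer[of S r "rev (code t)" "3 # v" "{1,2}" r' S'] assms set_code[of t] by auto

definition drop_tree :: com where
  "drop_tree = Push 2 3 ;; move_tree ;; While 2 {1,2} (Pop 2) ;; Pop 2"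

lemma rb_pops:
  assumes "S r = w @ v" "set w \<subseteq> A" "peek v \<notin> A" "r \<in> {0,2,3}" "S' = S(r := v)"
  shows "runsb (While r A (Pop r)) S (3 * length w + 1) S'"
  using assms(1,2,5)
proof (induction w arbitrary: S)
  case Nil
  then have "S' = S" by (auto simp: fun_eq_iff)
  with Nil assms show ?case by (auto intro: rb_whileF[THEN rb_mono])
next
  case (Cons a w)
  have 1: "runsb (Pop r) S 1 (S(r := w @ v))" using Cons.prems assms by (intro rb_pop) auto
  have "runsb (While r A (Pop r)) (S(r := w @ v)) (3 * length w + 1) S'"
    using Cons.prems by (intro Cons.IH) auto
  from rb_whileT[OF assms(4) _ 1 this] Cons.prems show ?case by (auto elim!: rb_mono)
qed

lemma rb_drop_tree:
  assumes "S 0 = code t @ u" "S' = S(0 := u)"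
  shows "runsb drop_tree S (12 * length (code t) + 10) S'"
proof -
  let ?n = "length (code t)"
  let ?S1 = "S(2 := 3 # S 2)" and ?S2 = "S(0 := u, 2 := rev (code t) @ 3 # S 2)"
  let ?S3 = "S(0 := u, 2 := 3 # S 2)"
  have "runsb (Push 2 3) S 2 ?S1" by (rule rb_push) auto
  moreover have "runsb move_tree ?S1 (9 * ?n + 6) ?S2"
    using assms by (intro rb_move_tree[where u = u]) (auto simp: fun_eq_iff)
  moreover have "runsb (While 2 {1,2} (Pop 2)) ?S2 (3 * length (rev (code t)) + 1) ?S3"
    using set_code[of t] by (intro rb_pops[where v = "3 # S 2"]) (auto simp: fun_eq_iff)
  moreover have "runsb (Pop 2) ?S3 1 S'" using assms by (intro rb_pop) (auto simp: fun_eq_iff)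
  ultimately have "runsb drop_tree S (2 + ((9 * ?n + 6) + ((3 * length (rev (code t)) + 1) + 1))) S'"
    unfolding drop_tree_def by - ((rule rb_seq, assumption)+, assumption)
  then show ?thesis by (rule rb_mono) simp
qed

definition dup2 :: com where
  "dup2 = While 2 {1,2} (Copy 0 2 ;; Copy 3 2 ;; Pop 2)"

lemma rb_dup2:
  assumes "S 2 = w @ 3 # v" "set w \<subseteq> {1,2}" "S' = S(0 := rev w @ S 0, 2 := 3 # v, 3 := rev w @ S 3)"
  shows "runsb dup2 S (7 * length w + 1) S'"
  using assms
proof (induction w arbitrary: S)
  case Nil
  then have "S' = S" "peek (S 2) \<notin> {1,2}" by (auto simp: fun_eq_iff)
  then show ?case unfolding dup2_def using rb_whileF[of 2 S "{1,2}"] by simp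
next
  case (Cons a w)
  let ?S1 = "S(0 := a # S 0)" and ?S2 = "S(0 := a # S 0, 3 := a # S 3)"
  let ?S3 = "S(0 := a # S 0, 3 := a # S 3, 2 := w @ 3 # v)"
  have "runsb (Copy 0 2) S 2 ?S1" using Cons.prems by (intro rb_copy) auto
  moreover have "runsb (Copy 3 2) ?S1 2 ?S2" using Cons.prems by (intro rb_copy) auto
  moreover have "runsb (Pop 2) ?S2 1 ?S3" using Cons.prems by (intro rb_pop) auto
  ultimately have 1: "runsb (Copy 0 2 ;; Copy 3 2 ;; Pop 2) S (2 + (2 + 1)) ?S3" by - ((rule rb_seq, assumption)+, assumption)
  have "runsb dup2 ?S3 (7 * length w + 1) S'"
    using Cons.prems by (intro Cons.IH) (auto simp: fun_eq_iff)
  from rb_whileT[OF _ _ 1 this[unfolded dup2_def]] Cons.prems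
  show ?case unfolding dup2_def by (auto elim!: rb_mono)
qed

definition dup_prog :: com where
  "dup_prog = Push 2 3 ;; move_tree ;; Push 3 3 ;; dup2 ;; xfer {1,2} 3 2 ;; Pop 3 ;; xfer {1,2} 2 0 ;; Pop 2"

lemma rb_dup:
  assumes "S 0 = code t @ u" "S' = S(0 := code t @ code t @ u)"
  shows "runsb dup_prog S (26 * length (code t) + 15) S'"
proof -
  let ?n = "length (code t)" and ?c = "code t"
  let ?S1 = "S(2 := 3 # S 2)" and ?S2 = "S(0 := u, 2 := rev ?c @ 3 # S 2)"
  let ?S3 = "S(0 := u, 2 := rev ?c @ 3 # S 2, 3 := 3 # S 3)"
  let ?S4 = "S(0 := ?c @ u, 2 := 3 # S 2, 3 := ?c @ 3 # S 3)"
  let ?S5 = "S(0 := ?c @ u, 2 := rev ?c @ 3 # S 2, 3 := 3 # S 3)"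
  let ?S6 = "S(0 := ?c @ u, 2 := rev ?c @ 3 # S 2)"
  let ?S7 = "S(0 := ?c @ ?c @ u, 2 := 3 # S 2)"
  have "runsb (Push 2 3) S 2 ?S1" by (rule rb_push) auto
  moreover have "runsb move_tree ?S1 (9 * ?n + 6) ?S2"
    using assms by (intro rb_move_tree[where u = u]) (auto simp: fun_eq_iff)
  moreover have "runsb (Push 3 3) ?S2 2 ?S3" by (rule rb_push) auto
  moreover have "runsb dup2 ?S3 (7 * length (rev ?c) + 1) ?S4"
    using set_code[of t] by (intro rb_dup2[where v = "S 2"]) (auto simp: fun_eq_iff)
  moreover have "runsb (xfer {1,2} 3 2) ?S4 (5 * ?n + 1) ?S5"
    by (rule rb_xfer_code[where v = "S 3"]) (auto simp: fun_eq_iff)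
  moreover have "runsb (Pop 3) ?S5 1 ?S6" by (rule rb_pop) (auto simp: fun_eq_iff)
  moreover have "runsb (xfer {1,2} 2 0) ?S6 (5 * ?n + 1) ?S7"
    by (rule rb_xfer_rev[where v = "S 2"]) (auto simp: fun_eq_iff)
  moreover have "runsb (Pop 2) ?S7 1 S'" using assms by (intro rb_pop) (auto simp: fun_eq_iff)
  ultimately have "runsb dup_prog S (2 + ((9 * ?n + 6) + (2 + ((7 * length (rev ?c) + 1) + ((5 * ?n + 1)
      + (1 + ((5 * ?n + 1) + 1))))))) S'"
    unfolding dup_prog_def by - ((rule rb_seq, assumption)+, assumption)
  then show ?thesis by (rule rb_mono) simp
qed

text \<open>Saves the top tree on stack 3 above a marker, in readable order, so that the tree below
  it becomes accessible.\<close>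

definition park :: com where
  "park = Push 2 3 ;; move_tree ;; Push 3 3 ;; xfer {1,2} 2 3 ;; Pop 2"

lemma rb_park:
  assumes "S 0 = code t @ u" "S' = S(0 := u, 3 := code t @ 3 # S 3)"
  shows "runsb park S (14 * length (code t) + 12) S'"
proof -
  let ?n = "length (code t)" and ?c = "code t"
  let ?S1 = "S(2 := 3 # S 2)" and ?S2 = "S(0 := u, 2 := rev ?c @ 3 # S 2)"
  let ?S3 = "S(0 := u, 2 := rev ?c @ 3 # S 2, 3 := 3 # S 3)"
  let ?S4 = "S(0 := u, 2 := 3 # S 2, 3 := ?c @ 3 # S 3)"
  have "runsb (Push 2 3) S 2 ?S1" by (rule rb_push) auto
  moreover have "runsb move_tree ?S1 (9 * ?n + 6) ?S2"
    using assms by (intro rb_move_tree[where u = u]) (auto simp: fun_eq_iff)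
  moreover have "runsb (Push 3 3) ?S2 2 ?S3" by (rule rb_push) auto
  moreover have "runsb (xfer {1,2} 2 3) ?S3 (5 * ?n + 1) ?S4"
    by (rule rb_xfer_rev[where v = "S 2"]) (auto simp: fun_eq_iff)
  moreover have "runsb (Pop 2) ?S4 1 S'" using assms by (intro rb_pop) (auto simp: fun_eq_iff)
  ultimately have "runsb park S (2 + ((9 * ?n + 6) + (2 + ((5 * ?n + 1) + 1)))) S'"
    unfolding park_def by - ((rule rb_seq, assumption)+, assumption)
  then show ?thesis by (rule rb_mono) simp
qed

definition swap_prog :: com where
  "swap_prog = park ;; Push 2 3 ;; move_tree ;; Push 2 3 ;; xfer {1,2} 3 2 ;; Pop 3 ;;
     xfer {1,2} 2 0 ;; Pop 2 ;; xfer {1,2} 2 0 ;; Pop 2"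

lemma rb_swap:
  assumes "S 0 = code s @ code t @ u" "S' = S(0 := code t @ code s @ u)"
  shows "runsb swap_prog S (24 * (length (code s) + length (code t)) + 30) S'"
proof -
  let ?n = "length (code s)" and ?m = "length (code t)" and ?c = "code s" and ?d = "code t"
  let ?S1 = "S(0 := ?d @ u, 3 := ?c @ 3 # S 3)"
  let ?S2 = "S(0 := ?d @ u, 2 := 3 # S 2, 3 := ?c @ 3 # S 3)"
  let ?S3 = "S(0 := u, 2 := rev ?d @ 3 # S 2, 3 := ?c @ 3 # S 3)"
  let ?S4 = "S(0 := u, 2 := 3 # rev ?d @ 3 # S 2, 3 := ?c @ 3 # S 3)"
  let ?S5 = "S(0 := u, 2 := rev ?c @ 3 # rev ?d @ 3 # S 2, 3 := 3 # S 3)"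
  let ?S6 = "S(0 := u, 2 := rev ?c @ 3 # rev ?d @ 3 # S 2)"
  let ?S7 = "S(0 := ?c @ u, 2 := 3 # rev ?d @ 3 # S 2)"
  let ?S8 = "S(0 := ?c @ u, 2 := rev ?d @ 3 # S 2)"
  let ?S9 = "S(0 := ?d @ ?c @ u, 2 := 3 # S 2)"
  have "runsb park S (14 * ?n + 12) ?S1" using assms by (intro rb_park) auto
  moreover have "runsb (Push 2 3) ?S1 2 ?S2" by (rule rb_push) (auto simp: fun_eq_iff)
  moreover have "runsb move_tree ?S2 (9 * ?m + 6) ?S3"
    by (intro rb_move_tree[where u = u]) (auto simp: fun_eq_iff)
  moreover have "runsb (Push 2 3) ?S3 2 ?S4" by (rule rb_push) (auto simp: fun_eq_iff)
  moreover have "runsb (xfer {1,2} 3 2) ?S4 (5 * ?n + 1) ?S5"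
    by (rule rb_xfer_code[where v = "S 3"]) (auto simp: fun_eq_iff)
  moreover have "runsb (Pop 3) ?S5 1 ?S6" by (rule rb_pop) (auto simp: fun_eq_iff)
  moreover have "runsb (xfer {1,2} 2 0) ?S6 (5 * ?n + 1) ?S7"
    by (rule rb_xfer_rev[where v = "rev ?d @ 3 # S 2"]) (auto simp: fun_eq_iff)
  moreover have "runsb (Pop 2) ?S7 1 ?S8" by (rule rb_pop) (auto simp: fun_eq_iff)
  moreover have "runsb (xfer {1,2} 2 0) ?S8 (5 * ?m + 1) ?S9"
    by (rule rb_xfer_rev[where v = "S 2"]) (auto simp: fun_eq_iff)
  moreover have "runsb (Pop 2) ?S9 1 S'" using assms by (intro rb_pop) (auto simp: fun_eq_iff)
  ultimately have "runsb swap_prog S ((14 * ?n + 12) + (2 + ((9 * ?m + 6) + (2 + ((5 * ?n + 1) + (1 +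
      ((5 * ?n + 1) + (1 + ((5 * ?m + 1) + 1))))))))) S'"
    unfolding swap_prog_def by - ((rule rb_seq, assumption)+, assumption)
  then show ?thesis by (rule rb_mono) simp
qed

definition skip :: com where
  "skip = Push 2 1 ;; Pop 2"

lemma rb_skip: "S' = S \<Longrightarrow> runsb skip S 3 S'"
  unfolding skip_def using rb_seq[OF rb_push[of 2 1 "S(2 := 1 # S 2)" S] rb_pop[of 2 S "S(2 := 1 # S 2)"]]
  by simp

fun push_list :: "nat list \<Rightarrow> com" where
  "push_list [] = skip"
| "push_list (a # w) = push_list w ;; Push 0 a"

lemma rb_push_list: "set w \<subseteq> {..<4} \<Longrightarrow> S' = S(0 := w @ S 0) \<Longrightarrow> runsb (push_list w) S (2 * length w + 3) S'"
proof (induction w arbitrary: S')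
  case Nil
  then show ?case by (auto intro: rb_skip)
next
  case (Cons a w)
  have "runsb (push_list w) S (2 * length w + 3) (S(0 := w @ S 0))" using Cons.prems(1) by (intro Cons.IH) auto
  moreover have "runsb (Push 0 a) (S(0 := w @ S 0)) 2 S'" using Cons.prems by (intro rb_push) auto
  ultimately have "runsb (push_list (a # w)) S ((2 * length w + 3) + 2) S'"
    unfolding push_list.simps by (rule rb_seq)
  then show ?case by (rule rb_mono) simp
qed

text \<open>The top of stack 2 is a flag: 1 as long as all compared symbols agree, 2 after the first
  mismatch. Stack 3 is popped only while a symbol of the tree is on top, so its marker survives when
  the tree there is the shorter one.\<close>

definition eq_loop :: com where
  "eq_loop = While 0 {1,2} ((If 0 {1} (If 3 {1} skip (Pop 2 ;; Push 2 2)) (If 3 {2} skip (Pop 2 ;; Push 2 2))) ;;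
     Pop 0 ;; If 3 {1,2} (Pop 3) skip)"

lemma rb_eq_loop:
  assumes "S 0 = y @ 3 # u" "S 3 = x @ 3 # v" "S 2 = b # w" "set y \<subseteq> {1,2}" "set x \<subseteq> {1,2}" "b \<in> {1,2}"
    "S' = S(0 := 3 # u, 3 := drop (length y) x @ 3 # v,
            2 := (if b = 1 \<and> take (length y) x = y then 1 else 2) # w)"
  shows "runsb eq_loop S (15 * length y + 1) S'"
  using assms
proof (induction y arbitrary: S x b)
  case Nil
  then have "S' = S" "peek (S 0) \<notin> {1,2}" by (auto simp: fun_eq_iff)
  then show ?case unfolding eq_loop_def using rb_whileF[of 0 S "{1,2}"] by simp
next
  case (Cons c y)
  let ?ok = "x \<noteq> [] \<and> hd x = c"
  let ?b = "if ?ok then b else 2"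
  let ?S1 = "S(2 := ?b # w)"
  let ?S2 = "S(2 := ?b # w, 0 := y @ 3 # u)"
  let ?S3 = "S(2 := ?b # w, 0 := y @ 3 # u, 3 := tl x @ 3 # v)"
  have P: "peek (S 3) = (if x = [] then 3 else hd x)" using Cons.prems(2) by (cases x) auto
  have c: "c = 1 \<or> c = 2" "peek (S 0) = c" using Cons.prems by auto
  have bad: "runsb (Pop 2 ;; Push 2 2) S (1 + 2) (S(2 := 2 # w))"
    by (rule rb_seq[OF rb_pop[OF _ refl] rb_push]) (use Cons.prems in auto)
  have ok: "runsb skip S (1 + 2) S" by (rule rb_mono[OF rb_skip]) simp_all
  have test: "runsb (If 3 {c} skip (Pop 2 ;; Push 2 2)) S ((1 + 2) + 2) ?S1"
  proof (cases ?ok)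
    case True
    then have "?S1 = S" using Cons.prems(3) by (auto simp: fun_eq_iff)
    with True P ok show ?thesis by (metis insertI1 insert_iff rb_ifT)
  next
    case False
    then have "peek (S 3) \<notin> {c}" using P c by auto
    from rb_ifF[OF _ this bad, of "skip"] False show ?thesis by auto
  qed
  have "runsb (If 0 {1} (If 3 {1} skip (Pop 2 ;; Push 2 2)) (If 3 {2} skip (Pop 2 ;; Push 2 2)))
      S (((1 + 2) + 2) + 2) ?S1"
  proof (cases "c = 1")
    case True
    show ?thesis using test unfolding True by (rule rb_ifT[rotated 2]) (use c True in simp_all)
  next
    case False
    with c have c2: "c = 2" by simp
    show ?thesis using test unfolding c2 by (rule rb_ifF[rotated 2]) (use c c2 in simp_all)
  qed
  moreover have "runsb (Pop 0) ?S1 1 ?S2" using Cons.prems by (intro rb_pop) auto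
  moreover have "runsb (If 3 {1,2} (Pop 3) skip) ?S2 (3 + 2) ?S3"
  proof (cases x)
    case Nil
    then show ?thesis using Cons.prems(2)
      by (intro rb_ifF rb_skip) (auto simp: fun_eq_iff)
  next
    case (Cons d x')
    then show ?thesis using Cons.prems(2,5)
      by (intro rb_ifT rb_pop[THEN rb_mono]) (auto simp: fun_eq_iff)
  qed
  ultimately have 1: "runsb ((If 0 {1} (If 3 {1} skip (Pop 2 ;; Push 2 2)) (If 3 {2} skip (Pop 2 ;; Push 2 2))) ;;
     Pop 0 ;; If 3 {1,2} (Pop 3) skip) S ((((1 + 2) + 2) + 2) + (1 + (3 + 2))) ?S3"
    by - ((rule rb_seq, assumption)+, assumption)
  have "runsb eq_loop ?S3 (15 * length y + 1) S'"
  proof (rule Cons.IH[of _ "tl x" ?b])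
    show "set (tl x) \<subseteq> {1,2}" using Cons.prems(5) by (cases x) auto
    have "(b = 1 \<and> take (length (c # y)) x = c # y) = (?b = 1 \<and> take (length y) (tl x) = y)"
      by (cases x) auto
    moreover have "drop (length (c # y)) x = drop (length y) (tl x)" by (cases x) auto
    ultimately show "S' = ?S3(0 := 3 # u, 3 := drop (length y) (tl x) @ 3 # v,
        2 := (if ?b = 1 \<and> take (length y) (tl x) = y then 1 else 2) # w)"
      using Cons.prems(7) by (simp add: fun_eq_iff)
  qed (use Cons.prems in auto)
  from rb_whileT[OF _ _ 1 this[unfolded eq_loop_def]] c
  show ?case unfolding eq_loop_def by (auto elim!: rb_mono)
qed

definition eq_prog :: com where
  "eq_prog = park ;; Push 2 3 ;; move_tree ;; Push 0 3 ;; xfer {1,2} 2 0 ;; Pop 2 ;; Push 2 1 ;; eq_loop ;; Pop 0 ;;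
     While 3 {1,2} (Pop 3) ;; Pop 3 ;; If 2 {1} (push_list [2,1,1]) (push_list [1]) ;; Pop 2"

lemma rb_eq:
  assumes "S 0 = code s @ code t @ u"
    "S' = S(0 := code (if s = t then Node Leaf Leaf else Leaf) @ u)"
  shows "runsb eq_prog S (29 * (length (code s) + length (code t)) + 60) S'"
proof -
  let ?n = "length (code s)" and ?m = "length (code t)" and ?c = "code s" and ?d = "code t"
  let ?S1 = "S(0 := ?d @ u, 3 := ?c @ 3 # S 3)"
  let ?S2 = "S(0 := ?d @ u, 2 := 3 # S 2, 3 := ?c @ 3 # S 3)"
  let ?S3 = "S(0 := u, 2 := rev ?d @ 3 # S 2, 3 := ?c @ 3 # S 3)"
  let ?S4 = "S(0 := 3 # u, 2 := rev ?d @ 3 # S 2, 3 := ?c @ 3 # S 3)"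
  let ?S5 = "S(0 := ?d @ 3 # u, 2 := 3 # S 2, 3 := ?c @ 3 # S 3)"
  let ?S6 = "S(0 := ?d @ 3 # u, 3 := ?c @ 3 # S 3)"
  let ?S7 = "S(0 := ?d @ 3 # u, 2 := 1 # S 2, 3 := ?c @ 3 # S 3)"
  let ?b = "if s = t then 1 else 2 :: nat"
  let ?S8 = "S(0 := 3 # u, 2 := ?b # S 2, 3 := drop ?m ?c @ 3 # S 3)"
  let ?S9 = "S(0 := u, 2 := ?b # S 2, 3 := drop ?m ?c @ 3 # S 3)"
  let ?S10 = "S(0 := u, 2 := ?b # S 2, 3 := 3 # S 3)"
  let ?S11 = "S(0 := u, 2 := ?b # S 2)"
  let ?S12 = "S(0 := code (if s = t then Node Leaf Leaf else Leaf) @ u, 2 := ?b # S 2)"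
  \<comment> \<open>Codes are prefix-free, so comparing as many symbols as the second code has
    already decides equality.\<close>
  have eq: "take ?m ?c = ?d \<longleftrightarrow> s = t"
    using code_prefix[of s "[]" t "drop ?m ?c"] by (metis append.right_neutral append_take_drop_id take_all order_refl)
  have "runsb park S (14 * ?n + 12) ?S1" using assms by (intro rb_park) auto
  moreover have "runsb (Push 2 3) ?S1 2 ?S2" by (rule rb_push) (auto simp: fun_eq_iff)
  moreover have "runsb move_tree ?S2 (9 * ?m + 6) ?S3"
    by (intro rb_move_tree[where u = u]) (auto simp: fun_eq_iff)
  moreover have "runsb (Push 0 3) ?S3 2 ?S4" by (rule rb_push) (auto simp: fun_eq_iff)
  moreover have "runsb (xfer {1,2} 2 0) ?S4 (5 * ?m + 1) ?S5"
    by (rule rb_xfer_rev[where v = "S 2"]) (auto simp: fun_eq_iff)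
  moreover have "runsb (Pop 2) ?S5 1 ?S6" by (rule rb_pop) (auto simp: fun_eq_iff)
  moreover have "runsb (Push 2 1) ?S6 2 ?S7" by (rule rb_push) (auto simp: fun_eq_iff)
  moreover have "runsb eq_loop ?S7 (15 * ?m + 1) ?S8"
    using set_code[of s] set_code[of t] eq
    by (intro rb_eq_loop[where x = ?c and b = 1 and w = "S 2" and u = u and v = "S 3"]) (auto simp: fun_eq_iff)
  moreover have "runsb (Pop 0) ?S8 1 ?S9" by (rule rb_pop) (auto simp: fun_eq_iff)
  moreover have "runsb (While 3 {1,2} (Pop 3)) ?S9 (3 * length (drop ?m ?c) + 1) ?S10"
    using set_code[of s] set_drop_subset[of ?m ?c]
    by (intro rb_pops[where v = "3 # S 3"]) (auto simp: fun_eq_iff)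
  moreover have "runsb (Pop 3) ?S10 1 ?S11" by (rule rb_pop) (auto simp: fun_eq_iff)
  moreover have "runsb (If 2 {1} (push_list [2,1,1]) (push_list [1])) ?S11 (9 + 2) ?S12"
  proof (cases "s = t")
    case True
    then show ?thesis by (intro rb_ifT rb_push_list[THEN rb_mono]) (auto simp: fun_eq_iff)
  next
    case False
    then show ?thesis by (intro rb_ifF rb_push_list[THEN rb_mono]) (auto simp: fun_eq_iff)
  qed
  moreover have "runsb (Pop 2) ?S12 1 S'" using assms by (intro rb_pop) (auto simp: fun_eq_iff)
  ultimately have "runsb eq_prog S ((14 * ?n + 12) + (2 + ((9 * ?m + 6) + (2 + ((5 * ?m + 1) + (1 + (2 +
      ((15 * ?m + 1) + (1 + ((3 * length (drop ?m ?c) + 1) + (1 + ((9 + 2) + 1)))))))))))) S'"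
    unfolding eq_prog_def by - ((rule rb_seq, assumption)+, assumption)
  then show ?thesis by (rule rb_mono) (simp add: diff_mult_distrib2)
qed

lemma rb_conv: "runsb c S n S' \<Longrightarrow> n \<le> k \<Longrightarrow> S' = T \<Longrightarrow> runsb c S k T"
  using rb_mono by blast

subsection \<open>Representable types\<close>

text \<open>Injectivity reduces the equality test on values to a comparison of trees.\<close>

class repr =
  fixes rep :: "'a \<Rightarrow> tree"
  assumes rep_inj: "rep x = rep y \<Longrightarrow> x = y"

instantiation bool :: repr
begin
definition rep_bool :: "bool \<Rightarrow> tree" where
  "rep_bool b = (if b then Node Leaf Leaf else Leaf)"
instance by standard (auto simp: rep_bool_def split: if_splits)
end

instantiation prod :: (repr, repr) repr
begin
definition rep_prod :: "'a \<times> 'b \<Rightarrow> tree" where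
  "rep_prod p = Node (rep (fst p)) (rep (snd p))"
instance by standard (auto simp: rep_prod_def dest!: rep_inj)
end

instantiation list :: (repr) repr
begin
primrec rep_list :: "'a list \<Rightarrow> tree" where
  "rep_list [] = Leaf"
| "rep_list (x # xs) = Node (rep x) (rep_list xs)"
instance
proof
  fix xs ys :: "'a list"
  show "rep xs = rep ys \<Longrightarrow> xs = ys"
    by (induction xs arbitrary: ys) (case_tac ys; auto dest: rep_inj)+
qed
end

text \<open>Natural numbers are represented in unary, integers in binary.\<close>

instantiation nat :: repr
begin
primrec rep_nat :: "nat \<Rightarrow> tree" where
  "rep_nat 0 = Leaf"
| "rep_nat (Suc n) = Node Leaf (rep_nat n)"
instance
proof
  fix m n :: nat
  show "rep m = rep n \<Longrightarrow> m = n"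
    by (induction m arbitrary: n) (case_tac n; auto)+
qed
end

instantiation int :: repr
begin
definition rep_int :: "int \<Rightarrow> tree" where
  "rep_int z = rep (z < 0, binary (nat \<bar>z\<bar>))"
instance
proof
  fix y z :: int
  assume "rep y = rep z"
  from rep_inj[OF this[unfolded rep_int_def]] have "(y < 0) = (z < 0)" "nat \<bar>y\<bar> = nat \<bar>z\<bar>"
    using binary_inj by auto
  then show "y = z" by auto
qed
end

definition sz :: "'a::repr \<Rightarrow> nat" where
  "sz x = length (code (rep x))"

lemma sz_simps [simp]:
  "sz (x, y) = sz x + sz y + 1"
  "sz ([] :: 'a::repr list) = 1"
  "sz (a # w) = sz a + sz w + 1"
  "sz True = 3" "sz False = 1"
  by (simp_all add: sz_def rep_prod_def rep_bool_def)

lemma sz_nat [simp]: "sz (n :: nat) = 2 * n + 1"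
  by (induction n) (simp_all add: sz_def)

lemma sz_pos: "0 < sz x"
  unfolding sz_def by (rule code_pos)

lemma sz_bool: "sz (b :: bool) \<le> 3"
  by (cases b) auto

lemma sz_append [simp]: "sz (xs @ ys) = sz xs + sz ys - 1"
proof (induction xs)
  case (Cons x xs)
  then show ?case using sz_pos[of xs] by simp
qed simp

lemma length_le_sz: "length xs \<le> sz xs"
  by (induction xs) auto

lemma sz_member: "x \<in> set xs \<Longrightarrow> sz x \<le> sz xs"
  by (induction xs) auto

lemma sz_bits_le: "sz (bs :: bool list) \<le> 4 * length bs + 1"
proof (induction bs)
  case (Cons b bs)
  then show ?case using sz_bool[of b] by simp
qed simp

subsection \<open>Closure properties\<close>

text \<open>The rest \<open>u\<close> of stack 0 and all other stacks, the output included, are left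
  as they were. A program can thus run above saved operands, on which composition, pairing and loops
  rely.\<close>

definition implements :: "com \<Rightarrow> nat poly \<Rightarrow> ('a::repr \<Rightarrow> 'b::repr) \<Rightarrow> bool" where
  "implements c p f \<longleftrightarrow> (\<forall>x S u. S 0 = code (rep x) @ u \<longrightarrow>
     runsb c S (poly p (sz x)) (S(0 := code (rep (f x)) @ u)))"

definition ptime :: "('a::repr \<Rightarrow> 'b::repr) \<Rightarrow> bool" where
  "ptime f \<longleftrightarrow> (\<exists>c p. implements c p f)"

named_theorems pt

lemma poly_mono_nat: "m \<le> n \<Longrightarrow> poly (p :: nat poly) m \<le> poly p n"
  by (induction p) (auto intro!: mult_le_mono add_left_mono)

lemma implementsI:
  assumes "\<And>x S u. S 0 = code (rep x) @ u \<Longrightarrow> runsb c S (t x) (S(0 := code (rep (f x)) @ u))"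
    "\<And>x. t x \<le> poly p (sz x)"
  shows "implements c p f"
  unfolding implements_def using assms rb_mono by blast

lemma implementsD:
  "implements c p f \<Longrightarrow> S 0 = code (rep x) @ u \<Longrightarrow> S' = S(0 := code (rep (f x)) @ u) \<Longrightarrow>
   runsb c S (poly p (sz x)) S'"
  unfolding implements_def by blast

lemma implements_sz:
  assumes "implements c p f"
  shows "sz (f x) \<le> sz x + poly p (sz x)"
proof -
  let ?S = "(\<lambda>_. [])(0 := code (rep x))"
  have "runsb c ?S (poly p (sz x)) (?S(0 := code (rep (f x)) @ []))"
    by (rule implementsD[OF assms, of _ x "[]"]) auto
  from rb_length_le[OF this, of 0] show ?thesis by (simp add: sz_def)
qed

lemma ptime_sz: "ptime f \<Longrightarrow> \<exists>q. \<forall>x. sz (f x) \<le> poly q (sz x)"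
proof -
  assume "ptime f"
  then obtain c p where "implements c p f" unfolding ptime_def by blast
  then have "\<forall>x. sz (f x) \<le> poly (p + [:0, 1:]) (sz x)"
    using implements_sz[of c p f] by (simp add: add.commute)
  then show ?thesis by blast
qed

lemma ptime_retype: "(\<And>x. rep (h x) = rep x) \<Longrightarrow> ptime h"
  unfolding ptime_def
  by (intro exI[of _ skip] exI[of _ "[:3:]"] implementsI[where t = "\<lambda>_. 3"] rb_skip) auto

text \<open>Computability depends on the codes only. This acts as a free type cast between values
  with the same tree, such as a pair and a nonempty list, or a unary number and a list of
  \<open>False\<close>.\<close>

lemma ptime_cong_rep: "ptime f \<Longrightarrow> (\<And>x. rep (g x) = rep (f x)) \<Longrightarrow> ptime g"
  unfolding ptime_def implements_def by simp

lemma ptime_id [pt]: "ptime (\<lambda>x. x)"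
  by (rule ptime_retype) simp

lemma ptime_const [pt]: "ptime (\<lambda>x :: 'a::repr. k :: 'b::repr)"
proof -
  let ?w = "code (rep k)"
  have "implements (drop_tree ;; push_list ?w) [:2 * length ?w + 13, 12:] (\<lambda>x :: 'a. k)"
  proof (rule implementsI)
    fix x :: 'a and S :: stacks and u
    assume S: "S 0 = code (rep x) @ u"
    have "runsb drop_tree S (12 * sz x + 10) (S(0 := u))"
      unfolding sz_def using S by (intro rb_drop_tree) auto
    moreover have "runsb (push_list ?w) (S(0 := u)) (2 * length ?w + 3) (S(0 := ?w @ u))"
      using set_code[of "rep k"] by (intro rb_push_list) auto
    ultimately show "runsb (drop_tree ;; push_list ?w) S (12 * sz x + 10 + (2 * length ?w + 3)) (S(0 := ?w @ u))"
      by (rule rb_seq)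
  qed simp
  then show ?thesis unfolding ptime_def by blast
qed

lemma ptime_comp:
  fixes f :: "'a::repr \<Rightarrow> 'b::repr" and g :: "'b \<Rightarrow> 'c::repr"
  assumes "ptime g" "ptime f"
  shows "ptime (\<lambda>x. g (f x))"
proof -
  obtain c p d q where *: "implements c p f" "implements d q g"
    using assms unfolding ptime_def by blast
  have "implements (c ;; d) (p + pcompose q (p + [:0, 1:])) (\<lambda>x. g (f x))"
  proof (rule implementsI)
    fix x :: 'a and S :: stacks and u
    assume S: "S 0 = code (rep x) @ u"
    have "runsb c S (poly p (sz x)) (S(0 := code (rep (f x)) @ u))"
      using S by (intro implementsD[OF *(1)]) auto
    moreover have "runsb d (S(0 := code (rep (f x)) @ u)) (poly q (sz (f x))) (S(0 := code (rep (g (f x))) @ u))"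
      by (intro implementsD[OF *(2)]) auto
    ultimately show "runsb (c ;; d) S (poly p (sz x) + poly q (sz (f x))) (S(0 := code (rep (g (f x))) @ u))"
      by (rule rb_seq)
  next
    fix x
    show "poly p (sz x) + poly q (sz (f x)) \<le> poly (p + pcompose q (p + [:0, 1:])) (sz x)"
      using implements_sz[OF *(1), of x] by (auto simp: poly_pcompose intro!: poly_mono_nat)
  qed
  then show ?thesis unfolding ptime_def by blast
qed

text \<open>The second component is computed first, on the upper of two copies, and then swapped
  below the argument; a final symbol 2 turns two adjacent codes into the code of a pair.\<close>

lemma ptime_pair [pt]:
  fixes f :: "'a::repr \<Rightarrow> 'b::repr" and g :: "'a \<Rightarrow> 'c::repr"
  assumes "ptime f" "ptime g"
  shows "ptime (\<lambda>x. (f x, g x))"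
proof -
  obtain c p d q where *: "implements c p f" "implements d q g"
    using assms unfolding ptime_def by blast
  let ?c = "dup_prog ;; d ;; swap_prog ;; c ;; Push 0 2"
  have "implements ?c ([:47, 74:] + Polynomial.smult 25 q + p) (\<lambda>x. (f x, g x))"
  proof (rule implementsI)
    fix x :: 'a and S :: stacks and u
    assume S: "S 0 = code (rep x) @ u"
    let ?x = "code (rep x)" and ?f = "code (rep (f x))" and ?g = "code (rep (g x))"
    have "runsb dup_prog S (26 * sz x + 15) (S(0 := ?x @ ?x @ u))"
      unfolding sz_def using S by (intro rb_dup) auto
    moreover have "runsb d (S(0 := ?x @ ?x @ u)) (poly q (sz x)) (S(0 := ?g @ ?x @ u))"
      by (intro implementsD[OF *(2)]) auto
    moreover have "runsb swap_prog (S(0 := ?g @ ?x @ u)) (24 * (sz (g x) + sz x) + 30) (S(0 := ?x @ ?g @ u))"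
      unfolding sz_def by (intro rb_swap) auto
    moreover have "runsb c (S(0 := ?x @ ?g @ u)) (poly p (sz x)) (S(0 := ?f @ ?g @ u))"
      by (intro implementsD[OF *(1)]) auto
    moreover have "runsb (Push 0 2) (S(0 := ?f @ ?g @ u)) 2 (S(0 := code (rep (f x, g x)) @ u))"
      by (intro rb_push) (auto simp: rep_prod_def)
    ultimately show "runsb ?c S ((26 * sz x + 15) + (poly q (sz x) + ((24 * (sz (g x) + sz x) + 30) +
        (poly p (sz x) + 2)))) (S(0 := code (rep (f x, g x)) @ u))"
      by - ((rule rb_seq, assumption)+, assumption)
  next
    fix x
    show "(26 * sz x + 15) + (poly q (sz x) + ((24 * (sz (g x) + sz x) + 30) + (poly p (sz x) + 2)))
      \<le> poly ([:47, 74:] + Polynomial.smult 25 q + p) (sz x)"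
      using implements_sz[OF *(2), of x] by simp
  qed
  then show ?thesis unfolding ptime_def by blast
qed

lemma ptime_fst_aux: "ptime (fst :: 'a::repr \<times> 'b::repr \<Rightarrow> 'a)"
proof -
  let ?c = "Pop 0 ;; swap_prog ;; drop_tree"
  have "implements ?c [:41, 36:] (fst :: 'a::repr \<times> 'b::repr \<Rightarrow> 'a)"
  proof (rule implementsI)
    fix p :: "'a \<times> 'b" and S :: stacks and u
    assume S: "S 0 = code (rep p) @ u"
    obtain x y where p: "p = (x, y)" by force
    let ?x = "code (rep x)" and ?y = "code (rep y)"
    have "runsb (Pop 0) S 1 (S(0 := ?x @ ?y @ u))"
      using S by (intro rb_pop) (auto simp: p rep_prod_def)
    moreover have "runsb swap_prog (S(0 := ?x @ ?y @ u)) (24 * (sz x + sz y) + 30) (S(0 := ?y @ ?x @ u))"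
      unfolding sz_def by (intro rb_swap) auto
    moreover have "runsb drop_tree (S(0 := ?y @ ?x @ u)) (12 * sz y + 10) (S(0 := ?x @ u))"
      unfolding sz_def by (intro rb_drop_tree) auto
    ultimately have "runsb ?c S (1 + ((24 * (sz x + sz y) + 30) + (12 * sz y + 10))) (S(0 := ?x @ u))"
      by - ((rule rb_seq, assumption)+, assumption)
    then show "runsb ?c S (36 * sz p + 41) (S(0 := code (rep (fst p)) @ u))"
      by (rule rb_conv) (simp_all add: p)
  qed simp
  then show ?thesis unfolding ptime_def by blast
qed

lemma ptime_snd_aux: "ptime (snd :: 'a::repr \<times> 'b::repr \<Rightarrow> 'b)"
proof -
  let ?c = "Pop 0 ;; drop_tree"
  have "implements ?c [:41, 36:] (snd :: 'a::repr \<times> 'b::repr \<Rightarrow> 'b)"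
  proof (rule implementsI)
    fix p :: "'a \<times> 'b" and S :: stacks and u
    assume S: "S 0 = code (rep p) @ u"
    obtain x y where p: "p = (x, y)" by force
    let ?x = "code (rep x)" and ?y = "code (rep y)"
    have "runsb (Pop 0) S 1 (S(0 := ?x @ ?y @ u))"
      using S by (intro rb_pop) (auto simp: p rep_prod_def)
    moreover have "runsb drop_tree (S(0 := ?x @ ?y @ u)) (12 * sz x + 10) (S(0 := ?y @ u))"
      unfolding sz_def by (intro rb_drop_tree) auto
    ultimately have "runsb ?c S (1 + (12 * sz x + 10)) (S(0 := ?y @ u))" by (rule rb_seq)
    then show "runsb ?c S (36 * sz p + 41) (S(0 := code (rep (snd p)) @ u))"
      by (rule rb_conv) (simp_all add: p)
  qed simp
  then show ?thesis unfolding ptime_def by blast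
qed

lemma ptime_fst [pt]: "ptime f \<Longrightarrow> ptime (\<lambda>x. fst (f x))"
  by (rule ptime_comp[OF ptime_fst_aux])

lemma ptime_snd [pt]: "ptime f \<Longrightarrow> ptime (\<lambda>x. snd (f x))"
  by (rule ptime_comp[OF ptime_snd_aux])

text \<open>A body with a bound variable is treated as a function of a tuple whose first component
  is the environment. The rules for other binders have the same shape, so that the collection
  \<open>pt\<close> can be applied backwards along the structure of a term.\<close>

lemma ptime_Let [pt]:
  assumes "ptime g" "ptime (\<lambda>p. f (fst p) (snd p))"
  shows "ptime (\<lambda>x. let y = g x in f x y)"
  using ptime_comp[OF assms(2) ptime_pair[OF ptime_id assms(1)]] by (simp add: Let_def)

lemma ptime_Cons [pt]:
  assumes "ptime f" "ptime g"
  shows "ptime (\<lambda>x. f x # g x)"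
  by (rule ptime_cong_rep[OF ptime_pair[OF assms]]) (simp add: rep_prod_def)

lemma ptime_Suc [pt]:
  assumes "ptime f"
  shows "ptime (\<lambda>x. Suc (f x))"
  by (rule ptime_cong_rep[OF ptime_pair[OF ptime_const[of False] assms]]) (simp add: rep_prod_def rep_bool_def)

lemma ptime_If [pt]:
  fixes f :: "'a::repr \<Rightarrow> 'b::repr"
  assumes "ptime b" "ptime f" "ptime g"
  shows "ptime (\<lambda>x. if b x then f x else g x)"
proof -
  obtain e r c p d q where *: "implements e r b" "implements c p f" "implements d q g"
    using assms unfolding ptime_def by metis
  let ?i = "If 0 {2} (drop_tree ;; c) (drop_tree ;; d)"
  let ?c = "dup_prog ;; e ;; ?i"
  have "implements ?c ([:63, 26:] + r + p + q) (\<lambda>x. if b x then f x else g x)"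
  proof (rule implementsI)
    fix x :: 'a and S :: stacks and u
    assume S: "S 0 = code (rep x) @ u"
    let ?x = "code (rep x)" and ?S = "S(0 := code (rep (b x)) @ code (rep x) @ u)"
    have "runsb dup_prog S (26 * sz x + 15) (S(0 := ?x @ ?x @ u))"
      unfolding sz_def using S by (intro rb_dup) auto
    moreover have "runsb e (S(0 := ?x @ ?x @ u)) (poly r (sz x)) ?S"
      by (intro implementsD[OF *(1)]) auto
    moreover have "runsb ?i ?S (46 + (poly p (sz x) + poly q (sz x)) + 2)
        (S(0 := code (rep (if b x then f x else g x)) @ u))"
    proof -
      have "runsb drop_tree ?S (12 * sz (b x) + 10) (S(0 := ?x @ u))"
        unfolding sz_def by (intro rb_drop_tree) auto
      then have 0: "runsb drop_tree ?S 46 (S(0 := ?x @ u))"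
        using sz_bool[of "b x"] by (auto elim!: rb_mono)
      show ?thesis
      proof (cases "b x")
        case True
        have "runsb c (S(0 := ?x @ u)) (poly p (sz x)) (S(0 := code (rep (f x)) @ u))"
          by (intro implementsD[OF *(2)]) auto
        from rb_mono[OF rb_ifT[where A = "{2}", OF _ _ rb_seq[OF 0 this]]] True
        show ?thesis by (auto simp: rep_bool_def)
      next
        case False
        have "runsb d (S(0 := ?x @ u)) (poly q (sz x)) (S(0 := code (rep (g x)) @ u))"
          by (intro implementsD[OF *(3)]) auto
        from rb_mono[OF rb_ifF[where A = "{2}", OF _ _ rb_seq[OF 0 this]]] False
        show ?thesis by (auto simp: rep_bool_def)
      qed
    qed
    ultimately show "runsb ?c S ((26 * sz x + 15) + (poly r (sz x) + (46 + (poly p (sz x) + poly q (sz x)) + 2)))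
        (S(0 := code (rep (if b x then f x else g x)) @ u))"
      by - ((rule rb_seq, assumption)+, assumption)
  qed simp
  then show ?thesis unfolding ptime_def by blast
qed

lemma ptime_conj [pt]: "ptime f \<Longrightarrow> ptime g \<Longrightarrow> ptime (\<lambda>x. f x \<and> g x)"
  by (rule ptime_cong_rep[OF ptime_If[of f g "\<lambda>_. False"]]) (auto intro: ptime_const)

lemma ptime_not [pt]: "ptime f \<Longrightarrow> ptime (\<lambda>x. \<not> f x)"
  by (rule ptime_cong_rep[OF ptime_If[of f "\<lambda>_. False" "\<lambda>_. True"]]) (auto intro: ptime_const)

lemma ptime_disj [pt]: "ptime f \<Longrightarrow> ptime g \<Longrightarrow> ptime (\<lambda>x. f x \<or> g x)"
  using ptime_not[OF ptime_conj[OF ptime_not ptime_not], of f g] by simp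

lemma ptime_imp [pt]: "ptime f \<Longrightarrow> ptime g \<Longrightarrow> ptime (\<lambda>x. f x \<longrightarrow> g x)"
  by (rule ptime_cong_rep[OF ptime_disj[OF ptime_not[of f]]]) auto

lemma ptime_eq [pt]:
  fixes f :: "'a::repr \<Rightarrow> 'b::repr"
  assumes "ptime f" "ptime g"
  shows "ptime (\<lambda>x. f x = g x)"
proof -
  let ?c = "Pop 0 ;; eq_prog"
  have "implements ?c [:61, 29:] (\<lambda>p. fst p = (snd p :: 'b))"
  proof (rule implementsI)
    fix p :: "'b \<times> 'b" and S :: stacks and u
    assume S: "S 0 = code (rep p) @ u"
    obtain x y where p: "p = (x, y)" by force
    let ?x = "code (rep x)" and ?y = "code (rep y)"
    have "runsb (Pop 0) S 1 (S(0 := ?x @ ?y @ u))"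
      using S by (intro rb_pop) (auto simp: p rep_prod_def)
    moreover have "runsb eq_prog (S(0 := ?x @ ?y @ u)) (29 * (sz x + sz y) + 60) (S(0 := code (rep (x = y)) @ u))"
      unfolding sz_def by (intro rb_eq) (auto simp: rep_bool_def dest: rep_inj)
    ultimately have "runsb ?c S (1 + (29 * (sz x + sz y) + 60)) (S(0 := code (rep (x = y)) @ u))"
      by (rule rb_seq)
    then show "runsb ?c S (29 * sz p + 61) (S(0 := code (rep (fst p = snd p)) @ u))"
      by (rule rb_conv) (simp_all add: p)
  qed simp
  then have "ptime (\<lambda>p. fst p = (snd p :: 'b))" unfolding ptime_def by blast
  from ptime_comp[OF this ptime_pair[OF assms]] show ?thesis by simp
qed

lemma ptime_case_list [pt]:
  fixes xs :: "'a::repr \<Rightarrow> 'b::repr list"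
  assumes "ptime xs" "ptime f" "ptime (\<lambda>p. g (fst p) (fst (snd p)) (snd (snd p)))"
  shows "ptime (\<lambda>x. case xs x of [] \<Rightarrow> f x | y # ys \<Rightarrow> g x y ys)"
proof -
  have "ptime (\<lambda>x. (xs x, x))" using assms by (intro pt)
  then obtain e r where e: "implements e r (\<lambda>x. (xs x, x))" unfolding ptime_def by blast
  from assms(2) obtain c p where c: "implements c p f" unfolding ptime_def by blast
  from assms(3) obtain d q where d: "implements d q (\<lambda>p. g (fst p) (fst (snd p)) (snd (snd p)))"
    unfolding ptime_def by blast
  note * = e c d
  let ?i = "If 0 {2} (swap_prog ;; Push 0 2 ;; d) (Pop 0 ;; c)"
  let ?c = "e ;; Pop 0 ;; ?i"
  let ?f = "\<lambda>x. case xs x of [] \<Rightarrow> f x | y # ys \<Rightarrow> g x y ys"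
  have "implements ?c ([:36, 24:] + Polynomial.smult 25 r + p + pcompose q (r + [:0, 1:])) ?f"
  proof (rule implementsI)
    fix x :: 'a and S :: stacks and u
    assume S: "S 0 = code (rep x) @ u"
    let ?x = "code (rep x)" and ?xs = "code (rep (xs x))"
    let ?m = "sz x + poly r (sz x)"
    have m: "sz (xs x) + sz x + 1 \<le> ?m" using implements_sz[OF *(1), of x] by simp
    have "runsb e S (poly r (sz x)) (S(0 := code (rep (xs x, x)) @ u))"
      using S by (intro implementsD[OF *(1)]) auto
    moreover have "runsb (Pop 0) (S(0 := code (rep (xs x, x)) @ u)) 1 (S(0 := ?xs @ ?x @ u))"
      by (intro rb_pop) (auto simp: rep_prod_def)
    moreover have "runsb ?i (S(0 := ?xs @ ?x @ u)) ((24 * ?m + 30) + (2 + (poly q ?m + poly p (sz x))) + 2)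
        (S(0 := code (rep (?f x)) @ u))"
    proof (cases "xs x")
      case Nil
      have "runsb (Pop 0) (S(0 := ?xs @ ?x @ u)) 1 (S(0 := ?x @ u))"
        using Nil by (intro rb_pop) auto
      moreover have "runsb c (S(0 := ?x @ u)) (poly p (sz x)) (S(0 := code (rep (f x)) @ u))"
        by (intro implementsD[OF *(2)]) auto
      ultimately have "runsb (Pop 0 ;; c) (S(0 := ?xs @ ?x @ u)) (1 + poly p (sz x)) (S(0 := code (rep (f x)) @ u))"
        by (rule rb_seq)
      from rb_mono[OF rb_ifF[where A = "{2}", OF _ _ this]] Nil show ?thesis by auto
    next
      case (Cons y ys)
      have 1: "runsb swap_prog (S(0 := ?xs @ ?x @ u)) (24 * (sz (xs x) + sz x) + 30) (S(0 := ?x @ ?xs @ u))"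
        unfolding sz_def by (intro rb_swap) auto
      have 2: "runsb (Push 0 2) (S(0 := ?x @ ?xs @ u)) 2 (S(0 := code (rep (x, y, ys)) @ u))"
        using Cons by (intro rb_push) (auto simp: rep_prod_def)
      have 3: "runsb d (S(0 := code (rep (x, y, ys)) @ u)) (poly q (sz (x, y, ys))) (S(0 := code (rep (?f x)) @ u))"
        using Cons by (intro implementsD[OF *(3)]) auto
      have "sz (x, y, ys) \<le> ?m" using m Cons by simp
      then have "poly q (sz (x, y, ys)) \<le> poly q ?m" by (rule poly_mono_nat)
      with m have le: "24 * (sz (xs x) + sz x) + 30 + (2 + poly q (sz (x, y, ys))) + 2 \<le>
          (24 * ?m + 30) + (2 + (poly q ?m + poly p (sz x))) + 2" by simp
      have "runsb ?i (S(0 := ?xs @ ?x @ u)) (24 * (sz (xs x) + sz x) + 30 + (2 + poly q (sz (x, y, ys))) + 2)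
          (S(0 := code (rep (?f x)) @ u))"
        by (rule rb_ifT[OF _ _ rb_seq[OF 1 rb_seq[OF 2 3]]]) (use Cons in auto)
      from rb_mono[OF this le] show ?thesis .
    qed
    ultimately show "runsb ?c S (poly r (sz x) + (1 + ((24 * ?m + 30) + (2 + (poly q ?m + poly p (sz x))) + 2)))
        (S(0 := code (rep (?f x)) @ u))"
      by - ((rule rb_seq, assumption)+, assumption)
  qed (simp add: poly_pcompose add.commute)
  then show ?thesis unfolding ptime_def by blast
qed

text \<open>A nonempty list has the code of the pair of its head and tail. Hence pushing a 2 onto
  list, environment and state yields the code of \<open>((y, ys), (x, st))\<close>, to which the
  step program applies, and popping the leading 2 of its result leaves the shorter list on top
  again. The test sees a 2 exactly when the list is nonempty.\<close>

definition fold_loop :: "com \<Rightarrow> com" where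
  "fold_loop c = While 0 {2} (Push 0 2 ;; c ;; Pop 0)"

lemma rb_fold_loop:
  fixes step :: "'a::repr \<Rightarrow> 's::repr \<Rightarrow> 'b::repr \<Rightarrow> 's"
  assumes G: "implements c p (\<lambda>z :: ('b \<times> 'b list) \<times> 'a \<times> 's. (snd (fst z), fst (snd z), step (fst (snd z)) (snd (snd z)) (fst (fst z))))"
  shows "S 0 = code (rep ys) @ code (rep (x, st)) @ u \<Longrightarrow>
    (\<And>n. sz (foldl (step x) st (take n ys)) \<le> B) \<Longrightarrow> sz ys \<le> Y \<Longrightarrow>
    runsb (fold_loop c) S (length ys * (poly p (Y + sz x + B + 2) + 5) + 1)
      (S(0 := 1 # code (rep (x, foldl (step x) st ys)) @ u))"
proof (induction ys arbitrary: st S)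
  case Nil
  then have "S(0 := 1 # code (rep (x, st)) @ u) = S" by (auto simp: fun_eq_iff)
  then show ?case using Nil unfolding fold_loop_def by (auto intro: rb_whileF[of 0, simplified])
next
  case (Cons y ys)
  let ?P = "poly p (Y + sz x + B + 2)"
  let ?S1 = "S(0 := code (rep ((y, ys), (x, st))) @ u)"
  let ?S2 = "S(0 := code (rep (ys, (x, step x st y))) @ u)"
  let ?S3 = "S(0 := code (rep ys) @ code (rep (x, step x st y)) @ u)"
  have B: "sz st \<le> B" using Cons.prems(2)[of 0] by simp
  have "runsb (Push 0 2) S 2 ?S1" using Cons.prems(1) by (intro rb_push) (auto simp: rep_prod_def)
  moreover have "runsb c ?S1 (poly p (sz ((y, ys), (x, st)))) ?S2"
    using implementsD[OF G, of ?S1 "((y, ys), (x, st))" u ?S2] by simp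
  then have "runsb c ?S1 ?P ?S2"
    by (rule rb_mono) (use B Cons.prems(3) in \<open>auto intro!: poly_mono_nat\<close>)
  moreover have "runsb (Pop 0) ?S2 1 ?S3" by (intro rb_pop) (auto simp: rep_prod_def)
  ultimately have 1: "runsb (Push 0 2 ;; c ;; Pop 0) S (2 + (?P + 1)) ?S3"
    by - ((rule rb_seq, assumption)+, assumption)
  have 2: "runsb (fold_loop c) ?S3 (length ys * (?P + 5) + 1)
      (?S3(0 := 1 # code (rep (x, foldl (step x) (step x st y) ys)) @ u))"
  proof (rule Cons.IH)
    show "sz (foldl (step x) (step x st y) (take n ys)) \<le> B" for n
      using Cons.prems(2)[of "Suc n"] by simp
  qed (use Cons.prems in auto)
  show ?case unfolding fold_loop_def
    by (rule rb_conv[OF rb_whileT[OF _ _ 1 2[unfolded fold_loop_def]]]) (use Cons.prems(1) in auto)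
qed

text \<open>Iterating a polynomial-time step can make the state grow exponentially; this is why a
  polynomial bound on all intermediate states is assumed.\<close>

lemma ptime_foldl_bounded:
  fixes xs :: "'a::repr \<Rightarrow> 'b::repr list" and init :: "'a \<Rightarrow> 's::repr"
  assumes "ptime xs" "ptime init" "ptime (\<lambda>p. step (fst p) (fst (snd p)) (snd (snd p)))"
    and B: "\<And>x n. sz (foldl (step x) (init x) (take n (xs x))) \<le> poly b (sz x)"
  shows "ptime (\<lambda>x. foldl (step x) (init x) (xs x))"
proof -
  have "ptime (\<lambda>z :: ('b \<times> 'b list) \<times> ('a \<times> 's).
      (\<lambda>p. step (fst p) (fst (snd p)) (snd (snd p))) (fst (snd z), snd (snd z), fst (fst z)))"
    by (rule ptime_comp[OF assms(3)]) (intro pt)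
  then have "ptime (\<lambda>z :: ('b \<times> 'b list) \<times> ('a \<times> 's).
      (snd (fst z), fst (snd z), step (fst (snd z)) (snd (snd z)) (fst (fst z))))"
    by (intro pt) simp
  then obtain c p where c: "implements c p (\<lambda>z :: ('b \<times> 'b list) \<times> ('a \<times> 's).
      (snd (fst z), fst (snd z), step (fst (snd z)) (snd (snd z)) (fst (fst z))))"
    unfolding ptime_def by blast
  have "ptime (\<lambda>x. (xs x, x, init x))" using assms by (intro pt)
  then obtain e r where e: "implements e r (\<lambda>x. (xs x, x, init x))" unfolding ptime_def by blast
  note * = c e
  let ?c = "e ;; Pop 0 ;; fold_loop c ;; Pop 0"
  let ?f = "\<lambda>x. (x, foldl (step x) (init x) (xs x))"
  let ?s = "r + [:0, 1:]"
  let ?q = "r + ?s * (pcompose p (?s + [:2, 1:] + b) + [:5:]) + [:3:]"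
  have "implements ?c ?q ?f"
  proof (rule implementsI)
    fix x :: 'a and S :: stacks and u
    assume S: "S 0 = code (rep x) @ u"
    let ?m = "sz x + poly r (sz x)"
    let ?P = "poly p (?m + sz x + poly b (sz x) + 2)"
    let ?S2 = "S(0 := code (rep (xs x)) @ code (rep (x, init x)) @ u)"
    let ?S3 = "S(0 := 1 # code (rep (?f x)) @ u)"
    have m: "sz (xs x) \<le> ?m" using implements_sz[OF *(2), of x] by simp
    have "runsb e S (poly r (sz x)) (S(0 := code (rep (xs x, x, init x)) @ u))"
      using S by (intro implementsD[OF *(2)]) auto
    moreover have "runsb (Pop 0) (S(0 := code (rep (xs x, x, init x)) @ u)) 1 ?S2"
      by (intro rb_pop) (auto simp: rep_prod_def)
    moreover have "runsb (fold_loop c) ?S2 (length (xs x) * (?P + 5) + 1) ?S3"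
      using rb_fold_loop[OF *(1), of ?S2 "xs x" x "init x" u "poly b (sz x)" ?m] B m by auto
    then have "runsb (fold_loop c) ?S2 (?m * (?P + 5) + 1) ?S3"
      by (rule rb_mono) (use m length_le_sz[of "xs x"] in \<open>auto intro!: mult_le_mono1\<close>)
    moreover have "runsb (Pop 0) ?S3 1 (S(0 := code (rep (?f x)) @ u))"
      by (intro rb_pop) auto
    ultimately show "runsb ?c S (poly r (sz x) + (1 + ((?m * (?P + 5) + 1) + 1))) (S(0 := code (rep (?f x)) @ u))"
      by - ((rule rb_seq, assumption)+, assumption)
  qed (simp add: poly_pcompose algebra_simps)
  then have "ptime ?f" unfolding ptime_def by blast
  from ptime_snd[OF this] show ?thesis by simp
qed

lemma foldl_sz_additive:
  assumes "\<And>st y. y \<in> set ys \<Longrightarrow> sz (step st y) \<le> sz st + k"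
  shows "sz (foldl step st ys) \<le> sz st + length ys * k"
  using assms
proof (induction ys arbitrary: st)
  case (Cons y ys)
  have "sz (foldl step (step st y) ys) \<le> sz (step st y) + length ys * k" using Cons by auto
  moreover have "sz (step st y) \<le> sz st + k" using Cons.prems by auto
  ultimately show ?case by simp
qed simp

text \<open>When the growth in one step is bounded in terms of the environment and the list element
  but not of the state, the increments merely add up over the list.\<close>

lemma ptime_foldl:
  fixes xs :: "'a::repr \<Rightarrow> 'b::repr list" and init :: "'a \<Rightarrow> 's::repr"
  assumes "ptime xs" "ptime init" "ptime (\<lambda>p. step (fst p) (fst (snd p)) (snd (snd p)))"
    and add: "\<And>x st y. sz (step x st y) \<le> sz st + poly b (sz x + sz y)"
  shows "ptime (\<lambda>x. foldl (step x) (init x) (xs x))"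
proof -
  obtain r s where rs: "\<And>x. sz (xs x) \<le> poly r (sz x)" "\<And>x. sz (init x) \<le> poly s (sz x)"
    using ptime_sz[OF assms(1)] ptime_sz[OF assms(2)] by blast
  show ?thesis
  proof (rule ptime_foldl_bounded[OF assms(1-3)])
    fix x :: 'a and n
    let ?k = "poly b (sz x + poly r (sz x))"
    have "sz (foldl (step x) (init x) (take n (xs x))) \<le> sz (init x) + length (take n (xs x)) * ?k"
    proof (rule foldl_sz_additive)
      fix st y assume "y \<in> set (take n (xs x))"
      then have "sz y \<le> poly r (sz x)" using in_set_takeD sz_member rs(1) le_trans by metis
      then have "poly b (sz x + sz y) \<le> ?k" by (intro poly_mono_nat) simp
      with add[of x st y] show "sz (step x st y) \<le> sz st + ?k" by simp
    qed
    also have "length (take n (xs x)) \<le> poly r (sz x)"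
      using length_le_sz[of "xs x"] rs(1)[of x] by simp
    finally show "sz (foldl (step x) (init x) (take n (xs x))) \<le> poly (s + r * pcompose b ([:0,1:] + r)) (sz x)"
      using rs(2)[of x] by (simp add: poly_pcompose add_mono)
  qed
qed

subsection \<open>Lists and unary numbers\<close>

lemma ptime_app2:
  assumes "ptime (\<lambda>p. f (fst p) (snd p))" "ptime g" "ptime h"
  shows "ptime (\<lambda>x. f (g x) (h x))"
  using ptime_comp[OF assms(1) ptime_pair[OF assms(2,3)]] by simp

lemma ptime_sz2:
  assumes "ptime (\<lambda>p. f (fst p) (snd p))"
  obtains b where "\<And>x y. sz (f x y) \<le> poly b (sz x + sz y)"
proof -
  obtain q where q: "\<And>p. sz (f (fst p) (snd p)) \<le> poly q (sz p)" using ptime_sz[OF assms] by blast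
  have "sz (f x y) \<le> poly (pcompose q [:1, 1:]) (sz x + sz y)" for x y
    using q[of "(x, y)"] by (simp add: poly_pcompose)
  then show ?thesis by (rule that)
qed

lemma ptime_rev [pt]:
  fixes xs :: "'a::repr \<Rightarrow> 'b::repr list"
  assumes "ptime xs"
  shows "ptime (\<lambda>x. rev (xs x))"
proof -
  have "foldl (\<lambda>st y. y # st) acc ys = rev ys @ acc" for ys acc :: "'b list"
    by (induction ys arbitrary: acc) auto
  moreover have "ptime (\<lambda>x. foldl (\<lambda>st y. y # st) [] (xs x))"
    by (rule ptime_foldl[where b = "[:1, 1:]"]) (intro pt assms | simp)+
  ultimately show ?thesis by simp
qed

lemma ptime_append [pt]:
  fixes xs ys :: "'a::repr \<Rightarrow> 'b::repr list"
  assumes "ptime xs" "ptime ys"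
  shows "ptime (\<lambda>x. xs x @ ys x)"
proof -
  have "foldl (\<lambda>st y. y # st) acc ys = rev ys @ acc" for ys acc :: "'b list"
    by (induction ys arbitrary: acc) auto
  moreover have "ptime (\<lambda>x. foldl (\<lambda>st y. y # st) (ys x) (rev (xs x)))"
    by (rule ptime_foldl[where b = "[:1, 1:]"]) (intro pt assms | simp)+
  ultimately show ?thesis by simp
qed

lemma ptime_map [pt]:
  fixes xs :: "'a::repr \<Rightarrow> 'b::repr list" and f :: "'a \<Rightarrow> 'b \<Rightarrow> 'c::repr"
  assumes "ptime (\<lambda>p. f (fst p) (snd p))" "ptime xs"
  shows "ptime (\<lambda>x. map (f x) (xs x))"
proof -
  have *: "rev (foldl (\<lambda>st y. g y # st) acc ys) = rev acc @ map g ys" for g :: "'b \<Rightarrow> 'c" and ys acc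
    by (induction ys arbitrary: acc) auto
  obtain b where b: "\<And>x y. sz (f x y) \<le> poly b (sz x + sz y)" using ptime_sz2[OF assms(1)] by blast
  have "ptime (\<lambda>x. rev (foldl (\<lambda>st y. f x y # st) [] (xs x)))"
  proof (intro ptime_rev, rule ptime_foldl[where b = "b + [:1:]"])
    show "ptime (\<lambda>p. f (fst p) (snd (snd p)) # fst (snd p))"
      by (intro pt ptime_app2[OF assms(1)])
  qed (intro pt assms | simp add: b)+
  then show ?thesis by (simp add: *)
qed

lemma ptime_filter [pt]:
  fixes xs :: "'a::repr \<Rightarrow> 'b::repr list"
  assumes "ptime (\<lambda>p. P (fst p) (snd p))" "ptime xs"
  shows "ptime (\<lambda>x. filter (P x) (xs x))"
proof -
  have *: "rev (foldl (\<lambda>st y. if Q y then y # st else st) acc ys) = rev acc @ filter Q ys"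
    for Q and ys acc :: "'b list"
    by (induction ys arbitrary: acc) auto
  have "ptime (\<lambda>x. rev (foldl (\<lambda>st y. if P x y then y # st else st) [] (xs x)))"
  proof (intro ptime_rev, rule ptime_foldl[where b = "[:1, 1:]"])
    show "ptime (\<lambda>p. if P (fst p) (snd (snd p)) then snd (snd p) # fst (snd p) else fst (snd p))"
      by (intro pt ptime_app2[OF assms(1)])
  qed (intro pt assms | simp)+
  then show ?thesis by (simp add: *)
qed

lemma ptime_Ball [pt]:
  fixes xs :: "'a::repr \<Rightarrow> 'b::repr list"
  assumes "ptime (\<lambda>p. P (fst p) (snd p))" "ptime xs"
  shows "ptime (\<lambda>x. \<forall>y\<in>set (xs x). P x y)"
proof -
  have *: "foldl (\<lambda>st y. st \<and> Q y) acc ys \<longleftrightarrow> acc \<and> (\<forall>y\<in>set ys. Q y)" for Q acc and ys :: "'b list"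
    by (induction ys arbitrary: acc) auto
  have "ptime (\<lambda>x. foldl (\<lambda>st y. st \<and> P x y) True (xs x))"
  proof (rule ptime_foldl[where b = "[:3:]"])
    show "ptime (\<lambda>p. fst (snd p) \<and> P (fst p) (snd (snd p)))"
      by (intro pt ptime_app2[OF assms(1)])
    show "sz (st \<and> P x y) \<le> sz st + poly [:3:] (sz x + sz y)" for x st y
      using sz_bool[of "st \<and> P x y"] by simp
  qed (intro pt assms)+
  then show ?thesis by (simp add: *)
qed

lemma ptime_Bex [pt]:
  fixes xs :: "'a::repr \<Rightarrow> 'b::repr list"
  assumes "ptime (\<lambda>p. P (fst p) (snd p))" "ptime xs"
  shows "ptime (\<lambda>x. \<exists>y\<in>set (xs x). P x y)"
  using ptime_not[OF ptime_Ball[OF ptime_not[OF assms(1)] assms(2)]] by simp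

lemma ptime_member [pt]: "ptime f \<Longrightarrow> ptime xs \<Longrightarrow> ptime (\<lambda>x. f x \<in> set (xs x))"
proof -
  assume a: "ptime f" "ptime xs"
  have "ptime (\<lambda>x. \<exists>y\<in>set (xs x). f x = y)"
    by (intro pt a ptime_comp[OF a(1)])
  then show ?thesis by simp
qed

lemma ptime_concat [pt]:
  fixes xss :: "'a::repr \<Rightarrow> 'b::repr list list"
  assumes "ptime xss"
  shows "ptime (\<lambda>x. concat (xss x))"
proof -
  have *: "foldl (@) acc yss = acc @ concat yss" for acc and yss :: "'b list list"
    by (induction yss arbitrary: acc) auto
  have "ptime (\<lambda>x. foldl (@) [] (xss x))"
    by (rule ptime_foldl[where b = "[:0, 1:]"]) (intro pt assms | simp)+
  then show ?thesis by (simp add: *)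
qed

lemma ptime_tl [pt]:
  fixes xs :: "'a::repr \<Rightarrow> 'b::repr list"
  assumes "ptime xs"
  shows "ptime (\<lambda>x. tl (xs x))"
proof -
  have "ptime (\<lambda>x. case xs x of [] \<Rightarrow> [] | y # ys \<Rightarrow> ys)" by (intro pt assms)
  moreover have "tl ys = (case ys of [] \<Rightarrow> [] | y # ys \<Rightarrow> ys)" for ys :: "'b list" by (cases ys) auto
  ultimately show ?thesis by simp
qed

text \<open>A unary number and a list of \<open>False\<close> have the same tree. Counting loops
  thus become folds over \<open>replicate n False\<close>.\<close>

lemma rep_replicate: "rep (replicate n False) = rep n"
  by (induction n) (simp_all add: rep_bool_def)

lemma ptime_falses [pt]: "ptime n \<Longrightarrow> ptime (\<lambda>x. replicate (n x) False)"
  by (rule ptime_cong_rep) (simp_all add: rep_replicate)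

lemma foldl_replicate: "foldl (\<lambda>st y. f st) a (replicate n b) = (f ^^ n) a"
  by (induction n arbitrary: a) (simp_all add: funpow_swap1)

lemma ptime_drop [pt]:
  fixes xs :: "'a::repr \<Rightarrow> 'b::repr list"
  assumes "ptime n" "ptime xs"
  shows "ptime (\<lambda>x. drop (n x) (xs x))"
proof -
  have *: "(tl ^^ k) ys = drop k ys" for k and ys :: "'b list"
    by (induction k) (simp_all add: drop_Suc tl_drop)
  have "ptime (\<lambda>x. foldl (\<lambda>st y. tl st) (xs x) (replicate (n x) False))"
  proof (rule ptime_foldl[where b = 0])
    show "sz (tl st) \<le> sz st + poly 0 (sz x + sz y)" for x :: 'a and st :: "'b list" and y :: bool
      by (cases st) auto
  qed (intro pt assms)+
  then show ?thesis by (simp add: foldl_replicate *)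
qed

text \<open>A total lookup with a default, since certificates of any shape have to be
  processed.\<close>

definition nthd :: "'a \<Rightarrow> 'a list \<Rightarrow> nat \<Rightarrow> 'a" where
  "nthd d xs n = (case drop n xs of [] \<Rightarrow> d | y # ys \<Rightarrow> y)"

lemma nthd_nth: "n < length xs \<Longrightarrow> nthd d xs n = xs ! n"
  unfolding nthd_def by (simp add: Cons_nth_drop_Suc[symmetric])

lemma ptime_nthd [pt]:
  assumes "ptime d" "ptime xs" "ptime n"
  shows "ptime (\<lambda>x. nthd (d x) (xs x) (n x))"
  unfolding nthd_def by (intro pt assms)

lemma ptime_length [pt]:
  fixes xs :: "'a::repr \<Rightarrow> 'b::repr list"
  assumes "ptime xs"
  shows "ptime (\<lambda>x. length (xs x))"
proof -
  have *: "foldl (\<lambda>n y. Suc n) k ys = k + length ys" for k and ys :: "'b list"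
    by (induction ys arbitrary: k) auto
  have "ptime (\<lambda>x. foldl (\<lambda>n y. Suc n) 0 (xs x))"
    by (rule ptime_foldl[where b = "[:2:]"]) (intro pt assms | simp)+
  then show ?thesis by (simp add: *)
qed

lemma ptime_add [pt]:
  fixes f g :: "'a::repr \<Rightarrow> nat"
  assumes "ptime f" "ptime g"
  shows "ptime (\<lambda>x. f x + g x)"
proof -
  have "ptime (\<lambda>x. foldl (\<lambda>n y. Suc n) (f x) (replicate (g x) False))"
    by (rule ptime_foldl[where b = "[:2:]"]) (intro pt assms | simp)+
  moreover have "(Suc ^^ k) n = n + k" for k n by (induction k) auto
  ultimately show ?thesis by (simp add: foldl_replicate add.commute)
qed

lemma ptime_pred:
  fixes f :: "'a::repr \<Rightarrow> nat"
  assumes "ptime f"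
  shows "ptime (\<lambda>x. f x - 1)"
proof (rule ptime_cong_rep)
  show "ptime (\<lambda>x. tl (replicate (f x) False))" by (intro pt assms)
  show "rep (f x - 1) = rep (tl (replicate (f x) False))" for x
    by (cases "f x") (simp_all add: rep_replicate)
qed

lemma ptime_diff [pt]:
  fixes f g :: "'a::repr \<Rightarrow> nat"
  assumes "ptime f" "ptime g"
  shows "ptime (\<lambda>x. f x - g x)"
proof -
  have "ptime (\<lambda>x. foldl (\<lambda>n y. n - 1) (f x) (replicate (g x) False))"
    by (rule ptime_foldl[where b = "0"]) (intro pt ptime_pred assms | simp)+
  moreover have "((\<lambda>n. n - 1) ^^ k) n = n - k" for k n :: nat by (induction k) auto
  ultimately show ?thesis by (simp add: foldl_replicate)
qed

lemma ptime_mult [pt]: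
  fixes f g :: "'a::repr \<Rightarrow> nat"
  assumes "ptime f" "ptime g"
  shows "ptime (\<lambda>x. f x * g x)"
proof -
  obtain q where q: "\<And>x. sz (g x) \<le> poly q (sz x)" using ptime_sz[OF assms(2)] by blast
  have "ptime (\<lambda>x. foldl (\<lambda>n y. n + g x) 0 (replicate (f x) False))"
  proof (rule ptime_foldl[where b = q])
    show "ptime (\<lambda>p. fst (snd p) + g (fst p))" by (intro pt ptime_comp[OF assms(2)])
    show "sz (n + g x) \<le> sz n + poly q (sz x + sz y)" for x n and y :: bool
      using q[of x] poly_mono_nat[of "sz x" "sz x + sz y" q] by simp
  qed (intro pt assms)+
  moreover have "((\<lambda>n. n + m) ^^ k) 0 = k * m" for k m :: nat by (induction k) auto
  ultimately show ?thesis by (simp add: foldl_replicate)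
qed

lemma ptime_le [pt]:
  fixes f g :: "'a::repr \<Rightarrow> nat"
  assumes "ptime f" "ptime g"
  shows "ptime (\<lambda>x. f x \<le> g x)"
proof -
  have "ptime (\<lambda>x. f x - g x = 0)" by (intro pt assms)
  then show ?thesis by simp
qed

lemma ptime_less [pt]:
  fixes f g :: "'a::repr \<Rightarrow> nat"
  assumes "ptime f" "ptime g"
  shows "ptime (\<lambda>x. f x < g x)"
  using ptime_not[OF ptime_le[OF assms(2,1)]] by (simp add: not_le)

lemma ptime_poly [pt]:
  fixes f :: "'a::repr \<Rightarrow> nat"
  assumes "ptime f"
  shows "ptime (\<lambda>x. poly p (f x))"
proof (induction p)
  case (pCons a p)
  then have "ptime (\<lambda>x. a + f x * poly p (f x))" by (intro pt assms)
  then show ?case by simp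
qed (simp add: ptime_const)

lemma sz_upt: "sz [0..<k] \<le> k * (2 * k + 2) + 1"
  by (induction k) auto

lemma ptime_upt0 [pt]:
  fixes n :: "'a::repr \<Rightarrow> nat"
  assumes "ptime n"
  shows "ptime (\<lambda>x. [0..<n x])"
proof -
  have *: "((\<lambda>st. st @ [length st]) ^^ k) [] = [0..<k]" for k by (induction k) auto
  obtain q where q: "\<And>x. sz (n x) \<le> poly q (sz x)" using ptime_sz[OF assms] by blast
  have "ptime (\<lambda>x. foldl (\<lambda>st y. st @ [length st]) [] (replicate (n x) False))"
  proof (rule ptime_foldl_bounded[where b = "q * (Polynomial.smult 2 q + [:2:]) + [:1:]"])
    fix x :: 'a and k
    let ?m = "min k (n x)"
    have "sz [0..<?m] \<le> ?m * (2 * ?m + 2) + 1" by (rule sz_upt)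
    also have "\<dots> \<le> poly q (sz x) * (2 * poly q (sz x) + 2) + 1"
      using q[of x] by (intro add_right_mono mult_le_mono) auto
    finally show "sz (foldl (\<lambda>st y. st @ [length st]) [] (take k (replicate (n x) False)))
        \<le> poly (q * (Polynomial.smult 2 q + [:2:]) + [:1:]) (sz x)"
      by (simp add: foldl_replicate *)
  qed (intro pt assms)+
  then show ?thesis by (simp add: foldl_replicate *)
qed

lemma ptime_replicate [pt]:
  assumes "ptime n" "ptime a"
  shows "ptime (\<lambda>x. replicate (n x) (a x))"
proof -
  have "ptime (\<lambda>x. map (\<lambda>y. a x) (replicate (n x) False))"
    by (intro pt assms ptime_comp[OF assms(2)])
  then show ?thesis by (simp add: map_replicate_const)
qed

lemma ptime_zip [pt]:
  fixes xs :: "'a::repr \<Rightarrow> 'b::repr list" and ys :: "'a \<Rightarrow> 'c::repr list"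
  assumes "ptime xs" "ptime ys"
  shows "ptime (\<lambda>x. zip (xs x) (ys x))"
proof -
  let ?step = "\<lambda>st y. case snd st of [] \<Rightarrow> (fst st, []) | z # zs \<Rightarrow> ((y, z) # fst st, zs)"
  have *: "rev (fst (foldl ?step (acc, zs) ws)) = rev acc @ zip ws zs" for acc zs and ws :: "'b list"
    by (induction ws arbitrary: acc zs) (auto split: list.split)
  have "ptime (\<lambda>x. rev (fst (foldl ?step ([], ys x) (xs x))))"
  proof (intro ptime_rev ptime_fst, rule ptime_foldl[where b = "[:1, 1:]"])
    show "sz (?step st y) \<le> sz st + poly [:1, 1:] (sz x + sz y)" for x :: 'a and st :: "('b \<times> 'c) list \<times> 'c list" and y
      by (cases st) (auto split: list.split)
  qed (intro pt assms)+
  then show ?thesis by (simp add: *)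
qed

subsection \<open>Connection with the machine model\<close>

text \<open>The input has been turned around on stack 2, so the word is read from its end and the
  list grows by prepending: \<open>[2,2,1,1]\<close> and \<open>[2,1]\<close> are a list node
  together with \<open>True\<close> or \<open>False\<close> as its head. The separator 3 puts a new
  empty list on top of the finished one.\<close>

definition in_loop :: com where
  "in_loop = While 2 {1,2,3} (If 2 {2} (push_list [2,2,1,1]) (If 2 {1} (push_list [2,1]) (push_list [1])) ;; Pop 2)"

lemma rb_in_loop_bits:
  "S 2 = rev (bits bs) @ v \<Longrightarrow> S 0 = code (rep cs) @ u \<Longrightarrow>
   runsb in_loop (S(2 := v, 0 := code (rep (bs @ cs)) @ u)) n S' \<Longrightarrow>
   runsb in_loop S (n + 20 * length bs) S'"
proof (induction bs arbitrary: S cs rule: rev_induct)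
  case Nil
  then have "S(2 := v, 0 := code (rep ([] @ cs)) @ u) = S" by (auto simp: fun_eq_iff bits_def)
  from rb_start[OF Nil.prems(3) this] show ?case by simp
next
  case (snoc b bs)
  let ?S1 = "S(0 := code (rep (b # cs)) @ u)"
  let ?S2 = "S(0 := code (rep (b # cs)) @ u, 2 := rev (bits bs) @ v)"
  have S2: "S 2 = (if b then 2 else 1) # rev (bits bs) @ v" using snoc.prems(1) by (simp add: bits_def)
  have "runsb (If 2 {2} (push_list [2,2,1,1]) (If 2 {1} (push_list [2,1]) (push_list [1]))) S 15 ?S1"
  proof (cases b)
    case True
    have h: "runsb (push_list [2,2,1,1]) S (2 * length [2,2,1,1::nat] + 3) ?S1"
      using True snoc.prems(2) by (intro rb_push_list) (auto simp: rep_bool_def)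
    show ?thesis by (rule rb_mono[OF rb_ifT[OF _ _ h]]) (use S2 True in simp_all)
  next
    case False
    have h: "runsb (push_list [2,1]) S (2 * length [2,1::nat] + 3) ?S1"
      using False snoc.prems(2) by (intro rb_push_list) (auto simp: rep_bool_def)
    show ?thesis by (rule rb_mono[OF rb_ifF[OF _ _ rb_ifT[OF _ _ h]]]) (use S2 False in simp_all)
  qed
  moreover have "runsb (Pop 2) ?S1 1 ?S2" using S2 by (intro rb_pop) auto
  ultimately have 1: "runsb (If 2 {2} (push_list [2,2,1,1]) (If 2 {1} (push_list [2,1]) (push_list [1])) ;; Pop 2) S (15 + 1) ?S2"
    by (rule rb_seq)
  have 2: "runsb in_loop ?S2 (n + 20 * length bs) S'"
    by (rule snoc.IH[of _ "b # cs"]) (use snoc.prems(3) in \<open>auto elim!: rb_start simp: fun_eq_iff\<close>)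
  show ?case unfolding in_loop_def
    by (rule rb_mono[OF rb_whileT[OF _ _ 1 2[unfolded in_loop_def]]]) (use S2 in auto)
qed

definition in_prog :: com where
  "in_prog = xfer {1,2,3} 0 2 ;; Push 0 1 ;; in_loop"

lemma peek_bits: "set (bits w) \<subseteq> {1,2,3}"
  by (auto simp: bits_def)

lemma input_stacks_simps [simp]: "input_stacks w 0 = w" "r \<noteq> 0 \<Longrightarrow> input_stacks w r = []"
  by (auto simp: input_stacks_def)

lemma rb_in_prog1: "runsb in_prog (input_stacks (bits w)) (25 * length w + 10) (input_stacks (code (rep w)))"
proof -
  let ?S1 = "(input_stacks [])(2 := rev (bits w))"
  let ?S2 = "(input_stacks [1])(2 := rev (bits w))"
  have "runsb (xfer {1,2,3} 0 2) (input_stacks (bits w)) (5 * length (bits w) + 1) ?S1"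
    using peek_bits[of w] by (intro rb_xfer[where v = "[]"]) (auto simp: fun_eq_iff input_stacks_def)
  moreover have "runsb (Push 0 1) ?S1 2 ?S2"
    by (rule rb_push) (auto simp: input_stacks_def fun_eq_iff)
  moreover have "runsb in_loop ?S2 (1 + 20 * length w) (input_stacks (code (rep w)))"
  proof (rule rb_in_loop_bits[of _ w "[]" "[]" "[]"])
    show "runsb in_loop (?S2(2 := [], 0 := code (rep (w @ [])) @ [])) 1 (input_stacks (code (rep w)))"
      unfolding in_loop_def by (rule rb_start[OF rb_whileF]) (auto simp: input_stacks_def fun_eq_iff)
  qed (auto simp: input_stacks_def)
  ultimately have "runsb in_prog (input_stacks (bits w)) ((5 * length (bits w) + 1) + (2 + (1 + 20 * length w)))
      (input_stacks (code (rep w)))"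
    unfolding in_prog_def by - ((rule rb_seq, assumption)+, assumption)
  then show ?thesis by (rule rb_mono) (simp add: bits_def)
qed

lemma rb_in_prog2:
  "runsb (in_prog ;; Push 0 2) (input_stacks (bits w @ [3] @ bits z)) (25 * (length w + length z) + 40)
     (input_stacks (code (rep (w, z))))"
proof -
  let ?i = "bits w @ [3] @ bits z"
  let ?S1 = "(input_stacks [])(2 := rev ?i)"
  let ?S2 = "(input_stacks [1])(2 := rev ?i)"
  let ?S3 = "(input_stacks (code (rep z)))(2 := 3 # rev (bits w))"
  let ?S4 = "(input_stacks (code (rep ([] :: bool list)) @ code (rep z)))(2 := 3 # rev (bits w))"
  let ?S5 = "(input_stacks (code (rep ([] :: bool list)) @ code (rep z)))(2 := rev (bits w))"
  let ?S6 = "input_stacks (code (rep w) @ code (rep z))"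
  have 6: "runsb in_loop ?S5 (1 + 20 * length w) ?S6"
  proof (rule rb_in_loop_bits[of _ w "[]" "[]" "code (rep z)"])
    show "runsb in_loop (?S5(2 := [], 0 := code (rep (w @ [])) @ code (rep z))) 1 ?S6"
      unfolding in_loop_def by (rule rb_start[OF rb_whileF]) (auto simp: input_stacks_def fun_eq_iff)
  qed (auto simp: input_stacks_def)
  have "runsb (If 2 {2} (push_list [2,2,1,1]) (If 2 {1} (push_list [2,1]) (push_list [1]))) ?S3
      (((2 * length [1::nat] + 3) + 2) + 2) ?S4"
    by (intro rb_ifF rb_push_list) (auto simp: input_stacks_def fun_eq_iff)
  moreover have "runsb (Pop 2) ?S4 1 ?S5" by (rule rb_pop) (auto simp: fun_eq_iff)
  ultimately have 5: "runsb (If 2 {2} (push_list [2,2,1,1]) (If 2 {1} (push_list [2,1]) (push_list [1])) ;; Pop 2) ?S3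
      ((((2 * length [1::nat] + 3) + 2) + 2) + 1) ?S5" by (rule rb_seq)
  have 4: "runsb in_loop ?S3 ((((2 * length [1::nat] + 3) + 2) + 2) + 1 + (1 + 20 * length w) + 2) ?S6"
    unfolding in_loop_def by (rule rb_whileT[OF _ _ 5 6[unfolded in_loop_def]]) auto
  have 3: "runsb in_loop ?S2 ((((2 * length [1::nat] + 3) + 2) + 2) + 1 + (1 + 20 * length w) + 2 + 20 * length z) ?S6"
  proof (rule rb_in_loop_bits[of _ z "3 # rev (bits w)" "[]" "[]"])
    show "runsb in_loop (?S2(2 := 3 # rev (bits w), 0 := code (rep (z @ [])) @ []))
        ((((2 * length [1::nat] + 3) + 2) + 2) + 1 + (1 + 20 * length w) + 2) ?S6"
      by (rule rb_start[OF 4]) (auto simp: input_stacks_def fun_eq_iff)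
  qed (auto simp: input_stacks_def)
  have 1: "runsb (xfer {1,2,3} 0 2) (input_stacks ?i) (5 * length ?i + 1) ?S1"
    using peek_bits[of w] peek_bits[of z]
    by (intro rb_xfer[where v = "[]"]) (auto simp: fun_eq_iff input_stacks_def)
  have 2: "runsb (Push 0 1) ?S1 2 ?S2"
    by (rule rb_push) (auto simp: input_stacks_def fun_eq_iff)
  have 7: "runsb (Push 0 2) ?S6 2 (input_stacks (code (rep (w, z))))"
    by (rule rb_push) (auto simp: input_stacks_def fun_eq_iff rep_prod_def)
  show ?thesis unfolding in_prog_def
    by (rule rb_mono[OF rb_seq[OF rb_seq[OF 1 rb_seq[OF 2 3]] 7]]) (simp add: bits_def)
qed

definition out_prog :: com where
  "out_prog = While 0 {2} (Pop 0 ;; If 0 {1} (Emit 1 ;; Pop 0) (Emit 2 ;; Pop 0 ;; Pop 0 ;; Pop 0))"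

lemma rb_out_prog:
  "S 0 = code (rep (bs :: bool list)) @ u \<Longrightarrow>
   \<exists>S'. runsb out_prog S (20 * length bs + 1) S' \<and> S' 1 = S 1 @ bits bs"
proof (induction bs arbitrary: S)
  case Nil
  have "runsb out_prog S 1 S" unfolding out_prog_def using Nil by (intro rb_whileF) auto
  then show ?case by (auto simp: bits_def)
next
  case (Cons b bs)
  let ?w = "code (rep bs) @ u" and ?e = "S 1 @ bits [b]"
  let ?S1 = "S(0 := code (rep b) @ ?w)" and ?S2 = "S(0 := ?w, 1 := ?e)"
  have "runsb (Pop 0) S 1 ?S1" using Cons.prems by (intro rb_pop) auto
  moreover have "runsb (If 0 {1} (Emit 1 ;; Pop 0) (Emit 2 ;; Pop 0 ;; Pop 0 ;; Pop 0)) ?S1 6 ?S2"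
  proof (cases b)
    case False
    have 1: "runsb (Emit 1) ?S1 1 (?S1(1 := ?e))" using False by (intro rb_emit) (auto simp: bits_def)
    have 2: "runsb (Pop 0) (?S1(1 := ?e)) 1 ?S2"
      using False by (intro rb_pop) (auto simp: rep_bool_def fun_eq_iff)
    show ?thesis by (rule rb_mono[OF rb_ifT[OF _ _ rb_seq[OF 1 2]]]) (use False in \<open>auto simp: rep_bool_def\<close>)
  next
    case True
    have 1: "runsb (Emit 2) ?S1 1 (?S1(1 := ?e))" using True by (intro rb_emit) (auto simp: bits_def)
    have 2: "runsb (Pop 0) (?S1(1 := ?e)) 1 (S(1 := ?e, 0 := 1 # 1 # ?w))"
      using True by (intro rb_pop) (auto simp: rep_bool_def fun_eq_iff)
    have 3: "runsb (Pop 0) (S(1 := ?e, 0 := 1 # 1 # ?w)) 1 (S(1 := ?e, 0 := 1 # ?w))"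
      by (intro rb_pop) auto
    have 4: "runsb (Pop 0) (S(1 := ?e, 0 := 1 # ?w)) 1 ?S2"
      by (intro rb_pop) (auto simp: fun_eq_iff)
    show ?thesis by (rule rb_mono[OF rb_ifF[OF _ _ rb_seq[OF 1 rb_seq[OF 2 rb_seq[OF 3 4]]]]])
        (use True in \<open>auto simp: rep_bool_def\<close>)
  qed
  ultimately have 1: "runsb (Pop 0 ;; If 0 {1} (Emit 1 ;; Pop 0) (Emit 2 ;; Pop 0 ;; Pop 0 ;; Pop 0)) S (1 + 6) ?S2"
    by (rule rb_seq)
  have "\<exists>S'. runsb out_prog ?S2 (20 * length bs + 1) S' \<and> S' 1 = ?S2 1 @ bits bs"
    by (rule Cons.IH) simp
  then obtain S' where S': "runsb out_prog ?S2 (20 * length bs + 1) S'" "S' 1 = ?S2 1 @ bits bs"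
    by blast
  have "runsb out_prog S (20 * length (b # bs) + 1) S'" unfolding out_prog_def
    by (rule rb_mono[OF rb_whileT[OF _ _ 1 S'(1)[unfolded out_prog_def]]]) (use Cons.prems in auto)
  moreover have "S' 1 = S 1 @ bits (b # bs)" using S'(2) by (simp add: bits_def)
  ultimately show ?case by blast
qed

lemma computable_if_implements:
  fixes f :: "'a::repr \<Rightarrow> bool list"
  assumes f: "ptime f"
    and conv: "\<And>x. runsb e (input_stacks (inp x)) (poly q (length (inp x))) (input_stacks (code (rep x)))"
    and sz: "\<And>x. sz x \<le> poly s (length (inp x))"
  shows "computable_in_polytime inp (\<lambda>x. bits (f x))"
proof -
  obtain c p where c: "implements c p f" using f unfolding ptime_def by blast
  let ?p = "pcompose p s" and ?c = "e ;; c ;; out_prog"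
  let ?t = "q + ?p + [:1:] + Polynomial.smult 20 (s + ?p)"
  have "tm_computes (tm_of (compile ?c 0)) (inp x) (poly ?t (length (inp x))) (bits (f x))" for x
  proof -
    let ?n = "length (inp x)"
    have le: "poly p (sz x) \<le> poly ?p ?n" using sz[of x] by (simp add: poly_pcompose poly_mono_nat)
    have 1: "runsb c (input_stacks (code (rep x))) (poly p (sz x)) (input_stacks (code (rep (f x))))"
      by (rule implementsD[OF c, of _ x "[]"]) (auto simp: input_stacks_def)
    obtain S' where S': "runsb out_prog (input_stacks (code (rep (f x)))) (20 * length (f x) + 1) S'"
      "S' 1 = bits (f x)"
      using rb_out_prog[of "input_stacks (code (rep (f x)))" "f x" "[]"] by auto
    from rb_seq[OF conv[of x] rb_seq[OF 1 S'(1)]] obtain k where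
      k: "runs ?c (input_stacks (inp x)) k S'" "k \<le> poly q ?n + (poly p (sz x) + (20 * length (f x) + 1))"
      unfolding runsb_def by blast
    have "length (f x) \<le> poly s ?n + poly ?p ?n"
      using length_le_sz[of "f x"] implements_sz[OF c, of x] sz[of x] le by linarith
    with k(2) le have "k \<le> poly ?t ?n" by simp
    from tm_computes_compile[OF k(1) this] S'(2) show ?thesis by simp
  qed
  then show ?thesis unfolding computable_in_polytime_def using tm_wf_tm_of by blast
qed

theorem polytime_function_ptime:
  assumes "ptime f"
  shows "polytime_function f"
  unfolding polytime_function_def
proof (rule computable_if_implements[OF assms, of in_prog _ "[:10, 25:]" "[:1, 4:]"])
  fix x :: "bool list"
  show "runsb in_prog (input_stacks (bits x)) (poly [:10, 25:] (length (bits x))) (input_stacks (code (rep x)))"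
    by (rule rb_mono[OF rb_in_prog1]) (simp add: bits_def)
  show "sz x \<le> poly [:1, 4:] (length (bits x))" using sz_bits_le[of x] by (simp add: bits_def)
qed

theorem polytime_verifier_ptime:
  assumes "ptime (\<lambda>p. V (fst p) (snd p))"
  shows "polytime_verifier V"
proof -
  let ?i = "\<lambda>(x, u). bits x @ [3] @ bits u"
  have "ptime (\<lambda>p. [V (fst p) (snd p)])" by (intro pt assms)
  then have "computable_in_polytime ?i (\<lambda>p. bits [V (fst p) (snd p)])"
  proof (rule computable_if_implements[of _ "in_prog ;; Push 0 2" _ "[:40, 25:]" "[:3, 4:]"])
    fix p :: "bool list \<times> bool list"
    obtain x u where p: "p = (x, u)" by force
    show "runsb (in_prog ;; Push 0 2) (input_stacks (?i p)) (poly [:40, 25:] (length (?i p)))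
        (input_stacks (code (rep p)))"
      unfolding p prod.case by (rule rb_mono[OF rb_in_prog2]) (simp add: bits_def)
    show "sz p \<le> poly [:3, 4:] (length (?i p))"
      using sz_bits_le[of x] sz_bits_le[of u] by (simp add: p bits_def)
  qed
  then show ?thesis unfolding polytime_verifier_def by (simp add: case_prod_beta')
qed

subsection \<open>Binary integers\<close>

primrec val :: "bool list \<Rightarrow> nat" where
  "val [] = 0"
| "val (b # bs) = of_bool b + 2 * val bs"

lemma val_binary [simp]: "val (binary n) = n"
proof (induction n rule: less_induct)
  case (less n)
  show ?case
  proof (cases "n = 0")
    case False
    then have "val (binary (n div 2)) = n div 2" by (intro less) simp
    with False show ?thesis by (simp add: binary.simps[of n] odd_two_times_div_two_succ)
  qed (simp add: binary.simps)
qed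

lemma val_append: "val (xs @ ys) = val xs + 2 ^ length xs * val ys"
  by (induction xs) (simp_all add: algebra_simps)

lemma val_replicate_False [simp]: "val (replicate n False) = 0"
  by (induction n) auto

lemma val_less: "val bs < 2 ^ length bs"
  by (induction bs) auto

lemma val_map_Not: "val (map Not bs) + val bs + 1 = 2 ^ length bs"
  by (induction bs) auto

lemma length_binary_le: "n < 2 ^ k \<Longrightarrow> length (binary n) \<le> k"
proof (induction k arbitrary: n)
  case (Suc k)
  then have "n div 2 < 2 ^ k" by auto
  with Suc.IH[of "n div 2"] show ?case by (cases "n = 0") (simp_all add: binary.simps[of n])
qed (simp add: binary.simps)

lemma less_length_binary: "n < 2 ^ length (binary n)"
  using val_less[of "binary n"] by simp

definition norm_bits :: "bool list \<Rightarrow> bool list" where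
  "norm_bits bs = foldl (\<lambda>r b. if \<not> b \<and> r = [] then [] else b # r) [] (rev bs)"

text \<open>Reading from the most significant end, zeros are dropped until the first one bit. The
  result is canonical, as the representation of integers requires.\<close>

lemma norm_bits: "norm_bits bs = binary (val bs)"
  unfolding norm_bits_def by (induction bs) (auto simp: binary.simps binary.simps[of 0])

lemma ptime_norm_bits [pt]:
  assumes "ptime f"
  shows "ptime (\<lambda>x. norm_bits (f x))"
proof -
  have "ptime norm_bits" unfolding norm_bits_def[abs_def]
  proof (rule ptime_foldl[where b = "[:4:]"])
    show "sz (if \<not> y \<and> st = [] then [] else y # st) \<le> sz st + poly [:4:] (sz x + sz y)"
      for x st :: "bool list" and y using sz_bool[of y] by auto
  qed (intro pt)+
  from ptime_comp[OF this assms] show ?thesis .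
qed

text \<open>The state consists of the carry and the sum bits so far, most significant first.\<close>

definition full_add :: "bool \<times> bool list \<Rightarrow> bool \<times> bool \<Rightarrow> bool \<times> bool list" where
  "full_add s p = ((fst p \<and> snd p) \<or> (fst s \<and> (fst p \<or> snd p)), (fst p \<noteq> (snd p \<noteq> fst s)) # snd s)"

definition ripple :: "bool list \<Rightarrow> bool list \<Rightarrow> bool \<times> bool list" where
  "ripple a b = foldl full_add (False, []) (zip a b)"

lemma foldl_full_add:
  "length a = length b \<Longrightarrow> foldl full_add (c, acc) (zip a b) = (c', acc') \<Longrightarrow>
   \<exists>s. acc' = rev s @ acc \<and> length s = length a \<and>
     val s + 2 ^ length a * of_bool c' = val a + val b + of_bool c"
proof (induction a b arbitrary: c acc rule: list_induct2)
  case (Cons x a y b)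
  let ?c = "(x \<and> y) \<or> (c \<and> (x \<or> y))" and ?d = "x \<noteq> (y \<noteq> c)"
  from Cons.prems have "foldl full_add (?c, ?d # acc) (zip a b) = (c', acc')"
    by (simp add: full_add_def[of "(c, acc)" "(x, y)"])
  from Cons.IH[OF this] obtain s where s: "acc' = rev s @ ?d # acc" "length s = length a"
    "val s + 2 ^ length a * of_bool c' = val a + val b + of_bool ?c" by blast
  from s(3) have "2 * val s + 2 * (2 ^ length a * of_bool c') = 2 * val a + 2 * val b + 2 * of_bool ?c" by linarith
  then have "val (?d # s) + 2 ^ length (x # a) * of_bool c' = val (x # a) + val (y # b) + of_bool c"
    by (cases x; cases y; cases c) (auto simp: algebra_simps)
  with s show ?case by (intro exI[of _ "?d # s"]) auto
qed simp

lemma ripple: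
  assumes "length a = length b" "ripple a b = (c, acc)"
  shows "length acc = length a" "val (rev acc) + 2 ^ length a * of_bool c = val a + val b"
  using foldl_full_add[OF assms(1) assms(2)[unfolded ripple_def]] by auto

lemma ptime_ripple [pt]:
  assumes "ptime f" "ptime g"
  shows "ptime (\<lambda>x. ripple (f x) (g x))"
  unfolding ripple_def
proof (rule ptime_foldl[where b = "[:7:]"])
  show "sz (full_add st y) \<le> sz st + poly [:7:] (sz x + sz y)" for x :: 'a and st y
    unfolding full_add_def
    using sz_bool[of "fst y \<and> snd y \<or> fst st \<and> (fst y \<or> snd y)"] sz_bool[of "fst y \<noteq> (snd y \<noteq> fst st)"]
    by (cases st) simp
qed (intro pt assms | simp only: full_add_def)+

definition pad :: "bool list \<Rightarrow> bool list \<Rightarrow> bool list" where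
  "pad a b = a @ replicate (length b) False"

lemma pad [simp]: "length (pad a b) = length a + length b" "val (pad a b) = val a"
  by (simp_all add: pad_def val_append)

definition add_bits :: "bool list \<Rightarrow> bool list \<Rightarrow> bool list" where
  "add_bits a b = (let r = ripple (pad a b) (pad b a) in rev (fst r # snd r))"

lemma add_bits [simp]: "val (add_bits a b) = val a + val b" "length (add_bits a b) = length a + length b + 1"
proof -
  obtain c acc where r: "ripple (pad a b) (pad b a) = (c, acc)" by force
  have l: "length (pad a b) = length (pad b a)" by simp
  from ripple[OF l r] r show "val (add_bits a b) = val a + val b" "length (add_bits a b) = length a + length b + 1"
    by (simp_all add: add_bits_def val_append)
qed

text \<open>On \<open>n\<close> bits the complement of \<open>a\<close> is
  \<open>2 ^ n - 1 - a\<close>. Adding \<open>b\<close> overflows iff \<open>a < b\<close>, and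
  otherwise the complement of the sum is \<open>a - b\<close>; so one ripple serves as comparison
  and subtraction.\<close>

definition sub_bits :: "bool list \<Rightarrow> bool list \<Rightarrow> bool \<times> bool list" where
  "sub_bits a b = (let r = ripple (map Not (pad a b)) (pad b a) in (fst r, map Not (rev (snd r))))"

lemma sub_bits:
  "fst (sub_bits a b) \<longleftrightarrow> val a < val b"
  "val b \<le> val a \<Longrightarrow> val (snd (sub_bits a b)) = val a - val b"
proof -
  obtain c acc where r: "ripple (map Not (pad a b)) (pad b a) = (c, acc)" by force
  have l: "length (map Not (pad a b)) = length (pad b a)" by simp
  let ?n = "length a + length b"
  have acc: "length (rev acc) = ?n" and v: "val (rev acc) + 2 ^ ?n * of_bool c = val (map Not (pad a b)) + val b"
    using ripple[OF l r] by simp_all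
  have 1: "val (map Not (pad a b)) + val a + 1 = 2 ^ ?n" using val_map_Not[of "pad a b"] by simp
  have 2: "val (map Not (rev acc)) + val (rev acc) + 1 = 2 ^ ?n" using val_map_Not[of "rev acc"] acc by simp
  have 3: "val (rev acc) < 2 ^ ?n" using val_less[of "rev acc"] acc by simp
  have f: "fst (sub_bits a b) = c" by (simp add: sub_bits_def r)
  show *: "fst (sub_bits a b) \<longleftrightarrow> val a < val b" unfolding f using v 1 3 by (cases c) auto
  assume "val b \<le> val a"
  with * f have "\<not> c" by auto
  with v 1 2 have "val (map Not (rev acc)) = val a - val b" by simp
  then show "val (snd (sub_bits a b)) = val a - val b" by (simp add: sub_bits_def r)
qed

lemma ptime_pad [pt]: "ptime f \<Longrightarrow> ptime g \<Longrightarrow> ptime (\<lambda>x. pad (f x) (g x))"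
  unfolding pad_def by (intro pt)

lemma ptime_add_bits [pt]: "ptime f \<Longrightarrow> ptime g \<Longrightarrow> ptime (\<lambda>x. add_bits (f x) (g x))"
  unfolding add_bits_def Let_def by (intro pt)

lemma ptime_sub_bits [pt]: "ptime f \<Longrightarrow> ptime g \<Longrightarrow> ptime (\<lambda>x. sub_bits (f x) (g x))"
  unfolding sub_bits_def Let_def by (intro pt)

definition mul_bits :: "bool list \<Rightarrow> bool list \<Rightarrow> bool list" where
  "mul_bits a b = foldl (\<lambda>acc d. if d then add_bits (False # acc) b else False # acc) [] (rev a)"

lemma mul_bits [simp]: "val (mul_bits a b) = val a * val b"
  unfolding mul_bits_def by (induction a) (auto simp: algebra_simps)

lemma ptime_mul_bits [pt]:
  assumes "ptime f" "ptime g"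
  shows "ptime (\<lambda>x. mul_bits (f x) (g x))"
proof -
  let ?s = "\<lambda>b acc d. if d then add_bits (False # acc) b else False # acc"
  \<comment> \<open>An addition may turn \<open>False\<close> bits into \<open>True\<close> bits,
    which have a larger \<open>sz\<close>, so the additive criterion fails; the length of the
    accumulator is bounded instead.\<close>
  have len: "length (foldl (?s b) acc ds) \<le> length acc + length ds * (length b + 2)" for b acc ds
  proof (induction ds arbitrary: acc)
    case (Cons d ds)
    have "length (?s b acc d) \<le> length acc + (length b + 2)" by simp
    with Cons[of "?s b acc d"] show ?case by simp
  qed simp
  obtain q r where qr: "\<And>x. sz (f x) \<le> poly q (sz x)" "\<And>x. sz (g x) \<le> poly r (sz x)"
    using ptime_sz[OF assms(1)] ptime_sz[OF assms(2)] by blast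
  show ?thesis unfolding mul_bits_def
  proof (rule ptime_foldl_bounded[where b = "[:4:] * (q * (r + [:2:])) + [:1:]"])
    show "ptime (\<lambda>p. if snd (snd p) then add_bits (False # fst (snd p)) (g (fst p)) else False # fst (snd p))"
      by (intro pt ptime_comp[OF assms(2)])
    fix x n
    have "length (foldl (?s (g x)) [] (take n (rev (f x)))) \<le> length (take n (rev (f x))) * (length (g x) + 2)"
      using len[of "g x" "[]" "take n (rev (f x))"] by simp
    also have "\<dots> \<le> poly q (sz x) * (poly r (sz x) + 2)"
    proof (rule mult_le_mono)
      show "length (take n (rev (f x))) \<le> poly q (sz x)"
        using length_le_sz[of "f x"] qr(1)[of x] by simp
      show "length (g x) + 2 \<le> poly r (sz x) + 2"
        using length_le_sz[of "g x"] qr(2)[of x] by simp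
    qed
    finally show "sz (foldl (?s (g x)) [] (take n (rev (f x)))) \<le> poly ([:4:] * (q * (r + [:2:])) + [:1:]) (sz x)"
      using sz_bits_le[of "foldl (?s (g x)) [] (take n (rev (f x)))"] by simp
  qed (intro pt assms)+
qed

definition mag :: "int \<Rightarrow> bool list" where
  "mag z = binary (nat \<bar>z\<bar>)"

lemma val_mag [simp]: "val (mag z) = nat \<bar>z\<bar>"
  by (simp add: mag_def)

lemma ptime_neg [pt]: "ptime f \<Longrightarrow> ptime (\<lambda>x. f x < (0::int))"
  using ptime_fst[OF ptime_cong_rep[of f "\<lambda>x. (f x < 0, mag (f x))"]] by (simp add: rep_int_def mag_def)

lemma ptime_mag [pt]: "ptime f \<Longrightarrow> ptime (\<lambda>x. mag (f x))"
  using ptime_snd[OF ptime_cong_rep[of f "\<lambda>x. (f x < 0, mag (f x))"]] by (simp add: rep_int_def mag_def)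

lemma ptime_signed:
  assumes "ptime s" "ptime f"
  shows "ptime (\<lambda>x. if s x then - int (val (f x)) else int (val (f x)))"
proof (rule ptime_cong_rep)
  \<comment> \<open>The test \<open>w \<noteq> []\<close> rules out a negative zero, whose sign bit
    would differ from that of 0.\<close>
  show "ptime (\<lambda>x. let w = norm_bits (f x) in (s x \<and> w \<noteq> [], w))"
    by (intro pt assms ptime_comp[OF assms(1)])
  have "binary n = [] \<longleftrightarrow> n = 0" for n by (simp add: binary.simps)
  then show "rep (if s x then - int (val (f x)) else int (val (f x))) =
      rep (let w = norm_bits (f x) in (s x \<and> w \<noteq> [], w))" for x
    by (auto simp: rep_int_def norm_bits)
qed

lemma ptime_val_diff:
  assumes "ptime f" "ptime g"
  shows "ptime (\<lambda>x. int (val (f x)) - int (val (g x)))"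
proof -
  have "ptime (\<lambda>x. if fst (sub_bits (f x) (g x)) then - int (val (snd (sub_bits (g x) (f x))))
      else int (val (if fst (sub_bits (f x) (g x)) then [] else snd (sub_bits (f x) (g x)))))"
  proof -
    have "ptime (\<lambda>x. if fst (sub_bits (f x) (g x))
        then - int (val (if fst (sub_bits (f x) (g x)) then snd (sub_bits (g x) (f x)) else snd (sub_bits (f x) (g x))))
        else int (val (if fst (sub_bits (f x) (g x)) then snd (sub_bits (g x) (f x)) else snd (sub_bits (f x) (g x)))))"
      by (intro ptime_signed pt assms)
    then show ?thesis by (rule ptime_cong_rep) simp
  qed
  then show ?thesis by (rule ptime_cong_rep) (auto simp: sub_bits)
qed

lemma ptime_add_int [pt]:
  fixes f g :: "'a::repr \<Rightarrow> int"
  assumes "ptime f" "ptime g"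
  shows "ptime (\<lambda>x. f x + g x)"
proof -
  \<comment> \<open>Nonnegative summands and the magnitudes of negative ones are added separately,
    which leaves a single subtraction and no case distinction on signs.\<close>
  let ?P = "\<lambda>z. if z < 0 then [] else mag z" and ?N = "\<lambda>z. if z < 0 then mag z else []"
  have "ptime (\<lambda>x. int (val (add_bits (?P (f x)) (?P (g x)))) - int (val (add_bits (?N (f x)) (?N (g x)))))"
    by (intro ptime_val_diff pt assms)
  then show ?thesis by (rule ptime_cong_rep) (auto intro!: arg_cong[of _ _ rep])
qed

lemma ptime_uminus_int [pt]:
  fixes f :: "'a::repr \<Rightarrow> int"
  assumes "ptime f"
  shows "ptime (\<lambda>x. - f x)"
proof -
  have "ptime (\<lambda>x. if \<not> f x < 0 then - int (val (mag (f x))) else int (val (mag (f x))))"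
    by (intro ptime_signed pt assms)
  then show ?thesis by (rule ptime_cong_rep) (auto intro!: arg_cong[of _ _ rep])
qed

lemma ptime_diff_int [pt]:
  fixes f g :: "'a::repr \<Rightarrow> int"
  assumes "ptime f" "ptime g"
  shows "ptime (\<lambda>x. f x - g x)"
  using ptime_add_int[OF assms(1) ptime_uminus_int[OF assms(2)]] by simp

lemma ptime_mult_int [pt]:
  fixes f g :: "'a::repr \<Rightarrow> int"
  assumes "ptime f" "ptime g"
  shows "ptime (\<lambda>x. f x * g x)"
proof -
  have "ptime (\<lambda>x. if (f x < 0) \<noteq> (g x < 0) then - int (val (mul_bits (mag (f x)) (mag (g x))))
      else int (val (mul_bits (mag (f x)) (mag (g x)))))"
    by (intro ptime_signed pt assms)
  then show ?thesis
    by (rule ptime_cong_rep) (auto simp: abs_mult[symmetric] abs_if mult_less_0_iff intro!: arg_cong[of _ _ rep])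
qed

lemma ptime_le_int [pt]:
  fixes f g :: "'a::repr \<Rightarrow> int"
  assumes "ptime f" "ptime g"
  shows "ptime (\<lambda>x. f x \<le> g x)"
proof -
  have "ptime (\<lambda>x. \<not> g x - f x < 0)" by (intro pt assms)
  then show ?thesis by (simp add: not_less)
qed

lemma ptime_less_int [pt]:
  fixes f g :: "'a::repr \<Rightarrow> int"
  assumes "ptime f" "ptime g"
  shows "ptime (\<lambda>x. f x < g x)"
  using ptime_not[OF ptime_le_int[OF assms(2,1)]] by (simp add: not_le)

lemma sz_int_le: "\<bar>z\<bar> < 2 ^ k \<Longrightarrow> sz (z :: int) \<le> 4 * k + 5"
proof -
  assume z: "\<bar>z\<bar> < 2 ^ k"
  have "sz z = sz (z < 0, mag z)" by (simp add: sz_def rep_int_def mag_def)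
  moreover have "nat \<bar>z\<bar> < 2 ^ k" using z by (simp add: nat_less_iff)
  then have "length (mag z) \<le> k" unfolding mag_def by (rule length_binary_le)
  ultimately show ?thesis using sz_bits_le[of "mag z"] sz_bool[of "z < 0"] by simp
qed

lemma int_less_sz: "\<bar>z :: int\<bar> < 2 ^ sz z"
proof -
  have "sz z = sz (z < 0, mag z)" by (simp add: sz_def rep_int_def mag_def)
  then have "length (mag z) \<le> sz z" using length_le_sz[of "mag z"] by simp
  then have "(2::nat) ^ length (mag z) \<le> 2 ^ sz z" by simp
  with less_length_binary[of "nat \<bar>z\<bar>"] have "nat \<bar>z\<bar> < 2 ^ sz z" unfolding mag_def by linarith
  then show ?thesis by (simp add: nat_less_iff)
qed

text \<open>An integer below \<open>2 ^ k\<close> in absolute value has size linear in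
  \<open>k\<close>. This keeps all partial sums polynomially small, as
  \<open>ptime_foldl_bounded\<close> demands.\<close>

lemma sum_list_less_sz: "\<bar>sum_list zs :: int\<bar> < 2 ^ sz zs"
proof (induction zs)
  case (Cons z zs)
  have "\<bar>sum_list (z # zs)\<bar> \<le> \<bar>z\<bar> + \<bar>sum_list zs\<bar>" by simp
  also have "\<dots> < 2 ^ sz z + 2 ^ sz zs" using int_less_sz[of z] Cons by simp
  also have "\<dots> \<le> (2 :: int) ^ (sz z + sz zs) + 2 ^ (sz z + sz zs)"
    by (intro add_mono power_increasing) auto
  finally show ?case by simp
qed simp

lemma sz_take: "sz (take n xs) \<le> sz xs"
  by (induction xs arbitrary: n) (auto simp: take_Cons split: nat.split)

lemma ptime_sum_list [pt]:
  fixes zs :: "'a::repr \<Rightarrow> int list"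
  assumes "ptime zs"
  shows "ptime (\<lambda>x. sum_list (zs x))"
proof -
  have *: "foldl (+) a ys = a + sum_list ys" for a :: int and ys
    by (induction ys arbitrary: a) auto
  obtain q where q: "\<And>x. sz (zs x) \<le> poly q (sz x)" using ptime_sz[OF assms] by blast
  have "ptime (\<lambda>x. foldl (+) 0 (zs x))"
  proof (rule ptime_foldl_bounded[where b = "Polynomial.smult 4 q + [:5:]"])
    fix x n
    have "sz (foldl (+) 0 (take n (zs x))) \<le> 4 * sz (take n (zs x)) + 5"
      unfolding * by (intro sz_int_le) (use sum_list_less_sz[of "take n (zs x)"] in simp)
    also have "\<dots> \<le> 4 * poly q (sz x) + 5" using sz_take[of n "zs x"] q[of x] by simp
    finally show "sz (foldl (+) 0 (take n (zs x))) \<le> poly (Polynomial.smult 4 q + [:5:]) (sz x)" by simp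
  qed (intro pt assms)+
  then show ?thesis by (simp add: *)
qed

lemma ptime_int [pt]: "ptime f \<Longrightarrow> ptime (\<lambda>x. int (f x))"
proof -
  assume "ptime f"
  then have "ptime (\<lambda>x. sum_list (replicate (f x) (1::int)))" by (intro pt)
  then show ?thesis by (simp add: sum_list_replicate)
qed

subsection \<open>Encoders\<close>

lemma enc_list_concat: "enc_list f xs = concat (map (\<lambda>x. True # f x) xs) @ [False]"
  by (induction xs) auto

lemma ptime_enc_list [pt]:
  assumes "ptime (\<lambda>p. f (fst p) (snd p))" "ptime xs"
  shows "ptime (\<lambda>x. enc_list (f x) (xs x))"
  unfolding enc_list_concat by (intro pt assms)

definition enc_mag :: "int \<Rightarrow> bool list" where
  "enc_mag z = enc_list (\<lambda>b. [b]) (mag z)"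

text \<open>It takes any pair and performs no reduction; \<open>enc_rat\<close> is recovered on the
  pairs returned by \<open>quotient_of\<close>.\<close>

definition enc_frac :: "int \<Rightarrow> int \<Rightarrow> bool list" where
  "enc_frac p q = (p < 0) # enc_mag p @ enc_mag q"

lemma ptime_enc_mag [pt]: "ptime f \<Longrightarrow> ptime (\<lambda>x. enc_mag (f x))"
  unfolding enc_mag_def by (intro pt)

lemma ptime_enc_frac [pt]: "ptime f \<Longrightarrow> ptime g \<Longrightarrow> ptime (\<lambda>x. enc_frac (f x) (g x))"
  unfolding enc_frac_def by (intro pt)

lemma enc_rat_frac:
  "quotient_of r = (p, q) \<Longrightarrow> enc_rat r = enc_frac p q"
  using quotient_of_denom_pos[of r p q]
  by (simp add: enc_rat_def enc_frac_def enc_int_def enc_nat_def enc_mag_def mag_def)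

lemma enc_nat_mag: "enc_nat n = enc_mag (int n)"
  by (simp add: enc_nat_def enc_mag_def mag_def)

section \<open>Linear programming\<close>

definition dot :: "nat \<Rightarrow> (nat \<Rightarrow> 'a::comm_ring_1) \<Rightarrow> (nat \<Rightarrow> 'a) \<Rightarrow> 'a" where
  "dot n u v = (\<Sum>j<n. u j * v j)"

lemma dot_lincomb:
  "dot n u (\<lambda>j. v j + k * w j) = dot n u v + k * dot n u w"
  "dot n (\<lambda>j. v j + k * w j) u = dot n v u + k * dot n w u"
  by (simp_all add: dot_def algebra_simps sum.distrib sum_distrib_left)

lemma dot_scale: "dot n u (\<lambda>j. k * w j) = k * dot n u w" "dot n (\<lambda>j. k * w j) u = k * dot n w u"
  by (simp_all add: dot_def algebra_simps sum_distrib_left)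

lemma dot_minus: "dot n u (\<lambda>j. - w j) = - dot n u w" "dot n (\<lambda>j. - w j) u = - dot n w u"
  by (simp_all add: dot_def sum_negf)

lemma dot_sum: "dot n (\<lambda>j. \<Sum>i\<in>I. l i * a i j) y = (\<Sum>i\<in>I. l i * dot n (a i) y)"
  unfolding dot_def by (subst sum_distrib_right, subst sum.swap) (simp add: sum_distrib_left mult.assoc)

lemma dot_cong: "(\<And>j. j < n \<Longrightarrow> u j = u' j) \<Longrightarrow> (\<And>j. j < n \<Longrightarrow> v j = v' j) \<Longrightarrow> dot n u v = dot n u' v'"
  by (simp add: dot_def)

lemma dot_self_pos: "j < n \<Longrightarrow> c j \<noteq> 0 \<Longrightarrow> 0 < dot n c (c :: nat \<Rightarrow> real)"
  unfolding dot_def by (rule sum_pos2[of _ j]) (auto simp: zero_less_mult_iff not_less_iff_gr_or_eq)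

subsection \<open>Farkas' lemma and complementary slackness\<close>

text \<open>Induction on the number of rows. If \<open>d\<close> separates \<open>c\<close> from the
  cone of the first \<open>m\<close> rows but violates the new row \<open>a m\<close>, all vectors
  are projected along \<open>a m\<close> onto the hyperplane orthogonal to \<open>d\<close>, and the
  alternative for the projected vectors is lifted back.\<close>

lemma farkas:
  fixes a :: "nat \<Rightarrow> nat \<Rightarrow> real"
  shows "(\<exists>l. (\<forall>i<m. 0 \<le> l i) \<and> (\<forall>j<n. c j = (\<Sum>i<m. l i * a i j))) \<or>
    (\<exists>d. (\<forall>i<m. dot n (a i) d \<le> 0) \<and> 0 < dot n c d)"
proof (induction m arbitrary: a c)
  case 0
  show ?case
  proof (cases "\<forall>j<n. c j = 0")
    case False
    then obtain j where "j < n" "c j \<noteq> 0" by auto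
    from dot_self_pos[where c = c, OF this] show ?thesis by auto
  qed auto
next
  case (Suc m)
  consider l where "\<forall>i<m. 0 \<le> l i" "\<forall>j<n. c j = (\<Sum>i<m. l i * a i j)"
    | d where "\<forall>i<m. dot n (a i) d \<le> 0" "0 < dot n c d" using Suc.IH[where a = a and c = c] by blast
  then show ?case
  proof cases
    case 1
    then show ?thesis
      by (intro disjI1 exI[of _ "\<lambda>i. if i < m then l i else 0"]) (auto simp: less_Suc_eq)
  next
    case 2
    let ?s = "dot n (a m) d"
    show ?thesis
    proof (cases "?s \<le> 0")
      case True
      with 2 show ?thesis by (intro disjI2 exI[of _ d]) (auto simp: less_Suc_eq)
    next
      case False
      define a' where "a' = (\<lambda>i j. a i j + (- (dot n (a i) d / ?s)) * a m j)"
      define c' where "c' = (\<lambda>j. c j + (- (dot n c d / ?s)) * a m j)"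
      consider l where "\<forall>i<m. 0 \<le> l i" "\<forall>j<n. c' j = (\<Sum>i<m. l i * a' i j)"
        | e where "\<forall>i<m. dot n (a' i) e \<le> 0" "0 < dot n c' e" using Suc.IH[where a = a' and c = c'] by blast
      then show ?thesis
      proof cases
        case l: 1
        \<comment> \<open>The coefficient of the new row restores what the projection removed. It is
          nonnegative since \<open>dot n c d\<close> is positive and the old rows have nonpositive
          products with \<open>d\<close>.\<close>
        let ?t = "(dot n c d - (\<Sum>i<m. l i * dot n (a i) d)) / ?s"
        have "(\<Sum>i<m. l i * dot n (a i) d) \<le> 0"
          using l(1) 2(1) by (intro sum_nonpos) (auto intro!: mult_nonneg_nonpos)
        then have t: "0 \<le> ?t" using 2(2) False by (intro divide_nonneg_nonneg) auto
        have "c j = (\<Sum>i<m. l i * a i j) + ?t * a m j" if "j < n" for j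
        proof -
          have "c j = c' j + dot n c d / ?s * a m j" by (simp add: c'_def)
          also have "c' j = (\<Sum>i<m. l i * a i j - l i * dot n (a i) d * (a m j / ?s))"
            using l(2) that by (simp add: a'_def algebra_simps)
          also have "\<dots> = (\<Sum>i<m. l i * a i j) - (\<Sum>i<m. l i * dot n (a i) d) * (a m j / ?s)"
            by (simp add: sum_subtractf sum_distrib_right sum_divide_distrib)
          finally show ?thesis by (simp add: diff_divide_distrib algebra_simps)
        qed
        with t l(1) show ?thesis
          by (intro disjI1 exI[of _ "\<lambda>i. if i < m then l i else ?t"]) (auto simp: less_Suc_eq)
      next
        case e: 2
        \<comment> \<open>Adding this multiple of \<open>d\<close> makes the direction orthogonal to
          the new row; its product with any other vector equals the product of \<open>e\<close> with
          the projection of that vector.\<close>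
        let ?k = "- (dot n (a m) e / ?s)"
        let ?e = "\<lambda>j. e j + ?k * d j"
        have "dot n u ?e = dot n (\<lambda>j. u j + (- (dot n u d / ?s)) * a m j) e" for u
          unfolding dot_lincomb by simp
        then have "dot n (a i) ?e = dot n (a' i) e" "dot n c ?e = dot n c' e" for i
          by (simp_all add: a'_def c'_def)
        moreover have "dot n (a m) ?e = 0" using False unfolding dot_lincomb by simp
        ultimately show ?thesis using e by (intro disjI2 exI[of _ ?e]) (auto simp: less_Suc_eq)
      qed
    qed
  qed
qed

text \<open>Each strict inequality leaves room for some positive step, the other constraints do not
  increase along the motion, and the minimum of finitely many positive numbers is positive.\<close>

lemma small_step:
  fixes p q r :: "nat \<Rightarrow> real"
  assumes "\<forall>i<m. p i < q i \<or> (p i \<le> q i \<and> r i \<le> 0)"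
  shows "\<exists>\<epsilon>>0. \<forall>e. 0 < e \<and> e \<le> \<epsilon> \<longrightarrow> (\<forall>i<m. p i + e * r i \<le> q i)"
  using assms
proof (induction m)
  case 0
  show ?case by (intro exI[of _ 1]) auto
next
  case (Suc m)
  then obtain \<epsilon> where \<epsilon>: "\<epsilon> > 0" "\<And>e i. 0 < e \<Longrightarrow> e \<le> \<epsilon> \<Longrightarrow> i < m \<Longrightarrow> p i + e * r i \<le> q i" by auto
  consider "p m < q m" "0 < r m" | "p m \<le> q m" "r m \<le> 0" using Suc.prems by force
  then show ?case
  proof cases
    case 1
    have "p m + e * r m \<le> q m" if "0 < e" "e \<le> (q m - p m) / r m" for e
      using that 1 by (simp add: field_simps)
    then show ?thesis using \<epsilon> 1
      by (intro exI[of _ "min \<epsilon> ((q m - p m) / r m)"]) (auto simp: less_Suc_eq)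
  next
    case 2
    have "p m + e * r m \<le> q m" if "0 < e" for e
      using mult_nonneg_nonpos[of e "r m"] that 2 by simp
    then show ?thesis using \<epsilon> by (intro exI[of _ \<epsilon>]) (auto simp: less_Suc_eq)
  qed
qed

text \<open>If \<open>- \<gamma>\<close> were outside the cone of the tight rows, Farkas' lemma
  would give a direction that violates no tight row and lowers the objective, and a small step along
  it would improve \<open>y\<close>.\<close>

lemma dual_solution:
  fixes a :: "nat \<Rightarrow> nat \<Rightarrow> real"
  assumes feas: "\<forall>i<m. dot n (a i) y \<le> \<beta> i"
    and opt: "\<And>z. \<forall>i<m. dot n (a i) z \<le> \<beta> i \<Longrightarrow> dot n \<gamma> y \<le> dot n \<gamma> z"
  obtains l where "\<And>i. i < m \<Longrightarrow> 0 \<le> l i" "\<And>i. i < m \<Longrightarrow> l i = 0 \<or> dot n (a i) y = \<beta> i"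
    "\<And>j. j < n \<Longrightarrow> (\<Sum>i<m. l i * a i j) = - \<gamma> j"
proof -
  define T where "T = (\<lambda>i. dot n (a i) y = \<beta> i)"
  \<comment> \<open>Rows that are not tight are replaced by zero rows, which keeps the index range
    \<open>m\<close>.\<close>
  define a' where "a' = (\<lambda>i j. if T i then a i j else 0)"
  consider l where "\<forall>i<m. 0 \<le> l i" "\<forall>j<n. - \<gamma> j = (\<Sum>i<m. l i * a' i j)"
    | d where "\<forall>i<m. dot n (a' i) d \<le> 0" "0 < dot n (\<lambda>j. - \<gamma> j) d"
    using farkas[where m = m and n = n and a = a' and c = "\<lambda>j. - \<gamma> j"] by blast
  then show ?thesis
  proof cases
    case 1
    have "(\<Sum>i<m. (if T i then l i else 0) * a i j) = (\<Sum>i<m. l i * a' i j)" for j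
      by (intro sum.cong) (auto simp: a'_def)
    with 1 show ?thesis by (intro that[of "\<lambda>i. if T i then l i else 0"]) (auto simp: T_def)
  next
    case 2
    have "dot n (a i) d \<le> 0" if "i < m" "T i" for i
      using 2(1) that by (auto simp: a'_def)
    then have "\<forall>i<m. dot n (a i) y < \<beta> i \<or> (dot n (a i) y \<le> \<beta> i \<and> dot n (a i) d \<le> 0)"
      using feas by (auto simp: T_def le_less)
    from small_step[OF this] obtain e where e: "e > 0" "\<forall>i<m. dot n (a i) y + e * dot n (a i) d \<le> \<beta> i"
      by blast
    have "dot n \<gamma> y \<le> dot n \<gamma> (\<lambda>j. y j + e * d j)"
      by (rule opt) (use e in \<open>simp add: dot_lincomb\<close>)
    then have "0 \<le> e * dot n \<gamma> d" by (simp add: dot_lincomb)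
    then have "0 \<le> dot n \<gamma> d" using e(1) by (simp add: zero_le_mult_iff)
    with 2(2) show ?thesis by (simp add: dot_minus)
  qed
qed

text \<open>If the coordinate \<open>i\<close> vanishes on the optimal face, then the \<open>i\<close>-th unit vector is a combination of
  rows with positive multipliers in some optimal dual solution: \<open>y\<close> both minimizes and maximizes
  the \<open>i\<close>-th coordinate on the optimal face, and the multipliers of the two dual solutions are added
  to an arbitrary optimal dual solution.\<close>

lemma dual_solution_strict:
  fixes a :: "nat \<Rightarrow> nat \<Rightarrow> real"
  assumes feas: "\<forall>r<m. dot n (a r) y \<le> \<beta> r"
    and opt: "\<And>z. \<forall>r<m. dot n (a r) z \<le> \<beta> r \<Longrightarrow> dot n \<gamma> y \<le> dot n \<gamma> z"
    and i: "i < n"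
    and zero: "\<And>z. \<forall>r<m. dot n (a r) z \<le> \<beta> r \<Longrightarrow> dot n \<gamma> z \<le> dot n \<gamma> y \<Longrightarrow> z i = y i"
  obtains l \<mu> where "\<And>r. r < m \<Longrightarrow> 0 \<le> l r" "\<And>r. r < m \<Longrightarrow> l r = 0 \<or> dot n (a r) y = \<beta> r"
    "\<And>j. j < n \<Longrightarrow> (\<Sum>r<m. l r * a r j) = - \<gamma> j"
    "\<And>r. r < m \<Longrightarrow> l r = 0 \<Longrightarrow> \<mu> r = 0"
    "\<And>j. j < n \<Longrightarrow> (\<Sum>r<m. \<mu> r * a r j) = (if j = i then 1 else 0)"
proof -
  obtain l0 where l0: "\<And>r. r < m \<Longrightarrow> 0 \<le> l0 r" "\<And>r. r < m \<Longrightarrow> l0 r = 0 \<or> dot n (a r) y = \<beta> r"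
    "\<And>j. j < n \<Longrightarrow> (\<Sum>r<m. l0 r * a r j) = - \<gamma> j"
    using dual_solution[OF feas opt] by blast
  \<comment> \<open>The extra row \<open>m\<close> bounds the objective by its optimal value, so the
    extended system describes the optimal face.\<close>
  let ?a = "\<lambda>r. if r < m then a r else \<gamma>" and ?\<beta> = "\<lambda>r. if r < m then \<beta> r else dot n \<gamma> y"
  let ?e = "\<lambda>j. if j = i then 1 else 0 :: real"
  have e: "dot n (\<lambda>j. s * ?e j) z = s * z i" for s z
    using i unfolding dot_def by (simp add: if_distrib[of "\<lambda>x. _ * x * _"] cong: if_cong)
  have ex: "\<exists>l \<theta>. (\<forall>r<m. 0 \<le> l r \<and> (l r = 0 \<or> dot n (a r) y = \<beta> r)) \<and> 0 \<le> \<theta> \<and>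
      (\<forall>j<n. (\<Sum>r<m. l r * a r j) + \<theta> * \<gamma> j = s * ?e j)" for s :: real
  proof -
    have "\<forall>r<Suc m. dot n (?a r) y \<le> ?\<beta> r" using feas by (auto simp: less_Suc_eq)
    moreover have "dot n (\<lambda>j. - s * ?e j) y \<le> dot n (\<lambda>j. - s * ?e j) z"
      if "\<forall>r<Suc m. dot n (?a r) z \<le> ?\<beta> r" for z
    proof -
      have "z i = y i" using that by (intro zero) (auto simp: less_Suc_eq)
      then show ?thesis by (simp only: e)
    qed
    ultimately obtain l where l: "\<And>r. r < Suc m \<Longrightarrow> 0 \<le> l r" "\<And>r. r < Suc m \<Longrightarrow> l r = 0 \<or> dot n (?a r) y = ?\<beta> r"
      "\<And>j. j < n \<Longrightarrow> (\<Sum>r<Suc m. l r * ?a r j) = - (- s * ?e j)"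
      using dual_solution[of "Suc m" n ?a y ?\<beta> "\<lambda>j. - s * ?e j"] by blast
    show ?thesis
    proof (intro exI[of _ l] exI[of _ "l m"] conjI allI impI)
      fix r assume "r < m"
      then show "0 \<le> l r" "l r = 0 \<or> dot n (a r) y = \<beta> r" using l(1)[of r] l(2)[of r] by auto
    next
      show "0 \<le> l m" using l(1) by simp
      fix j assume "j < n"
      from l(3)[OF this] show "(\<Sum>r<m. l r * a r j) + l m * \<gamma> j = s * ?e j" by simp
    qed
  qed
  obtain l1 \<theta>1 where l1: "\<forall>r<m. 0 \<le> l1 r \<and> (l1 r = 0 \<or> dot n (a r) y = \<beta> r)" "0 \<le> \<theta>1"
      "\<forall>j<n. (\<Sum>r<m. l1 r * a r j) + \<theta>1 * \<gamma> j = ?e j"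
    using ex[of 1] by auto
  obtain l2 \<theta>2 where l2: "\<forall>r<m. 0 \<le> l2 r \<and> (l2 r = 0 \<or> dot n (a r) y = \<beta> r)" "0 \<le> \<theta>2"
      "\<forall>j<n. (\<Sum>r<m. l2 r * a r j) + \<theta>2 * \<gamma> j = - ?e j"
    using ex[of "-1"] by auto
  \<comment> \<open>With \<open>l1\<close> and \<open>l2\<close> the rows combine to
    \<open>?e - \<theta>1 * \<gamma>\<close> and \<open>- ?e - \<theta>2 * \<gamma>\<close>, with
    \<open>l0\<close> to \<open>- \<gamma>\<close>. Together they give \<open>- \<gamma>\<close>
    times this factor.\<close>
  let ?k = "1 + \<theta>1 + \<theta>2"
  have k: "0 < ?k" using l1(2) l2(2) by simp
  let ?l = "\<lambda>r. (l0 r + l1 r + l2 r) / ?k"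
  \<comment> \<open>Subtracting \<open>\<theta>1\<close> times the identity for \<open>l0\<close>
    cancels the objective and leaves the unit vector, supported where \<open>l0\<close> or
    \<open>l1\<close> is positive.\<close>
  let ?\<mu> = "\<lambda>r. l1 r - \<theta>1 * l0 r"
  show ?thesis
  proof (rule that[of ?l ?\<mu>])
    fix r assume r: "r < m"
    show "0 \<le> ?l r" using l0(1)[OF r] l1(1) l2(1) r k by simp
    show "?l r = 0 \<or> dot n (a r) y = \<beta> r" using l0(2)[OF r] l1(1)[rule_format, OF r] l2(1)[rule_format, OF r] by auto
    assume "?l r = 0"
    then have "l0 r + l1 r + l2 r = 0" using k by simp
    with l0(1)[OF r] l1(1)[rule_format, OF r] l2(1)[rule_format, OF r] have "l0 r = 0 \<and> l1 r = 0"
      by linarith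
    then show "?\<mu> r = 0" by simp
  next
    fix j assume j: "j < n"
    note eqs = l0(3)[OF j] l1(3)[rule_format, OF j] l2(3)[rule_format, OF j]
    have "(\<Sum>r<m. ?l r * a r j) = ((\<Sum>r<m. l0 r * a r j) + (\<Sum>r<m. l1 r * a r j) + (\<Sum>r<m. l2 r * a r j)) / ?k"
      by (simp add: sum_divide_distrib sum.distrib[symmetric] algebra_simps)
    also have "(\<Sum>r<m. l0 r * a r j) + (\<Sum>r<m. l1 r * a r j) + (\<Sum>r<m. l2 r * a r j) = - \<gamma> j * ?k"
      using eqs by (simp add: algebra_simps)
    also have "- \<gamma> j * ?k / ?k = - \<gamma> j" using k by simp
    finally show "(\<Sum>r<m. ?l r * a r j) = - \<gamma> j" .
    have "(\<Sum>r<m. ?\<mu> r * a r j) = (\<Sum>r<m. l1 r * a r j) - \<theta>1 * (\<Sum>r<m. l0 r * a r j)"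
      by (simp add: sum_distrib_left sum_subtractf algebra_simps)
    with eqs show "(\<Sum>r<m. ?\<mu> r * a r j) = (if j = i then 1 else 0)" by simp
  qed
qed

subsection \<open>Small integer solutions\<close>

lemma det_abs_le:
  fixes A :: "int mat"
  assumes A: "A \<in> carrier_mat n n" and le: "\<And>i j. i < n \<Longrightarrow> j < n \<Longrightarrow> \<bar>A $$ (i, j)\<bar> \<le> K"
  shows "\<bar>det A\<bar> \<le> fact n * K ^ n"
proof -
  let ?P = "{p. p permutes {0..<n}}"
  have "\<bar>det A\<bar> \<le> (\<Sum>p\<in>?P. \<bar>signof p * (\<Prod>i = 0..<n. A $$ (i, p i))\<bar>)"
    using A unfolding det_def by (simp add: sum_abs)
  also have "\<dots> \<le> (\<Sum>p\<in>?P. K ^ n)"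
  proof (rule sum_mono)
    fix p assume "p \<in> ?P"
    then have p: "p permutes {0..<n}" by simp
    have "\<bar>\<Prod>i = 0..<n. A $$ (i, p i)\<bar> \<le> (\<Prod>i = 0..<n. K)"
      unfolding abs_prod using p le permutes_in_image[OF p] by (intro prod_mono) auto
    moreover have "\<bar>signof p :: int\<bar> = 1" by (auto simp: sign_def)
    ultimately show "\<bar>signof p * (\<Prod>i = 0..<n. A $$ (i, p i))\<bar> \<le> K ^ n"
      by (simp add: abs_mult)
  qed
  also have "\<dots> = fact n * K ^ n" by (simp add: card_permutations[of _ n])
  finally show ?thesis .
qed

text \<open>A solution with the largest number of tight rows will do: along a nonzero direction
  orthogonal to all tight rows, or its negative, one could move until a further row becomes
  tight.\<close>

lemma tight_maximal:
  fixes M :: "nat \<Rightarrow> nat \<Rightarrow> real"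
  assumes "\<forall>i<R. q i \<le> dot N (M i) z0"
    and pointed: "\<And>d. \<forall>i<R. dot N (M i) d = 0 \<Longrightarrow> \<forall>j<N. d j = 0"
  obtains z where "\<forall>i<R. q i \<le> dot N (M i) z"
    "\<And>d. \<forall>i<R. dot N (M i) z = q i \<longrightarrow> dot N (M i) d = 0 \<Longrightarrow> \<forall>j<N. d j = 0"
proof -
  let ?sol = "\<lambda>z. \<forall>i<R. q i \<le> dot N (M i) z"
  let ?T = "\<lambda>z. {i. i < R \<and> dot N (M i) z = q i}"
  have "?T z \<subseteq> {..<R}" for z by auto
  from card_mono[OF _ this] have "\<forall>z. ?sol z \<longrightarrow> card (?T z) < Suc R"
    by (simp add: less_Suc_eq_le)
  from ex_has_greatest_nat[where P = ?sol and f = "\<lambda>z. card (?T z)", OF assms(1) this]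
  obtain z where z': "?sol z \<and> (\<forall>w. ?sol w \<longrightarrow> card (?T w) \<le> card (?T z))" by (elim exE)
  note z = conjunct1[OF z'] conjunct2[OF z', rule_format]
  have "False" if d: "\<forall>i<R. dot N (M i) z = q i \<longrightarrow> dot N (M i) d = 0"
    and neg: "i0 < R" "dot N (M i0) d < 0" for d i0
  proof -
    let ?U = "{i. i < R \<and> dot N (M i) d < 0}"
    \<comment> \<open>Ratio test: the step length at which row \<open>i\<close> becomes tight when
      moving along \<open>d\<close>. The least of them preserves all rows and makes
      \<open>i1\<close> tight.\<close>
    let ?\<tau> = "\<lambda>i. (dot N (M i) z - q i) / (- dot N (M i) d)"
    have "finite ?U" "?U \<noteq> {}" using neg by auto
    then obtain i1 where i1: "i1 \<in> ?U" "\<And>i. i \<in> ?U \<Longrightarrow> ?\<tau> i1 \<le> ?\<tau> i"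
      using arg_min_if_finite[of ?U ?\<tau>] by (metis (no_types, lifting) linorder_not_less)
    let ?w = "\<lambda>j. z j + ?\<tau> i1 * d j"
    have i1': "i1 < R" "dot N (M i1) d < 0" using i1(1) by auto
    have "dot N (M i1) z \<noteq> q i1" using d i1' by auto
    have tau: "0 \<le> ?\<tau> i1" using z(1) i1' by (intro divide_nonneg_nonneg) auto
    have "?sol ?w"
    proof (intro allI impI)
      fix i assume i: "i < R"
      show "q i \<le> dot N (M i) ?w"
      proof (cases "dot N (M i) d < 0")
        case True
        then have "?\<tau> i1 \<le> ?\<tau> i" using i i1(2) by auto
        then have "?\<tau> i1 * (- dot N (M i) d) \<le> dot N (M i) z - q i"
          using True by (simp only: pos_le_divide_eq neg_0_less_iff_less)
        then show ?thesis unfolding dot_lincomb mult_minus_right by linarith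
      next
        case False
        then have "0 \<le> ?\<tau> i1 * dot N (M i) d" using tau by (intro mult_nonneg_nonneg) auto
        then show ?thesis using z(1) i unfolding dot_lincomb by force
      qed
    qed
    moreover have "dot N (M i1) ?w = q i1" using i1' unfolding dot_lincomb by simp
    moreover have "?T z \<subseteq> ?T ?w" using d unfolding dot_lincomb by auto
    ultimately have "?T z \<subset> ?T ?w" "?sol ?w" using i1' \<open>dot N (M i1) z \<noteq> q i1\<close> by blast+
    then show False using z(2)[of ?w] psubset_card_mono[of "?T ?w" "?T z"] by (simp add: not_less[symmetric])
  qed note neg = this
  have "\<forall>j<N. d j = 0" if d: "\<forall>i<R. dot N (M i) z = q i \<longrightarrow> dot N (M i) d = 0" for d
  proof (rule pointed, intro allI impI)
    fix i assume i: "i < R"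
    show "dot N (M i) d = 0"
      using neg[OF d i] neg[of "\<lambda>j. - d j", OF _ i] d by (fastforce simp: dot_minus)
  qed
  with z(1) show ?thesis by (rule that)
qed

text \<open>For \<open>R\<close> rows with entries bounded by \<open>K\<close>, the Gram matrix has
  entries up to \<open>R * K ^ 2\<close> and hence cofactors up to
  \<open>fact N * (R * K ^ 2) ^ N\<close>; the right-hand side of the normal equations is bounded by
  \<open>R * K\<close>, and Cramer's rule sums \<open>N\<close> products of the two.\<close>

definition sol_bound :: "nat \<Rightarrow> nat \<Rightarrow> int \<Rightarrow> int" where
  "sol_bound N R K = int N * (fact N * (int R * K ^ 2) ^ N) * (int R * K)"

text \<open>By the choice of the tight rows \<open>T\<close> the Gram matrix \<open>M\<^sub>T\<^sup>t M\<^sub>T\<close> is regular, so Cramer's rule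
  applied to the normal equations gives a small solution.\<close>

lemma small_solution_pointed:
  fixes M :: "nat \<Rightarrow> nat \<Rightarrow> int" and q :: "nat \<Rightarrow> int"
  assumes z0: "\<forall>i<R. real_of_int (q i) \<le> dot N (\<lambda>j. real_of_int (M i j)) z0"
    and pointed: "\<And>d. \<forall>i<R. dot N (\<lambda>j. real_of_int (M i j)) d = 0 \<Longrightarrow> \<forall>j<N. d j = 0"
    and q: "\<And>i. i < R \<Longrightarrow> q i \<in> {0, 1}"
    and K: "\<And>i j. i < R \<Longrightarrow> j < N \<Longrightarrow> \<bar>M i j\<bar> \<le> K" "1 \<le> K" "1 \<le> R"
  shows "\<exists>z. (\<forall>i<R. q i \<le> dot N (M i) z) \<and> (\<forall>j<N. \<bar>z j\<bar> \<le> sol_bound N R K)"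
proof -
  let ?M = "\<lambda>i j. real_of_int (M i j)"
  obtain z where z: "\<forall>i<R. real_of_int (q i) \<le> dot N (?M i) z"
    "\<And>d. \<forall>i<R. dot N (?M i) z = real_of_int (q i) \<longrightarrow> dot N (?M i) d = 0 \<Longrightarrow> \<forall>j<N. d j = 0"
    using tight_maximal[OF z0 pointed] by blast
  define T where "T = {i. i < R \<and> dot N (?M i) z = real_of_int (q i)}"
  have TR: "T \<subseteq> {..<R}" by (auto simp: T_def)
  have T: "finite T" "card T \<le> R" "T \<subseteq> {..<R}"
    using TR finite_subset[OF TR] card_mono[OF _ TR] by auto
  define g where "g = (\<lambda>j l. \<Sum>i\<in>T. M i j * M i l)"
  define v where "v = (\<lambda>j. \<Sum>i\<in>T. M i j * q i)"
  define G where "G = mat N N (\<lambda>(j, l). g j l)"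
  have G: "G \<in> carrier_mat N N" by (simp add: G_def)
  have gdot: "(\<Sum>l<N. real_of_int (g j l) * w l) = (\<Sum>i\<in>T. ?M i j * dot N (?M i) w)" for j w
    unfolding g_def dot_def
    by (simp add: sum_distrib_right sum_distrib_left, subst sum.swap) (simp add: mult.assoc)
  have det: "det G \<noteq> 0"
  proof
    assume "det G = 0"
    then have "det (map_mat real_of_int G) = 0" by (simp add: of_int_hom.hom_det)
    moreover have "map_mat real_of_int G \<in> carrier_mat N N" using G by simp
    ultimately obtain w where w: "w \<in> carrier_vec N" "w \<noteq> 0\<^sub>v N" "map_mat real_of_int G *\<^sub>v w = 0\<^sub>v N"
      using det_0_iff_vec_prod_zero by blast
    let ?w = "\<lambda>j. w $ j"
    have "(\<Sum>i\<in>T. ?M i j * dot N (?M i) ?w) = 0" if "j < N" for j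
    proof -
      have "(map_mat real_of_int G *\<^sub>v w) $ j = (\<Sum>l<N. real_of_int (g j l) * ?w l)"
        using that w(1) by (simp add: G_def scalar_prod_def lessThan_atLeast0)
      with w(3) that gdot[of j ?w] show ?thesis by simp
    qed
    \<comment> \<open>The quadratic form of the Gram matrix at \<open>w\<close> is the sum of the
      squares of the products with the tight rows, so all of these vanish.\<close>
    then have "(\<Sum>j<N. ?w j * (\<Sum>i\<in>T. ?M i j * dot N (?M i) ?w)) = 0" by simp
    also have "(\<Sum>j<N. ?w j * (\<Sum>i\<in>T. ?M i j * dot N (?M i) ?w)) = (\<Sum>i\<in>T. (dot N (?M i) ?w)\<^sup>2)"
      unfolding sum_distrib_left
      by (subst sum.swap, rule sum.cong) (simp_all add: power2_eq_square dot_def sum_distrib_right sum_distrib_left algebra_simps)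
    finally have "\<forall>i\<in>T. dot N (?M i) ?w = 0" using T(1) by (simp add: sum_nonneg_eq_0_iff)
    then have "\<forall>j<N. ?w j = 0" by (intro z(2)) (auto simp: T_def)
    then have "w = 0\<^sub>v N" using w(1) by (intro eq_vecI) auto
    with w(2) show False by simp
  qed
  define D where "D = det G"
  \<comment> \<open>Cramer's rule in the form that \<open>D * z\<close> is the adjugate of
    \<open>G\<close> applied to \<open>v\<close>.\<close>
  define p where "p = (\<lambda>j. \<Sum>l<N. adj_mat G $$ (j, l) * v l)"
  have gz: "(\<Sum>l<N. real_of_int (g j l) * z l) = real_of_int (v j)" for j
    unfolding gdot v_def by (auto simp: T_def intro!: sum.cong)
  have Dz: "real_of_int D * z j = real_of_int (p j)" if j: "j < N" for j
  proof -
    have ag: "(\<Sum>l<N. adj_mat G $$ (j, l) * g l h) = (if j = h then D else 0)" if h: "h < N" for h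
    proof -
      have "(adj_mat G * G) $$ (j, h) = (\<Sum>l<N. adj_mat G $$ (j, l) * g l h)"
        using j h adj_mat(1)[OF G] by (simp add: G_def scalar_prod_def lessThan_atLeast0)
      then show ?thesis using adj_mat(3)[OF G] j h by (cases "j = h") (auto simp: D_def)
    qed
    have "real_of_int (p j) = (\<Sum>l<N. real_of_int (adj_mat G $$ (j, l)) * (\<Sum>h<N. real_of_int (g l h) * z h))"
      by (simp add: p_def gz)
    also have "\<dots> = (\<Sum>h<N. real_of_int (\<Sum>l<N. adj_mat G $$ (j, l) * g l h) * z h)"
      unfolding of_int_sum sum_distrib_right sum_distrib_left by (subst sum.swap) (simp add: mult.assoc)
    also have "\<dots> = (\<Sum>h<N. if j = h then real_of_int D * z h else 0)"
      using ag by (intro sum.cong) auto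
    also have "\<dots> = real_of_int D * z j" using j by simp
    finally show ?thesis by simp
  qed
  \<comment> \<open>This is \<open>z\<close> times the absolute value of the determinant. Such a
    multiple still solves the system, because \<open>q i\<close> is 0 or 1 and the factor is at
    least 1; so no common denominator has to be kept.\<close>
  define y where "y = (\<lambda>j. sgn D * p j)"
  have Dy: "real_of_int \<bar>D\<bar> * z j = real_of_int (y j)" if "j < N" for j
    using Dz[OF that] by (simp add: y_def abs_sgn mult.assoc[symmetric] mult.commute)
  have D1: "1 \<le> \<bar>D\<bar>" using det by (simp add: D_def)
  have "q i \<le> dot N (M i) y" if i: "i < R" for i
  proof -
    have "real_of_int (dot N (M i) y) = dot N (?M i) (\<lambda>j. real_of_int \<bar>D\<bar> * z j)"
      unfolding dot_def using Dy by simp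
    also have "\<dots> = real_of_int \<bar>D\<bar> * dot N (?M i) z" by (rule dot_scale)
    finally have "real_of_int \<bar>D\<bar> * real_of_int (q i) \<le> real_of_int (dot N (M i) y)"
      using z(1) i D1 by (simp add: mult_left_mono)
    then have "\<bar>D\<bar> * q i \<le> dot N (M i) y" by (metis of_int_le_iff of_int_mult)
    with q[OF i] D1 show ?thesis by auto
  qed
  moreover have "\<bar>y j\<bar> \<le> sol_bound N R K" if j: "j < N" for j
  proof -
    let ?k = "int R * K ^ 2"
    have k1: "1 \<le> ?k" using mult_mono[of 1 "int R" 1 "K ^ 2"] K one_le_power[of K 2] by simp
    have gk: "\<bar>g h l\<bar> \<le> ?k" if "h < N" "l < N" for h l
    proof -
      have "\<bar>g h l\<bar> \<le> (\<Sum>i\<in>T. \<bar>M i h * M i l\<bar>)" unfolding g_def by (rule sum_abs)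
      also have "\<dots> \<le> (\<Sum>i\<in>T. K ^ 2)"
        using K T(3) that by (intro sum_mono) (auto simp: abs_mult power2_eq_square intro!: mult_mono)
      also have "\<dots> \<le> ?k" using T(2) by (simp add: mult_right_mono)
      finally show ?thesis .
    qed
    have vk: "\<bar>v l\<bar> \<le> int R * K" if "l < N" for l
    proof -
      have "\<bar>v l\<bar> \<le> (\<Sum>i\<in>T. \<bar>M i l * q i\<bar>)" unfolding v_def by (rule sum_abs)
      also have "\<dots> \<le> (\<Sum>i\<in>T. K)"
      proof (rule sum_mono)
        fix i assume "i \<in> T"
        then have "i < R" using T(3) by auto
        with q[OF this] K(1)[OF this that] K(2) show "\<bar>M i l * q i\<bar> \<le> K" by auto
      qed
      also have "\<dots> \<le> int R * K" using T(2) K(2) by (simp add: mult_right_mono)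
      finally show ?thesis .
    qed
    have adj: "\<bar>adj_mat G $$ (j, l)\<bar> \<le> fact N * ?k ^ N" if l: "l < N" for l
    proof -
      have "\<bar>det (mat_delete G l j)\<bar> \<le> fact (N - 1) * ?k ^ (N - 1)"
      proof (rule det_abs_le)
        show "mat_delete G l j \<in> carrier_mat (N - 1) (N - 1)" using mat_delete_carrier[OF G] .
        show "\<bar>mat_delete G l j $$ (i, h)\<bar> \<le> ?k" if "i < N - 1" "h < N - 1" for i h
          using that j l by (simp add: mat_delete_def G_def) (auto intro!: gk)
      qed
      also have "\<dots> \<le> fact N * ?k ^ N"
        using k1 by (intro mult_mono power_increasing fact_mono) auto
      finally show ?thesis using G j l by (simp add: adj_mat_def cofactor_def abs_mult power_abs)
    qed
    have "\<bar>y j\<bar> \<le> \<bar>p j\<bar>" by (simp add: y_def abs_mult abs_sgn_eq)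
    also have "\<dots> \<le> (\<Sum>l<N. \<bar>adj_mat G $$ (j, l) * v l\<bar>)" unfolding p_def by (rule sum_abs)
    also have "\<dots> \<le> (\<Sum>l<N. (fact N * ?k ^ N) * (int R * K))"
      using adj vk k1 by (intro sum_mono) (auto simp: abs_mult intro!: mult_mono)
    also have "\<dots> = sol_bound N R K" by (simp add: sol_bound_def)
    finally show ?thesis .
  qed
  ultimately show ?thesis by blast
qed

text \<open>Constraints that fix the sign of every coordinate to its sign in the given real solution
  keep that solution and make the system pointed.\<close>

lemma small_solution:
  fixes cs :: "((nat \<Rightarrow> int) \<times> int) list"
  assumes "\<forall>(a, q)\<in>set cs. real_of_int q \<le> dot N (\<lambda>j. real_of_int (a j)) z0"
    and cs: "\<forall>(a, q)\<in>set cs. q \<in> {0, 1} \<and> (\<forall>j<N. \<bar>a j\<bar> \<le> K)" and "1 \<le> K"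
  shows "\<exists>z. (\<forall>(a, q)\<in>set cs. q \<le> dot N a z) \<and> (\<forall>j<N. \<bar>z j\<bar> \<le> sol_bound N (length cs + N + 1) K)"
proof -
  define s where "s = (\<lambda>j. if 0 \<le> z0 j then 1 else - 1 :: int)"
  \<comment> \<open>The zero row provides at least one row even if \<open>cs\<close> is empty and
    \<open>N = 0\<close>.\<close>
  define ds where "ds = cs @ (\<lambda>_. 0, 0) # map (\<lambda>j. (\<lambda>l. if l = j then s j else 0, 0)) [0..<N]"
  have unit: "dot N (\<lambda>l. real_of_int (if l = j then s j else 0)) z = real_of_int (s j) * z j" if "j < N" for j z
  proof -
    have "dot N (\<lambda>l. real_of_int (if l = j then s j else 0)) z = (\<Sum>l<N. if l = j then real_of_int (s j) * z l else 0)"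
      unfolding dot_def by (intro sum.cong) auto
    then show ?thesis using that by simp
  qed
  have dsz0: "\<forall>(a, q)\<in>set ds. real_of_int q \<le> dot N (\<lambda>j. real_of_int (a j)) z0"
    using assms(1) by (auto simp: ds_def unit) (auto simp: dot_def s_def)
  have ds: "\<forall>(a, q)\<in>set ds. q \<in> {0, 1} \<and> (\<forall>j<N. \<bar>a j\<bar> \<le> K)"
    using cs assms(3) by (auto simp: ds_def s_def)
  let ?M = "\<lambda>i. fst (ds ! i)" and ?q = "\<lambda>i. snd (ds ! i)"
  have nth: "(?M i, ?q i) \<in> set ds" if "i < length ds" for i using that by simp
  have "\<exists>z. (\<forall>i<length ds. ?q i \<le> dot N (?M i) z) \<and> (\<forall>j<N. \<bar>z j\<bar> \<le> sol_bound N (length ds) K)"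
  proof (rule small_solution_pointed)
    show "\<forall>i<length ds. real_of_int (?q i) \<le> dot N (\<lambda>j. real_of_int (?M i j)) z0"
      using dsz0 nth by fastforce
    show "?q i \<in> {0, 1}" if "i < length ds" for i using ds nth[OF that] by blast
    show "\<bar>?M i j\<bar> \<le> K" if "i < length ds" "j < N" for i j using ds nth[OF that(1)] that(2) by blast
    show "\<forall>j<N. d j = 0" if d: "\<forall>i<length ds. dot N (\<lambda>j. real_of_int (?M i j)) d = 0" for d
    proof (intro allI impI)
      fix j assume j: "j < N"
      then have "(\<lambda>l. if l = j then s j else 0, 0) \<in> set ds" by (auto simp: ds_def)
      then obtain i where "i < length ds" "ds ! i = (\<lambda>l. if l = j then s j else 0, 0)"
        by (auto simp: in_set_conv_nth)
      with d have "dot N (\<lambda>l. real_of_int (if l = j then s j else 0)) d = 0" by force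
      with unit[OF j] show "d j = 0" by (auto simp: s_def split: if_splits)
    qed
  qed (use assms in \<open>auto simp: ds_def\<close>)
  then obtain z where z: "\<forall>i<length ds. ?q i \<le> dot N (?M i) z" "\<forall>j<N. \<bar>z j\<bar> \<le> sol_bound N (length ds) K"
    by blast
  have "q \<le> dot N a z" if "(a, q) \<in> set cs" for a q
  proof -
    have "(a, q) \<in> set ds" using that by (simp add: ds_def)
    then obtain i where "i < length ds" "ds ! i = (a, q)" by (auto simp: in_set_conv_nth)
    with z(1) show ?thesis by force
  qed
  moreover have "length ds = length cs + N + 1" by (simp add: ds_def)
  ultimately show ?thesis using z(2) by auto
qed

subsection \<open>Certificates\<close>

text \<open>Dimensions: \<open>M\<close> rows, \<open>N\<close> variables, \<open>K\<close> parameters, \<open>G\<close> rows of the parameter polyhedron.\<close>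

record 'a plp =
  pM :: nat
  pN :: nat
  pK :: nat
  pG :: nat
  pA :: "nat \<Rightarrow> nat \<Rightarrow> 'a"
  pB :: "nat \<Rightarrow> nat \<Rightarrow> 'a"
  pb :: "nat \<Rightarrow> 'a"
  pC :: "nat \<Rightarrow> nat \<Rightarrow> 'a"
  pc :: "nat \<Rightarrow> 'a"
  pD :: "nat \<Rightarrow> nat \<Rightarrow> 'a"
  pd :: "nat \<Rightarrow> 'a"
  pT :: nat

definition lfeas :: "real plp \<Rightarrow> (nat \<Rightarrow> real) \<Rightarrow> (nat \<Rightarrow> real) \<Rightarrow> bool" where
  "lfeas I x y \<longleftrightarrow> (\<forall>r<pM I. dot (pN I) (pA I r) y \<le> dot (pK I) (pB I r) x + pb I r)"

definition lcost :: "real plp \<Rightarrow> (nat \<Rightarrow> real) \<Rightarrow> nat \<Rightarrow> real" where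
  "lcost I x j = dot (pK I) (pC I j) x + pc I j"

definition lopt :: "real plp \<Rightarrow> (nat \<Rightarrow> real) \<Rightarrow> (nat \<Rightarrow> real) \<Rightarrow> bool" where
  "lopt I x y \<longleftrightarrow> lfeas I x y \<and> (\<forall>z. lfeas I x z \<longrightarrow> dot (pN I) (lcost I x) y \<le> dot (pN I) (lcost I x) z)"

definition linX :: "real plp \<Rightarrow> (nat \<Rightarrow> real) \<Rightarrow> bool" where
  "linX I x \<longleftrightarrow> (\<forall>r<pG I. dot (pK I) (pD I r) x \<le> pd I r)"

text \<open>The flag selects the pessimistic scenario.\<close>

definition solvable :: "bool \<Rightarrow> real plp \<Rightarrow> bool" where
  "solvable P I \<longleftrightarrow> (\<exists>x. linX I x \<and> (\<exists>y. lopt I x y \<and> y (pT I) = 0) \<and>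
     (P \<longrightarrow> (\<forall>y. lopt I x y \<longrightarrow> y (pT I) = 0)))"

definition slack :: "'a::linordered_idom plp \<Rightarrow> (nat \<Rightarrow> 'a) \<Rightarrow> (nat \<Rightarrow> 'a) \<Rightarrow> 'a \<Rightarrow> nat \<Rightarrow> 'a" where
  "slack I x y h r = dot (pK I) (pB I r) x + pb I r * h - dot (pN I) (pA I r) y"

text \<open>Certificates are homogeneous (\<open>h\<close> is the homogenizing variable), so that they can be scaled to
  integers. In the pessimistic scenario \<open>u\<close> expresses a multiple of the target unit vector by rows
  with positive multiplier \<open>l\<close>.\<close>

definition cert :: "bool \<Rightarrow> 'a::linordered_idom plp \<Rightarrow> (nat \<Rightarrow> 'a) \<Rightarrow> (nat \<Rightarrow> 'a) \<Rightarrow> (nat \<Rightarrow> 'a) \<Rightarrow>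
    (nat \<Rightarrow> 'a) \<Rightarrow> 'a \<Rightarrow> 'a \<Rightarrow> bool" where
  "cert P I x y l u h t \<longleftrightarrow> 0 < h \<and>
     (\<forall>r<pM I. 0 \<le> slack I x y h r \<and> 0 \<le> l r \<and> (l r = 0 \<or> slack I x y h r = 0)) \<and>
     (\<forall>r<pG I. dot (pK I) (pD I r) x \<le> pd I r * h) \<and> y (pT I) = 0 \<and>
     (\<forall>j<pN I. dot (pM I) (\<lambda>r. pA I r j) l + dot (pK I) (pC I j) x + pc I j * h = 0) \<and>
     (P \<longrightarrow> t \<noteq> 0 \<and> (\<forall>j<pN I. dot (pM I) (\<lambda>r. pA I r j) u = (if j = pT I then t else 0)) \<and>
        (\<forall>r<pM I. l r = 0 \<longrightarrow> u r = 0))"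

text \<open>Dividing by \<open>h\<close> dehomogenizes. Up to the factor \<open>1 / h\<close>, the
  cost of a feasible \<open>z\<close> exceeds that of \<open>y'\<close> by the sum of multipliers
  times slacks of \<open>z\<close>. This gives optimality; for another optimal solution it makes
  every row with positive multiplier tight, and as \<open>u\<close> lives on these rows, the target
  coordinate agrees with that of \<open>y'\<close>, which is 0.\<close>

lemma cert_sound_real:
  assumes c: "cert P I x y l u h (t :: real)" and i: "pT I < pN I"
  shows "solvable P I"
proof -
  let ?M = "pM I" and ?N = "pN I" and ?K = "pK I" and ?i = "pT I"
  have h: "0 < h" using c by (simp add: cert_def)
  define x' where "x' = (\<lambda>j. (1 / h) * x j)"
  define y' where "y' = (\<lambda>j. (1 / h) * y j)"
  have dx: "dot n v x' = dot n v x / h" "dot n v y' = dot n v y / h" for n v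
    unfolding x'_def y'_def dot_scale by simp_all
  define s where "s = (\<lambda>z r. dot ?K (pB I r) x' + pb I r - dot ?N (pA I r) z)"
  have s: "s y' r = slack I x y h r / h" for r
    using h by (simp add: s_def slack_def dx field_simps)
  have X: "linX I x'" using c h by (auto simp: cert_def linX_def dx field_simps)
  have F: "lfeas I x' z \<longleftrightarrow> (\<forall>r<?M. 0 \<le> s z r)" for z by (auto simp: lfeas_def s_def)
  have yF: "lfeas I x' y'" using c h by (auto simp: F s cert_def)
  have cost: "lcost I x' j = (- 1 / h) * (\<Sum>r<?M. l r * pA I r j)" if "j < ?N" for j
  proof -
    have "dot ?M (\<lambda>r. pA I r j) l + dot ?K (pC I j) x + pc I j * h = 0" using c that by (simp add: cert_def)
    then have "dot ?K (pC I j) x + pc I j * h = - (\<Sum>r<?M. l r * pA I r j)"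
      by (simp add: dot_def mult.commute)
    then have "(dot ?K (pC I j) x + pc I j * h) / h = - (\<Sum>r<?M. l r * pA I r j) / h" by simp
    then show ?thesis using h by (simp add: lcost_def dx add_divide_distrib)
  qed
  have cz: "dot ?N (lcost I x') z - dot ?N (lcost I x') y' = (1 / h) * (\<Sum>r<?M. l r * s z r)" for z
  proof -
    have "dot ?N (lcost I x') w = (- 1 / h) * (\<Sum>r<?M. l r * dot ?N (pA I r) w)" for w
    proof -
      have "dot ?N (lcost I x') w = dot ?N (\<lambda>j. (- 1 / h) * (\<Sum>r<?M. l r * pA I r j)) w"
        using cost by (intro dot_cong) auto
      then show ?thesis by (simp only: dot_scale dot_sum)
    qed
    then have "dot ?N (lcost I x') z - dot ?N (lcost I x') y' =
        (1 / h) * (\<Sum>r<?M. l r * (dot ?N (pA I r) y' - dot ?N (pA I r) z))"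
      by (simp add: sum_subtractf algebra_simps diff_divide_distrib)
    also have "(\<Sum>r<?M. l r * (dot ?N (pA I r) y' - dot ?N (pA I r) z)) = (\<Sum>r<?M. l r * s z r)"
    proof (rule sum.cong)
      fix r assume "r \<in> {..<?M}"
      then have "l r = 0 \<or> s y' r = 0" using c by (auto simp: cert_def s)
      then have "l r = 0 \<or> dot ?N (pA I r) y' = dot ?K (pB I r) x' + pb I r" by (auto simp: s_def)
      then show "l r * (dot ?N (pA I r) y' - dot ?N (pA I r) z) = l r * s z r"
        by (auto simp: s_def)
    qed simp
    finally show ?thesis .
  qed
  have lnn: "\<forall>r<?M. 0 \<le> l r" using c by (simp add: cert_def)
  have opt: "lopt I x' y'" unfolding lopt_def
  proof (intro conjI allI impI yF)
    fix z assume "lfeas I x' z"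
    then have "0 \<le> (1 / h) * (\<Sum>r<?M. l r * s z r)"
      using h lnn by (intro mult_nonneg_nonneg sum_nonneg) (auto simp: F)
    then show "dot ?N (lcost I x') y' \<le> dot ?N (lcost I x') z" using cz[of z] by simp
  qed
  have y0: "y' ?i = 0" using c by (simp add: cert_def y'_def)
  have "z ?i = 0" if P and z: "lopt I x' z" for z
  proof -
    have zF: "\<forall>r<?M. 0 \<le> s z r" using z by (simp add: lopt_def F)
    have "dot ?N (lcost I x') z \<le> dot ?N (lcost I x') y'" using z yF by (simp add: lopt_def)
    with cz[of z] have "(1 / h) * (\<Sum>r<?M. l r * s z r) \<le> 0" by linarith
    then have "(\<Sum>r<?M. l r * s z r) \<le> 0" using h by (auto simp: divide_le_0_iff)
    moreover have "0 \<le> (\<Sum>r<?M. l r * s z r)" using zF lnn by (intro sum_nonneg) auto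
    ultimately have "(\<Sum>r<?M. l r * s z r) = 0" by simp
    then have 0: "\<forall>r<?M. l r * s z r = 0"
      using zF lnn by (subst (asm) sum_nonneg_eq_0_iff) auto
    have t: "t \<noteq> 0" "\<And>j. j < ?N \<Longrightarrow> (\<Sum>r<?M. u r * pA I r j) = (if j = ?i then t else 0)"
      "\<And>r. r < ?M \<Longrightarrow> l r = 0 \<Longrightarrow> u r = 0"
      using c \<open>P\<close> by (auto simp: cert_def dot_def mult.commute)
    have e: "(\<Sum>r<?M. u r * dot ?N (pA I r) w) = t * w ?i" for w
    proof -
      have "(\<Sum>r<?M. u r * dot ?N (pA I r) w) = dot ?N (\<lambda>j. \<Sum>r<?M. u r * pA I r j) w"
        by (simp only: dot_sum)
      also have "\<dots> = (\<Sum>j<?N. if j = ?i then t * w j else 0)"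
        unfolding dot_def using t(2) by (intro sum.cong) auto
      finally show ?thesis using i by simp
    qed
    have "(\<Sum>r<?M. u r * dot ?N (pA I r) z) = (\<Sum>r<?M. u r * dot ?N (pA I r) y')"
    proof (rule sum.cong)
      fix r assume r: "r \<in> {..<?M}"
      then have "l r = 0 \<or> s y' r = 0" using c by (auto simp: cert_def s)
      moreover have "l r = 0 \<or> s z r = 0" using 0 r by auto
      ultimately have "u r = 0 \<or> dot ?N (pA I r) z = dot ?N (pA I r) y'"
        using t(3) r by (auto simp: s_def)
      then show "u r * dot ?N (pA I r) z = u r * dot ?N (pA I r) y'" by auto
    qed simp
    then show ?thesis using e[of z] e[of y'] t(1) y0 by simp
  qed
  with X opt y0 show ?thesis unfolding solvable_def by blast
qed

text \<open>Duality supplies the multipliers, with \<open>h = t = 1\<close>; in the pessimistic case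
  they come from \<open>dual_solution_strict\<close>, applied to the vanishing of the target
  coordinate on the optimal face.\<close>

lemma cert_complete_real:
  assumes "solvable P I" and i: "pT I < pN I"
  shows "\<exists>x y l u. cert P I x y l u 1 (1 :: real)"
proof -
  obtain x y where xy: "linX I x" "lopt I x y" "y (pT I) = 0"
    "P \<Longrightarrow> \<forall>z. lopt I x z \<longrightarrow> z (pT I) = 0"
    using assms(1) unfolding solvable_def by blast
  let ?\<beta> = "\<lambda>r. dot (pK I) (pB I r) x + pb I r"
  have feas: "\<forall>r<pM I. dot (pN I) (pA I r) y \<le> ?\<beta> r" using xy(2) by (simp add: lopt_def lfeas_def)
  have opt: "dot (pN I) (lcost I x) y \<le> dot (pN I) (lcost I x) z"
    if "\<forall>r<pM I. dot (pN I) (pA I r) z \<le> ?\<beta> r" for z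
    using xy(2) that by (simp add: lopt_def lfeas_def)
  have base: "cert P I x y l u 1 1"
    if l: "\<And>r. r < pM I \<Longrightarrow> 0 \<le> l r" "\<And>r. r < pM I \<Longrightarrow> l r = 0 \<or> dot (pN I) (pA I r) y = ?\<beta> r"
      "\<And>j. j < pN I \<Longrightarrow> (\<Sum>r<pM I. l r * pA I r j) = - lcost I x j"
      and u: "P \<Longrightarrow> \<forall>r<pM I. l r = 0 \<longrightarrow> u r = 0"
      "P \<Longrightarrow> \<forall>j<pN I. (\<Sum>r<pM I. u r * pA I r j) = (if j = pT I then 1 else 0)" for l u
  proof -
    have "dot (pM I) (\<lambda>r. pA I r j) l + dot (pK I) (pC I j) x + pc I j * 1 = 0" if "j < pN I" for j
      using l(3)[OF that] by (simp add: lcost_def dot_def mult.commute)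
    moreover have "l r = 0 \<or> slack I x y 1 r = 0" if "r < pM I" for r
      using l(2)[OF that] by (auto simp: slack_def)
    moreover have "0 \<le> slack I x y 1 r" if "r < pM I" for r
      using feas that by (simp add: slack_def)
    moreover have "dot (pK I) (pD I r) x \<le> pd I r * 1" if "r < pG I" for r
      using xy(1) that by (simp add: linX_def)
    ultimately show ?thesis unfolding cert_def using l(1) u xy(3) by (auto simp: dot_def mult.commute)
  qed
  show ?thesis
  proof (cases P)
    case False
    obtain l where l: "\<And>r. r < pM I \<Longrightarrow> 0 \<le> l r"
      "\<And>r. r < pM I \<Longrightarrow> l r = 0 \<or> dot (pN I) (pA I r) y = ?\<beta> r"
      "\<And>j. j < pN I \<Longrightarrow> (\<Sum>r<pM I. l r * pA I r j) = - lcost I x j"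
      by (rule dual_solution[where \<gamma> = "lcost I x" and a = "pA I" and \<beta> = ?\<beta> and m = "pM I" and n = "pN I" and y = y, OF feas opt]) blast+
    from base[OF l, of "\<lambda>_. 0"] False show ?thesis by blast
  next
    case True
    have zero: "z (pT I) = y (pT I)"
      if "\<forall>r<pM I. dot (pN I) (pA I r) z \<le> ?\<beta> r" "dot (pN I) (lcost I x) z \<le> dot (pN I) (lcost I x) y" for z
    proof -
      have "lopt I x z" unfolding lopt_def lfeas_def
        using that opt by (auto intro: order_trans)
      then show ?thesis using xy(3,4) True by simp
    qed
    obtain l u where l: "\<And>r. r < pM I \<Longrightarrow> 0 \<le> l r"
      "\<And>r. r < pM I \<Longrightarrow> l r = 0 \<or> dot (pN I) (pA I r) y = ?\<beta> r"
      "\<And>j. j < pN I \<Longrightarrow> (\<Sum>r<pM I. l r * pA I r j) = - lcost I x j"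
      "\<And>r. r < pM I \<Longrightarrow> l r = 0 \<Longrightarrow> u r = 0"
      "\<And>j. j < pN I \<Longrightarrow> (\<Sum>r<pM I. u r * pA I r j) = (if j = pT I then 1 else 0)"
      by (rule dual_solution_strict[where i = "pT I" and \<gamma> = "lcost I x" and a = "pA I" and \<beta> = ?\<beta> and m = "pM I" and n = "pN I" and y = y, OF feas _ i]) (erule opt | erule (1) zero | blast)+
    from base[OF l(1-3), of u] l(4,5) show ?thesis by blast
  qed
qed

subsection \<open>Integer certificates\<close>

text \<open>One factor for all data, so that the conditions of a certificate carry over after
  cancelling it. Only coordinates within the dimensions are compared.\<close>

definition scaled :: "int \<Rightarrow> int plp \<Rightarrow> real plp \<Rightarrow> bool" where
  "scaled s E I \<longleftrightarrow> 0 < s \<and> pM E = pM I \<and> pN E = pN I \<and> pK E = pK I \<and> pG E = pG I \<and> pT E = pT I \<and>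
     (\<forall>r<pM I. \<forall>j<pN I. real_of_int (pA E r j) = real_of_int s * pA I r j) \<and>
     (\<forall>r<pM I. \<forall>j<pK I. real_of_int (pB E r j) = real_of_int s * pB I r j) \<and>
     (\<forall>r<pM I. real_of_int (pb E r) = real_of_int s * pb I r) \<and>
     (\<forall>r<pN I. \<forall>j<pK I. real_of_int (pC E r j) = real_of_int s * pC I r j) \<and>
     (\<forall>r<pN I. real_of_int (pc E r) = real_of_int s * pc I r) \<and>
     (\<forall>r<pG I. \<forall>j<pK I. real_of_int (pD E r j) = real_of_int s * pD I r j) \<and>
     (\<forall>r<pG I. real_of_int (pd E r) = real_of_int s * pd I r)"

lemma of_int_dot: "real_of_int (dot n u v) = dot n (\<lambda>j. real_of_int (u j)) (\<lambda>j. real_of_int (v j))"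
  by (simp add: dot_def)

lemma dot_scaled:
  assumes "\<And>j. j < n \<Longrightarrow> real_of_int (u j) = s * v j"
  shows "dot n (\<lambda>j. real_of_int (u j)) w = s * dot n v w"
  unfolding dot_scale(2)[symmetric] using assms by (intro dot_cong) auto

lemma scaled_rows:
  assumes "scaled s E I"
  shows "r < pM I \<Longrightarrow> dot (pN I) (\<lambda>j. real_of_int (pA E r j)) w = real_of_int s * dot (pN I) (pA I r) w"
    "r < pM I \<Longrightarrow> dot (pK I) (\<lambda>j. real_of_int (pB E r j)) w = real_of_int s * dot (pK I) (pB I r) w"
    "j < pN I \<Longrightarrow> dot (pK I) (\<lambda>l. real_of_int (pC E j l)) w = real_of_int s * dot (pK I) (pC I j) w"
    "r < pG I \<Longrightarrow> dot (pK I) (\<lambda>l. real_of_int (pD E r l)) w = real_of_int s * dot (pK I) (pD I r) w"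
    "j < pN I \<Longrightarrow> dot (pM I) (\<lambda>r. real_of_int (pA E r j)) w = real_of_int s * dot (pM I) (\<lambda>r. pA I r j) w"
  using assms unfolding scaled_def by (auto intro!: dot_scaled)

lemma cert_sound:
  assumes s: "scaled s E I" and c: "cert P E x y l u h t" and i: "pT I < pN I"
  shows "solvable P I"
proof -
  let ?r = "\<lambda>f j. real_of_int (f j)" and ?s = "real_of_int s"
  have s0: "0 < ?s" and dims: "pM E = pM I" "pN E = pN I" "pK E = pK I" "pG E = pG I" "pT E = pT I"
    using s by (auto simp: scaled_def)
  note rows = scaled_rows[OF s]
  have sl: "real_of_int (slack E x y h r) = ?s * slack I (?r x) (?r y) (real_of_int h) r" if "r < pM I" for r
    using s that by (simp add: slack_def of_int_dot rows dims algebra_simps scaled_def)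
  \<comment> \<open>The unit vector is not part of the scaled data, so its multiple \<open>t\<close>
    has to be divided by the scale.\<close>
  have "cert P I (?r x) (?r y) (?r l) (?r u) (real_of_int h) (real_of_int t / ?s)"
    unfolding cert_def
  proof (intro conjI allI impI)
    show "0 < real_of_int h" "?r y (pT I) = 0" using c dims by (auto simp: cert_def)
  next
    fix r assume r: "r < pM I"
    then have "0 \<le> slack E x y h r" "0 \<le> l r" "l r = 0 \<or> slack E x y h r = 0"
      using c dims by (auto simp: cert_def)
    then have "0 \<le> ?s * slack I (?r x) (?r y) (real_of_int h) r" "0 \<le> ?r l r"
      "?r l r = 0 \<or> ?s * slack I (?r x) (?r y) (real_of_int h) r = 0"
      unfolding sl[OF r, symmetric] by simp_all
    then show "0 \<le> slack I (?r x) (?r y) (real_of_int h) r" "0 \<le> ?r l r"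
      "?r l r = 0 \<or> slack I (?r x) (?r y) (real_of_int h) r = 0"
      using s0 by (simp_all add: zero_le_mult_iff)
  next
    fix r assume r: "r < pG I"
    then have "dot (pK E) (pD E r) x \<le> pd E r * h" using c dims by (auto simp: cert_def)
    then have "real_of_int (dot (pK E) (pD E r) x) \<le> real_of_int (pd E r * h)" by (simp only: of_int_le_iff)
    then have "?s * dot (pK I) (pD I r) (?r x) \<le> ?s * (pd I r * real_of_int h)"
      using s r by (simp add: of_int_dot rows dims scaled_def)
    then show "dot (pK I) (pD I r) (?r x) \<le> pd I r * real_of_int h" using s0 by simp
  next
    fix j assume j: "j < pN I"
    then have "dot (pM E) (\<lambda>r. pA E r j) l + dot (pK E) (pC E j) x + pc E j * h = 0"
      using c dims by (auto simp: cert_def)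
    then have "real_of_int (dot (pM E) (\<lambda>r. pA E r j) l + dot (pK E) (pC E j) x + pc E j * h) = 0" by simp
    then have "?s * (dot (pM I) (\<lambda>r. pA I r j) (?r l) + dot (pK I) (pC I j) (?r x) + pc I j * real_of_int h) = 0"
      using s j by (simp add: of_int_dot rows dims scaled_def algebra_simps)
    then show "dot (pM I) (\<lambda>r. pA I r j) (?r l) + dot (pK I) (pC I j) (?r x) + pc I j * real_of_int h = 0"
      using s0 by simp
  next
    assume P
    then show "real_of_int t / ?s \<noteq> 0" using c s0 by (auto simp: cert_def)
    fix j assume j: "j < pN I"
    then have "dot (pM E) (\<lambda>r. pA E r j) u = (if j = pT I then t else 0)"
      using c dims \<open>P\<close> by (auto simp: cert_def)
    then have "real_of_int (dot (pM E) (\<lambda>r. pA E r j) u) = (if j = pT I then real_of_int t else 0)" by simp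
    then have "?s * dot (pM I) (\<lambda>r. pA I r j) (?r u) = (if j = pT I then real_of_int t else 0)"
      using s j by (simp add: of_int_dot rows dims)
    then show "dot (pM I) (\<lambda>r. pA I r j) (?r u) = (if j = pT I then real_of_int t / ?s else 0)"
      using s0 by (auto simp: field_simps split: if_splits)
  next
    fix r assume P "r < pM I" "?r l r = 0"
    then show "?r u r = 0" using c dims by (auto simp: cert_def)
  qed
  then show ?thesis using i by (rule cert_sound_real)
qed

text \<open>Coefficients for the unknowns of a certificate, arranged as one vector of length
  \<open>k + n + m + m + 2\<close>: the parameters, the LP variables, the multipliers
  \<open>l\<close> and \<open>u\<close>, and the scalars \<open>h\<close> and
  \<open>t\<close>.\<close>

definition blk :: "nat \<Rightarrow> nat \<Rightarrow> nat \<Rightarrow> (nat \<Rightarrow> 'a) \<Rightarrow> (nat \<Rightarrow> 'a) \<Rightarrow> (nat \<Rightarrow> 'a) \<Rightarrow> (nat \<Rightarrow> 'a) \<Rightarrow> 'a \<Rightarrow> 'a \<Rightarrow> nat \<Rightarrow> 'a" where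
  "blk k n m fx fy fl fu fh ft j =
     (if j < k then fx j else if j < k + n then fy (j - k) else if j < k + n + m then fl (j - (k + n))
      else if j < k + n + m + m then fu (j - (k + n + m)) else if j = k + n + m + m then fh else ft)"

lemma dot_add: "dot (a + b) u v = dot a u v + dot b (\<lambda>j. u (a + j)) (\<lambda>j. v (a + j))"
  by (induction b) (simp_all add: dot_def algebra_simps)

lemma dot_blk:
  "dot (k + n + m + m + 2) (blk k n m fx fy fl fu fh ft) z =
   dot k fx z + dot n fy (\<lambda>j. z (k + j)) + dot m fl (\<lambda>r. z (k + n + r)) + dot m fu (\<lambda>r. z (k + n + m + r))
   + fh * z (k + n + m + m) + ft * z (k + n + m + m + 1)"
proof -
  have "dot k (blk k n m fx fy fl fu fh ft) z = dot k fx z"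
    "dot n (\<lambda>j. blk k n m fx fy fl fu fh ft (k + j)) w = dot n fy w"
    "dot m (\<lambda>j. blk k n m fx fy fl fu fh ft (k + n + j)) w' = dot m fl w'"
    "dot m (\<lambda>j. blk k n m fx fy fl fu fh ft (k + n + m + j)) w' = dot m fu w'" for w w'
    by (auto intro!: dot_cong simp: blk_def)
  moreover have "dot 2 p q = p 0 * q 0 + p 1 * q 1" for p q :: "nat \<Rightarrow> 'a"
    by (simp add: dot_def numeral_2_eq_2)
  ultimately show ?thesis unfolding dot_add by (simp add: blk_def)
qed

lemma of_int_blk:
  "real_of_int (blk k n m fx fy fl fu fh ft j) = blk k n m (\<lambda>j. real_of_int (fx j)) (\<lambda>j. real_of_int (fy j))
     (\<lambda>j. real_of_int (fl j)) (\<lambda>j. real_of_int (fu j)) (real_of_int fh) (real_of_int ft) j"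
  by (simp add: blk_def)

lemma blk_abs_le:
  fixes fx :: "nat \<Rightarrow> int"
  assumes "\<forall>j<k. \<bar>fx j\<bar> \<le> K" "\<forall>j<n. \<bar>fy j\<bar> \<le> K" "\<forall>j<m. \<bar>fl j\<bar> \<le> K" "\<forall>j<m. \<bar>fu j\<bar> \<le> K" "\<bar>fh\<bar> \<le> K" "\<bar>ft\<bar> \<le> K"
  shows "\<bar>blk k n m fx fy fl fu fh ft j\<bar> \<le> K"
  using assms by (auto simp: blk_def)

lemma dot_zero: "dot n (\<lambda>j. 0) v = 0"
  by (simp add: dot_def)

definition unit :: "nat \<Rightarrow> nat \<Rightarrow> int" where
  "unit r j = (if j = r then 1 else 0)"

lemma dot_unit: "r < n \<Longrightarrow> dot n (unit r) v = v r" "r < n \<Longrightarrow> dot n (\<lambda>j. real_of_int (unit r j)) w = w r"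
  by (simp_all add: dot_def unit_def if_distrib[of "\<lambda>x. x * _"] if_distrib[of real_of_int] cong: if_cong)

definition plp_bound :: "int plp \<Rightarrow> int \<Rightarrow> bool" where
  "plp_bound E K \<longleftrightarrow>
     (\<forall>r<pM E. (\<forall>j<pN E. \<bar>pA E r j\<bar> \<le> K) \<and> (\<forall>j<pK E. \<bar>pB E r j\<bar> \<le> K) \<and> \<bar>pb E r\<bar> \<le> K) \<and>
     (\<forall>r<pN E. (\<forall>j<pK E. \<bar>pC E r j\<bar> \<le> K) \<and> \<bar>pc E r\<bar> \<le> K) \<and>
     (\<forall>r<pG E. (\<forall>j<pK E. \<bar>pD E r j\<bar> \<le> K) \<and> \<bar>pd E r\<bar> \<le> K)"

text \<open>\<open>S\<close> is the guessed support of \<open>l\<close>; it makes complementary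
  slackness linear, with slack 0 on \<open>S\<close> and multiplier 0 off \<open>S\<close>.
  Equations are pairs of inequalities. As everything is homogeneous in the unknowns, positivity of
  \<open>h\<close>, of \<open>t\<close> and of \<open>l\<close> on \<open>S\<close> may be demanded
  as \<open>\<ge> 1\<close>.\<close>

definition cert_rows :: "bool \<Rightarrow> int plp \<Rightarrow> (nat \<Rightarrow> bool) \<Rightarrow> ((nat \<Rightarrow> int) \<times> int) list" where
  "cert_rows P E S = (let b = blk (pK E) (pN E) (pM E); e = (\<lambda>_. 0 :: int) in
     map (\<lambda>r. (b (pB E r) (\<lambda>j. - pA E r j) e e (pb E r) 0, 0)) [0..<pM E] @
     map (\<lambda>r. (b (\<lambda>j. - pB E r j) (pA E r) e e (- pb E r) 0, 0)) (filter S [0..<pM E]) @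
     map (\<lambda>r. (b (\<lambda>j. - pD E r j) e e e (pd E r) 0, 0)) [0..<pG E] @
     [(b e (unit (pT E)) e e 0 0, 0), (b e (\<lambda>j. - unit (pT E) j) e e 0 0, 0), (b e e e e 1 0, 1)] @
     map (\<lambda>r. (b e e (unit r) e 0 0, if S r then 1 else 0)) [0..<pM E] @
     map (\<lambda>r. (b e e (\<lambda>j. - unit r j) e 0 0, 0)) (filter (\<lambda>r. \<not> S r) [0..<pM E]) @
     map (\<lambda>j. (b (pC E j) e (\<lambda>r. pA E r j) e (pc E j) 0, 0)) [0..<pN E] @
     map (\<lambda>j. (b (\<lambda>l. - pC E j l) e (\<lambda>r. - pA E r j) e (- pc E j) 0, 0)) [0..<pN E] @
     (if P then (b e e e e 0 1, 1) #
       map (\<lambda>j. (b e e e (\<lambda>r. pA E r j) 0 (if j = pT E then - 1 else 0), 0)) [0..<pN E] @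
       map (\<lambda>j. (b e e e (\<lambda>r. - pA E r j) 0 (if j = pT E then 1 else 0), 0)) [0..<pN E] @
       map (\<lambda>r. (b e e e (unit r) 0 0, 0)) (filter (\<lambda>r. \<not> S r) [0..<pM E]) @
       map (\<lambda>r. (b e e e (\<lambda>j. - unit r j) 0 0, 0)) (filter (\<lambda>r. \<not> S r) [0..<pM E])
      else []))"

lemma length_cert_rows: "length (cert_rows P E S) \<le> 6 * pM E + pG E + 4 * pN E + 4"
proof -
  have "length (filter Q [0..<n]) \<le> n" for Q n using length_filter_le[of Q "[0..<n]"] by simp
  from this[of S "pM E"] this[of "\<lambda>r. \<not> S r" "pM E"] show ?thesis
    by (simp add: cert_rows_def Let_def)
qed

lemma cert_rows_bound:
  assumes "plp_bound E K" "1 \<le> K"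
  shows "\<forall>(a, q)\<in>set (cert_rows P E S). q \<in> {0, 1} \<and> (\<forall>j<N. \<bar>a j\<bar> \<le> K)"
  using assms unfolding cert_rows_def Let_def plp_bound_def
  by (auto intro!: blk_abs_le simp: unit_def split: if_splits)

text \<open>A real certificate supplies the support \<open>S\<close>, and after rescaling it
  satisfies \<open>cert_rows\<close>; \<open>small_solution\<close> then replaces it by a bounded
  integer solution of the same system.\<close>

lemma cert_complete:
  assumes s: "scaled s E I" and sol: "solvable P I" and i: "pT I < pN I" and K: "plp_bound E K" "1 \<le> K"
    and N: "N = pK E + pN E + pM E + pM E + 2" and R: "R = 6 * pM E + pG E + 4 * pN E + 4 + N + 1"
  shows "\<exists>x y l u h t. cert P E x y l u h t \<and> (\<forall>j<pK E. \<bar>x j\<bar> \<le> sol_bound N R K) \<and>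
    (\<forall>j<pN E. \<bar>y j\<bar> \<le> sol_bound N R K) \<and> (\<forall>r<pM E. \<bar>l r\<bar> \<le> sol_bound N R K \<and> \<bar>u r\<bar> \<le> sol_bound N R K) \<and>
    \<bar>h\<bar> \<le> sol_bound N R K \<and> \<bar>t\<bar> \<le> sol_bound N R K"
proof -
  have s0: "0 < s" and dims: "pM E = pM I" "pN E = pN I" "pK E = pK I" "pG E = pG I" "pT E = pT I"
    using s by (auto simp: scaled_def)
  note rows = scaled_rows[OF s]
  obtain x y l u where c: "cert P I x y l u 1 1" using cert_complete_real[OF sol i] by blast
  define S where "S = (\<lambda>r. l r \<noteq> 0)"
  \<comment> \<open>The factor \<open>\<sigma>\<close> lifts all positive multipliers to at least
    1.\<close>
  have "\<exists>\<sigma>\<ge>1. \<forall>r<m. S r \<longrightarrow> 1 \<le> \<sigma> * \<bar>l r\<bar>" for m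
  proof (induction m)
    case (Suc m)
    then obtain \<sigma> where \<sigma>: "\<sigma> \<ge> 1" "\<forall>r<m. S r \<longrightarrow> 1 \<le> \<sigma> * \<bar>l r\<bar>" by blast
    let ?\<sigma> = "max \<sigma> (1 / \<bar>l m\<bar>)"
    have "1 \<le> ?\<sigma> * \<bar>l r\<bar>" if "r < Suc m" "S r" for r
    proof (cases "r = m")
      case True
      then have "1 / \<bar>l m\<bar> * \<bar>l r\<bar> \<le> ?\<sigma> * \<bar>l r\<bar>" by (intro mult_right_mono) auto
      with True that show ?thesis by (simp add: S_def)
    next
      case False
      then have "1 \<le> \<sigma> * \<bar>l r\<bar>" "\<sigma> * \<bar>l r\<bar> \<le> ?\<sigma> * \<bar>l r\<bar>" using \<sigma> that by (auto intro!: mult_right_mono)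
      then show ?thesis by linarith
    qed
    with \<sigma>(1) show ?case by (intro exI[of _ ?\<sigma>]) auto
  qed auto
  then obtain \<sigma> where \<sigma>': "\<sigma> \<ge> 1" "\<forall>r<pM I. S r \<longrightarrow> 1 \<le> \<sigma> * \<bar>l r\<bar>" by blast
  moreover have "\<bar>l r\<bar> = l r" if "r < pM I" for r using c that by (simp add: cert_def)
  ultimately have \<sigma>: "\<sigma> \<ge> 1" "\<forall>r<pM I. S r \<longrightarrow> 1 \<le> \<sigma> * l r" by auto
  let ?S = "real_of_int s"
  \<comment> \<open>The unknowns \<open>x\<close>, \<open>y\<close>, \<open>l\<close> and
    \<open>h\<close> share conditions and are scaled together. \<open>u\<close> and \<open>t\<close>
    have conditions of their own; there the matrix \<open>pA E\<close> is \<open>s\<close> times the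
    real one, so the value 1 of \<open>t\<close> becomes \<open>s\<close>.\<close>
  define z0 where "z0 = blk (pK E) (pN E) (pM E) (\<lambda>j. \<sigma> * x j) (\<lambda>j. \<sigma> * y j) (\<lambda>r. \<sigma> * l r) u \<sigma> ?S"
  have z0: "dot (pK I) f z0 = \<sigma> * dot (pK I) f x" "dot (pN I) f (\<lambda>j. z0 (pK I + j)) = \<sigma> * dot (pN I) f y"
    "dot (pM I) f (\<lambda>r. z0 (pK I + pN I + r)) = \<sigma> * dot (pM I) f l"
    "dot (pM I) f (\<lambda>r. z0 (pK I + pN I + pM I + r)) = dot (pM I) f u"
    "z0 (pK I + pN I + pM I + pM I) = \<sigma>" "z0 (pK I + pN I + pM I + pM I + 1) = ?S"
    "r < pN I \<Longrightarrow> z0 (pK I + r) = \<sigma> * y r"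
    "r < pM I \<Longrightarrow> z0 (pK I + pN I + r) = \<sigma> * l r" "r < pM I \<Longrightarrow> z0 (pK I + pN I + pM I + r) = u r" for f r
    unfolding dot_scale(1)[symmetric]
    by (auto intro!: dot_cong simp: z0_def blk_def dims)
  have D: "dot N (\<lambda>j. real_of_int (blk (pK I) (pN I) (pM I) fx fy fl fu fh ft j)) z0 =
      \<sigma> * dot (pK I) (\<lambda>j. real_of_int (fx j)) x + \<sigma> * dot (pN I) (\<lambda>j. real_of_int (fy j)) y
      + \<sigma> * dot (pM I) (\<lambda>j. real_of_int (fl j)) l + dot (pM I) (\<lambda>j. real_of_int (fu j)) u
      + real_of_int fh * \<sigma> + real_of_int ft * ?S" for fx fy fl fu fh ft
    unfolding of_int_blk N dims dot_blk z0 by simp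
  have cI: "\<And>r. r < pM I \<Longrightarrow> 0 \<le> slack I x y 1 r" "\<And>r. r < pM I \<Longrightarrow> 0 \<le> l r"
    "\<And>r. r < pM I \<Longrightarrow> S r \<Longrightarrow> slack I x y 1 r = 0" "\<And>r. r < pG I \<Longrightarrow> dot (pK I) (pD I r) x \<le> pd I r"
    "y (pT I) = 0" "\<And>j. j < pN I \<Longrightarrow> dot (pM I) (\<lambda>r. pA I r j) l + dot (pK I) (pC I j) x + pc I j = 0"
    "\<And>j. P \<Longrightarrow> j < pN I \<Longrightarrow> dot (pM I) (\<lambda>r. pA I r j) u = (if j = pT I then 1 else 0)"
    "\<And>r. P \<Longrightarrow> r < pM I \<Longrightarrow> \<not> S r \<Longrightarrow> u r = 0"
    using c by (auto simp: cert_def S_def)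
  have coeff: "\<And>r. r < pM I \<Longrightarrow> real_of_int (pb E r) = ?S * pb I r" "\<And>r. r < pN I \<Longrightarrow> real_of_int (pc E r) = ?S * pc I r"
    "\<And>r. r < pG I \<Longrightarrow> real_of_int (pd E r) = ?S * pd I r"
    using s by (auto simp: scaled_def)
  have du: "\<sigma> * (?S * dot (pK I) (pC I j) x) + \<sigma> * (?S * dot (pM I) (\<lambda>r. pA I r j) l) + ?S * pc I j * \<sigma> = 0"
    if "j < pN I" for j
  proof -
    have "\<sigma> * ?S * (dot (pM I) (\<lambda>r. pA I r j) l + dot (pK I) (pC I j) x + pc I j) = 0" using cI(6)[OF that] by simp
    then show ?thesis by (simp add: algebra_simps)
  qed
  have "\<forall>(a, q)\<in>set (cert_rows P E S). real_of_int q \<le> dot N (\<lambda>j. real_of_int (a j)) z0"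
  proof -
    note simps = D rows dims dot_zero dot_minus coeff dot_unit of_int_minus of_int_0 of_int_1
      mult_zero_left mult_zero_right add_0_left add_0_right
    have 1: "0 \<le> dot N (\<lambda>j. real_of_int (blk (pK E) (pN E) (pM E) (pB E r) (\<lambda>j. - pA E r j) (\<lambda>_. 0) (\<lambda>_. 0) (pb E r) 0 j)) z0"
      if "r < pM I" for r
    proof -
      have "0 \<le> \<sigma> * ?S * slack I x y 1 r" using cI(1)[OF that] s0 \<sigma>(1) by simp
      then show ?thesis using that by (simp add: simps slack_def algebra_simps)
    qed
    have 2: "0 \<le> dot N (\<lambda>j. real_of_int (blk (pK E) (pN E) (pM E) (\<lambda>j. - pB E r j) (pA E r) (\<lambda>_. 0) (\<lambda>_. 0) (- pb E r) 0 j)) z0"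
      if "r < pM I" "S r" for r
    proof -
      have "\<sigma> * ?S * slack I x y 1 r = 0" using cI(3)[OF that] by simp
      then show ?thesis using that unfolding slack_def by (simp add: simps algebra_simps)
    qed
    have 3: "0 \<le> dot N (\<lambda>j. real_of_int (blk (pK E) (pN E) (pM E) (\<lambda>j. - pD E r j) (\<lambda>_. 0) (\<lambda>_. 0) (\<lambda>_. 0) (pd E r) 0 j)) z0"
      if "r < pG I" for r
    proof -
      have "0 \<le> \<sigma> * ?S * (pd I r - dot (pK I) (pD I r) x)" using cI(4)[OF that] s0 \<sigma>(1) by simp
      then show ?thesis using that by (simp add: simps algebra_simps)
    qed
    have 4: "0 \<le> dot N (\<lambda>j'. real_of_int (blk (pK E) (pN E) (pM E) (pC E j) (\<lambda>_. 0) (\<lambda>r. pA E r j) (\<lambda>_. 0) (pc E j) 0 j')) z0"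
      if "j < pN I" for j
      using that du[OF that] by (simp add: simps algebra_simps)
    have 5: "0 \<le> dot N (\<lambda>j'. real_of_int (blk (pK E) (pN E) (pM E) (\<lambda>l. - pC E j l) (\<lambda>_. 0) (\<lambda>r. - pA E r j) (\<lambda>_. 0) (- pc E j) 0 j')) z0"
      if "j < pN I" for j
      using that du[OF that] by (simp add: simps algebra_simps)
    have 6: "0 \<le> dot N (\<lambda>j'. real_of_int (blk (pK E) (pN E) (pM E) (\<lambda>_. 0) (unit (pT E)) (\<lambda>_. 0) (\<lambda>_. 0) 0 0 j')) z0"
      using i cI(5) by (simp add: simps)
    have 7: "0 \<le> dot N (\<lambda>j'. real_of_int (blk (pK E) (pN E) (pM E) (\<lambda>_. 0) (\<lambda>j. - unit (pT E) j) (\<lambda>_. 0) (\<lambda>_. 0) 0 0 j')) z0"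
      using i cI(5) by (simp add: simps)
    have 8: "1 \<le> dot N (\<lambda>j'. real_of_int (blk (pK E) (pN E) (pM E) (\<lambda>_. 0) (\<lambda>_. 0) (\<lambda>_. 0) (\<lambda>_. 0) 1 0 j')) z0"
      using \<sigma>(1) by (simp add: simps)
    have 9: "real_of_int (if S r then 1 else 0) \<le> dot N (\<lambda>j'. real_of_int (blk (pK E) (pN E) (pM E) (\<lambda>_. 0) (\<lambda>_. 0) (unit r) (\<lambda>_. 0) 0 0 j')) z0"
      if "r < pM I" for r
      using that \<sigma> cI(2)[OF that] by (simp add: simps)
    have 10: "0 \<le> dot N (\<lambda>j'. real_of_int (blk (pK E) (pN E) (pM E) (\<lambda>_. 0) (\<lambda>_. 0) (\<lambda>j. - unit r j) (\<lambda>_. 0) 0 0 j')) z0"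
      if "r < pM I" "\<not> S r" for r
      using that by (simp add: simps S_def)
    have 11: "1 \<le> dot N (\<lambda>j'. real_of_int (blk (pK E) (pN E) (pM E) (\<lambda>_. 0) (\<lambda>_. 0) (\<lambda>_. 0) (\<lambda>_. 0) 0 1 j')) z0"
      if "P"
      using s0 by (simp add: simps)
    have 12: "0 \<le> dot N (\<lambda>j'. real_of_int (blk (pK E) (pN E) (pM E) (\<lambda>_. 0) (\<lambda>_. 0) (\<lambda>_. 0) (\<lambda>r. pA E r j) 0 (if j = pT E then - 1 else 0) j')) z0"
      if "P" "j < pN I" for j
      using that cI(7)[OF that] by (simp add: simps)
    have 13: "0 \<le> dot N (\<lambda>j'. real_of_int (blk (pK E) (pN E) (pM E) (\<lambda>_. 0) (\<lambda>_. 0) (\<lambda>_. 0) (\<lambda>r. - pA E r j) 0 (if j = pT E then 1 else 0) j')) z0"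
      if "P" "j < pN I" for j
      using that cI(7)[OF that] by (simp add: simps)
    have 14: "0 \<le> dot N (\<lambda>j'. real_of_int (blk (pK E) (pN E) (pM E) (\<lambda>_. 0) (\<lambda>_. 0) (\<lambda>_. 0) (unit r) 0 0 j')) z0"
      if "P" "r < pM I" "\<not> S r" for r
      using that cI(8)[OF that] by (simp add: simps)
    have 15: "0 \<le> dot N (\<lambda>j'. real_of_int (blk (pK E) (pN E) (pM E) (\<lambda>_. 0) (\<lambda>_. 0) (\<lambda>_. 0) (\<lambda>j. - unit r j) 0 0 j')) z0"
      if "P" "r < pM I" "\<not> S r" for r
      using that cI(8)[OF that] by (simp add: simps)
    show ?thesis using 1 2 3 4 5 6 7 8 9 10 11 12 13 14 15 dims
      by (auto simp: cert_rows_def Let_def)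
  qed
  from small_solution[OF this cert_rows_bound[OF K]] K(2)
  obtain z where z: "\<forall>(a, q)\<in>set (cert_rows P E S). q \<le> dot N a z"
    "\<forall>j<N. \<bar>z j\<bar> \<le> sol_bound N (length (cert_rows P E S) + N + 1) K" by blast
  have bound: "\<bar>z j\<bar> \<le> sol_bound N R K" if "j < N" for j
  proof -
    have "length (cert_rows P E S) + N + 1 \<le> R" using length_cert_rows[of P E S] R by simp
    then have "sol_bound N (length (cert_rows P E S) + N + 1) K \<le> sol_bound N R K"
      using K(2) unfolding sol_bound_def
      by (intro mult_mono mult_left_mono power_mono mult_right_mono) auto
    with z(2) that show ?thesis by (meson order_trans)
  qed
  let ?x = "z" and ?y = "\<lambda>j. z (pK E + j)" and ?l = "\<lambda>r. z (pK E + pN E + r)"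
    and ?u = "\<lambda>r. z (pK E + pN E + pM E + r)"
  let ?h = "z (pK E + pN E + pM E + pM E)" and ?t = "z (pK E + pN E + pM E + pM E + 1)"
  note D' = dot_blk[of "pK E" "pN E" "pM E" _ _ _ _ _ _ z, folded N]
  have iE: "pT E < pN E" using i dims by simp
  note zz = z(1)[unfolded cert_rows_def Let_def]
  have sl1: "0 \<le> slack E ?x ?y ?h r" if "r < pM E" for r
  proof -
    have "0 \<le> dot N (blk (pK E) (pN E) (pM E) (pB E r) (\<lambda>j. - pA E r j) (\<lambda>_. 0) (\<lambda>_. 0) (pb E r) 0) z"
      using zz that by auto
    then show ?thesis by (simp add: D' dot_zero dot_minus slack_def)
  qed
  have sl2: "slack E ?x ?y ?h r = 0" if "r < pM E" "S r" for r
  proof -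
    have "0 \<le> dot N (blk (pK E) (pN E) (pM E) (\<lambda>j. - pB E r j) (pA E r) (\<lambda>_. 0) (\<lambda>_. 0) (- pb E r) 0) z"
      using zz that by auto
    with sl1[OF that(1)] show ?thesis by (simp add: D' dot_zero dot_minus slack_def)
  qed
  have DX: "dot (pK E) (pD E r) ?x \<le> pd E r * ?h" if "r < pG E" for r
  proof -
    have "0 \<le> dot N (blk (pK E) (pN E) (pM E) (\<lambda>j. - pD E r j) (\<lambda>_. 0) (\<lambda>_. 0) (\<lambda>_. 0) (pd E r) 0) z"
      using zz that by auto
    then show ?thesis by (simp add: D' dot_zero dot_minus)
  qed
  have y0: "?y (pT E) = 0"
  proof -
    have "0 \<le> dot N (blk (pK E) (pN E) (pM E) (\<lambda>_. 0) (unit (pT E)) (\<lambda>_. 0) (\<lambda>_. 0) 0 0) z"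
      "0 \<le> dot N (blk (pK E) (pN E) (pM E) (\<lambda>_. 0) (\<lambda>j. - unit (pT E) j) (\<lambda>_. 0) (\<lambda>_. 0) 0 0) z"
      using zz by auto
    then show ?thesis by (simp add: D' dot_zero dot_minus dot_unit iE)
  qed
  have h0: "0 < ?h"
  proof -
    have "1 \<le> dot N (blk (pK E) (pN E) (pM E) (\<lambda>_. 0) (\<lambda>_. 0) (\<lambda>_. 0) (\<lambda>_. 0) 1 0) z" using zz by auto
    then show ?thesis by (simp add: D' dot_zero)
  qed
  have l1: "(if S r then 1 else 0) \<le> ?l r" if "r < pM E" for r
  proof -
    have "set (map (\<lambda>r. (blk (pK E) (pN E) (pM E) (\<lambda>_. 0) (\<lambda>_. 0) (unit r) (\<lambda>_. 0) 0 0, if S r then 1 else 0)) [0..<pM E])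
        \<subseteq> set (cert_rows P E S)"
      unfolding cert_rows_def Let_def set_append by blast
    with z(1) have "\<forall>(a, q)\<in>set (map (\<lambda>r. (blk (pK E) (pN E) (pM E) (\<lambda>_. 0) (\<lambda>_. 0) (unit r) (\<lambda>_. 0) 0 0, if S r then 1 else 0)) [0..<pM E]).
        q \<le> dot N a z" by blast
    then have "(if S r then 1 else 0) \<le> dot N (blk (pK E) (pN E) (pM E) (\<lambda>_. 0) (\<lambda>_. 0) (unit r) (\<lambda>_. 0) 0 0) z"
      using that by simp
    then show ?thesis using that by (simp add: D' dot_zero dot_unit)
  qed
  have l2: "?l r = 0" if "r < pM E" "\<not> S r" for r
  proof -
    have "0 \<le> dot N (blk (pK E) (pN E) (pM E) (\<lambda>_. 0) (\<lambda>_. 0) (\<lambda>j. - unit r j) (\<lambda>_. 0) 0 0) z"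
      using zz that by auto
    then show ?thesis using that l1[OF that(1)] by (simp add: D' dot_zero dot_minus dot_unit)
  qed
  have dual: "dot (pM E) (\<lambda>r. pA E r j) ?l + dot (pK E) (pC E j) ?x + pc E j * ?h = 0" if "j < pN E" for j
  proof -
    have "0 \<le> dot N (blk (pK E) (pN E) (pM E) (pC E j) (\<lambda>_. 0) (\<lambda>r. pA E r j) (\<lambda>_. 0) (pc E j) 0) z"
      "0 \<le> dot N (blk (pK E) (pN E) (pM E) (\<lambda>l. - pC E j l) (\<lambda>_. 0) (\<lambda>r. - pA E r j) (\<lambda>_. 0) (- pc E j) 0) z"
      using zz that by auto
    then show ?thesis by (simp add: D' dot_zero dot_minus)
  qed
  have pess: "?t \<noteq> 0 \<and> (\<forall>j<pN E. dot (pM E) (\<lambda>r. pA E r j) ?u = (if j = pT E then ?t else 0)) \<and>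
      (\<forall>r<pM E. ?l r = 0 \<longrightarrow> ?u r = 0)" if P
  proof (intro conjI allI impI)
    have "1 \<le> dot N (blk (pK E) (pN E) (pM E) (\<lambda>_. 0) (\<lambda>_. 0) (\<lambda>_. 0) (\<lambda>_. 0) 0 1) z"
      using zz that by auto
    then show "?t \<noteq> 0" by (simp add: D' dot_zero)
  next
    fix j assume j: "j < pN E"
    let ?L1 = "map (\<lambda>j. (blk (pK E) (pN E) (pM E) (\<lambda>_. 0) (\<lambda>_. 0) (\<lambda>_. 0) (\<lambda>r. pA E r j) 0 (if j = pT E then - 1 else 0), 0)) [0..<pN E]"
    let ?L2 = "map (\<lambda>j. (blk (pK E) (pN E) (pM E) (\<lambda>_. 0) (\<lambda>_. 0) (\<lambda>_. 0) (\<lambda>r. - pA E r j) 0 (if j = pT E then 1 else 0), 0)) [0..<pN E]"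
    have "set ?L1 \<subseteq> set (cert_rows P E S)" "set ?L2 \<subseteq> set (cert_rows P E S)"
      unfolding cert_rows_def Let_def set_append if_P[OF that] list.set(2) by blast+
    with z(1) have "\<forall>(a, q)\<in>set ?L1. q \<le> dot N a z" "\<forall>(a, q)\<in>set ?L2. q \<le> dot N a z" by blast+
    then have "0 \<le> dot N (blk (pK E) (pN E) (pM E) (\<lambda>_. 0) (\<lambda>_. 0) (\<lambda>_. 0) (\<lambda>r. pA E r j) 0 (if j = pT E then - 1 else 0)) z"
      "0 \<le> dot N (blk (pK E) (pN E) (pM E) (\<lambda>_. 0) (\<lambda>_. 0) (\<lambda>_. 0) (\<lambda>r. - pA E r j) 0 (if j = pT E then 1 else 0)) z"
      using j by simp_all
    then show "dot (pM E) (\<lambda>r. pA E r j) ?u = (if j = pT E then ?t else 0)"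
      by (auto simp add: D' dot_zero dot_minus split: if_splits)
  next
    fix r assume r: "r < pM E" "?l r = 0"
    have nS: "\<not> S r" using l1[OF r(1)] r(2) by (auto split: if_splits)
    have "0 \<le> dot N (blk (pK E) (pN E) (pM E) (\<lambda>_. 0) (\<lambda>_. 0) (\<lambda>_. 0) (unit r) 0 0) z"
      "0 \<le> dot N (blk (pK E) (pN E) (pM E) (\<lambda>_. 0) (\<lambda>_. 0) (\<lambda>_. 0) (\<lambda>j. - unit r j) 0 0) z"
      using zz that r(1) nS by auto
    then show "?u r = 0" using r by (simp add: D' dot_zero dot_minus dot_unit)
  qed
  have "cert P E ?x ?y ?l ?u ?h ?t" unfolding cert_def
  proof (intro conjI allI impI)
    fix r assume r: "r < pM E"
    show "0 \<le> ?l r" using l1[OF r] by (auto split: if_splits)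
    show "?l r = 0 \<or> slack E ?x ?y ?h r = 0" using l2[OF r] sl2[OF r] by blast
  qed (use h0 sl1 DX y0 dual pess in auto)
  then show ?thesis using bound by (intro exI conjI) (auto simp: N)
qed

section \<open>Membership in NP\<close>

subsection \<open>Decoding certificates\<close>

text \<open>A certificate is a string over six symbols of three bits: the two bits and one terminator for
  each of the four levels of lists.\<close>

definition symb :: "nat \<Rightarrow> bool list" where
  "symb n = [4 \<le> n, odd (n div 2), odd n]"

lemma val_symb: "n < 8 \<Longrightarrow> val (rev (symb n)) = n"
proof -
  assume "n < 8"
  then have "n = 0 \<or> n = 1 \<or> n = 2 \<or> n = 3 \<or> n = 4 \<or> n = 5 \<or> n = 6 \<or> n = 7" by linarith
  then show ?thesis by (elim disjE) (simp_all add: symb_def)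
qed

lemma symb_inj: "m < 8 \<Longrightarrow> n < 8 \<Longrightarrow> symb m = symb n \<longleftrightarrow> m = n"
  using val_symb by metis

definition chunks :: "bool list \<Rightarrow> bool list list" where
  "chunks u = rev (snd (foldl (\<lambda>st b. if length (fst st) = 2 then ([], (fst st @ [b]) # snd st)
     else (fst st @ [b], snd st)) ([], []) u))"

lemma chunks_concat: "\<forall>w\<in>set ws. length w = 3 \<Longrightarrow> chunks (concat ws) = ws"
proof -
  let ?s = "\<lambda>st b. if length (fst st) = 2 then ([], (fst st @ [b]) # snd st) else (fst st @ [b], snd st)"
  have "foldl ?s ([], acc) (concat ws) = ([], rev ws @ acc)" if "\<forall>w\<in>set ws. length w = 3"
    for ws acc :: "bool list list"
    using that
  proof (induction ws arbitrary: acc)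
    case (Cons w ws)
    then obtain a b c where "w = [a, b, c]"
      by (auto simp: numeral_eq_Suc length_Suc_conv)
    with Cons show ?case by simp
  qed simp
  then show "\<forall>w\<in>set ws. length w = 3 \<Longrightarrow> chunks (concat ws) = ws"
    by (simp add: chunks_def)
qed

definition split_at :: "'a \<Rightarrow> 'a list \<Rightarrow> 'a list list" where
  "split_at s u = rev (snd (foldl (\<lambda>st b. if b = s then ([], rev (fst st) # snd st)
     else (b # fst st, snd st)) ([], []) u))"

text \<open>The symbol terminates each element instead of separating neighbours, so the empty list
  and the list of one empty element differ.\<close>

definition join_with :: "'a \<Rightarrow> 'a list list \<Rightarrow> 'a list" where
  "join_with s ws = concat (map (\<lambda>w. w @ [s]) ws)"

lemma split_at_join: "\<forall>w\<in>set ws. s \<notin> set w \<Longrightarrow> split_at s (join_with s ws) = ws"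
proof -
  let ?f = "\<lambda>st b. if b = s then ([], rev (fst st) # snd st) else (b # fst st, snd st)"
  have 1: "foldl ?f (c, acc) (w @ [s]) = ([], (rev c @ w) # acc)" if "s \<notin> set w" for c acc w
    using that by (induction w arbitrary: c) auto
  have "foldl ?f ([], acc) (join_with s ws) = ([], rev ws @ acc)" if "\<forall>w\<in>set ws. s \<notin> set w" for ws acc
    using that
  proof (induction ws arbitrary: acc)
    case (Cons w ws)
    have "foldl ?f ([], acc) (join_with s (w # ws)) = foldl ?f (foldl ?f ([], acc) (w @ [s])) (join_with s ws)"
      by (simp add: join_with_def)
    with Cons 1[of w "[]" acc] show ?case by (simp del: foldl_append)
  qed (simp add: join_with_def)
  then show "\<forall>w\<in>set ws. s \<notin> set w \<Longrightarrow> split_at s (join_with s ws) = ws"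
    by (simp add: split_at_def)
qed

lemma set_join_with: "set (join_with s ws) \<subseteq> insert s (\<Union>(set ` set ws))"
  by (auto simp: join_with_def)

lemma length_join_with: "\<forall>w\<in>set ws. length w \<le> b \<Longrightarrow> length ws \<le> r \<Longrightarrow> length (join_with s ws) \<le> r * (b + 1)"
proof -
  assume a: "\<forall>w\<in>set ws. length w \<le> b" "length ws \<le> r"
  have "length (join_with s ws) \<le> length ws * (b + 1)"
    using a(1) by (induction ws) (auto simp: join_with_def)
  also have "\<dots> \<le> r * (b + 1)" using a(2) by (rule mult_le_mono1)
  finally show ?thesis .
qed

definition dec_int :: "bool list list \<Rightarrow> int" where
  "dec_int w = (if nthd (symb 0) w 0 = symb 1 then - int (val (map (\<lambda>s. s = symb 1) (tl w)))
     else int (val (map (\<lambda>s. s = symb 1) (tl w))))"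

definition code_int :: "int \<Rightarrow> bool list list" where
  "code_int z = symb (if z < 0 then 1 else 0) # map (\<lambda>b. symb (if b then 1 else 0)) (mag z)"

lemma dec_int_code: "dec_int (code_int z) = z"
proof -
  have "map (\<lambda>b. symb (if b then 1 else 0) = symb 1) (mag z) = mag z"
    by (rule map_idI) (auto simp: symb_inj)
  then show ?thesis
    by (simp add: dec_int_def code_int_def nthd_def symb_inj comp_def)
qed

type_synonym cdata = "int list list list list"

text \<open>Every string is decoded to some data; whether this is a valid certificate is left to the
  checks in \<open>verify\<close>.\<close>

definition decode :: "bool list \<Rightarrow> cdata" where
  "decode u = map (\<lambda>m. map (\<lambda>r. map (\<lambda>e. map (\<lambda>z. dec_int z) (split_at (symb 2) e))
     (split_at (symb 3) r)) (split_at (symb 4) m)) (split_at (symb 5) (chunks u))"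

definition encode :: "cdata \<Rightarrow> bool list" where
  "encode W = concat (join_with (symb 5) (map (\<lambda>m. join_with (symb 4) (map (\<lambda>r. join_with (symb 3)
     (map (\<lambda>e. join_with (symb 2) (map code_int e)) r)) m)) W))"

lemma decode_encode: "decode (encode W) = W"
proof -
  let ?e = "\<lambda>e. join_with (symb 2) (map code_int e)"
  let ?r = "\<lambda>r. join_with (symb 3) (map ?e r)"
  let ?m = "\<lambda>m. join_with (symb 4) (map ?r m)"
  have z: "set (code_int z) \<subseteq> {symb 0, symb 1}" for z by (auto simp: code_int_def)
  have e: "set (?e e) \<subseteq> {symb 0, symb 1, symb 2}" for e
    using set_join_with[of "symb 2" "map code_int e"] z by fastforce
  have r: "set (?r r) \<subseteq> {symb 0, symb 1, symb 2, symb 3}" for r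
    using set_join_with[of "symb 3" "map ?e r"] e by fastforce
  have m: "set (?m m) \<subseteq> {symb 0, symb 1, symb 2, symb 3, symb 4}" for m
    using set_join_with[of "symb 4" "map ?r m"] r by fastforce
  have W: "set (join_with (symb 5) (map ?m W)) \<subseteq> {symb 0, symb 1, symb 2, symb 3, symb 4, symb 5}"
    using set_join_with[of "symb 5" "map ?m W"] m by fastforce
  have "chunks (encode W) = join_with (symb 5) (map ?m W)" unfolding encode_def
    by (rule chunks_concat) (use W in \<open>auto simp: symb_def\<close>)
  moreover have "split_at (symb 5) (join_with (symb 5) (map ?m W)) = map ?m W"
    by (rule split_at_join) (use m in \<open>fastforce simp: symb_inj\<close>)
  moreover have "split_at (symb 4) (?m m) = map ?r m" for m
    by (rule split_at_join) (use r in \<open>fastforce simp: symb_inj\<close>)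
  moreover have "split_at (symb 3) (?r r) = map ?e r" for r
    by (rule split_at_join) (use e in \<open>fastforce simp: symb_inj\<close>)
  moreover have "split_at (symb 2) (?e e) = map code_int e" for e
    by (rule split_at_join) (use z in \<open>fastforce simp: symb_inj\<close>)
  ultimately show ?thesis by (simp add: decode_def comp_def dec_int_code)
qed

lemma length_encode:
  assumes "length W \<le> 8" "\<forall>m\<in>set W. length m \<le> R \<and> (\<forall>r\<in>set m. length r \<le> R \<and>
    (\<forall>e\<in>set r. length e \<le> R \<and> (\<forall>z\<in>set e. \<bar>z\<bar> < 2 ^ B)))"
  shows "length (encode W) \<le> 3 * (8 * (R * (R * (R * (B + 2) + 1) + 1) + 1))"
proof -
  let ?e = "\<lambda>e. join_with (symb 2) (map code_int e)"
  let ?r = "\<lambda>r. join_with (symb 3) (map ?e r)"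
  let ?m = "\<lambda>m. join_with (symb 4) (map ?r m)"
  have z: "length (code_int z) \<le> B + 1" if "\<bar>z\<bar> < 2 ^ B" for z
  proof -
    have "nat \<bar>z\<bar> < 2 ^ B" using that by (simp add: nat_less_iff)
    from length_binary_le[OF this] show ?thesis by (simp add: code_int_def mag_def)
  qed
  let ?b = "B + 1 + 1"
  have e: "length (?e e) \<le> R * ?b" if "length e \<le> R" "\<forall>z\<in>set e. \<bar>z\<bar> < 2 ^ B" for e
    using that z length_join_with[of "map code_int e" "B + 1" R] by simp
  have r: "length (?r r) \<le> R * (R * ?b + 1)"
    if "length r \<le> R" "\<forall>e\<in>set r. length e \<le> R \<and> (\<forall>z\<in>set e. \<bar>z\<bar> < 2 ^ B)" for r
    using that e by (intro length_join_with) auto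
  have m: "length (?m m) \<le> R * (R * (R * ?b + 1) + 1)"
    if "length m \<le> R \<and> (\<forall>r\<in>set m. length r \<le> R \<and> (\<forall>e\<in>set r. length e \<le> R \<and> (\<forall>z\<in>set e. \<bar>z\<bar> < 2 ^ B)))" for m
    using that r by (intro length_join_with) auto
  have "length (join_with (symb 5) (map ?m W)) \<le> 8 * (R * (R * (R * ?b + 1) + 1) + 1)"
    using assms m by (intro length_join_with) auto
  moreover have "length (concat ws) = 3 * length ws" if "\<forall>w\<in>set ws. length w = 3" for ws :: "bool list list"
    using that by (induction ws) auto
  moreover have "\<forall>w\<in>set (join_with (symb 5) (map ?m W)). length w = 3"
    by (auto simp: join_with_def code_int_def symb_def)
  ultimately show ?thesis by (simp add: encode_def)
qed

lemma ptime_chunks [pt]: "ptime f \<Longrightarrow> ptime (\<lambda>x. chunks (f x))"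
proof -
  let ?s = "\<lambda>st b. if length (fst st) = 2 then ([], (fst st @ [b]) # snd st) else (fst st @ [b], snd st)"
  have "ptime chunks" unfolding chunks_def[abs_def]
  proof (intro ptime_rev ptime_snd, rule ptime_foldl[where b = "[:6:]"])
    show "sz (?s st b) \<le> sz st + poly [:6:] (sz x + sz b)" for x :: "bool list" and st and b :: bool
      using sz_bool[of b] sz_pos[of "fst st"] by (cases st) auto
  qed (intro pt)+
  from ptime_comp[OF this] show "ptime f \<Longrightarrow> ptime (\<lambda>x. chunks (f x))" .
qed

lemma ptime_split_at [pt]:
  assumes "ptime s" "ptime f"
  shows "ptime (\<lambda>x. split_at (s x) (f x))"
proof -
  let ?s = "\<lambda>x st b. if b = s x then ([], rev (fst st) # snd st) else (b # fst st, snd st)"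
  have sz_rev: "sz (rev w) = sz w" for w :: "'b list"
  proof (induction w)
    case (Cons a w)
    then show ?case using sz_pos[of "rev w"] by simp
  qed simp
  show ?thesis unfolding split_at_def
  proof (intro ptime_rev ptime_snd, rule ptime_foldl[where b = "[:3, 1:]"])
    show "ptime (\<lambda>p. ?s (fst p) (fst (snd p)) (snd (snd p)))"
      by (intro pt ptime_comp[OF assms(1)])
    show "sz (?s x st b) \<le> sz st + poly [:3, 1:] (sz x + sz b)" for x st b
      by (cases st) (auto simp: sz_rev)
  qed (intro pt assms)+
qed

lemma ptime_decode [pt]: "ptime f \<Longrightarrow> ptime (\<lambda>x. decode (f x))"
proof -
  assume f: "ptime f"
  have d: "ptime (\<lambda>x. dec_int (g x))" if "ptime g" for g :: "'b::repr \<Rightarrow> bool list list"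
    unfolding dec_int_def by (intro ptime_signed pt that)
  show ?thesis unfolding decode_def by (intro pt f d)
qed

subsection \<open>The verifier\<close>

text \<open>A certificate for an instance consists of the matrices \<open>A, B, b, C, c, D, d\<close> (vectors have one
  row) and a list of vectors. A matrix entry \<open>p / q\<close> is given as \<open>[e, p, q, v, w]\<close> with
  \<open>e = s p / q\<close> for a common scale \<open>s\<close> and \<open>v p + w q = 1\<close>, which certifies that the fraction is
  reduced.\<close>

definition mt :: "cdata \<Rightarrow> nat \<Rightarrow> int list list list" where
  "mt W i = nthd [] W i"

definition rw :: "cdata \<Rightarrow> nat \<Rightarrow> int list list" where
  "rw W i = nthd [] (mt W i) 0"

text \<open>Component 7 has a single row: the vectors \<open>x\<close>, \<open>y\<close>,
  \<open>l\<close>, \<open>u\<close>, then \<open>[s, h, t]\<close>, then a list whose length is the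
  target index.\<close>

definition vc :: "cdata \<Rightarrow> nat \<Rightarrow> int list" where
  "vc W i = nthd [] (rw W 7) i"

definition scl :: "cdata \<Rightarrow> int" where
  "scl W = nthd 0 (vc W 4) 0"

text \<open>\<open>C\<close> is the matrix that surely has a first row, since there is at least one
  variable.\<close>

definition npar :: "cdata \<Rightarrow> nat" where
  "npar W = length (nthd [] (mt W 3) 0)"

definition nvar :: "cdata \<Rightarrow> nat" where
  "nvar W = length (rw W 4)"

definition tgt :: "cdata \<Rightarrow> nat" where
  "tgt W = length (vc W 5)"

definition fld :: "int list \<Rightarrow> nat \<Rightarrow> int" where
  "fld e i = nthd 0 e i"

definition ok_entry :: "int \<Rightarrow> int list \<Rightarrow> bool" where
  "ok_entry s e \<longleftrightarrow> 0 < fld e 2 \<and> fld e 1 * s = fld e 2 * fld e 0 \<and> fld e 3 * fld e 1 + fld e 4 * fld e 2 = 1"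

definition wfW :: "cdata \<Rightarrow> bool" where
  "wfW W \<longleftrightarrow> 0 < scl W \<and> (\<forall>r\<in>set (mt W 0). length r = nvar W) \<and>
     length (mt W 1) = length (mt W 0) \<and> (\<forall>r\<in>set (mt W 1). length r = npar W) \<and>
     length (rw W 2) = length (mt W 0) \<and>
     length (mt W 3) = nvar W \<and> (\<forall>r\<in>set (mt W 3). length r = npar W) \<and>
     (\<forall>r\<in>set (mt W 5). length r = npar W) \<and> length (rw W 6) = length (mt W 5) \<and> tgt W < nvar W \<and>
     (\<forall>r\<in>set (mt W 0 @ mt W 1 @ mt W 3 @ mt W 5 @ [rw W 2, rw W 4, rw W 6]). \<forall>e\<in>set r. ok_entry (scl W) e)"

definition zeroB :: "cdata \<Rightarrow> bool" where
  "zeroB W \<longleftrightarrow> (\<forall>r\<in>set (mt W 1). \<forall>e\<in>set r. fld e 1 = 0)"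

definition enc_entry :: "int list \<Rightarrow> bool list" where
  "enc_entry e = enc_frac (fld e 1) (fld e 2)"

text \<open>It takes the place of a parser: an input is accepted only if it equals the code of the
  instance in the certificate. The reduction writes its output with the same function.\<close>

definition encW :: "cdata \<Rightarrow> bool list" where
  "encW W = (let v = enc_list (\<lambda>e. enc_entry e); m = enc_list (\<lambda>r. enc_list (\<lambda>e. enc_entry e) r) in
     m (mt W 0) @ m (mt W 1) @ v (rw W 2) @ m (mt W 3) @ v (rw W 4) @ m (mt W 5) @ v (rw W 6) @ enc_mag (int (tgt W)))"

definition entry :: "int list list list \<Rightarrow> nat \<Rightarrow> nat \<Rightarrow> int list" where
  "entry m r j = nthd [] (nthd [] m r) j"

definition plpW :: "cdata \<Rightarrow> int plp" where
  "plpW W = \<lparr>pM = length (mt W 0), pN = nvar W, pK = npar W, pG = length (mt W 5),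
     pA = (\<lambda>r j. fld (entry (mt W 0) r j) 0), pB = (\<lambda>r j. fld (entry (mt W 1) r j) 0),
     pb = (\<lambda>r. fld (nthd [] (rw W 2) r) 0), pC = (\<lambda>r j. fld (entry (mt W 3) r j) 0),
     pc = (\<lambda>r. fld (nthd [] (rw W 4) r) 0), pD = (\<lambda>r j. fld (entry (mt W 5) r j) 0),
     pd = (\<lambda>r. fld (nthd [] (rw W 6) r) 0), pT = tgt W\<rparr>"

text \<open>The standard form in natural form: \<open>A y \<le> b\<close>, \<open>- A y \<le> - b\<close>, \<open>- y \<le> 0\<close>.\<close>

definition std :: "'a::comm_ring_1 \<Rightarrow> 'a plp \<Rightarrow> 'a plp" where
  "std s I = \<lparr>pM = pM I + pM I + pN I, pN = pN I, pK = pK I, pG = pG I,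
     pA = (\<lambda>r j. if r < pM I then pA I r j else if r < pM I + pM I then - pA I (r - pM I) j
       else if r - (pM I + pM I) = j then - s else 0),
     pB = (\<lambda>r j. if r < pM I then pB I r j else if r < pM I + pM I then - pB I (r - pM I) j else 0),
     pb = (\<lambda>r. if r < pM I then pb I r else if r < pM I + pM I then - pb I (r - pM I) else 0),
     pC = pC I, pc = pc I, pD = pD I, pd = pd I, pT = pT I\<rparr>"

definition form :: "lp_form \<Rightarrow> 'a::comm_ring_1 \<Rightarrow> 'a plp \<Rightarrow> 'a plp" where
  "form F s I = (if F = Standard then std s I else I)"

definition verify :: "bool \<Rightarrow> bool \<Rightarrow> lp_form \<Rightarrow> bool list \<Rightarrow> cdata \<Rightarrow> bool" where
  "verify fx P F x W \<longleftrightarrow> wfW W \<and> (fx \<longrightarrow> zeroB W) \<and> x = encW W \<and>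
     cert P (form F (scl W) (plpW W)) (fld (vc W 0)) (fld (vc W 1)) (fld (vc W 2)) (fld (vc W 3))
       (fld (vc W 4) 1) (fld (vc W 4) 2)"

lemma ptime_sel [pt]:
  "ptime f \<Longrightarrow> ptime g \<Longrightarrow> ptime (\<lambda>x. mt (f x) (g x))"
  "ptime f \<Longrightarrow> ptime g \<Longrightarrow> ptime (\<lambda>x. rw (f x) (g x))"
  "ptime f \<Longrightarrow> ptime g \<Longrightarrow> ptime (\<lambda>x. vc (f x) (g x))"
  "ptime f \<Longrightarrow> ptime (\<lambda>x. scl (f x))"
  "ptime f \<Longrightarrow> ptime (\<lambda>x. npar (f x))"
  "ptime f \<Longrightarrow> ptime (\<lambda>x. nvar (f x))"
  "ptime f \<Longrightarrow> ptime (\<lambda>x. tgt (f x))"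
  "ptime h \<Longrightarrow> ptime g \<Longrightarrow> ptime (\<lambda>x. fld (h x) (g x))"
  "ptime m \<Longrightarrow> ptime g \<Longrightarrow> ptime k \<Longrightarrow> ptime (\<lambda>x. entry (m x) (g x) (k x))"
  unfolding mt_def rw_def vc_def scl_def npar_def nvar_def tgt_def fld_def entry_def by (intro pt; assumption)+

lemma ptime_All_less [pt]:
  assumes "ptime (\<lambda>p. P (fst p) (snd p))" "ptime n"
  shows "ptime (\<lambda>x. \<forall>r<(n x :: nat). P x r)"
  using ptime_Ball[OF assms(1) ptime_upt0[OF assms(2)]] by (simp add: Ball_def)

lemma ptime_dot [pt]:
  fixes u v :: "'a::repr \<Rightarrow> nat \<Rightarrow> int"
  assumes "ptime (\<lambda>p. u (fst p) (snd p))" "ptime (\<lambda>p. v (fst p) (snd p))" "ptime n"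
  shows "ptime (\<lambda>x. dot (n x) (u x) (v x))"
proof -
  have "ptime (\<lambda>x. sum_list (map (\<lambda>j. u x j * v x j) [0..<n x]))" by (intro pt assms)
  then show ?thesis by (simp add: dot_def interv_sum_list_conv_sum_set_nat lessThan_atLeast0)
qed

lemma ptime_wfW [pt]: "ptime f \<Longrightarrow> ptime (\<lambda>x. wfW (f x))"
proof -
  have "ptime wfW" unfolding wfW_def[abs_def] ok_entry_def by (intro pt)
  from ptime_comp[OF this] show "ptime f \<Longrightarrow> ptime (\<lambda>x. wfW (f x))" .
qed

lemma ptime_zeroB [pt]: "ptime f \<Longrightarrow> ptime (\<lambda>x. zeroB (f x))"
proof -
  have "ptime zeroB" unfolding zeroB_def[abs_def] by (intro pt)
  from ptime_comp[OF this] show "ptime f \<Longrightarrow> ptime (\<lambda>x. zeroB (f x))" .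
qed

lemma ptime_encW [pt]: "ptime f \<Longrightarrow> ptime (\<lambda>x. encW (f x))"
proof -
  have "ptime encW" unfolding encW_def[abs_def] enc_entry_def Let_def by (intro pt)
  from ptime_comp[OF this] show "ptime f \<Longrightarrow> ptime (\<lambda>x. encW (f x))" .
qed

lemma ptime_certW:
  "ptime (\<lambda>W. cert P (form F (scl W) (plpW W)) (fld (vc W 0)) (fld (vc W 1)) (fld (vc W 2)) (fld (vc W 3))
       (fld (vc W 4) 1) (fld (vc W 4) 2))"
  unfolding cert_def slack_def form_def std_def plpW_def
  by (cases F) (simp_all only: lp_form.distinct if_True if_False simp_thms plp.simps, intro pt, intro pt)

lemma ptime_verify: "ptime (\<lambda>p. verify fx P F (fst p) (decode (snd p)))"
  unfolding verify_def by (intro pt ptime_comp[OF ptime_certW])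

subsection \<open>Matrices and coordinate functions\<close>

definition plp0 :: "ilfp \<Rightarrow> real plp" where
  "plp0 I = \<lparr>pM = dim_row (lp_A I), pN = dim_col (lp_A I), pK = dim_col (lp_C I), pG = dim_row (X_D I),
     pA = (\<lambda>r j. real_of_rat (lp_A I $$ (r, j))), pB = (\<lambda>r j. real_of_rat (lp_B I $$ (r, j))),
     pb = (\<lambda>r. real_of_rat (lp_b I $ r)), pC = (\<lambda>r j. real_of_rat (lp_C I $$ (r, j))),
     pc = (\<lambda>r. real_of_rat (lp_c I $ r)), pD = (\<lambda>r j. real_of_rat (X_D I $$ (r, j))),
     pd = (\<lambda>r. real_of_rat (X_d I $ r)), pT = fixed_index I\<rparr>"

lemma all_less_split3:
  "(\<forall>r<m + m + n. P r) \<longleftrightarrow> (\<forall>r<m. P r) \<and> (\<forall>r<m. P (m + r)) \<and> (\<forall>r<n. P (m + m + r))" for n m :: nat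
proof
  assume *: "(\<forall>r<m. P r) \<and> (\<forall>r<m. P (m + r)) \<and> (\<forall>r<n. P (m + m + r))"
  show "\<forall>r<m + m + n. P r"
  proof (intro allI impI)
    fix r assume "r < m + m + n"
    then consider "r < m" | "r - m < m" "r = m + (r - m)" | "r - (m + m) < n" "r = m + m + (r - (m + m))"
      by linarith
    then show "P r" using * by cases metis+
  qed
qed auto

lemma dot_delta:
  fixes s :: "'a::comm_ring_1"
  shows "r < n \<Longrightarrow> dot n (\<lambda>j. if r = j then s else 0) y = s * y r"
  by (simp add: dot_def if_distrib[of "\<lambda>x. x * _"] cong: if_cong)

lemma lfeas_std:
  "lfeas (std 1 I) x y \<longleftrightarrow>
    (\<forall>r<pM I. dot (pN I) (pA I r) y = dot (pK I) (pB I r) x + pb I r) \<and> (\<forall>r<pN I. 0 \<le> y r)"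
proof -
  have A: "pA (std 1 I) r = pA I r" "pB (std 1 I) r = pB I r" "pb (std 1 I) r = pb I r"
    "pA (std 1 I) (pM I + r) = (\<lambda>j. - pA I r j)" "pB (std 1 I) (pM I + r) = (\<lambda>j. - pB I r j)"
    "pb (std 1 I) (pM I + r) = - pb I r" if "r < pM I" for r
    using that by (auto simp: std_def)
  have B: "pA (std 1 I) (pM I + pM I + r) = (\<lambda>j. if r = j then - 1 else 0)"
    "pB (std 1 I) (pM I + pM I + r) = (\<lambda>j. 0)" "pb (std 1 I) (pM I + pM I + r) = 0" for r
    by (auto simp: std_def)
  have D: "pM (std 1 I) = pM I + pM I + pN I" "pN (std 1 I) = pN I" "pK (std 1 I) = pK I"
    by (simp_all add: std_def)
  show ?thesis unfolding lfeas_def D all_less_split3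
    by (auto simp: A B dot_minus dot_delta dot_zero) (smt (verit))
qed

lemma lopt_std_cost: "lcost (std 1 I) x = lcost I x" "pN (std 1 I) = pN I" "linX (std 1 I) x = linX I x"
    "pT (std 1 I) = pT I"
  by (simp_all add: lcost_def linX_def std_def fun_eq_iff)

lemma mult_mat_vec_dot:
  assumes "A \<in> carrier_mat m n" "x \<in> carrier_vec n" "r < m"
  shows "(real_mat A *\<^sub>v x) $ r = dot n (\<lambda>j. real_of_rat (A $$ (r, j))) (\<lambda>j. x $ j)"
  using assms by (simp add: scalar_prod_def dot_def lessThan_atLeast0)

text \<open>Coordinate functions have arbitrary values beyond the dimension, where vectors have
  none; this justifies the passage between \<open>z\<close> and \<open>vec n z\<close>.\<close>

lemma lfeas_cong:
  assumes "\<And>j. j < pN I \<Longrightarrow> y j = z j"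
  shows "lfeas (form F 1 I) x y = lfeas (form F 1 I) x z"
proof -
  have *: "dot (pN I) v y = dot (pN I) v z" for v using assms by (intro dot_cong) auto
  show ?thesis
  proof (cases F)
    case Standard
    then show ?thesis using assms by (simp add: form_def lfeas_std *)
  qed (simp add: form_def lfeas_def *)
qed

context
  fixes I :: ilfp and m n k g :: nat
  assumes dims: "lp_A I \<in> carrier_mat m n" "lp_B I \<in> carrier_mat m k" "lp_b I \<in> carrier_vec m"
    "lp_C I \<in> carrier_mat n k" "lp_c I \<in> carrier_vec n" "X_D I \<in> carrier_mat g k" "X_d I \<in> carrier_vec g"
    "fixed_index I < n"
begin

lemma plp0_dims: "pM (plp0 I) = m" "pN (plp0 I) = n" "pK (plp0 I) = k" "pG (plp0 I) = g" "pT (plp0 I) = fixed_index I"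
  using dims by (auto simp: plp0_def)

lemma lp_feasible_iff:
  assumes x: "x \<in> carrier_vec k" and y: "y \<in> carrier_vec n"
  shows "y \<in> lp_feasible F I x \<longleftrightarrow> lfeas (form F 1 (plp0 I)) (\<lambda>j. x $ j) (\<lambda>j. y $ j)"
proof -
  have A: "(real_mat (lp_A I) *\<^sub>v y) $ r = dot n (pA (plp0 I) r) (\<lambda>j. y $ j)" if "r < m" for r
    using mult_mat_vec_dot[OF dims(1) y that] by (simp add: plp0_def)
  have B: "lp_rhs I x $ r = dot k (pB (plp0 I) r) (\<lambda>j. x $ j) + pb (plp0 I) r" if "r < m" for r
    using mult_mat_vec_dot[OF dims(2) x that] dims that by (simp add: lp_rhs_def plp0_def)
  have d: "dim_vec (real_mat (lp_A I) *\<^sub>v y) = m" "dim_vec (lp_rhs I x) = m" "dim_col (lp_A I) = n"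
    using dims by (auto simp: lp_rhs_def)
  show ?thesis
  proof (cases F)
    case Natural
    then show ?thesis using y A B d
      by (simp add: form_def lfeas_def plp0_dims less_eq_vec_def)
  next
    case Standard
    have "real_mat (lp_A I) *\<^sub>v y = lp_rhs I x \<longleftrightarrow>
        (\<forall>r<m. dot n (pA (plp0 I) r) (\<lambda>j. y $ j) = dot k (pB (plp0 I) r) (\<lambda>j. x $ j) + pb (plp0 I) r)"
      using A B d by (auto simp: vec_eq_iff)
    moreover have "0\<^sub>v n \<le> y \<longleftrightarrow> (\<forall>r<n. 0 \<le> y $ r)" using y by (auto simp: less_eq_vec_def)
    ultimately show ?thesis using Standard y d by (simp add: form_def lfeas_std plp0_dims)
  qed
qed

lemma lp_objective_dot:
  assumes x: "x \<in> carrier_vec k" and y: "y \<in> carrier_vec n"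
  shows "lp_objective I x y = dot n (lcost (plp0 I) (\<lambda>j. x $ j)) (\<lambda>j. y $ j)"
proof -
  have "(real_mat (lp_C I) *\<^sub>v x + real_vec (lp_c I)) $ j = lcost (plp0 I) (\<lambda>j. x $ j) j" if "j < n" for j
    using mult_mat_vec_dot[OF dims(4) x that] dims that by (simp add: lcost_def plp0_dims) (simp add: plp0_def)
  moreover have "lp_objective I x y = (\<Sum>j<n. (real_mat (lp_C I) *\<^sub>v x + real_vec (lp_c I)) $ j * y $ j)"
    using y by (simp add: lp_objective_def scalar_prod_def lessThan_atLeast0)
  ultimately show ?thesis by (simp add: dot_def)
qed

lemma Opt_iff:
  assumes x: "x \<in> carrier_vec k" and y: "y \<in> carrier_vec n"
  shows "y \<in> Opt F I x \<longleftrightarrow> lopt (form F 1 (plp0 I)) (\<lambda>j. x $ j) (\<lambda>j. y $ j)"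
proof -
  let ?J = "form F 1 (plp0 I)" and ?x = "\<lambda>j. x $ j"
  have c: "lcost ?J ?x = lcost (plp0 I) ?x" "pN ?J = n"
    by (simp_all add: form_def lopt_std_cost plp0_dims)
  have sub: "z \<in> carrier_vec n" if "z \<in> lp_feasible F I x" for z
    using that dims by (cases F) auto
  have "(\<forall>z\<in>lp_feasible F I x. lp_objective I x y \<le> lp_objective I x z) \<longleftrightarrow>
      (\<forall>z. lfeas ?J ?x z \<longrightarrow> dot (pN ?J) (lcost ?J ?x) (\<lambda>j. y $ j) \<le> dot (pN ?J) (lcost ?J ?x) z)"
    (is "?L \<longleftrightarrow> ?R")
  proof
    assume L: ?L
    show ?R
    proof (intro allI impI)
      fix z assume z: "lfeas ?J ?x z"
      let ?z = "vec n z"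
      have "lfeas ?J ?x (\<lambda>j. ?z $ j)" using z by (subst lfeas_cong[of _ _ z]) (simp_all add: plp0_dims)
      then have "?z \<in> lp_feasible F I x" using lp_feasible_iff[OF x, of ?z] by simp
      with L have "lp_objective I x y \<le> lp_objective I x ?z" by blast
      moreover have "dot n v (\<lambda>j. ?z $ j) = dot n v z" for v by (intro dot_cong) auto
      ultimately show "dot (pN ?J) (lcost ?J ?x) (\<lambda>j. y $ j) \<le> dot (pN ?J) (lcost ?J ?x) z"
        using lp_objective_dot[OF x y] lp_objective_dot[OF x, of ?z] by (simp add: c)
    qed
  next
    assume R: ?R
    show ?L
    proof
      fix z assume z: "z \<in> lp_feasible F I x"
      then have "lfeas ?J ?x (\<lambda>j. z $ j)" using lp_feasible_iff[OF x sub[OF z]] by simp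
      with R show "lp_objective I x y \<le> lp_objective I x z"
        using lp_objective_dot[OF x y] lp_objective_dot[OF x sub[OF z]] by (simp add: c)
    qed
  qed
  then show ?thesis using lp_feasible_iff[OF x y] by (simp add: Opt_def lopt_def)
qed

lemma lopt_cong:
  assumes "\<And>j. j < n \<Longrightarrow> y j = z j"
  shows "lopt (form F 1 (plp0 I)) x y = lopt (form F 1 (plp0 I)) x z"
proof -
  have "pN (form F 1 (plp0 I)) = n" by (simp add: form_def lopt_std_cost plp0_dims)
  moreover have "dot n v y = dot n v z" for v using assms by (intro dot_cong) auto
  ultimately show ?thesis using lfeas_cong[of "plp0 I" y z F x] assms by (simp add: lopt_def plp0_dims)
qed

lemma lopt_cong_x:
  assumes "\<And>j. j < k \<Longrightarrow> x j = x' j"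
  shows "lopt (form F 1 (plp0 I)) x y = lopt (form F 1 (plp0 I)) x' y"
proof -
  have "pK (form F 1 (plp0 I)) = k" by (simp add: form_def std_def plp0_dims)
  moreover have "dot k v x = dot k v x'" for v using assms by (intro dot_cong) auto
  ultimately show ?thesis by (simp add: lopt_def lfeas_def lcost_def[abs_def])
qed

lemma param_set_iff: "x \<in> carrier_vec k \<Longrightarrow> x \<in> param_set I \<longleftrightarrow> linX (form F 1 (plp0 I)) (\<lambda>j. x $ j)"
proof -
  assume x: "x \<in> carrier_vec k"
  have "(real_mat (X_D I) *\<^sub>v x) $ r = dot k (pD (plp0 I) r) (\<lambda>j. x $ j)" if "r < g" for r
    using mult_mat_vec_dot[OF dims(6) x that] by (simp add: plp0_def)
  moreover have "linX (form F 1 (plp0 I)) z = linX (plp0 I) z" for z by (simp add: form_def lopt_std_cost)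
  moreover have "pd (plp0 I) r = real_of_rat (X_d I $ r)" for r by (simp add: plp0_def)
  ultimately show ?thesis using x dims
    by (auto simp: param_set_def linX_def plp0_dims less_eq_vec_def)
qed

lemma solvable_iff:
  "solvable P (form F 1 (plp0 I)) \<longleftrightarrow>
    (\<exists>x\<in>param_set I. Opt F I x \<inter> target_set I \<noteq> {} \<and> (P \<longrightarrow> Opt F I x \<subseteq> target_set I))"
proof -
  let ?J = "form F 1 (plp0 I)" and ?i = "fixed_index I"
  have i: "pT ?J = ?i" by (simp add: form_def lopt_std_cost plp0_dims)
  have subX: "x \<in> carrier_vec k" if "x \<in> param_set I" for x using that dims by (auto simp: param_set_def)
  have subO: "y \<in> carrier_vec n" if "y \<in> Opt F I x" for x y
    using that dims by (cases F) (auto simp: Opt_def)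
  have T: "y \<in> target_set I \<longleftrightarrow> y $ ?i = 0" if "y \<in> carrier_vec n" for y
    using that dims by (auto simp: target_set_def)
  have nat: "lopt ?J x y \<longleftrightarrow> lopt ?J x (\<lambda>j. vec n y $ j)" "vec n y $ ?i = y ?i" for x y
    using dims(8) by (simp_all add: lopt_cong[of y "\<lambda>j. vec n y $ j"])
  have main: "(\<exists>y. lopt ?J (\<lambda>j. x $ j) y \<and> y ?i = 0) \<and> (P \<longrightarrow> (\<forall>y. lopt ?J (\<lambda>j. x $ j) y \<longrightarrow> y ?i = 0))
      \<longleftrightarrow> Opt F I x \<inter> target_set I \<noteq> {} \<and> (P \<longrightarrow> Opt F I x \<subseteq> target_set I)" (is "?A \<and> ?B \<longleftrightarrow> ?C \<and> ?D")
    if x: "x \<in> carrier_vec k" for x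
  proof -
    have 1: "vec n y \<in> Opt F I x" if "lopt ?J (\<lambda>j. x $ j) y" for y
      using Opt_iff[OF x, of "vec n y" F] nat(1)[of "\<lambda>j. x $ j" y] that by simp
    have "?A \<longleftrightarrow> ?C"
    proof
      assume ?A
      then obtain y where "lopt ?J (\<lambda>j. x $ j) y" "y ?i = 0" by blast
      then have "vec n y \<in> Opt F I x \<inter> target_set I" using 1 T[of "vec n y"] nat(2)[of y] by simp
      then show ?C by blast
    next
      assume ?C
      then obtain y where "y \<in> Opt F I x" "y \<in> target_set I" by blast
      then show ?A using Opt_iff[OF x subO] T[OF subO] by blast
    qed
    moreover have "?B \<longleftrightarrow> ?D"
    proof
      assume ?B
      then show ?D using Opt_iff[OF x subO] T[OF subO] by blast
    next
      assume D: ?D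
      show ?B
      proof (intro impI allI)
        fix y assume P "lopt ?J (\<lambda>j. x $ j) y"
        then have "vec n y \<in> target_set I" using 1 D by blast
        then show "y ?i = 0" using T[of "vec n y"] nat(2)[of y] by simp
      qed
    qed
    ultimately show ?thesis by blast
  qed
  show ?thesis
  proof
    assume "solvable P ?J"
    then obtain x where x: "linX ?J x" "(\<exists>y. lopt ?J x y \<and> y ?i = 0) \<and> (P \<longrightarrow> (\<forall>y. lopt ?J x y \<longrightarrow> y ?i = 0))"
      unfolding solvable_def i by blast
    let ?x = "vec k x"
    have "dot k v x = dot k v (\<lambda>j. ?x $ j)" for v by (intro dot_cong) auto
    moreover have "pK ?J = k" by (simp add: form_def std_def plp0_dims)
    ultimately have "linX ?J (\<lambda>j. ?x $ j)" using x(1) by (simp add: linX_def)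
    then have "?x \<in> param_set I" using param_set_iff[of ?x F] by simp
    moreover have "lopt ?J (\<lambda>j. ?x $ j) y \<longleftrightarrow> lopt ?J x y" for y by (rule lopt_cong_x) simp
    then have "Opt F I ?x \<inter> target_set I \<noteq> {} \<and> (P \<longrightarrow> Opt F I ?x \<subseteq> target_set I)"
      using main[of ?x] x(2) by simp
    ultimately show "\<exists>x\<in>param_set I. Opt F I x \<inter> target_set I \<noteq> {} \<and> (P \<longrightarrow> Opt F I x \<subseteq> target_set I)" by blast
  next
    assume "\<exists>x\<in>param_set I. Opt F I x \<inter> target_set I \<noteq> {} \<and> (P \<longrightarrow> Opt F I x \<subseteq> target_set I)"
    then obtain x where x: "x \<in> param_set I" "Opt F I x \<inter> target_set I \<noteq> {} \<and> (P \<longrightarrow> Opt F I x \<subseteq> target_set I)"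
      by blast
    then show "solvable P ?J"
      unfolding solvable_def i using main[OF subX[OF x(1)]] param_set_iff[OF subX[OF x(1)], of F] by blast
  qed
qed

end

lemma optimistic_iff: "ilfp_instance I \<Longrightarrow> optimistic F I \<longleftrightarrow> solvable False (form F 1 (plp0 I))"
  unfolding ilfp_instance_def optimistic_def by (elim exE conjE, subst solvable_iff) auto

lemma pessimistic_iff: "ilfp_instance I \<Longrightarrow> pessimistic F I \<longleftrightarrow> solvable True (form F 1 (plp0 I))"
  unfolding ilfp_instance_def pessimistic_def by (elim exE conjE, subst solvable_iff) (assumption+, blast)

definition scenario :: "bool \<Rightarrow> lp_form \<Rightarrow> ilfp \<Rightarrow> bool" where
  "scenario P F I \<longleftrightarrow> (if P then pessimistic F I else optimistic F I)"

lemma scenario_iff: "ilfp_instance I \<Longrightarrow> scenario P F I \<longleftrightarrow> solvable P (form F 1 (plp0 I))"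
  by (simp add: scenario_def optimistic_iff pessimistic_iff)

subsection \<open>From certificates to instances\<close>

definition ratof :: "int list \<Rightarrow> rat" where
  "ratof e = Rat.Fract (fld e 1) (fld e 2)"

text \<open>A common divisor of numerator and denominator divides their Bezout combination, which is
  1.\<close>

lemma ok_entry_quotient:
  assumes "ok_entry s e"
  shows "quotient_of (ratof e) = (fld e 1, fld e 2)"
proof -
  have b: "fld e 3 * fld e 1 + fld e 4 * fld e 2 = 1" and q: "0 < fld e 2" using assms by (auto simp: ok_entry_def)
  have "coprime (fld e 1) (fld e 2)"
  proof (rule coprimeI)
    fix d assume "d dvd fld e 1" "d dvd fld e 2"
    then have "d dvd fld e 3 * fld e 1 + fld e 4 * fld e 2" by simp
    with b show "is_unit d" by simp
  qed
  with q show ?thesis by (simp add: ratof_def quotient_of_Fract Rat.normalize_stable)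
qed

lemma enc_entry_ratof: "ok_entry s e \<Longrightarrow> enc_rat (ratof e) = enc_entry e"
  using enc_rat_frac[OF ok_entry_quotient] by (simp add: enc_entry_def)

lemma ok_entry_scaled: "ok_entry s e \<Longrightarrow> real_of_int (fld e 0) = real_of_int s * real_of_rat (ratof e)"
proof -
  assume "ok_entry s e"
  then have q: "0 < fld e 2" and e: "fld e 1 * s = fld e 2 * fld e 0" by (auto simp: ok_entry_def)
  from arg_cong[OF e, of real_of_int] q show ?thesis by (simp add: ratof_def of_rat_rat field_simps)
qed

lemma ok_entry_zero: "ok_entry s e \<Longrightarrow> ratof e = 0 \<longleftrightarrow> fld e 1 = 0"
  using ok_entry_quotient[of s e] by (auto simp: ratof_def Rat.rat_number_collapse)

definition matW :: "nat \<Rightarrow> int list list list \<Rightarrow> rat mat" where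
  "matW n L = mat (length L) n (\<lambda>(i, j). ratof (entry L i j))"

definition vecW :: "int list list \<Rightarrow> rat vec" where
  "vecW l = vec (length l) (\<lambda>i. ratof (nthd [] l i))"

definition instW :: "cdata \<Rightarrow> ilfp" where
  "instW W = \<lparr>lp_A = matW (nvar W) (mt W 0), lp_B = matW (npar W) (mt W 1), lp_b = vecW (rw W 2),
     lp_C = matW (npar W) (mt W 3), lp_c = vecW (rw W 4), X_D = matW (npar W) (mt W 5), X_d = vecW (rw W 6),
     fixed_index = tgt W\<rparr>"

lemma entry_nth: "i < length L \<Longrightarrow> j < length (L ! i) \<Longrightarrow> entry L i j = L ! i ! j"
  by (simp add: entry_def nthd_nth)

lemma enc_list_map: "enc_list f (map g xs) = enc_list (\<lambda>x. f (g x)) xs"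
  by (induction xs) auto

lemma enc_list_cong: "(\<And>x. x \<in> set xs \<Longrightarrow> f x = g x) \<Longrightarrow> enc_list f xs = enc_list g xs"
  by (induction xs) auto

lemma mat_to_list_matW: "\<forall>r\<in>set L. length r = n \<Longrightarrow> mat_to_list (matW n L) = map (map ratof) L"
  by (auto simp: mat_to_list_def matW_def entry_nth intro!: nth_equalityI)

lemma enc_matW:
  assumes "\<forall>r\<in>set L. length r = n" "\<forall>r\<in>set L. \<forall>e\<in>set r. ok_entry s e"
  shows "enc_mat (matW n L) = enc_list (\<lambda>r. enc_list (\<lambda>e. enc_entry e) r) L"
  unfolding enc_mat_def mat_to_list_matW[OF assms(1)] enc_list_map
  using assms(2) by (intro enc_list_cong) (auto simp: enc_entry_ratof[of s])

lemma enc_vecW: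
  assumes "\<forall>e\<in>set l. ok_entry s e"
  shows "enc_vec (vecW l) = enc_list (\<lambda>e. enc_entry e) l"
proof -
  have "list_of_vec (vecW l) = map ratof l"
    by (auto simp: vecW_def nthd_nth intro!: nth_equalityI)
  then show ?thesis unfolding enc_vec_def
    using assms by (simp add: enc_list_map) (intro enc_list_cong, auto simp: enc_entry_ratof[of s])
qed

lemma wfW_dims:
  assumes "wfW W"
  shows "0 < scl W" "length (mt W 1) = length (mt W 0)" "length (rw W 2) = length (mt W 0)"
    "length (mt W 3) = nvar W" "length (rw W 6) = length (mt W 5)" "length (rw W 4) = nvar W" "tgt W < nvar W"
  using assms unfolding wfW_def by (blast, blast, blast, blast, blast, simp only: nvar_def, blast)

lemma wfW_len:
  assumes "wfW W"
  shows "\<forall>r\<in>set (mt W 0). length r = nvar W" "\<forall>r\<in>set (mt W 1). length r = npar W"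
    "\<forall>r\<in>set (mt W 3). length r = npar W" "\<forall>r\<in>set (mt W 5). length r = npar W"
  using assms unfolding wfW_def by blast+

lemma wfW_ok:
  assumes "wfW W"
  shows "i \<in> {0, 1, 3, 5} \<Longrightarrow> \<forall>r\<in>set (mt W i). \<forall>e\<in>set r. ok_entry (scl W) e"
    "i \<in> {2, 4, 6} \<Longrightarrow> \<forall>e\<in>set (rw W i). ok_entry (scl W) e"
proof -
  have *: "\<forall>r\<in>set (mt W 0 @ mt W 1 @ mt W 3 @ mt W 5 @ [rw W 2, rw W 4, rw W 6]). \<forall>e\<in>set r. ok_entry (scl W) e"
    using assms unfolding wfW_def by blast
  show "i \<in> {0, 1, 3, 5} \<Longrightarrow> \<forall>r\<in>set (mt W i). \<forall>e\<in>set r. ok_entry (scl W) e"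
    "i \<in> {2, 4, 6} \<Longrightarrow> \<forall>e\<in>set (rw W i). ok_entry (scl W) e"
    using * by auto
qed

lemma encW_instW:
  assumes "wfW W"
  shows "encW W = enc_ilfp (instW W)"
  unfolding encW_def Let_def enc_ilfp_def instW_def
  using enc_matW[OF wfW_len(1) wfW_ok(1), OF assms assms] enc_matW[OF wfW_len(2) wfW_ok(1), OF assms assms]
    enc_matW[OF wfW_len(3) wfW_ok(1), OF assms assms] enc_matW[OF wfW_len(4) wfW_ok(1), OF assms assms]
    enc_vecW[OF wfW_ok(2), OF assms]
  by (simp add: enc_nat_mag)

lemma instance_instW:
  assumes "wfW W"
  shows "ilfp_instance (instW W)"
  unfolding ilfp_instance_def
  by (intro exI[of _ "length (mt W 0)"] exI[of _ "nvar W"] exI[of _ "npar W"] exI[of _ "length (mt W 5)"])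
    (simp add: instW_def matW_def vecW_def wfW_dims[OF assms] wfW_dims(2)[OF assms, simplified])

lemma scaled_plpW:
  assumes "wfW W"
  shows "scaled (scl W) (plpW W) (plp0 (instW W))"
proof -
  have ok: "ok_entry (scl W) (entry (mt W l) i j)"
    if "l \<in> {0, 1, 3, 5}" "i < length (mt W l)" "j < length (mt W l ! i)" for l i j
    unfolding entry_nth[OF that(2,3)]
    using wfW_ok(1)[OF assms that(1)] nth_mem[OF that(2)] nth_mem[OF that(3)] by blast
  have okv: "ok_entry (scl W) (nthd [] (rw W l) i)" if "l \<in> {2, 4, 6}" "i < length (rw W l)" for l i
    unfolding nthd_nth[OF that(2)] using wfW_ok(2)[OF assms that(1)] nth_mem[OF that(2)] by blast
  have len: "r < length (mt W 0) \<Longrightarrow> length (mt W 0 ! r) = nvar W"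
    "r < length (mt W 1) \<Longrightarrow> length (mt W 1 ! r) = npar W"
    "r < length (mt W 3) \<Longrightarrow> length (mt W 3 ! r) = npar W"
    "r < length (mt W 5) \<Longrightarrow> length (mt W 5 ! r) = npar W" for r
    using wfW_len[OF assms] by auto
  note dims = wfW_dims[OF assms] wfW_dims(2)[OF assms, simplified]
  show ?thesis
    unfolding scaled_def plpW_def plp0_def instW_def matW_def vecW_def
    by (simp add: dims len len(2)[simplified] ok_entry_scaled[OF ok] ok_entry_scaled[OF okv])
qed

lemma zeroB_iff:
  assumes "wfW W"
  shows "zeroB W \<longleftrightarrow> fixed_rhs (instW W)"
proof -
  let ?L = "mt W 1"
  have len: "\<forall>r\<in>set ?L. length r = npar W" and ok: "\<forall>r\<in>set ?L. \<forall>e\<in>set r. ok_entry (scl W) e"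
    using wfW_len(2)[OF assms] wfW_ok(1)[OF assms, of 1] by auto
  have "fixed_rhs (instW W) \<longleftrightarrow> (\<forall>i<length ?L. \<forall>j<npar W. ratof (entry ?L i j) = 0)"
    by (auto simp: fixed_rhs_def instW_def matW_def mat_eq_iff)
  also have "\<dots> \<longleftrightarrow> (\<forall>i<length ?L. \<forall>j<length (?L ! i). ratof (?L ! i ! j) = 0)"
    using len by (auto simp: entry_nth)
  also have "\<dots> \<longleftrightarrow> (\<forall>r\<in>set ?L. \<forall>e\<in>set r. ratof e = 0)"
    by (auto simp: all_set_conv_all_nth)
  also have "\<dots> \<longleftrightarrow> zeroB W" using ok by (auto simp: zeroB_def ok_entry_zero[of "scl W"])
  finally show ?thesis by simp
qed

text \<open>In \<open>std s\<close> the sign conditions have the coefficient \<open>- s\<close>, so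
  they are scaled like all other rows.\<close>

lemma scaled_form: "scaled s E I \<Longrightarrow> scaled s (form F s E) (form F 1 I)"
  unfolding form_def
proof (cases "F = Standard")
  case True
  assume s: "scaled s E I"
  have "r - pM I < pM I" if "\<not> r < pM I" "r < pM I + pM I" for r using that by simp
  with s True show "scaled s (if F = Standard then std s E else E) (if F = Standard then std 1 I else I)"
    by (auto simp: scaled_def std_def)
qed simp

definition problem :: "bool \<Rightarrow> bool \<Rightarrow> lp_form \<Rightarrow> language" where
  "problem fx P F = ilfp_language (\<lambda>I. (fx \<longrightarrow> fixed_rhs I) \<and> scenario P F I)"

lemma verify_sound:
  assumes "verify fx P F x W"
  shows "x \<in> problem fx P F"
proof -
  have wf: "wfW W" and x: "x = encW W" and z: "fx \<longrightarrow> zeroB W" using assms by (auto simp: verify_def)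
  let ?I = "instW W"
  have "pT (form F 1 (plp0 ?I)) < pN (form F 1 (plp0 ?I))"
    using wf by (simp add: form_def std_def plp0_def instW_def matW_def wfW_def)
  with cert_sound[OF scaled_form[OF scaled_plpW[OF wf]]] assms
  have "solvable P (form F 1 (plp0 ?I))" unfolding verify_def by blast
  then have "scenario P F ?I" using scenario_iff[OF instance_instW[OF wf]] by simp
  moreover have "fx \<longrightarrow> fixed_rhs ?I" using z zeroB_iff[OF wf] by simp
  ultimately show ?thesis unfolding problem_def ilfp_language_def
    using x encW_instW[OF wf] instance_instW[OF wf] by blast
qed

subsection \<open>Short certificates exist\<close>

lemma cert_cong:
  assumes "cert P E x y l u h t" "pT E < pN E"
    and "\<And>j. j < pK E \<Longrightarrow> x' j = x j" "\<And>j. j < pN E \<Longrightarrow> y' j = y j"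
    "\<And>r. r < pM E \<Longrightarrow> l' r = l r" "\<And>r. r < pM E \<Longrightarrow> u' r = u r"
  shows "cert P E x' y' l' u' h t"
proof -
  have d: "dot (pK E) v x' = dot (pK E) v x" "dot (pN E) v y' = dot (pN E) v y"
    "dot (pM E) v l' = dot (pM E) v l" "dot (pM E) v u' = dot (pM E) v u" for v
    using assms by (auto intro!: dot_cong)
  then have "slack E x' y' h r = slack E x y h r" for r by (simp add: slack_def)
  with d assms show ?thesis unfolding cert_def by auto
qed

text \<open>The exponent arises by applying \<open>n \<le> 2 ^ n\<close> and
  \<open>fact N \<le> 2 ^ (N * N)\<close> to the factors of \<open>sol_bound\<close> in turn, for
  entries bounded by \<open>2 ^ a\<close>.\<close>

definition bexp :: "nat \<Rightarrow> nat \<Rightarrow> nat \<Rightarrow> nat" where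
  "bexp N R a = N + N * N + (R + 2 * a) * N + (R + a)"

lemma bexp_mono: "N \<le> N' \<Longrightarrow> R \<le> R' \<Longrightarrow> bexp N R a \<le> bexp N' R' a"
  unfolding bexp_def by (intro add_mono mult_le_mono) auto

lemma sol_bound_le: "sol_bound N R (2 ^ a) \<le> 2 ^ bexp N R a"
proof -
  have p: "int n \<le> 2 ^ n" for n
  proof -
    have "int n < int (2 ^ n)" by (simp only: of_nat_less_iff less_exp)
    then show ?thesis by simp
  qed
  have "fact N \<le> (2::int) ^ (N * N)"
  proof -
    have "(fact N :: int) \<le> int N ^ N" using fact_le_power[of N, where 'a = int] by simp
    also have "\<dots> \<le> (2 ^ N) ^ N" by (intro power_mono p) simp
    finally show ?thesis by (simp add: power_mult)
  qed
  moreover have "(int R * (2 ^ a) ^ 2) ^ N \<le> (2::int) ^ ((R + 2 * a) * N)"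
  proof -
    have "int R * (2 ^ a) ^ 2 \<le> 2 ^ R * (2 ^ a) ^ 2" by (intro mult_right_mono p) simp
    also have "\<dots> = 2 ^ (R + 2 * a)" by (simp add: power_add power_mult[symmetric] mult.commute)
    finally show ?thesis by (simp add: power_mult power_mono)
  qed
  moreover have "int R * 2 ^ a \<le> 2 ^ (R + a)" using p[of R] by (simp add: power_add mult_right_mono)
  ultimately have "sol_bound N R (2 ^ a) \<le> 2 ^ N * (2 ^ (N * N) * 2 ^ ((R + 2 * a) * N)) * 2 ^ (R + a)"
    unfolding sol_bound_def using p[of N] by (intro mult_mono) auto
  also have "\<dots> = 2 ^ bexp N R a" by (simp add: bexp_def power_add)
  finally show ?thesis .
qed

lemma length_enc_list_ge: "length xs \<le> length (enc_list f xs)"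
  by (induction xs) auto

lemma length_enc_list_member: "x \<in> set xs \<Longrightarrow> length (f x) \<le> length (enc_list f xs)"
  by (induction xs) auto

definition wt :: "rat list \<Rightarrow> nat" where
  "wt rs = sum_list (map (\<lambda>r. length (enc_rat r)) rs)"

lemma wt_append: "wt (xs @ ys) = wt xs + wt ys"
  by (simp add: wt_def)

lemma wt_enc_list: "wt xs \<le> length (enc_list enc_rat xs)"
  by (induction xs) (auto simp: wt_def)

lemma wt_enc_mat: "wt (concat (mat_to_list M)) \<le> length (enc_mat M)"
proof -
  have "wt (concat xss) \<le> length (enc_list (enc_list enc_rat) xss)" for xss
  proof (induction xss)
    case (Cons xs xss)
    then show ?case using wt_enc_list[of xs] by (simp add: wt_append)
  qed (simp add: wt_def)
  then show ?thesis by (simp add: enc_mat_def)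
qed

definition rats :: "ilfp \<Rightarrow> rat list" where
  "rats I = concat (mat_to_list (lp_A I)) @ concat (mat_to_list (lp_B I)) @ list_of_vec (lp_b I) @
     concat (mat_to_list (lp_C I)) @ list_of_vec (lp_c I) @ concat (mat_to_list (X_D I)) @ list_of_vec (X_d I)"

lemma wt_rats: "wt (rats I) \<le> length (enc_ilfp I)"
  using wt_enc_mat[of "lp_A I"] wt_enc_mat[of "lp_B I"] wt_enc_mat[of "lp_C I"] wt_enc_mat[of "X_D I"]
    wt_enc_list[of "list_of_vec (lp_b I)"] wt_enc_list[of "list_of_vec (lp_c I)"] wt_enc_list[of "list_of_vec (X_d I)"]
  by (simp add: rats_def wt_append enc_ilfp_def enc_vec_def)

abbreviation num :: "rat \<Rightarrow> int" where "num r \<equiv> fst (quotient_of r)"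
abbreviation den :: "rat \<Rightarrow> int" where "den r \<equiv> snd (quotient_of r)"

lemma int_less_enc_mag: "\<bar>z\<bar> < 2 ^ length (enc_mag z)"
proof -
  have "length (mag z) \<le> length (enc_mag z)" unfolding enc_mag_def by (rule length_enc_list_ge)
  then have "(2::nat) ^ length (mag z) \<le> 2 ^ length (enc_mag z)" by simp
  with less_length_binary[of "nat \<bar>z\<bar>"] have "nat \<bar>z\<bar> < 2 ^ length (enc_mag z)" unfolding mag_def by linarith
  then show ?thesis by (simp add: nat_less_iff)
qed

lemma num_den_less: "\<bar>num r\<bar> < 2 ^ length (enc_rat r)" "\<bar>den r\<bar> < 2 ^ length (enc_rat r)"
proof -
  have l: "length (enc_rat r) = 1 + length (enc_mag (num r)) + length (enc_mag (den r))"
    using enc_rat_frac[of r "num r" "den r"] by (simp add: enc_frac_def)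
  have "(2::int) ^ length (enc_mag (num r)) \<le> 2 ^ length (enc_rat r)"
    "(2::int) ^ length (enc_mag (den r)) \<le> 2 ^ length (enc_rat r)"
    by (rule power_increasing, simp add: l, simp)+
  with int_less_enc_mag[of "num r"] int_less_enc_mag[of "den r"]
  show "\<bar>num r\<bar> < 2 ^ length (enc_rat r)" "\<bar>den r\<bar> < 2 ^ length (enc_rat r)" by linarith+
qed

text \<open>Bit lengths add up in a product. Hence the product of all denominators, used as the
  common scale, is no longer than the input.\<close>

lemma prod_den_le: "0 < prod_list (map den rs)" "prod_list (map den rs) \<le> 2 ^ wt rs"
proof (induction rs)
  case (Cons r rs)
  { case 1 then show ?case using Cons quotient_of_denom_pos'[of r] by simp }
  { case 2
    have "den r \<le> 2 ^ length (enc_rat r)" using num_den_less(2)[of r] by linarith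
    then show ?case using Cons quotient_of_denom_pos'[of r]
      by (simp add: wt_def power_add mult_mono) }
qed (simp_all add: wt_def)

lemma wt_member: "r \<in> set rs \<Longrightarrow> length (enc_rat r) \<le> wt rs"
  unfolding wt_def by (simp add: member_le_sum_list)

text \<open>The first coefficient is reduced modulo \<open>q\<close> and the difference moved into
  the second one; the identity itself then bounds the second coefficient.\<close>

lemma bezout_bounded:
  fixes p q :: int
  assumes "coprime p q" "0 < q"
  obtains v w where "v * p + w * q = 1" "\<bar>v\<bar> \<le> q" "\<bar>w\<bar> \<le> \<bar>p\<bar> + 1"
proof -
  obtain a b where ab: "a * p + b * q = 1" using bezout_int[of p q] assms(1) by auto
  let ?v = "a mod q" and ?w = "b + (a div q) * p"
  have "r * p + (b + d * p) * q = 1" if "a = d * q + r" for d r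
    using ab unfolding that by (simp add: algebra_simps)
  from this[of "a div q" ?v] have 1: "?v * p + ?w * q = 1" by simp
  have v: "0 \<le> ?v" "?v < q" using assms(2) by simp_all
  have "?w * q = 1 - ?v * p" using 1 by simp
  then have "\<bar>?w\<bar> * q = \<bar>1 - ?v * p\<bar>" using assms(2) by (metis abs_mult abs_of_pos)
  also have "\<dots> \<le> 1 + \<bar>?v * p\<bar>" by simp
  also have "\<bar>?v * p\<bar> \<le> q * \<bar>p\<bar>" using v by (simp add: abs_mult mult_right_mono)
  finally have "\<bar>?w\<bar> * q \<le> 1 + q * \<bar>p\<bar>" by simp
  also have "\<dots> \<le> (\<bar>p\<bar> + 1) * q" using assms(2) by (simp add: algebra_simps)
  finally have "\<bar>?w\<bar> \<le> \<bar>p\<bar> + 1" using assms(2) by simp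
  with 1 v show ?thesis by (intro that[of ?v ?w]) auto
qed

text \<open>The scaled number is a numerator below \<open>2 ^ L\<close> times a factor of at most
  \<open>2 ^ L\<close>; the additional 1 in the exponent makes the bound strict and also covers the
  Bezout coefficients.\<close>

definition good_entry :: "nat \<Rightarrow> int \<Rightarrow> rat \<Rightarrow> int list \<Rightarrow> bool" where
  "good_entry L s r e \<longleftrightarrow> ok_entry s e \<and> fld e 1 = num r \<and> fld e 2 = den r \<and> length e = 5 \<and>
     (\<forall>z\<in>set e. \<bar>z\<bar> < 2 ^ (2 * L + 1))"

lemma ex_good_entry:
  assumes "length (enc_rat r) \<le> L" "den r dvd s" "0 < s" "s \<le> 2 ^ L"
  shows "\<exists>e. good_entry L s r e"
proof -
  have q: "0 < den r" by (rule quotient_of_denom_pos')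
  have "coprime (num r) (den r)" using quotient_of_coprime[of r "num r" "den r"] by simp
  then obtain v w where vw: "v * num r + w * den r = 1" "\<bar>v\<bar> \<le> den r" "\<bar>w\<bar> \<le> \<bar>num r\<bar> + 1"
    using q by (rule bezout_bounded)
  let ?e = "[num r * (s div den r), num r, den r, v, w]"
  have fld: "fld ?e 0 = num r * (s div den r)" "fld ?e 1 = num r" "fld ?e 2 = den r" "fld ?e 3 = v" "fld ?e 4 = w"
    by (simp_all add: fld_def nthd_def eval_nat_numeral)
  have "(2::int) ^ length (enc_rat r) \<le> 2 ^ L" using assms(1) by simp
  then have b: "\<bar>num r\<bar> < 2 ^ L" "\<bar>den r\<bar> < 2 ^ L" using num_den_less[of r] by linarith+
  define U T :: int where "U = 2 ^ L" and "T = 2 ^ (2 * L)"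
  have L: "U \<le> T" "1 \<le> T" "2 ^ (2 * L + 1) = 2 * T" by (simp_all add: U_def T_def)
  obtain k where k: "s = den r * k" using assms(2) by (rule dvdE)
  then have "0 < k" using q assms(3) by (simp add: zero_less_mult_iff)
  then have "0 \<le> s div den r" "s div den r \<le> s" using q k mult_right_mono[of 1 "den r" k] by simp_all
  then have "\<bar>num r * (s div den r)\<bar> \<le> 2 ^ L * 2 ^ L"
    using b(1) assms(4) by (simp only: abs_mult) (intro mult_mono, auto)
  then have "\<bar>num r * (s div den r)\<bar> \<le> T" by (simp add: T_def mult_2 power_add)
  with b[folded U_def] L(1,2) vw(2,3) have "\<forall>z\<in>set ?e. \<bar>z\<bar> < 2 ^ (2 * L + 1)"
    unfolding L(3) by auto
  moreover have "num r * s = den r * (num r * (s div den r))" using assms(2) by simp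
  ultimately show ?thesis using q vw(1) by (intro exI[of _ ?e]) (simp add: good_entry_def ok_entry_def fld fld(2)[simplified])
qed

definition em :: "(rat \<Rightarrow> int list) \<Rightarrow> rat mat \<Rightarrow> int list list list" where
  "em ent M = map (map ent) (mat_to_list M)"

definition ev :: "(rat \<Rightarrow> int list) \<Rightarrow> rat vec \<Rightarrow> int list list" where
  "ev ent v = map ent (list_of_vec v)"

definition certW :: "ilfp \<Rightarrow> (rat \<Rightarrow> int list) \<Rightarrow> int \<Rightarrow> int list \<Rightarrow> int list \<Rightarrow> int list \<Rightarrow> int list \<Rightarrow> int \<Rightarrow> int \<Rightarrow> cdata" where
  "certW I ent s x y l u h t = [em ent (lp_A I), em ent (lp_B I), [ev ent (lp_b I)], em ent (lp_C I), [ev ent (lp_c I)],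
     em ent (X_D I), [ev ent (X_d I)], [[x, y, l, u, [s, h, t], replicate (fixed_index I) 0]]]"

lemma certW_sel:
  "mt (certW I ent s x y l u h t) 0 = em ent (lp_A I)" "mt (certW I ent s x y l u h t) 1 = em ent (lp_B I)"
  "mt (certW I ent s x y l u h t) (Suc 0) = em ent (lp_B I)"
  "rw (certW I ent s x y l u h t) 2 = ev ent (lp_b I)" "mt (certW I ent s x y l u h t) 3 = em ent (lp_C I)"
  "rw (certW I ent s x y l u h t) 4 = ev ent (lp_c I)" "mt (certW I ent s x y l u h t) 5 = em ent (X_D I)"
  "rw (certW I ent s x y l u h t) 6 = ev ent (X_d I)"
  "vc (certW I ent s x y l u h t) 0 = x" "vc (certW I ent s x y l u h t) 1 = y"
  "vc (certW I ent s x y l u h t) 2 = l" "vc (certW I ent s x y l u h t) 3 = u"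
  "fld (vc (certW I ent s x y l u h t) 4) 1 = h" "fld (vc (certW I ent s x y l u h t) 4) 2 = t"
  "scl (certW I ent s x y l u h t) = s" "tgt (certW I ent s x y l u h t) = fixed_index I"
  "nvar (certW I ent s x y l u h t) = dim_vec (lp_c I)"
  "npar (certW I ent s x y l u h t) = length (nthd [] (em ent (lp_C I)) 0)"
  by (simp_all add: certW_def mt_def rw_def vc_def fld_def scl_def tgt_def nvar_def npar_def nthd_def eval_nat_numeral ev_def)

lemma length_em: "length (em ent M) = dim_row M" "r \<in> set (em ent M) \<Longrightarrow> length r = dim_col M"
  by (auto simp: em_def mat_to_list_def)

lemma nthd_cases: "nthd d xs n = d \<or> nthd d xs n \<in> set xs"
proof (cases "n < length xs")
  case True
  then show ?thesis by (simp add: nthd_nth)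
qed (simp add: nthd_def)

lemma fld_abs_le: "\<forall>z\<in>set e. \<bar>z\<bar> \<le> K \<Longrightarrow> 0 \<le> K \<Longrightarrow> \<bar>fld e i\<bar> \<le> K"
  using nthd_cases[of 0 e i] by (auto simp: fld_def)

lemma fld_entry_abs_le:
  "\<forall>r\<in>set m. \<forall>e\<in>set r. \<forall>z\<in>set e. \<bar>z\<bar> \<le> K \<Longrightarrow> 0 \<le> K \<Longrightarrow> \<bar>fld (entry m r j) i\<bar> \<le> K"
proof (rule fld_abs_le)
  assume a: "\<forall>r\<in>set m. \<forall>e\<in>set r. \<forall>z\<in>set e. \<bar>z\<bar> \<le> K"
  show "\<forall>z\<in>set (entry m r j). \<bar>z\<bar> \<le> K"
    using nthd_cases[of "[]" m r] nthd_cases[of "[]" "nthd [] m r" j] a unfolding entry_def by fastforce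
qed

lemma fld_nthd_abs_le:
  "\<forall>e\<in>set r. \<forall>z\<in>set e. \<bar>z\<bar> \<le> K \<Longrightarrow> 0 \<le> K \<Longrightarrow> \<bar>fld (nthd [] r j) i\<bar> \<le> K"
  using fld_abs_le[of "nthd [] r j"] nthd_cases[of "[]" r j] by fastforce

lemma plp_bound_form: "plp_bound E K \<Longrightarrow> \<bar>s\<bar> \<le> K \<Longrightarrow> plp_bound (form F s E) K"
proof -
  assume a: "plp_bound E K" "\<bar>s\<bar> \<le> K"
  have "r - pM E < pM E" if "\<not> r < pM E" "r < pM E + pM E" for r using that by simp
  moreover have "0 \<le> K" using a(2) by simp
  ultimately show ?thesis using a by (auto simp: form_def plp_bound_def std_def)
qed

text \<open>\<open>3 * L + 6\<close> bounds the length of every list inside a component: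
  \<open>m + m + n\<close> rows of the standard form, 5 numbers of an entry, 6 vectors in the last
  component. \<open>8 * L + 2\<close> and \<open>31 * L + 7\<close> bound the values of
  \<open>N\<close> and \<open>R\<close> in \<open>cert_complete\<close>, and entries are at most
  \<open>2 ^ (2 * L + 1)\<close>.\<close>

definition cert_len :: "nat \<Rightarrow> nat" where
  "cert_len L = (let R = 3 * L + 6; B = bexp (8 * L + 2) (31 * L + 7) (2 * L + 1) + 1
     in 3 * (8 * (R * (R * (R * (B + 2) + 1) + 1) + 1)))"

lemma verify_complete:
  assumes "x \<in> problem fx P F"
  shows "\<exists>W. verify fx P F x W \<and> length (encode W) \<le> cert_len (length x)"
proof -
  obtain I where I: "ilfp_instance I" "x = enc_ilfp I" "fx \<longrightarrow> fixed_rhs I" "scenario P F I"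
    using assms unfolding problem_def ilfp_language_def by blast
  define L where "L = length x"
  obtain m n k g where dims: "lp_A I \<in> carrier_mat m n" "lp_B I \<in> carrier_mat m k" "lp_b I \<in> carrier_vec m"
    "lp_C I \<in> carrier_mat n k" "lp_c I \<in> carrier_vec n" "X_D I \<in> carrier_mat g k" "X_d I \<in> carrier_vec g"
    "fixed_index I < n" using I(1) unfolding ilfp_instance_def by blast
  define s where "s = prod_list (map den (rats I))"
  have wL: "wt (rats I) \<le> L" using wt_rats[of I] I(2) by (simp add: L_def)
  then have "(2::int) ^ wt (rats I) \<le> 2 ^ L" by simp
  from prod_den_le(1) order_trans[OF prod_den_le(2) this] have s: "0 < s" "s \<le> 2 ^ L"
    unfolding s_def by this
  have "\<forall>r\<in>set (rats I). \<exists>e. good_entry L s r e"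
  proof
    fix r assume r: "r \<in> set (rats I)"
    show "\<exists>e. good_entry L s r e"
    proof (rule ex_good_entry[OF _ _ s])
      show "length (enc_rat r) \<le> L" using wt_member[OF r] wL by simp
      show "den r dvd s" unfolding s_def using r by (intro prod_list_dvd) auto
    qed
  qed
  then obtain ent where ent: "\<And>r. r \<in> set (rats I) \<Longrightarrow> good_entry L s r (ent r)" by metis
  let ?ms = "[lp_A I, lp_B I, lp_C I, X_D I]" and ?vs = "[lp_b I, lp_c I, X_d I]"
  have enc_ent: "enc_entry e = enc_rat r" if "good_entry L s r e" for r e
    using that enc_rat_frac[of r "num r" "den r"] by (simp add: good_entry_def enc_entry_def)
  have em_ent: "good_entry L s r (ent r)"
    if "M \<in> set ?ms" "row \<in> set (mat_to_list M)" "r \<in> set row" for M row r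
    using that by (intro ent) (auto simp: rats_def)
  have ev_ent: "good_entry L s r (ent r)" if "v \<in> set ?vs" "r \<in> set (list_of_vec v)" for v r
    using that by (intro ent) (auto simp: rats_def)
  have gm: "\<forall>r\<in>set (em ent M). \<forall>e\<in>set r. ok_entry s e \<and> length e = 5 \<and> (\<forall>z\<in>set e. \<bar>z\<bar> < 2 ^ (2 * L + 1))"
    and fm: "\<forall>row\<in>set (mat_to_list M). \<forall>r\<in>set row. enc_entry (ent r) = enc_rat r" if "M \<in> set ?ms" for M
    using em_ent[OF that, unfolded good_entry_def] enc_ent[OF em_ent[OF that]] by (auto simp: em_def)
  have gv: "\<forall>e\<in>set (ev ent v). ok_entry s e \<and> length e = 5 \<and> (\<forall>z\<in>set e. \<bar>z\<bar> < 2 ^ (2 * L + 1))"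
    and fv: "\<forall>r\<in>set (list_of_vec v). enc_entry (ent r) = enc_rat r" if "v \<in> set ?vs" for v
    using ev_ent[OF that, unfolded good_entry_def] enc_ent[OF ev_ent[OF that]] by (auto simp: ev_def)
  have npar: "length (nthd [] (em ent (lp_C I)) 0) = k"
  proof -
    have "0 < length (em ent (lp_C I))" using dims by (simp add: length_em)
    then show ?thesis using dims length_em(2)[of "nthd [] (em ent (lp_C I)) 0" ent "lp_C I"] nth_mem
      by (auto simp: nthd_nth)
  qed
  have wf: "wfW (certW I ent s x y l u h t)" for x y l u h t
  proof -
    have "\<forall>r\<in>set (em ent (lp_A I) @ em ent (lp_B I) @ em ent (lp_C I) @ em ent (X_D I) @
        [ev ent (lp_b I), ev ent (lp_c I), ev ent (X_d I)]). \<forall>e\<in>set r. ok_entry s e"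
      using gm gv by auto
    moreover have "length (ev ent v) = dim_vec v" for v by (simp add: ev_def)
    ultimately show ?thesis unfolding wfW_def certW_sel npar using s(1) dims
      by (auto simp: length_em)
  qed
  have enc: "encW (certW I ent s x y l u h t) = enc_ilfp I" for x y l u h t
  proof -
    have "enc_list (\<lambda>r. enc_list (\<lambda>e. enc_entry e) r) (em ent M) = enc_mat M" if "M \<in> set ?ms" for M
      unfolding em_def enc_mat_def enc_list_map using fm[OF that] by (intro enc_list_cong) auto
    moreover have "enc_list (\<lambda>e. enc_entry e) (ev ent v) = enc_vec v" if "v \<in> set ?vs" for v
      unfolding ev_def enc_vec_def enc_list_map using fv[OF that] by (intro enc_list_cong) auto
    ultimately show ?thesis unfolding encW_def Let_def certW_sel by (simp add: enc_ilfp_def enc_nat_mag)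
  qed
  \<comment> \<open>The instance in the certificate has the same code as \<open>I\<close>, and codes
    are injective on instances.\<close>
  have inst: "instW (certW I ent s x y l u h t) = I" for x y l u h t
    using enc_ilfp_inj instance_instW[OF wf] I(1) encW_instW[OF wf] enc unfolding inj_on_def by auto
  \<comment> \<open>The integer data depend only on the part of the certificate that repeats the
    instance, so they can be fixed before its vectors are known.\<close>
  define E where "E = form F s (plpW (certW I ent s [] [] [] [] 0 0))"
  have plpW: "form F s (plpW (certW I ent s x y l u h t)) = E" for x y l u h t
    unfolding E_def plpW_def certW_sel ..
  have Edims: "pK E = k" "pN E = n" "pG E = g" "pT E = fixed_index I" "pM E \<le> m + m + n"
    using dims unfolding E_def plpW_def certW_sel npar by (auto simp: form_def std_def length_em)
  have sc: "scaled s E (form F 1 (plp0 I))"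
    using scaled_form[OF scaled_plpW[OF wf]] unfolding E_def inst certW_sel by blast
  have iI: "pT (form F 1 (plp0 I)) < pN (form F 1 (plp0 I))"
    using dims by (simp add: form_def std_def plp0_def)
  have sol: "solvable P (form F 1 (plp0 I))" using I(4) scenario_iff[OF I(1)] by simp
  let ?a = "2 * L + 1"
  have "plp_bound (plpW (certW I ent s [] [] [] [] 0 0)) (2 ^ ?a)"
  proof -
    have m: "\<bar>fld (entry (em ent M) r j) i\<bar> \<le> 2 ^ ?a" if "M \<in> set ?ms" for M r j i
      by (rule fld_entry_abs_le) (use gm[OF that] in \<open>auto intro: less_imp_le\<close>)
    have v: "\<bar>fld (nthd [] (ev ent v) j) i\<bar> \<le> 2 ^ ?a" if "v \<in> set ?vs" for v j i
      by (rule fld_nthd_abs_le) (use gv[OF that] in \<open>auto intro: less_imp_le\<close>)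
    show ?thesis unfolding plp_bound_def plpW_def certW_sel plp.simps using m v by simp
  qed
  moreover have "\<bar>s\<bar> \<le> 2 ^ ?a"
  proof -
    have "(2::int) ^ L \<le> 2 ^ ?a" by (rule power_increasing) auto
    with s show ?thesis by linarith
  qed
  ultimately have bound: "plp_bound E (2 ^ ?a)" unfolding E_def by (rule plp_bound_form)
  let ?N = "pK E + pN E + pM E + pM E + 2"
  let ?R = "6 * pM E + pG E + 4 * pN E + 4 + ?N + 1"
  let ?B = "bexp (8 * L + 2) (31 * L + 7) ?a + 1"
  have one: "(1::int) \<le> 2 ^ ?a" by (rule one_le_power) simp
  obtain x' y' l' u' h' t' where c: "cert P E x' y' l' u' h' t'"
    "\<forall>j<pK E. \<bar>x' j\<bar> \<le> sol_bound ?N ?R (2 ^ ?a)" "\<forall>j<pN E. \<bar>y' j\<bar> \<le> sol_bound ?N ?R (2 ^ ?a)"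
    "\<forall>r<pM E. \<bar>l' r\<bar> \<le> sol_bound ?N ?R (2 ^ ?a) \<and> \<bar>u' r\<bar> \<le> sol_bound ?N ?R (2 ^ ?a)"
    "\<bar>h'\<bar> \<le> sol_bound ?N ?R (2 ^ ?a)" "\<bar>t'\<bar> \<le> sol_bound ?N ?R (2 ^ ?a)"
    using cert_complete[OF sc sol iI bound one refl refl] by (elim exE conjE, intro that)
  have dL: "m \<le> L" "n \<le> L" "k \<le> L" "g \<le> L"
  proof -
    have "dim_row M \<le> length (enc_mat M)" for M
      using length_enc_list_ge[of "mat_to_list M"] by (simp add: enc_mat_def length_mat_to_list)
    from this[of "lp_A I"] this[of "lp_C I"] this[of "X_D I"] dims
    show "m \<le> L" "n \<le> L" "g \<le> L" by (auto simp: L_def I(2) enc_ilfp_def)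
    have "mat_to_list (lp_C I) ! 0 \<in> set (mat_to_list (lp_C I))"
      using dims by (intro nth_mem) (auto simp: length_mat_to_list)
    moreover have "length (mat_to_list (lp_C I) ! 0) = k" using dims by (auto simp: mat_to_list_nth)
    ultimately have "k \<le> length (enc_mat (lp_C I))"
      using length_enc_list_member[of "mat_to_list (lp_C I) ! 0" "mat_to_list (lp_C I)" "enc_list enc_rat"]
        length_enc_list_ge[of "mat_to_list (lp_C I) ! 0" enc_rat] by (simp add: enc_mat_def)
    then show "k \<le> L" by (simp add: L_def I(2) enc_ilfp_def)
  qed
  have "?N \<le> 8 * L + 2" "?R \<le> 31 * L + 7" using Edims dL by linarith+
  then have "bexp ?N ?R ?a \<le> bexp (8 * L + 2) (31 * L + 7) ?a" by (rule bexp_mono)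
  then have "(2::int) ^ bexp ?N ?R ?a \<le> 2 ^ bexp (8 * L + 2) (31 * L + 7) ?a" by (intro power_increasing) auto
  also have "\<dots> < 2 ^ ?B" by simp
  finally have sB: "sol_bound ?N ?R (2 ^ ?a) < 2 ^ ?B" using sol_bound_le[of ?N ?R ?a] by linarith
  have aB: "(2::int) ^ ?a \<le> 2 ^ ?B"
    by (rule power_increasing) (simp_all add: bexp_def)
  let ?x = "map x' [0..<pK E]" and ?y = "map y' [0..<pN E]" and ?l = "map l' [0..<pM E]" and ?u = "map u' [0..<pM E]"
  define W where "W = certW I ent s ?x ?y ?l ?u h' t'"
  have fld: "fld (map f [0..<j]) i = f i" if "i < j" for f i and j :: nat
    using that by (simp add: fld_def nthd_nth)
  have "pT E < pN E" using Edims dims by simp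
  then have "cert P E (fld ?x) (fld ?y) (fld ?l) (fld ?u) h' t'"
    by (rule cert_cong[OF c(1)]) (simp_all add: fld)
  moreover have "fx \<longrightarrow> zeroB W" using I(3) zeroB_iff[OF wf] by (simp add: W_def inst)
  ultimately have "verify fx P F x W"
    unfolding verify_def W_def certW_sel plpW using wf enc I(2) by simp
  moreover have "length (encode W) \<le> cert_len L"
    unfolding cert_len_def Let_def
  proof (rule length_encode)
    show "length W \<le> 8" by (simp add: W_def certW_def)
    let ?ok = "\<lambda>M. length M \<le> 3 * L + 6 \<and> (\<forall>r\<in>set M. length r \<le> 3 * L + 6 \<and>
      (\<forall>e\<in>set r. length e \<le> 3 * L + 6 \<and> (\<forall>z\<in>set e. \<bar>z\<bar> < (2::int) ^ ?B)))"
    have e: "length e \<le> 3 * L + 6 \<and> (\<forall>z\<in>set e. \<bar>z\<bar> < (2::int) ^ ?B)"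
      if "length e = 5 \<and> (\<forall>z\<in>set e. \<bar>z\<bar> < (2::int) ^ ?a)" for e :: "int list"
      using that aB by (auto intro: less_le_trans)
    have dM: "dim_row M \<le> 3 * L + 6 \<and> dim_col M \<le> 3 * L + 6" if "M \<in> set ?ms" for M
      using that dims dL by auto
    have okM: "?ok (em ent M)" if M: "M \<in> set ?ms" for M
    proof -
      have "\<forall>r\<in>set (em ent M). \<forall>e\<in>set r. length e \<le> 3 * L + 6 \<and> (\<forall>z\<in>set e. \<bar>z\<bar> < (2::int) ^ ?B)"
        using gm[OF M] e by blast
      moreover have "length (em ent M) \<le> 3 * L + 6" "\<forall>r\<in>set (em ent M). length r \<le> 3 * L + 6"
        using dM[OF M] length_em by metis+
      ultimately show ?thesis by blast
    qed
    have dv: "dim_vec v \<le> 3 * L + 6" if "v \<in> set ?vs" for v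
      using that dims dL by auto
    have okV: "?ok [ev ent v]" if v: "v \<in> set ?vs" for v
    proof -
      have "\<forall>e\<in>set (ev ent v). length e \<le> 3 * L + 6 \<and> (\<forall>z\<in>set e. \<bar>z\<bar> < (2::int) ^ ?B)"
        using gv[OF v] e by blast
      moreover have "length (ev ent v) \<le> 3 * L + 6" using dv[OF v] by (simp add: ev_def)
      ultimately show ?thesis by simp
    qed
    have "\<bar>s\<bar> < 2 ^ ?B" using s aB \<open>\<bar>s\<bar> \<le> 2 ^ ?a\<close> power_strict_increasing[of L ?a "2::int"] by linarith
    moreover have "pM E \<le> 3 * L + 6" "pK E \<le> 3 * L + 6" "pN E \<le> 3 * L + 6" "fixed_index I \<le> 3 * L + 6"
      using Edims dL dims by auto
    ultimately have okC: "?ok [[?x, ?y, ?l, ?u, [s, h', t'], replicate (fixed_index I) 0]]"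
      using c(2-) sB by (auto intro: le_less_trans)
    show "\<forall>M\<in>set W. ?ok M"
    proof
      fix M assume "M \<in> set W"
      then consider M' where "M' \<in> set ?ms" "M = em ent M'" | v where "v \<in> set ?vs" "M = [ev ent v]"
        | "M = [[?x, ?y, ?l, ?u, [s, h', t'], replicate (fixed_index I) 0]]"
        unfolding W_def certW_def by (simp only: list.set) blast
      then show "?ok M"
      proof cases
        case 1
        show ?thesis unfolding 1(2) by (rule okM[OF 1(1)])
      next
        case 2
        show ?thesis unfolding 2(2) by (rule okV[OF 2(1)])
      next
        case 3
        show ?thesis unfolding 3 by (rule okC)
      qed
    qed
  qed
  ultimately show ?thesis unfolding L_def by blast
qed

lemma in_NP_problem: "in_NP (problem fx P F)"
proof -
  have "\<exists>p :: nat poly. \<forall>L. cert_len L = poly p L"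
  proof -
    let ?N = "[:2, 8:] :: nat poly" and ?R0 = "[:7, 31:] :: nat poly" and ?a = "[:1, 2:] :: nat poly"
    let ?B = "?N + ?N * ?N + (?R0 + [:2:] * ?a) * ?N + (?R0 + ?a) + [:1:]"
    let ?R = "[:6, 3:] :: nat poly"
    have "cert_len L = poly ([:3:] * ([:8:] * (?R * (?R * (?R * (?B + [:2:]) + [:1:]) + [:1:]) + [:1:]))) L" for L
      by (simp add: cert_len_def Let_def bexp_def algebra_simps)
    then show ?thesis by blast
  qed
  then obtain p :: "nat poly" where p: "\<And>L. cert_len L = poly p L" by blast
  let ?V = "\<lambda>x u. verify fx P F x (decode u)"
  have "x \<in> problem fx P F \<longleftrightarrow> (\<exists>u. length u \<le> poly p (length x) \<and> ?V x u)" for x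
  proof
    assume "x \<in> problem fx P F"
    from verify_complete[OF this] obtain W where
      "verify fx P F x W" "length (encode W) \<le> cert_len (length x)" by blast
    then show "\<exists>u. length u \<le> poly p (length x) \<and> ?V x u"
      by (intro exI[of _ "encode W"]) (simp add: decode_encode p)
  qed (use verify_sound in blast)
  moreover have "polytime_verifier ?V" by (rule polytime_verifier_ptime) (rule ptime_verify)
  ultimately show ?thesis unfolding in_NP_def by blast
qed

section \<open>NP-hardness\<close>

subsection \<open>Integer instances\<close>

definition realp :: "int plp \<Rightarrow> real plp" where
  "realp E = \<lparr>pM = pM E, pN = pN E, pK = pK E, pG = pG E, pA = (\<lambda>r j. real_of_int (pA E r j)),
     pB = (\<lambda>r j. real_of_int (pB E r j)), pb = (\<lambda>r. real_of_int (pb E r)), pC = (\<lambda>r j. real_of_int (pC E r j)),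
     pc = (\<lambda>r. real_of_int (pc E r)), pD = (\<lambda>r j. real_of_int (pD E r j)), pd = (\<lambda>r. real_of_int (pd E r)), pT = pT E\<rparr>"

lemma realp_std: "realp (std 1 E) = std 1 (realp E)"
  by (simp add: realp_def std_def fun_eq_iff)

lemma solvable_scaled_1:
  assumes s: "scaled 1 E I" and i: "pT I < pN I"
  shows "solvable P I \<longleftrightarrow> solvable P (realp E)"
proof -
  have dims: "pM E = pM I" "pN E = pN I" "pK E = pK I" "pG E = pG I" "pT E = pT I"
    using s by (auto simp: scaled_def)
  have f: "lfeas I x y \<longleftrightarrow> lfeas (realp E) x y" for x y
    using s scaled_rows(1,2)[OF s] by (simp add: lfeas_def realp_def dims scaled_def)
  have c: "dot (pN I) (lcost I x) y = dot (pN I) (lcost (realp E) x) y" for x y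
    using s scaled_rows(3)[OF s] by (intro dot_cong) (simp_all add: lcost_def realp_def dims scaled_def)
  have X: "linX I x \<longleftrightarrow> linX (realp E) x" for x
    using s scaled_rows(4)[OF s] by (simp add: linX_def realp_def dims scaled_def)
  have n: "pN (realp E) = pN I" "pT (realp E) = pT I" by (simp_all add: realp_def dims)
  have "lopt I x y \<longleftrightarrow> lopt (realp E) x y" for x y by (simp add: lopt_def f c n)
  then show ?thesis by (simp add: solvable_def X n)
qed

text \<open>An integer as an entry for scale 1, with denominator 1 and the Bezout identity
  \<open>0 * z + 1 * 1 = 1\<close>.\<close>

definition ient :: "int \<Rightarrow> int list" where
  "ient z = [z, z, 1, 0, 1]"

lemma ient: "ok_entry 1 (ient z)" "fld (ient z) 0 = z" "fld (ient z) (Suc 0) = z"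
  by (simp_all add: ient_def ok_entry_def fld_def nthd_def eval_nat_numeral)

text \<open>The layout of certificates is reused so that \<open>encW\<close> yields the code of the
  instance; in the last component only the scale and the target index are filled in.\<close>

definition Wplp :: "int plp \<Rightarrow> cdata" where
  "Wplp E = [map (\<lambda>r. map (\<lambda>j. ient (pA E r j)) [0..<pN E]) [0..<pM E],
     map (\<lambda>r. map (\<lambda>j. ient (pB E r j)) [0..<pK E]) [0..<pM E],
     [map (\<lambda>r. ient (pb E r)) [0..<pM E]],
     map (\<lambda>r. map (\<lambda>j. ient (pC E r j)) [0..<pK E]) [0..<pN E],
     [map (\<lambda>r. ient (pc E r)) [0..<pN E]],
     map (\<lambda>r. map (\<lambda>j. ient (pD E r j)) [0..<pK E]) [0..<pG E],
     [map (\<lambda>r. ient (pd E r)) [0..<pG E]],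
     [[[], [], [], [], [1, 0, 0], replicate (pT E) 0]]]"

lemma Wplp_sel:
  "mt (Wplp E) 0 = map (\<lambda>r. map (\<lambda>j. ient (pA E r j)) [0..<pN E]) [0..<pM E]"
  "mt (Wplp E) 1 = map (\<lambda>r. map (\<lambda>j. ient (pB E r j)) [0..<pK E]) [0..<pM E]"
  "rw (Wplp E) 2 = map (\<lambda>r. ient (pb E r)) [0..<pM E]"
  "mt (Wplp E) 3 = map (\<lambda>r. map (\<lambda>j. ient (pC E r j)) [0..<pK E]) [0..<pN E]"
  "rw (Wplp E) 4 = map (\<lambda>r. ient (pc E r)) [0..<pN E]"
  "mt (Wplp E) 5 = map (\<lambda>r. map (\<lambda>j. ient (pD E r j)) [0..<pK E]) [0..<pG E]"
  "rw (Wplp E) 6 = map (\<lambda>r. ient (pd E r)) [0..<pG E]"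
  "scl (Wplp E) = 1" "tgt (Wplp E) = pT E" "nvar (Wplp E) = pN E"
  by (simp_all add: Wplp_def mt_def rw_def vc_def fld_def scl_def tgt_def nvar_def nthd_def eval_nat_numeral)

lemma npar_Wplp: "0 < pN E \<Longrightarrow> npar (Wplp E) = pK E"
  unfolding npar_def Wplp_sel by (simp add: nthd_nth)

lemma wfW_Wplp: "pT E < pN E \<Longrightarrow> wfW (Wplp E)"
  unfolding wfW_def Wplp_sel using npar_Wplp[of E] by (auto simp: ient)

lemma entry_map: "r < m \<Longrightarrow> j < n \<Longrightarrow> entry (map (\<lambda>r. map (f r) [0..<n]) [0..<m]) r j = f r j"
  by (simp add: entry_def nthd_nth)

lemma scaled_Wplp:
  assumes "pT E < pN E"
  shows "scaled 1 E (plp0 (instW (Wplp E)))"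
proof -
  have "scaled 1 (plpW (Wplp E)) (plp0 (instW (Wplp E)))"
    using scaled_plpW[OF wfW_Wplp[OF assms]] by (simp add: Wplp_sel)
  moreover have "npar (Wplp E) = pK E" using assms by (intro npar_Wplp) simp
  ultimately show ?thesis
    unfolding scaled_def plpW_def Wplp_sel plp.simps by (auto simp: entry_map nthd_nth ient)
qed

text \<open>The intended LP is \<open>E\<close> read in standard form. A natural-form instance
  receives the equivalent inequalities as its data, so both forms describe the same LP.\<close>

definition red_plp :: "lp_form \<Rightarrow> int plp \<Rightarrow> int plp" where
  "red_plp F E = (if F = Natural then std 1 E else E)"

text \<open>A zero matrix \<open>B\<close> makes \<open>fixed_rhs\<close> true, so both values of
  \<open>fx\<close> lead to the same condition. Injectivity of \<open>enc_ilfp\<close> identifies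
  the instance behind the code.\<close>

lemma encW_Wplp_iff:
  assumes T: "pT E < pN E" and B: "\<And>r j. pB E r j = 0"
  shows "encW (Wplp (red_plp F E)) \<in> problem fx P F \<longleftrightarrow> solvable P (std 1 (realp E))"
proof -
  let ?W = "Wplp (red_plp F E)" and ?I = "instW (Wplp (red_plp F E))"
  have T': "pT (red_plp F E) < pN (red_plp F E)" using T by (simp add: red_plp_def std_def)
  note wf = wfW_Wplp[OF T'] and inst = instance_instW[OF wfW_Wplp[OF T']]
  have "\<forall>r\<in>set (mt ?W 1). \<forall>e\<in>set r. fld e 1 = 0"
    unfolding Wplp_sel using B by (auto simp: red_plp_def std_def ient)
  then have fx: "fixed_rhs ?I" using zeroB_iff[OF wf] by (simp add: zeroB_def)
  have "encW ?W \<in> problem fx P F \<longleftrightarrow> scenario P F ?I"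
  proof
    assume "encW ?W \<in> problem fx P F"
    then obtain J where "encW ?W = enc_ilfp J" "ilfp_instance J" "scenario P F J"
      unfolding problem_def ilfp_language_def by blast
    moreover from this have "J = ?I" using enc_ilfp_inj inst encW_instW[OF wf] unfolding inj_on_def by auto
    ultimately show "scenario P F ?I" by simp
  next
    assume "scenario P F ?I"
    then show "encW ?W \<in> problem fx P F"
      using inst fx encW_instW[OF wf] unfolding problem_def ilfp_language_def by blast
  qed
  also have "\<dots> \<longleftrightarrow> solvable P (form F 1 (plp0 ?I))" by (rule scenario_iff[OF inst])
  also have "\<dots> \<longleftrightarrow> solvable P (realp (form F 1 (red_plp F E)))"
  proof (rule solvable_scaled_1)
    show "scaled 1 (form F 1 (red_plp F E)) (form F 1 (plp0 ?I))" by (rule scaled_form[OF scaled_Wplp[OF T']])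
    show "pT (form F 1 (plp0 ?I)) < pN (form F 1 (plp0 ?I))"
    proof -
      have "pT (red_plp F E) = pT (plp0 ?I)" "pN (red_plp F E) = pN (plp0 ?I)"
        using scaled_Wplp[OF T'] unfolding scaled_def by blast+
      moreover have "pT (form F 1 E) < pN (form F 1 E) \<longleftrightarrow> pT E < pN E" for E :: "'b::comm_ring_1 plp"
        by (simp add: form_def std_def)
      ultimately show ?thesis using T' by metis
    qed
  qed
  also have "realp (form F 1 (red_plp F E)) = std 1 (realp E)"
    by (cases F) (simp_all add: form_def red_plp_def realp_std)
  finally show ?thesis .
qed

subsection \<open>Satisfiability\<close>

type_synonym clause = "nat list \<times> nat list"

definition satisfies :: "(nat \<Rightarrow> bool) \<Rightarrow> clause list \<Rightarrow> bool" where
  "satisfies v cls \<longleftrightarrow> (\<forall>c\<in>set cls. (\<exists>l\<in>set (fst c). v l) \<or> (\<exists>l\<in>set (snd c). \<not> v l))"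

text \<open>The parameters range over a relaxation of the satisfying assignments. With variables
  \<open>p\<^sub>r, q\<^sub>r, s \<ge> 0\<close>, constraints \<open>p\<^sub>r + q\<^sub>r + s = 1\<close> and objective
  \<open>\<Sum>\<^sub>r 4 x\<^sub>r p\<^sub>r + 4 (1 - x\<^sub>r) q\<^sub>r + s\<close>, the target \<open>s = 0\<close> is optimal only if
  \<open>\<Sum>\<^sub>r min x\<^sub>r (1 - x\<^sub>r) \<le> 1 / 4\<close>, and then rounding \<open>x\<close> keeps every clause satisfied.\<close>

definition cnf_plp :: "nat \<Rightarrow> clause list \<Rightarrow> int plp" where
  "cnf_plp N cls = \<lparr>pM = N, pN = N + N + 1, pK = N, pG = N + N + length cls,
     pA = (\<lambda>r j. if j = r \<or> j = N + r \<or> j = N + N then 1 else 0),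
     pB = (\<lambda>r j. 0), pb = (\<lambda>r. 1),
     pC = (\<lambda>j l. if j = l then 4 else if j = N + l then - 4 else 0),
     pc = (\<lambda>j. if j < N then 0 else if j < N + N then 4 else 1),
     pD = (\<lambda>r l. if r < N then (if r = l then - 1 else 0) else if r < N + N then (if r - N = l then 1 else 0)
       else (if l \<in> set (fst (nthd ([], []) cls (r - (N + N)))) then - 1 else 0)
          + (if l \<in> set (snd (nthd ([], []) cls (r - (N + N)))) then 1 else 0)),
     pd = (\<lambda>r. if r < N then 0 else if r < N + N then 1
       else sum_list (map (\<lambda>l. if l \<in> set (snd (nthd ([], []) cls (r - (N + N)))) then 1 else 0) [0..<N]) - 1),
     pT = N + N\<rparr>"

context
  fixes N :: nat and cls :: "clause list"
begin

abbreviation "rp \<equiv> realp (cnf_plp N cls)"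

lemma rp_dims: "pM rp = N" "pN rp = N + N + 1" "pK rp = N" "pG rp = N + N + length cls" "pT rp = N + N"
  by (simp_all add: realp_def cnf_plp_def)

lemma rp_feas:
  "lfeas (std 1 rp) x y \<longleftrightarrow> (\<forall>r<N. y r + y (N + r) + y (N + N) = 1) \<and> (\<forall>r<N + N + 1. 0 \<le> y r)"
proof -
  have "dot (N + N + 1) (pA rp r) y = y r + y (N + r) + y (N + N)" if r: "r < N" for r
  proof -
    have "dot N (pA rp r) y = dot N (\<lambda>j. if r = j then 1 else 0) y"
      "dot N (\<lambda>j. pA rp r (N + j)) (\<lambda>j. y (N + j)) = dot N (\<lambda>j. if r = j then 1 else 0) (\<lambda>j. y (N + j))"
      using r by (auto simp: realp_def cnf_plp_def intro!: dot_cong)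
    moreover have "dot 1 (\<lambda>j. pA rp r (N + N + j)) (\<lambda>j. y (N + N + j)) = y (N + N)"
      by (simp add: dot_def realp_def cnf_plp_def)
    ultimately show ?thesis unfolding dot_add using r by (simp add: dot_delta)
  qed
  moreover have "pB rp r = (\<lambda>j. 0)" "pb rp r = 1" for r by (simp_all add: realp_def cnf_plp_def)
  ultimately show ?thesis unfolding lfeas_std rp_dims by (simp add: dot_zero)
qed

lemma rp_cost:
  "dot (N + N + 1) (lcost (std 1 rp) x) y =
    (\<Sum>r<N. 4 * x r * y r + 4 * (1 - x r) * y (N + r)) + y (N + N)"
proof -
  have C: "lcost rp x j = (if j < N then 4 * x j else if j < N + N then 4 - 4 * x (j - N) else 1)"
    if j: "j < N + N + 1" for j
  proof -
    consider "j < N" | "N \<le> j" "j < N + N" | "j = N + N" using j by linarith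
    then show ?thesis
    proof cases
      case 1
      then have "dot N (pC rp j) x = dot N (\<lambda>l. if j = l then 4 else 0) x"
        by (auto simp: realp_def cnf_plp_def intro!: dot_cong)
      then have "dot N (pC rp j) x = 4 * x j" using dot_delta[OF 1, of "4::real" x] by simp
      with 1 show ?thesis by (simp add: lcost_def rp_dims) (simp add: realp_def cnf_plp_def)
    next
      case 2
      then have "dot N (pC rp j) x = dot N (\<lambda>l. if j - N = l then - 4 else 0) x"
        by (auto simp: realp_def cnf_plp_def intro!: dot_cong)
      moreover have "j - N < N" using 2 by simp
      ultimately have "dot N (pC rp j) x = - 4 * x (j - N)" using dot_delta[of "j - N" N "- 4::real" x] by simp
      with 2 show ?thesis by (simp add: lcost_def rp_dims) (simp add: realp_def cnf_plp_def)
    next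
      case 3
      then have "dot N (pC rp j) x = dot N (\<lambda>l. 0) x"
        by (auto simp: realp_def cnf_plp_def intro!: dot_cong)
      with 3 show ?thesis by (simp add: lcost_def rp_dims dot_zero) (simp add: realp_def cnf_plp_def)
    qed
  qed
  have "dot N (lcost rp x) y = dot N (\<lambda>r. 4 * x r) y"
    "dot N (\<lambda>j. lcost rp x (N + j)) (\<lambda>j. y (N + j)) = dot N (\<lambda>r. 4 - 4 * x r) (\<lambda>j. y (N + j))"
    "dot 1 (\<lambda>j. lcost rp x (N + N + j)) (\<lambda>j. y (N + N + j)) = y (N + N)"
    by (auto simp: C intro!: dot_cong) (simp add: dot_def C)
  then show ?thesis unfolding lopt_std_cost dot_add by (simp add: dot_def sum.distrib[symmetric] algebra_simps)
qed

text \<open>The left-hand side of a clause inequality before the constants of the negative literals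
  are moved to the right. Summation runs over variables, so repeated literals count once, in
  accordance with \<open>pd\<close>.\<close>

definition clause_sum :: "(nat \<Rightarrow> real) \<Rightarrow> clause \<Rightarrow> real" where
  "clause_sum x c = (\<Sum>l<N. (if l \<in> set (fst c) then x l else 0) + (if l \<in> set (snd c) then 1 - x l else 0))"

lemma rp_X:
  "linX (std 1 rp) x \<longleftrightarrow> (\<forall>r<N. 0 \<le> x r \<and> x r \<le> 1) \<and> (\<forall>c\<in>set cls. 1 \<le> clause_sum x c)"
proof -
  have split: "(\<forall>r<N + N + m. Q r) \<longleftrightarrow> (\<forall>r<N. Q r) \<and> (\<forall>r<N. Q (N + r)) \<and> (\<forall>r<m. Q (N + N + r))" for Q m
    by (rule all_less_split3)
  have D1: "dot N (pD rp r) x = - x r" "pd rp r = 0" if "r < N" for r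
  proof -
    have "dot N (pD rp r) x = dot N (\<lambda>l. if r = l then - 1 else 0) x"
      using that by (auto simp: realp_def cnf_plp_def intro!: dot_cong)
    then show "dot N (pD rp r) x = - x r" using dot_delta[OF that, of "- 1::real" x] by simp
    show "pd rp r = 0" using that by (simp add: realp_def cnf_plp_def)
  qed
  have D2: "dot N (pD rp (N + r)) x = x r" "pd rp (N + r) = 1" if "r < N" for r
  proof -
    have "dot N (pD rp (N + r)) x = dot N (\<lambda>l. if r = l then 1 else 0) x"
      using that by (auto simp: realp_def cnf_plp_def intro!: dot_cong)
    then show "dot N (pD rp (N + r)) x = x r" using dot_delta[OF that, of "1::real" x] by simp
    show "pd rp (N + r) = 1" using that by (simp add: realp_def cnf_plp_def)
  qed
  have D3: "dot N (pD rp (N + N + r)) x \<le> pd rp (N + N + r) \<longleftrightarrow> 1 \<le> clause_sum x (cls ! r)"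
    if r: "r < length cls" for r
  proof -
    let ?c = "cls ! r"
    have "nthd ([], []) cls r = ?c" using r by (rule nthd_nth)
    then have 1: "dot N (pD rp (N + N + r)) x =
        (\<Sum>l<N. (if l \<in> set (fst ?c) then - x l else 0) + (if l \<in> set (snd ?c) then x l else 0))"
      unfolding dot_def by (intro sum.cong) (auto simp: realp_def cnf_plp_def)
    have 2: "pd rp (N + N + r) = (\<Sum>l<N. if l \<in> set (snd ?c) then 1 else 0) - 1"
      using \<open>nthd ([], []) cls r = ?c\<close>
      by (simp add: realp_def cnf_plp_def interv_sum_list_conv_sum_set_nat lessThan_atLeast0 if_distrib[of real_of_int] cong: if_cong)
    have "pd rp (N + N + r) - dot N (pD rp (N + N + r)) x = clause_sum x ?c - 1"
      unfolding 1 2 clause_sum_def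
      by (simp add: sum_subtractf[symmetric]) (intro sum.cong, auto)
    then show ?thesis by linarith
  qed
  have "linX (std 1 rp) x \<longleftrightarrow> linX rp x" by (simp add: lopt_std_cost)
  also have "\<dots> \<longleftrightarrow> (\<forall>r<N. 0 \<le> x r) \<and> (\<forall>r<N. x r \<le> 1) \<and> (\<forall>r<length cls. 1 \<le> clause_sum x (cls ! r))"
    unfolding linX_def rp_dims split using D1 D2 D3 by simp
  finally show ?thesis by (auto simp: all_set_conv_all_nth)
qed

lemma satisfies_if_solvable:
  assumes "solvable P (std 1 rp)"
  shows "\<exists>v. satisfies v cls"
proof -
  obtain x y where x: "linX (std 1 rp) x" and y: "lopt (std 1 rp) x y" "y (N + N) = 0"
    using assms unfolding solvable_def by (auto simp: lopt_std_cost rp_dims)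
  let ?m = "\<lambda>r. min (x r) (1 - x r)"
  have x01: "\<And>r. r < N \<Longrightarrow> 0 \<le> x r \<and> x r \<le> 1" and xc: "\<And>c. c \<in> set cls \<Longrightarrow> 1 \<le> clause_sum x c"
    using x by (auto simp: rp_X)
  have yf: "\<And>r. r < N \<Longrightarrow> y r + y (N + r) = 1" "\<And>r. r < N + N + 1 \<Longrightarrow> 0 \<le> y r"
    using y by (auto simp: lopt_def rp_feas)
  let ?z = "\<lambda>j. if j = N + N then 1 else 0"
  have "lfeas (std 1 rp) x ?z" by (auto simp: rp_feas)
  then have "dot (N + N + 1) (lcost (std 1 rp) x) y \<le> dot (N + N + 1) (lcost (std 1 rp) x) ?z"
    using y(1) by (simp add: lopt_def lopt_std_cost rp_dims)
  also have "\<dots> = 1" unfolding rp_cost by (auto intro!: sum.neutral)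
  finally have le1: "(\<Sum>r<N. 4 * x r * y r + 4 * (1 - x r) * y (N + r)) \<le> 1" unfolding rp_cost using y(2) by simp
  \<comment> \<open>As \<open>y r + y (N + r) = 1\<close>, each summand on the right is a weighted
    mean of \<open>4 * x r\<close> and \<open>4 * (1 - x r)\<close>.\<close>
  have "(\<Sum>r<N. 4 * ?m r) \<le> (\<Sum>r<N. 4 * x r * y r + 4 * (1 - x r) * y (N + r))"
  proof (rule sum_mono)
    fix r assume "r \<in> {..<N}"
    then have r: "r < N" by simp
    have nn: "0 \<le> y r" "0 \<le> y (N + r)" using yf(2) r by auto
    have "4 * ?m r = 4 * ?m r * y r + 4 * ?m r * y (N + r)"
      using yf(1)[OF r] by (simp add: distrib_left[symmetric])
    also have "\<dots> \<le> 4 * x r * y r + 4 * (1 - x r) * y (N + r)"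
      by (intro add_mono mult_right_mono nn) (simp_all only: mult_left_mono min.cobounded1 min.cobounded2 zero_le_numeral)
    finally show "4 * ?m r \<le> 4 * x r * y r + 4 * (1 - x r) * y (N + r)" .
  qed
  with le1 have m: "(\<Sum>r<N. ?m r) \<le> 1 / 4" by (simp add: sum_distrib_left[symmetric])
  have "satisfies (\<lambda>l. 1 / 2 < x l) cls" unfolding satisfies_def
  proof (rule ballI, rule ccontr)
    fix c assume c: "c \<in> set cls" and no: "\<not> ((\<exists>l\<in>set (fst c). 1 / 2 < x l) \<or> (\<exists>l\<in>set (snd c). \<not> 1 / 2 < x l))"
    \<comment> \<open>A literal of a clause falsified by rounding has its variable rounded against
      it, so it contributes the smaller of \<open>x l\<close> and \<open>1 - x l\<close>; no
      variable occurs with both signs, as the clause would then be true.\<close>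
    have "clause_sum x c \<le> (\<Sum>l<N. ?m l)" unfolding clause_sum_def
    proof (rule sum_mono)
      fix l assume "l \<in> {..<N}"
      then have l: "0 \<le> x l" "x l \<le> 1" using x01 by auto
      consider "l \<in> set (fst c)" "x l \<le> 1 / 2" "l \<notin> set (snd c)" | "l \<notin> set (fst c)" "1 / 2 < x l" "l \<in> set (snd c)"
        | "l \<notin> set (fst c)" "l \<notin> set (snd c)" using no by force
      then show "(if l \<in> set (fst c) then x l else 0) + (if l \<in> set (snd c) then 1 - x l else 0) \<le> ?m l"
        using l by cases auto
    qed
    with m xc[OF c] show False by simp
  qed
  then show ?thesis by blast
qed

text \<open>For 0-1 parameters a feasible solution with last coordinate 0 has cost 0, while every
  feasible solution costs at least its last coordinate. So this coordinate vanishes on all optimal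
  solutions, which settles both scenarios.\<close>

lemma solvable_if_satisfies:
  assumes v: "satisfies v cls" and bound: "\<forall>c\<in>set cls. \<forall>l\<in>set (fst c) \<union> set (snd c). l < N"
  shows "solvable P (std 1 rp)"
proof -
  let ?x = "\<lambda>l. of_bool (v l) :: real"
  have "1 \<le> clause_sum ?x c" if c: "c \<in> set cls" for c
  proof -
    let ?t = "\<lambda>l. (if l \<in> set (fst c) then ?x l else 0) + (if l \<in> set (snd c) then 1 - ?x l else 0)"
    obtain l where l: "l \<in> set (fst c) \<and> v l \<or> l \<in> set (snd c) \<and> \<not> v l"
      using v c unfolding satisfies_def by blast
    then have "l < N" using bound c by blast
    then have "?t l \<le> sum ?t {..<N}" by (intro member_le_sum) auto
    moreover have "1 \<le> ?t l" using l by auto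
    ultimately show ?thesis unfolding clause_sum_def by linarith
  qed
  then have X: "linX (std 1 rp) ?x" by (auto simp: rp_X)
  define y where "y = (\<lambda>j. if j < N then 1 - ?x j else if j < N + N then ?x (j - N) else 0)"
  have yf: "lfeas (std 1 rp) ?x y" by (auto simp: rp_feas y_def)
  have cy: "dot (N + N + 1) (lcost (std 1 rp) ?x) y = 0"
    unfolding rp_cost by (auto simp: y_def intro!: sum.neutral)
  have cz: "z (N + N) \<le> dot (N + N + 1) (lcost (std 1 rp) ?x) z" "0 \<le> z (N + N)"
    if "lfeas (std 1 rp) ?x z" for z
  proof -
    have nn: "\<forall>r<N + N + 1. 0 \<le> z r" using that by (simp add: rp_feas)
    then have "0 \<le> (\<Sum>r<N. 4 * ?x r * z r + 4 * (1 - ?x r) * z (N + r))" by (intro sum_nonneg) auto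
    then show "z (N + N) \<le> dot (N + N + 1) (lcost (std 1 rp) ?x) z" unfolding rp_cost by simp
    show "0 \<le> z (N + N)" using nn by simp
  qed
  have opt: "lopt (std 1 rp) ?x y" unfolding lopt_def
    using yf cy cz by (force simp: lopt_std_cost rp_dims)
  have "z (N + N) = 0" if z: "lopt (std 1 rp) ?x z" for z
  proof -
    have "lfeas (std 1 rp) ?x z" "dot (N + N + 1) (lcost (std 1 rp) ?x) z \<le> 0"
      using z yf cy unfolding lopt_def by (auto simp: lopt_std_cost rp_dims)
    with cz[of z] show ?thesis by linarith
  qed
  moreover have "y (N + N) = 0" by (simp add: y_def)
  ultimately show ?thesis unfolding solvable_def using X opt by (auto simp: lopt_std_cost rp_dims)
qed

end

lemma encW_cnf_iff:
  assumes "\<forall>c\<in>set cls. \<forall>l\<in>set (fst c) \<union> set (snd c). l < N"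
  shows "encW (Wplp (red_plp F (cnf_plp N cls))) \<in> problem fx P F \<longleftrightarrow> (\<exists>v. satisfies v cls)"
proof -
  have "encW (Wplp (red_plp F (cnf_plp N cls))) \<in> problem fx P F \<longleftrightarrow> solvable P (std 1 (realp (cnf_plp N cls)))"
    by (rule encW_Wplp_iff) (simp_all add: cnf_plp_def)
  then show ?thesis using satisfies_if_solvable solvable_if_satisfies assms by blast
qed

lemma ptime_encW_cnf:
  assumes N: "ptime N" and cls: "ptime cls"
  shows "ptime (\<lambda>x. encW (Wplp (red_plp F (cnf_plp (N x) (cls x)))))"
proof -
  have "ptime (\<lambda>x. Wplp (red_plp F (cnf_plp (N x) (cls x))))"
    unfolding Wplp_def ient_def red_plp_def std_def cnf_plp_def
    by (cases F) (simp_all only: lp_form.distinct if_True if_False simp_thms plp.simps,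
      intro pt N cls ptime_comp[OF N] ptime_comp[OF cls], intro pt N cls ptime_comp[OF N] ptime_comp[OF cls])
  then show ?thesis by (rule ptime_encW)
qed

section \<open>The tableau of a verifier\<close>

text \<open>One more than the displacement of the head, which keeps positions natural numbers: what
  is at position \<open>z\<close> after a step was at \<open>z + shift mv - 1\<close> before, unless
  it was just written.\<close>

definition shift :: "move \<Rightarrow> nat" where
  "shift mv = (case mv of MoveLeft \<Rightarrow> 0 | Stay \<Rightarrow> 1 | MoveRight \<Rightarrow> 2)"

lemma shift_le: "shift mv \<le> 2"
  by (simp add: shift_def split: move.split)

text \<open>In the halting state the symbols are written back and the heads stay, so halted
  computations obey the same clauses and all can be given the length \<open>T\<close>.\<close>

definition total_delta :: "tm \<Rightarrow> nat \<Rightarrow> nat list \<Rightarrow> nat \<times> (nat \<times> move) list" where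
  "total_delta M q s = (if q < num_states M then delta M q s else (q, idle s))"

lemma tm_step_total_delta:
  "tm_step M cfg = (let e = total_delta M (fst cfg) (map read_tape (snd cfg))
     in (fst e, map2 act_tape (snd e) (snd cfg)))"
  by (cases cfg; cases "delta M (fst cfg) (map read_tape (snd cfg))") (simp add: total_delta_def map2_act_idle0)

text \<open>Cells are addressed relative to the head, so that the symbols read always sit at offset 0.
  Index \<open>num_tapes M\<close> stands for the state.\<close>

definition cell :: "tm \<Rightarrow> config \<Rightarrow> nat \<Rightarrow> int \<Rightarrow> nat" where
  "cell M cfg i d = (if i < num_tapes M then fst (snd cfg ! i) (snd (snd cfg ! i) + d) else fst cfg)"

definition wf_cfg :: "tm \<Rightarrow> config \<Rightarrow> bool" where
  "wf_cfg M cfg \<longleftrightarrow> fst cfg \<le> num_states M \<and> length (snd cfg) = num_tapes M \<and>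
     (\<forall>i<num_tapes M. \<forall>z. fst (snd cfg ! i) z < num_symbols M)"

lemma cell_less: "wf_cfg M cfg \<Longrightarrow> i < num_tapes M \<Longrightarrow> cell M cfg i d < num_symbols M"
  by (simp add: wf_cfg_def cell_def)

definition reads :: "tm \<Rightarrow> config \<Rightarrow> nat list" where
  "reads M cfg = map (\<lambda>i. cell M cfg i 0) [0..<num_tapes M]"

lemma reads_eq: "wf_cfg M cfg \<Longrightarrow> map read_tape (snd cfg) = reads M cfg"
proof (rule nth_equalityI)
  fix i assume "wf_cfg M cfg" "i < length (map read_tape (snd cfg))"
  then show "map read_tape (snd cfg) ! i = reads M cfg ! i"
    by (cases "snd cfg ! i") (simp add: reads_def cell_def wf_cfg_def)
qed (simp add: reads_def wf_cfg_def)

lemma total_delta_wf: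
  assumes "tm_wf M" "q \<le> num_states M" "length s = num_tapes M" "set s \<subseteq> {..<num_symbols M}"
  shows "fst (total_delta M q s) \<le> num_states M" "length (snd (total_delta M q s)) = num_tapes M"
    "i < num_tapes M \<Longrightarrow> fst (snd (total_delta M q s) ! i) < num_symbols M"
proof -
  have "fst (total_delta M q s) \<le> num_states M \<and> length (snd (total_delta M q s)) = num_tapes M \<and>
     fst ` set (snd (total_delta M q s)) \<subseteq> {..<num_symbols M}"
    using assms unfolding tm_wf_def total_delta_def by (auto simp: idle_def)
  then show "fst (total_delta M q s) \<le> num_states M" "length (snd (total_delta M q s)) = num_tapes M"
    "i < num_tapes M \<Longrightarrow> fst (snd (total_delta M q s) ! i) < num_symbols M"
    by (auto dest!: subsetD intro: nth_mem)
qed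

lemma act_tape_cell:
  "fst (act_tape a tp) (snd (act_tape a tp) + d) =
     (if d + int (shift (snd a)) = 1 then fst a else fst tp (snd tp + (d + int (shift (snd a)) - 1)))"
  by (cases a; cases tp; cases "snd a") (auto simp: shift_def algebra_simps)

lemma step_cell:
  assumes M: "tm_wf M" and wf: "wf_cfg M cfg"
  defines "e \<equiv> total_delta M (fst cfg) (reads M cfg)"
  shows "wf_cfg M (tm_step M cfg)" "fst (tm_step M cfg) = fst e"
    "i < num_tapes M \<Longrightarrow> cell M (tm_step M cfg) i d =
      (if d + int (shift (snd (snd e ! i))) = 1 then fst (snd e ! i)
       else cell M cfg i (d + int (shift (snd (snd e ! i))) - 1))"
    "i < num_tapes M \<Longrightarrow> \<bar>snd (snd (tm_step M cfg) ! i)\<bar> \<le> \<bar>snd (snd cfg ! i)\<bar> + 1"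
proof -
  have s: "length (reads M cfg) = num_tapes M" "set (reads M cfg) \<subseteq> {..<num_symbols M}"
    using cell_less[OF wf] by (auto simp: reads_def)
  have q: "fst cfg \<le> num_states M" and l: "length (snd cfg) = num_tapes M"
    using wf by (simp_all add: wf_cfg_def)
  note e = total_delta_wf[OF M q s, folded e_def]
  have st: "tm_step M cfg = (fst e, map2 act_tape (snd e) (snd cfg))"
    unfolding tm_step_total_delta reads_eq[OF wf] by (simp add: e_def Let_def)
  have nth: "snd (tm_step M cfg) ! i = act_tape (snd e ! i) (snd cfg ! i)" if "i < num_tapes M" for i
    using that e(2) l by (simp add: st)
  show "fst (tm_step M cfg) = fst e" by (simp add: st)
  show v: "cell M (tm_step M cfg) i d =
      (if d + int (shift (snd (snd e ! i))) = 1 then fst (snd e ! i)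
       else cell M cfg i (d + int (shift (snd (snd e ! i))) - 1))" if "i < num_tapes M" for i d
    using that by (simp add: cell_def nth act_tape_cell)
  have "fst (snd (tm_step M cfg) ! i) z < num_symbols M" if "i < num_tapes M" for i z
  proof -
    have "fst (snd (tm_step M cfg) ! i) z = cell M (tm_step M cfg) i (z - snd (snd (tm_step M cfg) ! i))"
      using that by (simp add: cell_def)
    also have "\<dots> < num_symbols M" unfolding v[OF that] using e(3)[OF that] cell_less[OF wf that] by simp
    finally show ?thesis .
  qed
  then show "wf_cfg M (tm_step M cfg)" using e l by (simp add: wf_cfg_def st)
  show "\<bar>snd (snd (tm_step M cfg) ! i)\<bar> \<le> \<bar>snd (snd cfg ! i)\<bar> + 1" if "i < num_tapes M"
    unfolding nth[OF that] by (cases "snd e ! i"; cases "snd cfg ! i"; cases "snd (snd e ! i)") auto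
qed

definition tm_run :: "tm \<Rightarrow> nat list \<Rightarrow> nat \<Rightarrow> config" where
  "tm_run M w t = (tm_step M ^^ t) (init_config M w)"

lemma tm_run_Suc: "tm_run M w (Suc t) = tm_step M (tm_run M w t)"
  by (simp add: tm_run_def)

lemma init_tapes:
  assumes "tm_wf M"
  shows "snd (tm_run M w 0) ! 0 = (tape_of w, 0)" "0 < i \<Longrightarrow> i < num_tapes M \<Longrightarrow> snd (tm_run M w 0) ! i = (tape_of [], 0)"
    "fst (tm_run M w 0) = 0" "length (snd (tm_run M w 0)) = num_tapes M"
  using assms by (auto simp: tm_run_def init_config_def tm_wf_def nth_Cons')

lemma init_cell:
  assumes "tm_wf M"
  shows "cell M (tm_run M w 0) 0 d = tape_of w d" "0 < i \<Longrightarrow> i < num_tapes M \<Longrightarrow> cell M (tm_run M w 0) i d = 0"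
    "cell M (tm_run M w 0) (num_tapes M) d = 0"
  using assms by (auto simp: cell_def init_tapes[OF assms] tape_of_def tm_wf_def)

lemma wf_tm_run:
  assumes M: "tm_wf M" and w: "set w \<subseteq> {..<4}"
  shows "wf_cfg M (tm_run M w t)"
proof (induction t)
  case 0
  have "4 \<le> num_symbols M" using M by (simp add: tm_wf_def)
  then have "tape_of w z < num_symbols M" for z
    using w by (auto simp: tape_of_def subset_iff dest!: spec[of _ "w ! nat z"])
  moreover have "tape_of [] z < num_symbols M" for z using \<open>4 \<le> _\<close> by (simp add: tape_of_def)
  ultimately have "fst (snd (tm_run M w 0) ! i) z < num_symbols M" if "i < num_tapes M" for i z
    using that init_tapes[OF M, where w = w] by (cases "i = 0") auto
  then show ?case using init_tapes[OF M, where w = w] by (simp add: wf_cfg_def)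
next
  case (Suc t)
  then show ?case unfolding tm_run_Suc by (rule step_cell(1)[OF M])
qed

lemma head_bound:
  assumes M: "tm_wf M" and w: "set w \<subseteq> {..<4}" and i: "i < num_tapes M"
  shows "\<bar>snd (snd (tm_run M w t) ! i)\<bar> \<le> int t"
proof (induction t)
  case 0
  show ?case using i init_tapes[OF M, where w = w] by (cases "i = 0") auto
next
  case (Suc t)
  then show ?case using step_cell(4)[OF M wf_tm_run[OF M w] i, of t] unfolding tm_run_Suc by simp
qed

lemma tm_computes_mono:
  assumes "tm_computes M w t out" "t \<le> t'"
  shows "fst (snd (tm_run M w t') ! 1) = tape_of out"
proof -
  obtain q ts where c: "tm_run M w t = (q, ts)" by force
  then have h: "q = num_states M" "fst (ts ! 1) = tape_of out"
    using assms(1) by (auto simp: tm_computes_def tm_run_def)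
  have "tm_run M w (t + n) = (q, ts)" for n
    by (induction n) (simp_all add: c tm_run_Suc h)
  then show ?thesis using h assms(2) by (metis le_add_diff_inverse snd_conv)
qed

subsection \<open>The clauses\<close>

text \<open>The heads move by at most one cell per step, so after \<open>t \<le> T\<close> steps the offsets up to
  \<open>2 T - t\<close> are determined by the offsets up to \<open>2 T\<close> at time 0. Offset 0 is stored at
  position \<open>2 T\<close>.\<close>

definition base :: "tm \<Rightarrow> nat \<Rightarrow> nat" where
  "base M T = 4 * T + (num_tapes M + num_symbols M + num_states M + 5)"

text \<open>A numeral in base \<open>base M T\<close>, which exceeds all tape indices, positions,
  symbols and states that occur. Hence different atoms have different indices, and all lie below the
  fourth power of the base.\<close>

definition vidx :: "tm \<Rightarrow> nat \<Rightarrow> nat \<Rightarrow> nat \<Rightarrow> nat \<Rightarrow> nat \<Rightarrow> nat" where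
  "vidx M T t i z a = ((t * base M T + i) * base M T + z) * base M T + a"

lemma mult_add_inj:
  fixes b :: nat
  assumes "x * b + y = x' * b + y'" "y < b" "y' < b"
  shows "x = x' \<and> y = y'"
  using arg_cong[OF assms(1), of "\<lambda>n. n div b"] arg_cong[OF assms(1), of "\<lambda>n. n mod b"] assms(2,3) by simp

lemma vidx_inj:
  assumes "vidx M T t i z a = vidx M T t' i' z' a'"
    "i < base M T" "z < base M T" "a < base M T" "i' < base M T" "z' < base M T" "a' < base M T"
  shows "t = t' \<and> i = i' \<and> z = z' \<and> a = a'"
  using assms mult_add_inj unfolding vidx_def by metis

lemma mult_add_less: "x < m \<Longrightarrow> y < b \<Longrightarrow> x * b + y < m * (b :: nat)"
  by (metis add.commute add_less_cancel_right less_le_trans mult_Suc mult_le_mono1 Suc_leI)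

lemma vidx_less:
  "t < base M T \<Longrightarrow> i < base M T \<Longrightarrow> z < base M T \<Longrightarrow> a < base M T \<Longrightarrow>
    vidx M T t i z a < base M T * base M T * base M T * base M T"
  unfolding vidx_def by (intro mult_add_less)

type_synonym row = "nat \<times> nat list \<times> nat \<times> (nat \<times> nat) list"

text \<open>For a fixed machine this table is a constant, and the transition function enters the
  clauses only through it; the reduction can thus write them although \<open>delta\<close> is an
  arbitrary function.\<close>

definition delta_rows :: "tm \<Rightarrow> row list" where
  "delta_rows M = concat (map (\<lambda>q. map (\<lambda>s. (q, s, fst (total_delta M q s),
       map (\<lambda>a. (fst a, shift (snd a))) (snd (total_delta M q s))))
     (List.n_lists (num_tapes M) [0..<num_symbols M])) [0..<num_states M + 1])"

definition row_pre :: "tm \<Rightarrow> nat \<Rightarrow> nat \<Rightarrow> row \<Rightarrow> nat list" where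
  "row_pre M T t r = vidx M T t (num_tapes M) (2 * T) (fst r) #
     map (\<lambda>i. vidx M T t i (2 * T) (nthd 0 (fst (snd r)) i)) [0..<num_tapes M]"

text \<open>The position \<open>z\<close> with \<open>z + snd a = 2 * T + 1\<close> held the scanned
  cell and receives the written symbol. Every other one takes over the symbol from
  \<open>z + snd a - 1\<close>; if this falls outside the window, nothing is demanded.\<close>

definition cell_clauses :: "tm \<Rightarrow> nat \<Rightarrow> nat \<Rightarrow> row \<Rightarrow> nat \<Rightarrow> nat \<Rightarrow> nat \<times> nat \<Rightarrow> clause list" where
  "cell_clauses M T t r i z a =
     (if z + snd a = 2 * T + 1 then [([vidx M T (t + 1) i z (fst a)], row_pre M T t r)]
      else if 1 \<le> z + snd a \<and> z + snd a \<le> 4 * T + 1 then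
        map (\<lambda>b. ([vidx M T (t + 1) i z b], vidx M T t i (z + snd a - 1) b # row_pre M T t r)) [0..<num_symbols M]
      else [])"

definition row_clauses :: "tm \<Rightarrow> nat \<Rightarrow> nat \<Rightarrow> row \<Rightarrow> clause list" where
  "row_clauses M T t r = ([vidx M T (t + 1) (num_tapes M) (2 * T) (fst (snd (snd r)))], row_pre M T t r) #
     concat (map (\<lambda>i. concat (map (\<lambda>z. cell_clauses M T t r i z (nthd (0, 0) (snd (snd (snd r))) i))
       [0..<4 * T + 1])) [0..<num_tapes M])"

text \<open>Symbols permitted on the input tape: the cells behind the separator are left open, as
  they hold the witness, of length at most \<open>m\<close>.\<close>

definition init_symbols :: "bool list \<Rightarrow> nat \<Rightarrow> nat \<Rightarrow> nat \<Rightarrow> nat list" where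
  "init_symbols x m T z = (if z < 2 * T then [0]
     else if z - 2 * T < length x then [if nthd False x (z - 2 * T) then 2 else 1]
     else if z - 2 * T = length x then [3]
     else if z - 2 * T \<le> length x + m then [0, 1, 2] else [0])"

text \<open>The last family propagates blanks to the right of the separator, so that the open cells
  form one word followed by blanks.\<close>

definition init_clauses :: "tm \<Rightarrow> bool list \<Rightarrow> nat \<Rightarrow> nat \<Rightarrow> clause list" where
  "init_clauses M x m T = ([vidx M T 0 (num_tapes M) (2 * T) 0], []) #
     concat (map (\<lambda>i. map (\<lambda>z. ([vidx M T 0 i z 0], [])) [0..<4 * T + 1]) [1..<num_tapes M]) @
     map (\<lambda>z. (map (\<lambda>a. vidx M T 0 0 z a) (init_symbols x m T z), [])) [0..<4 * T + 1] @
     map (\<lambda>z. ([vidx M T 0 0 (z + 1) 0], [vidx M T 0 0 z 0])) (filter (\<lambda>z. 2 * T + length x < z) [0..<4 * T])"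

text \<open>The output is the single symbol 2 or 1, so acceptance means absence of 1. The offset of
  the output cell depends on the final head position, which is why 1 is excluded at every position
  of the window.\<close>

definition tableau :: "tm \<Rightarrow> bool list \<Rightarrow> nat \<Rightarrow> nat \<Rightarrow> clause list" where
  "tableau M x m T = init_clauses M x m T @
     concat (map (\<lambda>t. concat (map (\<lambda>r. row_clauses M T t r) (delta_rows M))) [0..<T]) @
     map (\<lambda>z. ([], [vidx M T T 1 z 1])) [0..<4 * T + 1]"

lemma ptime_vidx:
  fixes T :: "'a::repr \<Rightarrow> nat"
  assumes "ptime T" "ptime t" "ptime i" "ptime z" "ptime a"
  shows "ptime (\<lambda>x. vidx M (T x) (t x) (i x) (z x) (a x))"
  unfolding vidx_def base_def by (intro pt assms)

lemma ptime_row_pre: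
  fixes T :: "'a::repr \<Rightarrow> nat"
  assumes "ptime T" "ptime t" "ptime r"
  shows "ptime (\<lambda>x. row_pre M (T x) (t x) (r x))"
  unfolding row_pre_def by (intro ptime_vidx pt ptime_comp[OF assms(1)] ptime_comp[OF assms(2)] ptime_comp[OF assms(3)])

lemma ptime_cell_clauses:
  fixes T :: "'a::repr \<Rightarrow> nat"
  assumes "ptime T" "ptime t" "ptime r" "ptime i" "ptime z" "ptime a"
  shows "ptime (\<lambda>x. cell_clauses M (T x) (t x) (r x) (i x) (z x) (a x))"
  unfolding cell_clauses_def
  by (intro ptime_vidx ptime_row_pre pt ptime_comp[OF assms(1)] ptime_comp[OF assms(2)] ptime_comp[OF assms(3)]
    ptime_comp[OF assms(4)] ptime_comp[OF assms(5)] ptime_comp[OF assms(6)])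

lemma ptime_row_clauses:
  fixes T :: "'a::repr \<Rightarrow> nat"
  assumes "ptime T" "ptime t" "ptime r"
  shows "ptime (\<lambda>x. row_clauses M (T x) (t x) (r x))"
  unfolding row_clauses_def
  by (intro ptime_vidx ptime_row_pre ptime_cell_clauses pt ptime_comp[OF assms(1)] ptime_comp[OF assms(2)] ptime_comp[OF assms(3)])

lemma ptime_tableau:
  assumes "ptime m" "ptime T"
  shows "ptime (\<lambda>x. tableau M x (m x) (T x))"
  unfolding tableau_def init_clauses_def init_symbols_def
  by (intro ptime_vidx ptime_row_clauses pt ptime_comp[OF assms(1)] ptime_comp[OF assms(2)])

lemma delta_rows_iff:
  "r \<in> set (delta_rows M) \<longleftrightarrow> (\<exists>q s. q \<le> num_states M \<and> length s = num_tapes M \<and> set s \<subseteq> {..<num_symbols M} \<and>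
     r = (q, s, fst (total_delta M q s), map (\<lambda>a. (fst a, shift (snd a))) (snd (total_delta M q s))))"
  by (auto simp: delta_rows_def set_n_lists less_Suc_eq_le image_iff lessThan_atLeast0)

lemma tableau_bound:
  assumes M: "tm_wf M" and c: "c \<in> set (tableau M x m T)" and l: "l \<in> set (fst c) \<union> set (snd c)"
  shows "l < base M T * base M T * base M T * base M T"
proof -
  let ?B = "base M T * base M T * base M T * base M T"
  have A: "4 \<le> num_symbols M" and k: "2 \<le> num_tapes M" using M by (simp_all add: tm_wf_def)
  have b: "vidx M T t i z a < ?B" if "t \<le> T" "i \<le> num_tapes M" "z \<le> 4 * T + 1" "a < num_symbols M + num_states M + 1" for t i z a
    using that by (intro vidx_less) (auto simp: base_def)
  have pre: "l < ?B" if "r \<in> set (delta_rows M)" "t < T" "l \<in> set (row_pre M T t r)" for r t l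
  proof -
    obtain q s where r: "q \<le> num_states M" "length s = num_tapes M" "set s \<subseteq> {..<num_symbols M}" "fst r = q" "fst (snd r) = s"
      using \<open>r \<in> set (delta_rows M)\<close> unfolding delta_rows_iff by auto
    have "s ! i < num_symbols M" if "i < num_tapes M" for i using r(2,3) that by (auto simp: subset_iff)
    then have "s ! i < num_symbols M + num_states M + 1" if "i < num_tapes M" for i using that by fastforce
    with \<open>t < T\<close> \<open>l \<in> _\<close> r show ?thesis unfolding row_pre_def by (auto simp: nthd_nth intro!: b)
  qed
  consider "c \<in> set (init_clauses M x m T)" | t r where "t < T" "r \<in> set (delta_rows M)" "c \<in> set (row_clauses M T t r)"
    | z where "z < 4 * T + 1" "c = ([], [vidx M T T 1 z 1])"
    using c unfolding tableau_def by (auto simp del: upt_Suc)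
  then show ?thesis
  proof cases
    case 1
    have "a < 4" if "a \<in> set (init_symbols x m T z)" for a z
      using that by (auto simp: init_symbols_def split: if_splits)
    then have "a < num_symbols M + num_states M + 1" if "a \<in> set (init_symbols x m T z)" for a z
      using that A by fastforce
    then show ?thesis using 1 l A k unfolding init_clauses_def by (auto intro!: b)
  next
    case 2
    obtain q s where q: "q \<le> num_states M" "length s = num_tapes M" "set s \<subseteq> {..<num_symbols M}"
      and r: "r = (q, s, fst (total_delta M q s), map (\<lambda>a. (fst a, shift (snd a))) (snd (total_delta M q s)))"
      using 2(2) unfolding delta_rows_iff by auto
    note e = total_delta_wf[OF M q]
    have "fst (snd (snd r)) < num_symbols M + num_states M + 1"
      "\<And>i. i < num_tapes M \<Longrightarrow> fst (nthd (0, 0) (snd (snd (snd r))) i) < num_symbols M + num_states M + 1"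
      using e by (auto simp: r nthd_nth intro!: le_imp_less_Suc trans_le_add2 trans_less_add1 less_SucI)
    with 2(1,3) l show ?thesis unfolding row_clauses_def cell_clauses_def
      by (auto intro!: b dest: pre[OF 2(2,1)] split: if_splits)
  next
    case 3
    then show ?thesis using l A k by (auto intro!: b)
  qed
qed

lemma satisfies_append: "satisfies v (cs @ ds) \<longleftrightarrow> satisfies v cs \<and> satisfies v ds"
  by (auto simp: satisfies_def)

lemma satisfies_Cons: "satisfies v (c # cs) \<longleftrightarrow> satisfies v [c] \<and> satisfies v cs"
  by (auto simp: satisfies_def)

lemma satisfies_unit: "satisfies v [(ps, ns)] \<longleftrightarrow> (\<forall>l\<in>set ns. v l) \<longrightarrow> (\<exists>l\<in>set ps. v l)"
  by (auto simp: satisfies_def)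

lemma satisfies_map: "satisfies v (map f xs) \<longleftrightarrow> (\<forall>x\<in>set xs. satisfies v [f x])"
  by (auto simp: satisfies_def)

lemma satisfies_concat: "satisfies v (concat (map f xs)) \<longleftrightarrow> (\<forall>x\<in>set xs. satisfies v (f x))"
  by (auto simp: satisfies_def)

lemmas satisfies_simps = satisfies_append satisfies_Cons[of _ _ "_ # _"] satisfies_Cons[of _ _ "_ @ _"]
  satisfies_Cons[of _ _ "concat _"] satisfies_unit satisfies_map satisfies_concat

lemma satisfies_init_clauses:
  fixes v :: "nat \<Rightarrow> bool" and M T
  defines "V \<equiv> \<lambda>t i z a. v (vidx M T t i z a)"
  shows "satisfies v (init_clauses M x m T) \<longleftrightarrow> V 0 (num_tapes M) (2 * T) 0 \<and>
    (\<forall>i z. 1 \<le> i \<and> i < num_tapes M \<and> z \<le> 4 * T \<longrightarrow> V 0 i z 0) \<and>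
    (\<forall>z\<le>4 * T. \<exists>a\<in>set (init_symbols x m T z). V 0 0 z a) \<and>
    (\<forall>z. 2 * T + length x < z \<and> z < 4 * T \<and> V 0 0 z 0 \<longrightarrow> V 0 0 (z + 1) 0)"
  unfolding init_clauses_def satisfies_simps V_def by (auto simp: less_Suc_eq_le simp del: upt_Suc)

lemma satisfies_row_clauses:
  fixes v :: "nat \<Rightarrow> bool" and M T
  defines "V \<equiv> \<lambda>t i z a. v (vidx M T t i z a)"
  shows "satisfies v (row_clauses M T t r) \<longleftrightarrow>
    (V t (num_tapes M) (2 * T) (fst r) \<and> (\<forall>i<num_tapes M. V t i (2 * T) (nthd 0 (fst (snd r)) i)) \<longrightarrow>
      V (t + 1) (num_tapes M) (2 * T) (fst (snd (snd r))) \<and>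
      (\<forall>i z. i < num_tapes M \<and> z \<le> 4 * T \<longrightarrow> (let a = nthd (0, 0) (snd (snd (snd r))) i in
        if z + snd a = 2 * T + 1 then V (t + 1) i z (fst a)
        else 1 \<le> z + snd a \<and> z + snd a \<le> 4 * T + 1 \<longrightarrow>
          (\<forall>b<num_symbols M. V t i (z + snd a - 1) b \<longrightarrow> V (t + 1) i z b))))"
proof -
  have pre: "(\<forall>l\<in>set (row_pre M T t r). v l) \<longleftrightarrow>
      V t (num_tapes M) (2 * T) (fst r) \<and> (\<forall>i<num_tapes M. V t i (2 * T) (nthd 0 (fst (snd r)) i))"
    by (auto simp: row_pre_def V_def)
  have cell: "satisfies v (cell_clauses M T t r i z a) \<longleftrightarrow> ((\<forall>l\<in>set (row_pre M T t r). v l) \<longrightarrow>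
        (if z + snd a = 2 * T + 1 then V (t + 1) i z (fst a)
        else 1 \<le> z + snd a \<and> z + snd a \<le> 4 * T + 1 \<longrightarrow>
          (\<forall>b<num_symbols M. V t i (z + snd a - 1) b \<longrightarrow> V (t + 1) i z b)))" for i z a
    unfolding cell_clauses_def V_def by (simp add: satisfies_simps) (auto simp: satisfies_def)
  show ?thesis unfolding row_clauses_def satisfies_simps cell pre[symmetric] Let_def
    by (auto simp: V_def less_Suc_eq_le simp del: One_nat_def upt_Suc)
qed

lemma satisfies_tableau:
  "satisfies v (tableau M x m T) \<longleftrightarrow> satisfies v (init_clauses M x m T) \<and>
    (\<forall>t<T. \<forall>r\<in>set (delta_rows M). satisfies v (row_clauses M T t r)) \<and>
    (\<forall>z\<le>4 * T. \<not> v (vidx M T T 1 z 1))"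
  unfolding tableau_def satisfies_simps by (auto simp: less_Suc_eq_le simp del: upt_Suc)

subsection \<open>Satisfying assignments are accepting computations\<close>

definition vinput :: "bool list \<Rightarrow> bool list \<Rightarrow> nat list" where
  "vinput x u = bits x @ [3] @ bits u"

lemma vinput_symbols: "set (vinput x u) \<subseteq> {..<4}"
  by (auto simp: vinput_def bits_def)

lemma tape_of_vinput:
  "tape_of (vinput x u) (int j) = (if j < length x then if x ! j then 2 else 1
     else if j = length x then 3
     else if j \<le> length x + length u then if u ! (j - length x - 1) then 2 else 1 else 0)"
  by (auto simp: tape_of_def vinput_def bits_def nth_append nth_Cons')

lemma tape_of_neg: "z < 0 \<Longrightarrow> tape_of w z = 0"
  by (simp add: tape_of_def)

lemma row_of_cfg:
  assumes M: "tm_wf M" and wf: "wf_cfg M cfg"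
  defines "e \<equiv> total_delta M (fst cfg) (reads M cfg)"
  shows "(fst cfg, reads M cfg, fst e, map (\<lambda>a. (fst a, shift (snd a))) (snd e)) \<in> set (delta_rows M)"
  unfolding delta_rows_iff e_def using wf cell_less[OF wf] by (auto simp: reads_def wf_cfg_def)

lemma nthd_acts:
  assumes M: "tm_wf M" and wf: "wf_cfg M cfg" and i: "i < num_tapes M"
  defines "e \<equiv> total_delta M (fst cfg) (reads M cfg)"
  shows "nthd (0, 0) (map (\<lambda>a. (fst a, shift (snd a))) (snd e)) i = (fst (snd e ! i), shift (snd (snd e ! i)))"
proof -
  have "length (snd e) = num_tapes M"
    unfolding e_def using wf cell_less[OF wf] by (intro total_delta_wf(2)[OF M]) (auto simp: reads_def wf_cfg_def)
  then show ?thesis using i by (simp add: nthd_nth)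
qed

lemma nthd_reads: "i < num_tapes M \<Longrightarrow> nthd 0 (reads M cfg) i = cell M cfg i 0"
  by (simp add: reads_def nthd_nth)

text \<open>A satisfying assignment may claim several symbols for one cell, but those of the actual
  computation are always among them. After \<open>t\<close> steps this is known at positions
  \<open>t\<close> to \<open>4 * T - t\<close>, since each step loses one at either end.\<close>

lemma computation_true:
  fixes v :: "nat \<Rightarrow> bool"
  assumes M: "tm_wf M" and w: "set w \<subseteq> {..<4}" and t: "t \<le> T"
    and step: "\<forall>t<T. \<forall>r\<in>set (delta_rows M). satisfies v (row_clauses M T t r)"
    and state: "v (vidx M T 0 (num_tapes M) (2 * T) 0)"
    and cells: "\<And>i z. i < num_tapes M \<Longrightarrow> z \<le> 4 * T \<Longrightarrow> v (vidx M T 0 i z (cell M (tm_run M w 0) i (int z - int (2 * T))))"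
  shows "v (vidx M T t (num_tapes M) (2 * T) (fst (tm_run M w t))) \<and>
    (\<forall>i z. i < num_tapes M \<and> t \<le> z \<and> z + t \<le> 4 * T \<longrightarrow>
       v (vidx M T t i z (cell M (tm_run M w t) i (int z - int (2 * T)))))"
  using t
proof (induction t)
  case 0
  show ?case using state cells init_tapes(3)[OF M] by simp
next
  case (Suc t)
  let ?c = "tm_run M w t" and ?V = "\<lambda>t i z a. v (vidx M T t i z a)"
  note wf = wf_tm_run[OF M w, of t]
  define e where "e = total_delta M (fst ?c) (reads M ?c)"
  have IH: "?V t (num_tapes M) (2 * T) (fst ?c)"
    "\<And>i z. i < num_tapes M \<Longrightarrow> t \<le> z \<Longrightarrow> z + t \<le> 4 * T \<Longrightarrow> ?V t i z (cell M ?c i (int z - int (2 * T)))"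
    using Suc by auto
  \<comment> \<open>The scanned cells, at position \<open>2 * T\<close>, are still in the window
    because \<open>t < T\<close>.\<close>
  have pre: "?V t i (2 * T) (nthd 0 (reads M ?c) i)" if "i < num_tapes M" for i
    using IH(2)[OF that, of "2 * T"] Suc.prems by (simp add: nthd_reads that)
  have "satisfies v (row_clauses M T t (fst ?c, reads M ?c, fst e, map (\<lambda>a. (fst a, shift (snd a))) (snd e)))"
    using step Suc.prems row_of_cfg[OF M wf, folded e_def] by (meson Suc_le_lessD)
  from this[unfolded satisfies_row_clauses fst_conv snd_conv] IH(1) pre
  have new: "?V (t + 1) (num_tapes M) (2 * T) (fst e)"
    "\<And>i z. i < num_tapes M \<Longrightarrow> z \<le> 4 * T \<Longrightarrow>
      (let a = (fst (snd e ! i), shift (snd (snd e ! i))) in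
        if z + snd a = 2 * T + 1 then ?V (t + 1) i z (fst a)
        else 1 \<le> z + snd a \<and> z + snd a \<le> 4 * T + 1 \<longrightarrow>
          (\<forall>b<num_symbols M. ?V t i (z + snd a - 1) b \<longrightarrow> ?V (t + 1) i z b))"
    using nthd_acts[OF M wf, folded e_def] by simp_all
  have "?V (Suc t) i z (cell M (tm_run M w (Suc t)) i (int z - int (2 * T)))"
    if i: "i < num_tapes M" and z: "Suc t \<le> z" "z + Suc t \<le> 4 * T" for i z
  proof -
    let ?s = "shift (snd (snd e ! i))"
    note cell = step_cell(3)[OF M wf i, folded e_def tm_run_Suc, of "int z - int (2 * T)"]
    have s: "?s \<le> 2" by (rule shift_le)
    note n = new(2)[OF i, of z, unfolded Let_def fst_conv snd_conv]
    show ?thesis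
    proof (cases "z + ?s = 2 * T + 1")
      case True
      then have "int z - int (2 * T) + int ?s = 1" by linarith
      then show ?thesis using n True z unfolding cell by simp
    next
      case False
      then have d: "int z - int (2 * T) + int ?s \<noteq> 1" by linarith
      have eq: "int z - int (2 * T) + int ?s - 1 = int (z + ?s - 1) - int (2 * T)" using z by linarith
      then have v: "cell M (tm_run M w (Suc t)) i (int z - int (2 * T)) = cell M ?c i (int (z + ?s - 1) - int (2 * T))"
        unfolding cell eq by (simp only: d if_False)
      have "?V t i (z + ?s - 1) (cell M ?c i (int (z + ?s - 1) - int (2 * T)))"
        using z s by (intro IH(2) i) linarith+
      moreover have "1 \<le> z + ?s" "z + ?s \<le> 4 * T + 1" "z \<le> 4 * T" using z s by linarith+
      ultimately show ?thesis using n False cell_less[OF wf i] unfolding v by simp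
    qed
  qed
  moreover have "fst (tm_run M w (Suc t)) = fst e"
    using step_cell(2)[OF M wf] by (simp add: tm_run_Suc e_def)
  ultimately show ?case using new(1) by simp
qed

lemma satisfying_witness:
  assumes M: "tm_wf M" and v: "satisfies v (tableau M x m T)"
  obtains u where "length u \<le> m" "fst (snd (tm_run M (vinput x u) T) ! 1) 0 \<noteq> 1"
proof -
  let ?V = "\<lambda>t i z a. v (vidx M T t i z a)"
  have init: "?V 0 (num_tapes M) (2 * T) 0"
    "\<And>i z. 1 \<le> i \<Longrightarrow> i < num_tapes M \<Longrightarrow> z \<le> 4 * T \<Longrightarrow> ?V 0 i z 0"
    "\<And>z. z \<le> 4 * T \<Longrightarrow> \<exists>a\<in>set (init_symbols x m T z). ?V 0 0 z a"
    "\<And>z. 2 * T + length x < z \<Longrightarrow> z < 4 * T \<Longrightarrow> ?V 0 0 z 0 \<Longrightarrow> ?V 0 0 (z + 1) 0"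
    and step: "\<forall>t<T. \<forall>r\<in>set (delta_rows M). satisfies v (row_clauses M T t r)"
    and final: "\<And>z. z \<le> 4 * T \<Longrightarrow> \<not> ?V T 1 z 1"
    using v unfolding satisfies_tableau satisfies_init_clauses by blast+
  define b where "b = 2 * T + length x + 1"
  \<comment> \<open>The witness ends at the first open cell that may be blank, or after
    \<open>m\<close> cells. Before that, each cell admits 1 or 2, and 2 is preferred; from there on
    blanks propagate.\<close>
  define n where "n = (LEAST j. j = m \<or> ?V 0 0 (b + j) 0)"
  define u where "u = map (\<lambda>j. ?V 0 0 (b + j) 2) [0..<n]"
  have n: "n = m \<or> ?V 0 0 (b + n) 0" unfolding n_def by (rule LeastI[of _ m]) simp
  have nm: "n \<le> m" unfolding n_def by (rule Least_le) simp
  have before: "\<not> ?V 0 0 (b + j) 0" if "j < n" for j using not_less_Least that unfolding n_def by blast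
  have after: "?V 0 0 (b + j) 0" if "n \<le> j" "j < m" "b + j \<le> 4 * T" for j
    using that
  proof (induction j rule: dec_induct)
    case base
    then show ?case using n by simp
  next
    case (step j)
    then show ?case using init(4)[of "b + j"] by (simp add: b_def)
  qed
  have first: "?V 0 0 z (tape_of (vinput x u) (int z - int (2 * T)))" if z: "z \<le> 4 * T" for z
  proof (cases "z < 2 * T")
    case True
    then show ?thesis using init(3)[OF z] by (simp add: init_symbols_def tape_of_neg)
  next
    case False
    define j where "j = z - 2 * T"
    have j: "z = 2 * T + j" "int z - int (2 * T) = int j" using False by (simp_all add: j_def)
    show ?thesis
    proof (cases "length x < j \<and> j \<le> length x + m")
      case False
      then show ?thesis using init(3)[OF z] nm unfolding j(2) tape_of_vinput
        by (auto simp: init_symbols_def j(1) nthd_nth u_def split: if_splits)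
    next
      case True
      define i where "i = j - length x - 1"
      have i: "j = length x + 1 + i" "i < m" using True by (auto simp: i_def)
      have zi: "z = b + i" by (simp add: b_def j(1) i(1))
      have "?V 0 0 z 0 \<or> ?V 0 0 z 1 \<or> ?V 0 0 z 2"
        using init(3)[OF z] True by (auto simp: init_symbols_def j(1))
      then show ?thesis using before[of i] after[of i] i z unfolding j(2) tape_of_vinput
        by (auto simp: zi u_def)
    qed
  qed
  note sy = vinput_symbols[of x u]
  have cells: "?V 0 i z (cell M (tm_run M (vinput x u) 0) i (int z - int (2 * T)))" if "i < num_tapes M" "z \<le> 4 * T" for i z
    using first[OF that(2)] init(2)[OF _ that] that(1) by (cases "i = 0") (simp_all add: init_cell[OF M])
  have one: "1 < num_tapes M" using M by (simp add: tm_wf_def)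
  let ?tp = "snd (tm_run M (vinput x u) T) ! 1"
  have h: "\<bar>snd ?tp\<bar> \<le> int T" by (rule head_bound[OF M sy one])
  \<comment> \<open>The position of the absolute cell 0 of the output tape, relative to the head.
    The head is at most \<open>T\<close> away from 0, so this lies between \<open>T\<close> and
    \<open>3 * T\<close>, inside the window at time \<open>T\<close>.\<close>
  let ?z = "nat (int (2 * T) - snd ?tp)"
  have "?V T 1 ?z (cell M (tm_run M (vinput x u) T) 1 (int ?z - int (2 * T)))"
  proof (rule conjunct2[OF computation_true[OF M sy order_refl step init(1) cells], rule_format])
    show "1 < num_tapes M \<and> T \<le> ?z \<and> ?z + T \<le> 4 * T" using one h by linarith
  qed
  also have "cell M (tm_run M (vinput x u) T) 1 (int ?z - int (2 * T)) = fst ?tp 0"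
  proof -
    have "snd ?tp \<le> 2 * int T" using h by linarith
    then show ?thesis using one by (simp add: cell_def)
  qed
  finally have "fst ?tp 0 \<noteq> 1" using final[of ?z] h by auto
  then show thesis using that[of u] nm by (simp add: u_def)
qed

lemma satisfiable_if_accepted:
  assumes M: "tm_wf M" and u: "length u \<le> m" and acc: "\<And>z. fst (snd (tm_run M (vinput x u) T) ! 1) z \<noteq> 1"
  shows "\<exists>v. satisfies v (tableau M x m T)"
proof -
  define C where "C = tm_run M (vinput x u)"
  \<comment> \<open>True exactly on the codes of the facts about the actual computation; the bounds
    by \<open>base M T\<close> make the code decodable.\<close>
  define v where "v = (\<lambda>l. \<exists>t i z a. i < base M T \<and> z < base M T \<and> a < base M T \<and> l = vidx M T t i z a \<and>
    a = cell M (C t) i (int z - int (2 * T)))"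
  have V: "v (vidx M T t i z a) \<longleftrightarrow> a = cell M (C t) i (int z - int (2 * T))"
    if "i < base M T" "z < base M T" "a < base M T" for t i z a
  proof
    assume "v (vidx M T t i z a)"
    then show "a = cell M (C t) i (int z - int (2 * T))" unfolding v_def using vidx_inj that by blast
  next
    assume "a = cell M (C t) i (int z - int (2 * T))"
    then show "v (vidx M T t i z a)" unfolding v_def using that by blast
  qed
  have k: "2 \<le> num_tapes M" and A: "4 \<le> num_symbols M" using M by (simp_all add: tm_wf_def)
  have b: "i < base M T" if "i \<le> 4 * T + num_tapes M + num_symbols M + num_states M + 4" for i
    using that by (simp add: base_def)
  note wf = wf_tm_run[OF M vinput_symbols[of x u], folded C_def]
  note iv = init_cell[OF M, where w = "vinput x u", folded C_def]
  have "satisfies v (init_clauses M x m T)"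
    unfolding satisfies_init_clauses
  proof (intro conjI allI impI)
    show "v (vidx M T 0 (num_tapes M) (2 * T) 0)" by (subst V) (simp_all add: b iv)
  next
    fix i z assume "1 \<le> i \<and> i < num_tapes M \<and> z \<le> 4 * T"
    then show "v (vidx M T 0 i z 0)" by (subst V) (simp_all add: b iv)
  next
    fix z assume z: "z \<le> 4 * T"
    let ?a = "tape_of (vinput x u) (int z - int (2 * T))"
    have "?a \<in> set (init_symbols x m T z)"
    proof (cases "z < 2 * T")
      case True
      then show ?thesis by (simp add: init_symbols_def tape_of_neg)
    next
      case False
      define j where "j = z - 2 * T"
      have j: "z = 2 * T + j" "int z - int (2 * T) = int j" using False by (simp_all add: j_def)
      show ?thesis unfolding j(2) tape_of_vinput using u by (auto simp: init_symbols_def j(1) nthd_nth)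
    qed
    moreover have "?a < 4" using \<open>?a \<in> _\<close> by (auto simp: init_symbols_def split: if_splits)
    then have "v (vidx M T 0 0 z ?a)" using z by (subst V) (simp_all add: b iv)
    ultimately show "\<exists>a\<in>set (init_symbols x m T z). v (vidx M T 0 0 z a)" by blast
  next
    fix z assume z: "2 * T + length x < z \<and> z < 4 * T \<and> v (vidx M T 0 0 z 0)"
    define j where "j = z - 2 * T"
    have j: "z = 2 * T + j" "int z - int (2 * T) = int j" "int (z + 1) - int (2 * T) = int (j + 1)" "length x < j"
      using z by (auto simp: j_def)
    have "tape_of (vinput x u) (int j) = 0" using z V[of 0 z 0 0] by (simp add: b iv j(2)[symmetric])
    then have "tape_of (vinput x u) (int (j + 1)) = 0"
      using j(4) unfolding tape_of_vinput by (auto split: if_splits)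
    then have "cell M (C 0) 0 (int (z + 1) - int (2 * T)) = 0" unfolding iv j(3) .
    then show "v (vidx M T 0 0 (z + 1) 0)" by (subst V) (use z in \<open>simp_all add: b\<close>)
  qed
  moreover have "satisfies v (row_clauses M T t r)" if t: "t < T" and r: "r \<in> set (delta_rows M)" for t r
    unfolding satisfies_row_clauses
  proof (rule impI)
    obtain q s where q: "q \<le> num_states M" "length s = num_tapes M" "set s \<subseteq> {..<num_symbols M}"
      and r_def: "r = (q, s, fst (total_delta M q s), map (\<lambda>a. (fst a, shift (snd a))) (snd (total_delta M q s)))"
      using r unfolding delta_rows_iff by blast
    have s: "s ! i < num_symbols M" if "i < num_tapes M" for i using q that by (auto simp: subset_iff)
    assume pre: "v (vidx M T t (num_tapes M) (2 * T) (fst r)) \<and>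
      (\<forall>i<num_tapes M. v (vidx M T t i (2 * T) (nthd 0 (fst (snd r)) i)))"
    then have qt: "q = fst (C t)" using q by (subst (asm) V) (simp_all add: b r_def cell_def)
    have st: "s = reads M (C t)"
    proof (rule nth_equalityI)
      fix i assume "i < length s"
      then have i: "i < num_tapes M" by (simp add: q)
      then have "v (vidx M T t i (2 * T) (s ! i))" using pre by (simp add: r_def nthd_nth q)
      then show "s ! i = reads M (C t) ! i" using i s[OF i] by (subst (asm) V) (simp_all add: b reads_def)
    qed (simp add: q reads_def)
    define e where "e = total_delta M (fst (C t)) (reads M (C t))"
    have r_eq: "fst (snd (snd r)) = fst e" "snd (snd (snd r)) = map (\<lambda>a. (fst a, shift (snd a))) (snd e)"
      by (simp_all add: r_def e_def qt st)
    have Cs: "C (t + 1) = tm_step M (C t)" by (simp add: C_def tm_run_Suc)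
    have e: "fst e \<le> num_states M" "\<And>i. i < num_tapes M \<Longrightarrow> fst (snd e ! i) < num_symbols M"
      using total_delta_wf[OF M q] unfolding e_def qt st by auto
    show "v (vidx M T (t + 1) (num_tapes M) (2 * T) (fst (snd (snd r)))) \<and>
      (\<forall>i z. i < num_tapes M \<and> z \<le> 4 * T \<longrightarrow> (let a = nthd (0, 0) (snd (snd (snd r))) i in
        if z + snd a = 2 * T + 1 then v (vidx M T (t + 1) i z (fst a))
        else 1 \<le> z + snd a \<and> z + snd a \<le> 4 * T + 1 \<longrightarrow>
          (\<forall>b<num_symbols M. v (vidx M T t i (z + snd a - 1) b) \<longrightarrow> v (vidx M T (t + 1) i z b))))"
      unfolding r_eq
    proof (intro conjI allI impI)
      show "v (vidx M T (t + 1) (num_tapes M) (2 * T) (fst e))"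
        using e(1) step_cell(2)[OF M wf, of t, folded Cs e_def] by (subst V) (simp_all add: b cell_def)
    next
      fix i z assume iz: "i < num_tapes M \<and> z \<le> 4 * T"
      then have i: "i < num_tapes M" and z: "z \<le> 4 * T" by auto
      let ?s = "shift (snd (snd e ! i))"
      note cell = step_cell(3)[OF M wf i, of t, folded e_def Cs, of "int z - int (2 * T)"]
      have bi: "i < base M T" "z < base M T" using i z by (simp_all add: b)
      have ba: "a < base M T" if "a < num_symbols M" for a using that by (simp add: b)
      have "v (vidx M T (t + 1) i z (fst (snd e ! i)))" if "z + ?s = 2 * T + 1"
      proof -
        have "int z - int (2 * T) + int ?s = 1" using that by linarith
        then show ?thesis unfolding V[OF bi ba[OF e(2)[OF i]]] cell by simp
      qed
      moreover have "v (vidx M T (t + 1) i z a)"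
        if "z + ?s \<noteq> 2 * T + 1" "1 \<le> z + ?s" "z + ?s \<le> 4 * T + 1" "a < num_symbols M" "v (vidx M T t i (z + ?s - 1) a)" for a
      proof -
        have "z + ?s - 1 < base M T" using that(3) by (simp add: b)
        then have a: "a = cell M (C t) i (int (z + ?s - 1) - int (2 * T))" using that(5) V bi(1) ba[OF that(4)] by blast
        have n1: "int z - int (2 * T) + int ?s \<noteq> 1"
          and eq: "int (z + ?s - 1) - int (2 * T) = int z - int (2 * T) + int ?s - 1"
          using that(1,2) by linarith+
        show ?thesis using a unfolding V[OF bi ba[OF that(4)]] cell by (simp only: n1 if_False eq)
      qed
      ultimately show "let a = nthd (0, 0) (map (\<lambda>a. (fst a, shift (snd a))) (snd e)) i in
        if z + snd a = 2 * T + 1 then v (vidx M T (t + 1) i z (fst a))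
        else 1 \<le> z + snd a \<and> z + snd a \<le> 4 * T + 1 \<longrightarrow>
          (\<forall>b<num_symbols M. v (vidx M T t i (z + snd a - 1) b) \<longrightarrow> v (vidx M T (t + 1) i z b))"
        unfolding nthd_acts[OF M wf i, of t, folded e_def] Let_def fst_conv snd_conv by presburger
    qed
  qed
  moreover have "\<not> v (vidx M T T 1 z 1)" if "z \<le> 4 * T" for z
    using that k A acc[symmetric] by (subst V) (auto simp: b cell_def C_def)
  ultimately show ?thesis unfolding satisfies_tableau by blast
qed

lemma satisfiable_tableau_iff:
  assumes M: "tm_wf M"
    and run: "\<And>u. length u \<le> m \<Longrightarrow> tm_computes M (vinput x u) (t u) (bits [V x u]) \<and> t u \<le> T"
  shows "(\<exists>v. satisfies v (tableau M x m T)) \<longleftrightarrow> (\<exists>u. length u \<le> m \<and> V x u)"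
proof
  have out: "fst (snd (tm_run M (vinput x u) T) ! 1) = tape_of [if V x u then 2 else 1]" if "length u \<le> m" for u
    using run[OF that] tm_computes_mono[of M "vinput x u" "t u" "bits [V x u]" T] by (simp add: bits_def)
  {
    assume "\<exists>v. satisfies v (tableau M x m T)"
    then obtain u where "length u \<le> m" "fst (snd (tm_run M (vinput x u) T) ! 1) 0 \<noteq> 1"
      using satisfying_witness[OF M] by blast
    then show "\<exists>u. length u \<le> m \<and> V x u" using out[of u] by (auto simp: tape_of_def split: if_splits)
  next
    assume "\<exists>u. length u \<le> m \<and> V x u"
    then obtain u where "length u \<le> m" "V x u" by blast
    then show "\<exists>v. satisfies v (tableau M x m T)"
      using out[of u] by (intro satisfiable_if_accepted[OF M]) (auto simp: tape_of_def nth_Cons' split: if_splits)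
  }
qed

subsection \<open>Hardness\<close>

theorem NP_hard_problem: "NP_hard (problem fx P F)"
  unfolding NP_hard_def
proof (intro allI impI)
  fix L assume "in_NP L"
  then obtain V and p :: "nat poly" where "polytime_verifier V"
    and L: "\<And>x. x \<in> L \<longleftrightarrow> (\<exists>u. length u \<le> poly p (length x) \<and> V x u)"
    unfolding in_NP_def by blast
  then obtain M and q :: "nat poly" where M: "tm_wf M"
    and run: "\<And>x u. tm_computes M (vinput x u) (poly q (length (vinput x u))) (bits [V x u])"
    unfolding polytime_verifier_def computable_in_polytime_def vinput_def by auto
  define m where "m = (\<lambda>x :: bool list. poly p (length x))"
  \<comment> \<open>The input of the verifier has length at most that of \<open>x\<close>, plus 1
    for the separator, plus \<open>m x\<close>; polynomials over the natural numbers are monotone,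
    so \<open>T x\<close> bounds the run time for all admissible witnesses.\<close>
  define T where "T = (\<lambda>x :: bool list. poly q (length x + (1 + m x)))"
  define N where "N = (\<lambda>x. base M (T x) * base M (T x) * base M (T x) * base M (T x))"
  define f where "f = (\<lambda>x. encW (Wplp (red_plp F (cnf_plp (N x) (tableau M x (m x) (T x))))))"
  have m: "ptime m" unfolding m_def by (intro pt)
  have T: "ptime T" unfolding T_def by (intro pt m)
  have "ptime N" unfolding N_def base_def by (intro pt T)
  then have "ptime f" unfolding f_def by (intro ptime_encW_cnf ptime_tableau m T)
  then have "polytime_function f" by (rule polytime_function_ptime)
  moreover have "x \<in> L \<longleftrightarrow> f x \<in> problem fx P F" for x
  proof -
    have "f x \<in> problem fx P F \<longleftrightarrow> (\<exists>v. satisfies v (tableau M x (m x) (T x)))"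
      unfolding f_def N_def by (rule encW_cnf_iff) (blast intro: tableau_bound[OF M])
    also have "\<dots> \<longleftrightarrow> (\<exists>u. length u \<le> m x \<and> V x u)"
    proof (rule satisfiable_tableau_iff[OF M, where t = "\<lambda>u. poly q (length (vinput x u))"], intro conjI run)
      fix u :: "bool list" assume "length u \<le> m x"
      then show "poly q (length (vinput x u)) \<le> T x"
        unfolding T_def by (intro poly_mono_nat) (simp add: vinput_def bits_def)
    qed
    finally show ?thesis by (simp add: L m_def)
  qed
  ultimately show "polytime_reducible L (problem fx P F)" unfolding polytime_reducible_def by blast
qed

lemma NP_complete_problem: "NP_complete (problem fx P F)"
  by (simp add: NP_complete_def in_NP_problem NP_hard_problem)

theorem theorem10:
  fixes F :: lp_form
  shows "NP_complete (ilfp_language (optimistic F)) \<and>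
         NP_complete (ilfp_language (pessimistic F)) \<and>
         NP_complete (ilfp_language (\<lambda>I. fixed_rhs I \<and> optimistic F I)) \<and>
         NP_complete (ilfp_language (\<lambda>I. fixed_rhs I \<and> pessimistic F I))"
  using NP_complete_problem[of False False F] NP_complete_problem[of False True F]
    NP_complete_problem[of True False F] NP_complete_problem[of True True F]
  by (simp add: problem_def scenario_def)

end
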